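(* Let $\beta\in\{1,2,4\}$, let $U$ be a non-trivial connection on $\mathcal G$ with values in $\mathbb U_{\beta,n}$, and let $\lambda_1(x)\ge\dots\ge\lambda_n(x)$ be the eigenvalues of $\Phi(x)$, $x\in V$, where $\Phi$ is the $E_{\beta,n}$-valued Gaussian free field twisted by $U$. Let $\nu=(\nu_1,\dots,\nu_{m(\nu)})$ be a finite tuple of positive integers with $|\nu|=\nu_1+\dots+\nu_{m(\nu)}$ even, let $F:\mathbb R^V\to\mathbb R$ be bounded measurable, and let $x_1,\dots,x_{|\nu|}\in V$ be such that for every $l\in\{1,\dots,m(\nu)\}$ the vertices $x_k$ with $\nu_1+\dots+\nu_{l-1}+1\le k\le\nu_1+\dots+\nu_l$ are all equal. Then $$\Big\langle \prod_{l=1}^{m(\nu)}\Big(\sum_{i=1}^n\lambda_i(x_{\nu_1+\dots+\nu_l})^{\nu_l}\Big)F\Big(\tfrac12\sum_{i=1}^n\lambda_i^2\Big)\Big\rangle^U_{\beta,n}$$ $$=\sum_{\rho\in\mathcal R_\nu}w_{\nu,\beta}(\rho)\int_{\gamma_1,\dots,\gamma_{|\nu|/2}}\Big\langle F\Big(\tfrac12\sum_{i=1}^n\lambda_i^2+L(\gamma_1)+\dots+L(\gamma_{|\nu|/2})\Big)\Big\rangle^U_{\beta,n}\;W^U_{\rho}(\gamma_1,\dots,\gamma_{|\nu|/2})\;\mu_{\mathbf p_\nu(\rho)}^{x_1,\dots,x_{|\nu|}}(d\gamma_1,\dots,d\gamma_{|\nu|/2}),$$ where $W^U_\rho(\gamma_1,\dots,\gamma_{|\nu|/2})$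 is a product of $f_\nu(\rho)$ Wilson loops, one for each boundary cycle of the ribbon pairing $\rho$: the factor of a boundary cycle is $\operatorname{Tr}(\mathsf{hol}^U(\ell))$ if $\beta\in\{1,2\}$ and $\operatorname{Re}(\operatorname{Tr}(\mathsf{hol}^U(\ell)))$ if $\beta=4$, with $\ell$ the loop obtained by concatenating the random walk paths $\gamma_i$ and their time-reversals met along that boundary cycle. (That is, compared with the expansion for the untwisted field, in which the factor is $n^{f_\nu(\rho)}$, each $n^{f_\nu(\rho)}$ is replaced by the product $W_\rho^U$.)
   Context: **Network and path measures.** $\mathcal G=(V,E)$ is a finite undirected connected graph without multiple edges or self-loops, with conductances $C(x,y)=C(y,x)>0$ for $\{x,y\}\in E$ and a killing measure $\kappa:V\to[0,\infty)$, not identically zero. $(X_t)$ is the Markov jump process on $V$ jumping from $x$ to a neighbour $y$ at rate $C(x,y)$ and killed at $x$ at rate $\kappa(x)$; $\zeta$ is the killing time; $p_t(x,y)=\mathbb P(X_t=y,t<\zeta\mid X_0=x)$. $\mathbb P_t^{x,y}$ is the bridge law, i.e. the law of $(X_s)_{0\le s\le t}$ started at $x$ and conditioned on $X_t=y$, $t<\zeta$. Set $\mu^{x,y}(d\gamma)=\int_0^\infty \mathbb P_t^{x,y}(d\gamma)\,p_t(x,y)\,dt$, a finite measure on paths from $x$ to $y$ of finite lifetime. For a path $\gamma$ of lifetime $T(\gamma)$, $L(\gamma)(x)=\int_0^{T(\gamma)}\mathbf 1_{\{\gamma(t)=x\}}dt$, $x\in V$. For a partition in pairs $\mathbf p=\{\{a_1,b_1\},\dots,\{a_r,b_r\}\}$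 of $\{1,\dots,2r\}$, with the convention $a_i<b_i$ (the ordering of the pairs is fixed arbitrarily and is immaterial), $\mu_{\mathbf p}^{x_1,\dots,x_{2r}}(d\gamma_1,\dots,d\gamma_r)=\prod_{i=1}^r\mu^{x_{a_i},x_{b_i}}(d\gamma_i)$. **Connection, holonomy, Wilson loops.** $n\ge2$ is an integer. $\mathbb U_{\beta,n}$ is $O(n)$ for $\beta=1$, $U(n)$ for $\beta=2$, and the group $U(n,\mathbb H)$ of quaternionic $n\times n$ matrices with $UU^*=I_n$ for $\beta=4$, where $(M^* )_{ij}=\overline{M_{ji}}$. A connection is a family $U(x,y)\in\mathbb U_{\beta,n}$, for every oriented edge, with $U(y,x)=U(x,y)^*=U(x,y)^{-1}$. The holonomy along a nearest-neighbour path with successive vertices $y_1,\dots,y_j$ (the discrete skeleton of a continuous-time path) is $\mathsf{hol}^U(\gamma)=U(y_1,y_2)\cdots U(y_{j-1},y_j)$ ($I_n$ if there is no jump). For the time-reversal $\overleftarrow\gamma$, $\mathsf{hol}^U(\overleftarrow\gamma)=\mathsf{hol}^U(\gamma)^*$. The connection is trivial if there are $\mathfrak U(x)\in\mathbb U_{\beta,n}$, $x\in V$, with $U(x,y)=\mathfrak U(x)^{-1}\mathfrak U(y)$ for all $\{x,y\}\in E$; non-trivial otherwise. A Wilson loop is $\operatorname{Tr}(\mathsf{hol}^U(\ell))$ ($\beta\in\{1,2\}$) or $\operatorname{Re}(\operatorname{Tr}(\mathsf{hol}^U(\ell)))$ ($\beta=4$) for a closed path $\ell$; it does not depend on where $\ell$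 is rooted. **Twisted matrix-valued field.** $E_{\beta,n}$ is the real vector space of $n\times n$ real symmetric ($\beta=1$), complex Hermitian ($\beta=2$), quaternionic Hermitian ($\beta=4$) matrices, with inner product $(M,M')\mapsto\operatorname{Re}(\operatorname{Tr}(MM'))$. The field $\Phi:V\to E_{\beta,n}$ under $\langle\cdot\rangle^U_{\beta,n}$ has density proportional to $$\exp\Big(-\tfrac12\sum_{x\in V}\kappa(x)\operatorname{Tr}(M(x)^2)-\tfrac12\sum_{\{x,y\}\in E}C(x,y)\operatorname{Tr}((M(y)-U(y,x)M(x)U(x,y))^2)\Big)$$ with respect to Lebesgue measure on $(E_{\beta,n})^V$; $\langle\cdot\rangle^U_{\beta,n}$ also denotes expectation. For quaternionic Hermitian matrices, eigenvalues are the (real) right eigenvalues, i.e. the $\lambda_i$ with $Q^*MQ=\operatorname{Diag}(\lambda_1,\dots,\lambda_n)$ for some $Q\in U(n,\mathbb H)$. $\sum_i\lambda_i^2$ is the field $x\mapsto\sum_i\lambda_i(x)^2$. **Ribbon pairings and trails.** Given $\nu$, there are $m(\nu)$ vertices; the $l$-th carries $\nu_l$ ribbon half-edges labelled $\nu_1+\dots+\nu_{l-1}+1,\dots,\nu_1+\dots+\nu_l$ in this (clockwise) cyclic order. Let $\sigma$ be the permutation of $\{1,\dots,|\nu|\}$ sending each label to the next one in the cyclic order around its vertex. A ribbon pairing $\rho\in\mathcal R_\nu$ is a partition in pairs $\mathbf p_\nu(\rho)$ of $\{1,\dots,|\nu|\}$ together with a choice, for each pair, of "straight" or "twisted". Each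 half-edge $k$ has two sides $(k,+)$ and $(k,-)$. At vertices, $(k,+)$ is joined to $(\sigma(k),-)$ for every $k$. For a straight pair $\{k,k'\}$, $(k,+)$ is glued to $(k',-)$ and $(k,-)$ to $(k',+)$; for a twisted pair, $(k,+)$ is glued to $(k',+)$ and $(k,-)$ to $(k',-)$. The sides form disjoint cycles (boundary cycles), alternating vertex-joins and gluings; $f_\nu(\rho)$ is their number, and $\chi_\nu(\rho)=m(\nu)-|\nu|/2+f_\nu(\rho)$. The weights are $$w_{\nu,1}(\rho)=2^{-|\nu|/2},\quad w_{\nu,2}(\rho)=\mathbf 1_{\{\rho\text{ has only straight edges}\}},\quad w_{\nu,4}(\rho)=(-2)^{\chi_\nu(\rho)}2^{-2m(\nu)+|\nu|/2}.$$ **The loops.** Let $\mathbf p_\nu(\rho)=\{\{a_i,b_i\}\}_i$, $a_i<b_i$, with $\gamma_i$ from $x_{a_i}$ to $x_{b_i}$. The loop $\ell$ of a boundary cycle is obtained by traversing the cycle, from any starting point; each time a gluing is traversed from half-edge $k$ to half-edge $k'$ with $\{k,k'\}=\{a_i,b_i\}$, one appends $\gamma_i$ if $k<k'$ and $\overleftarrow{\gamma_i}$ if $k>k'$ (vertex-joins contribute nothing, as $x_k=x_{\sigma(k)}$). For $\beta\in\{1,4\}$ the direction of traversal is arbitrary; for $\beta=2$ (only $\rho$ with all edges straight contribute) the cycle is traversed in the direction in which every vertex-join is traversed from $(k,+)$ to $(\sigma(k),-)$. *)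

theory Defs
  imports "HOL-Probability.Probability"
begin

section \<open>Quaternions\<close>

text \<open>\<^term>\<open>Quat a b c d\<close> stands for $a + bi + cj + dk$ with $ij = k$.\<close>

datatype quat = Quat (qRe: real) (qI: real) (qJ: real) (qK: real)

lemma quat_eq_iff: "p = q \<longleftrightarrow> qRe p = qRe q \<and> qI p = qI q \<and> qJ p = qJ q \<and> qK p = qK q"
  by (cases p; cases q) simp

instantiation quat :: ring_1
begin

definition "0 = Quat 0 0 0 0"
definition "1 = Quat 1 0 0 0"
definition "p + q = Quat (qRe p + qRe q) (qI p + qI q) (qJ p + qJ q) (qK p + qK q)"
definition "p - q = Quat (qRe p - qRe q) (qI p - qI q) (qJ p - qJ q) (qK p - qK q)"
definition "- p = Quat (- qRe p) (- qI p) (- qJ p) (- qK p)"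
definition "p * q = Quat
  (qRe p * qRe q - qI p * qI q - qJ p * qJ q - qK p * qK q)
  (qRe p * qI q + qI p * qRe q + qJ p * qK q - qK p * qJ q)
  (qRe p * qJ q - qI p * qK q + qJ p * qRe q + qK p * qI q)
  (qRe p * qK q + qI p * qJ q - qJ p * qI q + qK p * qRe q)"

lemma quat_sel_simps [simp]:
  "qRe 0 = 0" "qI 0 = 0" "qJ 0 = 0" "qK 0 = 0"
  "qRe 1 = 1" "qI 1 = 0" "qJ 1 = 0" "qK 1 = 0"
  "qRe (p + q) = qRe p + qRe q" "qI (p + q) = qI p + qI q"
  "qJ (p + q) = qJ p + qJ q" "qK (p + q) = qK p + qK q"
  "qRe (p - q) = qRe p - qRe q" "qI (p - q) = qI p - qI q"
  "qJ (p - q) = qJ p - qJ q" "qK (p - q) = qK p - qK q"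
  "qRe (- p) = - qRe p" "qI (- p) = - qI p" "qJ (- p) = - qJ p" "qK (- p) = - qK p"
  "qRe (p * q) = qRe p * qRe q - qI p * qI q - qJ p * qJ q - qK p * qK q"
  "qI (p * q) = qRe p * qI q + qI p * qRe q + qJ p * qK q - qK p * qJ q"
  "qJ (p * q) = qRe p * qJ q - qI p * qK q + qJ p * qRe q + qK p * qI q"
  "qK (p * q) = qRe p * qK q + qI p * qJ q - qJ p * qI q + qK p * qRe q"
  by (simp_all add: zero_quat_def one_quat_def plus_quat_def minus_quat_def uminus_quat_def
      times_quat_def)

instance
  by standard (simp_all add: quat_eq_iff algebra_simps)

end

instantiation quat :: real_algebra_1
begin

definition "r *\<^sub>R q = Quat (r * qRe q) (r * qI q) (r * qJ q) (r * qK q)"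

lemma quat_scaleR_sel [simp]:
  "qRe (r *\<^sub>R q) = r * qRe q" "qI (r *\<^sub>R q) = r * qI q"
  "qJ (r *\<^sub>R q) = r * qJ q" "qK (r *\<^sub>R q) = r * qK q"
  by (simp_all add: scaleR_quat_def)

instance
  by standard (simp_all add: quat_eq_iff algebra_simps)

end

instantiation quat :: real_inner
begin

definition inner_quat_def:
  "inner p q = qRe p * qRe q + qI p * qI q + qJ p * qJ q + qK p * qK q"
definition norm_quat_def: "norm (q :: quat) = sqrt (inner q q)"
definition dist_quat_def: "dist (p :: quat) q = norm (p - q)"
definition sgn_quat_def: "sgn (q :: quat) = q /\<^sub>R norm q"
definition uniformity_quat_def [code del]:
  "(uniformity :: (quat \<times> quat) filter) = (INF e\<in>{0 <..}. principal {(p, q). dist p q < e})"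
definition open_quat_def [code del]:
  "open (S :: quat set) \<longleftrightarrow> (\<forall>p\<in>S. eventually (\<lambda>(p', q). p' = p \<longrightarrow> q \<in> S) uniformity)"

instance
proof
  fix p q s :: quat and r :: real and S :: "quat set"
  show "inner p q = inner q p" by (simp add: inner_quat_def mult.commute)
  show "inner (p + q) s = inner p s + inner q s" by (simp add: inner_quat_def algebra_simps)
  show "inner (r *\<^sub>R p) q = r * inner p q" by (simp add: inner_quat_def algebra_simps)
  show "0 \<le> inner p p" by (simp add: inner_quat_def)
  show "inner p p = 0 \<longleftrightarrow> p = 0"
    by (simp add: inner_quat_def quat_eq_iff add_nonneg_eq_0_iff)
qed (rule norm_quat_def dist_quat_def sgn_quat_def uniformity_quat_def open_quat_def)+

end

instantiation quat :: euclidean_space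
begin

definition Basis_quat_def: "Basis = {Quat 1 0 0 0, Quat 0 1 0 0, Quat 0 0 1 0, Quat 0 0 0 1}"

instance
proof
  show "(Basis :: quat set) \<noteq> {}" "finite (Basis :: quat set)" by (simp_all add: Basis_quat_def)
next
  fix u v :: quat assume "u \<in> Basis" "v \<in> Basis"
  then show "inner u v = (if u = v then 1 else 0)"
    unfolding Basis_quat_def by (elim insertE emptyE) (simp_all add: inner_quat_def)
next
  fix u :: quat
  show "(\<forall>v\<in>Basis. inner u v = 0) \<longleftrightarrow> u = 0"
    unfolding Basis_quat_def quat_eq_iff[of u] by (simp add: inner_quat_def)
qed

end

definition qcnj :: "quat \<Rightarrow> quat" where
  "qcnj q = Quat (qRe q) (- qI q) (- qJ q) (- qK q)"


section \<open>Matrices over the reals, complex numbers and quaternions\<close>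

text \<open>
  The three cases are treated inside the quaternionic matrices: a real (\<open>\<beta> = 1\<close>), respectively
  complex (\<open>\<beta> = 2\<close>), matrix is a quaternionic matrix all of whose entries have vanishing
  \<open>i, j, k\<close> parts, respectively vanishing \<open>j, k\<close> parts. These entries form copies of the fields
  of real and complex numbers on which \<^const>\<open>qcnj\<close> is the identity, respectively the complex
  conjugation.
\<close>

definition scalars :: "nat \<Rightarrow> quat set" where
  "scalars \<beta> = (if \<beta> = 1 then {q. qI q = 0 \<and> qJ q = 0 \<and> qK q = 0}
    else if \<beta> = 2 then {q. qJ q = 0 \<and> qK q = 0} else UNIV)"

definition adj :: "quat^'n^'n \<Rightarrow> quat^'n^'n" where
  "adj M = (\<chi> i j. qcnj (M $ j $ i))"

definition unitary_group :: "nat \<Rightarrow> (quat^'n^'n) set" where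
  "unitary_group \<beta> = {Q. (\<forall>i j. Q $ i $ j \<in> scalars \<beta>) \<and> Q ** adj Q = mat 1}"

definition hermitian_space :: "nat \<Rightarrow> (quat^'n^'n) set" where
  "hermitian_space \<beta> = {M. (\<forall>i j. M $ i $ j \<in> scalars \<beta>) \<and> adj M = M}"

definition diag_matrix :: "('n \<Rightarrow> real) \<Rightarrow> quat^'n^'n" where
  "diag_matrix d = (\<chi> i j. if i = j then of_real (d i) else 0)"

text \<open>
  The nonincreasing list, of length \<open>CARD('n)\<close>, of the eigenvalues of \<open>M\<close>, with multiplicities.
\<close>

definition is_spectrum :: "nat \<Rightarrow> quat^'n^'n \<Rightarrow> real list \<Rightarrow> bool" where
  "is_spectrum \<beta> M l \<longleftrightarrow> (\<exists>Q\<in>unitary_group \<beta>. \<exists>d. adj Q ** M ** Q = diag_matrix d \<and>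
     l = rev (sorted_list_of_multiset (image_mset d (mset_set UNIV))))"

definition eigval :: "nat \<Rightarrow> quat^'n^'n \<Rightarrow> nat \<Rightarrow> real" where
  "eigval \<beta> M i = (THE l. is_spectrum \<beta> M l) ! (i - 1)"


section \<open>The graph, the jump process and the path measures\<close>

text \<open>
  The vertex set is the finite type \<open>'v\<close>; the edge set \<open>E\<close> contains both orientations of every
  edge. Values of \<open>C\<close> off \<open>E\<close> play no role.
\<close>

locale network =
  fixes E :: "('v::finite \<times> 'v) set" and C :: "'v \<Rightarrow> 'v \<Rightarrow> real" and \<kappa> :: "'v \<Rightarrow> real"
  assumes sym_edges: "sym E"
    and no_loops: "irrefl E"
    and connected: "\<And>x y. (x, y) \<in> E\<^sup>*"
    and conductance_pos: "\<And>x y. (x, y) \<in> E \<Longrightarrow> C x y > 0"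
    and conductance_sym: "\<And>x y. (x, y) \<in> E \<Longrightarrow> C x y = C y x"
    and killing_nonneg: "\<And>x. \<kappa> x \<ge> 0"
    and killing_nonzero: "\<exists>x. \<kappa> x \<noteq> 0"

definition jump_rate :: "('v \<times> 'v) set \<Rightarrow> ('v \<Rightarrow> 'v \<Rightarrow> real) \<Rightarrow> 'v \<Rightarrow> 'v \<Rightarrow> real" where
  "jump_rate E C x y = (if (x, y) \<in> E then C x y else 0)"

definition total_rate ::
  "('v::finite \<times> 'v) set \<Rightarrow> ('v \<Rightarrow> 'v \<Rightarrow> real) \<Rightarrow> ('v \<Rightarrow> real) \<Rightarrow> 'v \<Rightarrow> real" where
  "total_rate E C \<kappa> x = \<kappa> x + (\<Sum>y\<in>UNIV. jump_rate E C x y)"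

text \<open>Law of the position after leaving \<open>x\<close>; \<^const>\<open>None\<close> is the cemetery.\<close>

definition jump_law ::
  "('v::finite \<times> 'v) set \<Rightarrow> ('v \<Rightarrow> 'v \<Rightarrow> real) \<Rightarrow> ('v \<Rightarrow> real) \<Rightarrow> 'v \<Rightarrow> 'v option pmf" where
  "jump_law E C \<kappa> x = embed_pmf (\<lambda>z. (case z of None \<Rightarrow> \<kappa> x | Some y \<Rightarrow> jump_rate E C x y)
     / total_rate E C \<kappa> x)"

definition holding_law ::
  "('v::finite \<times> 'v) set \<Rightarrow> ('v \<Rightarrow> 'v \<Rightarrow> real) \<Rightarrow> ('v \<Rightarrow> real) \<Rightarrow> 'v \<Rightarrow> real measure" where
  "holding_law E C \<kappa> x =
     density (restrict_space lborel {0<..}) (exponential_density (total_rate E C \<kappa> x))"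

text \<open>
  The process is realised by its jump chain and holding times. A sample point \<open>\<omega>\<close> consists of
  independent pairs \<open>\<omega> (k, y)\<close>, where \<open>\<omega> (k, y)\<close> is the holding time and the next position to be used
  if the \<open>k\<close>-th state of the jump chain is \<open>y\<close>.
\<close>

type_synonym 'v sample = "nat \<times> 'v \<Rightarrow> real \<times> 'v option"

definition sample_measure ::
  "('v::finite \<times> 'v) set \<Rightarrow> ('v \<Rightarrow> 'v \<Rightarrow> real) \<Rightarrow> ('v \<Rightarrow> real) \<Rightarrow> 'v sample measure" where
  "sample_measure E C \<kappa> =
     (\<Pi>\<^sub>M (k, y)\<in>UNIV. holding_law E C \<kappa> y \<Otimes>\<^sub>M measure_pmf (jump_law E C \<kappa> y))"

primrec jump_chain :: "'v \<Rightarrow> 'v sample \<Rightarrow> nat \<Rightarrow> 'v option" where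
  "jump_chain x \<omega> 0 = Some x"
| "jump_chain x \<omega> (Suc k) = (case jump_chain x \<omega> k of None \<Rightarrow> None | Some y \<Rightarrow> snd (\<omega> (k, y)))"

definition holding_time :: "'v \<Rightarrow> 'v sample \<Rightarrow> nat \<Rightarrow> real" where
  "holding_time x \<omega> k = (case jump_chain x \<omega> k of None \<Rightarrow> 0 | Some y \<Rightarrow> fst (\<omega> (k, y)))"

definition jump_time :: "'v \<Rightarrow> 'v sample \<Rightarrow> nat \<Rightarrow> real" where
  "jump_time x \<omega> k = (\<Sum>j<k. holding_time x \<omega> j)"

text \<open>
  \<open>position x \<omega> t\<close> is the position at time \<open>t\<close> of the process started at \<open>x\<close>; it is \<^const>\<open>None\<close> from
  the killing time on, because \<^const>\<open>jump_time\<close> is constant once the chain is killed.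
\<close>

definition position :: "'v \<Rightarrow> 'v sample \<Rightarrow> real \<Rightarrow> 'v option" where
  "position x \<omega> t =
     (if \<exists>k. jump_time x \<omega> k \<le> t \<and> t < jump_time x \<omega> (Suc k)
      then jump_chain x \<omega> (LEAST k. jump_time x \<omega> k \<le> t \<and> t < jump_time x \<omega> (Suc k))
      else None)"

text \<open>
  A path is a pair of its lifetime \<open>T\<close> and a right-continuous step function on the interval from \<open>0\<close>
  to \<open>T\<close>, extended by its end values to all real times. \<open>has_skeleton \<gamma> ts ys\<close> says that \<open>\<gamma>\<close> visits
  successively the vertices \<open>ys\<close>, arriving at them at the times \<open>ts\<close>.
\<close>

type_synonym 'v path = "real \<times> (real \<Rightarrow> 'v)"

definition has_skeleton :: "'v path \<Rightarrow> real list \<Rightarrow> 'v list \<Rightarrow> bool" where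
  "has_skeleton \<gamma> ts ys \<longleftrightarrow>
     ys \<noteq> [] \<and> length ts = length ys \<and> distinct_adj ys \<and>
     hd ts = 0 \<and> sorted_wrt (<) ts \<and> last ts \<le> fst \<gamma> \<and>
     (\<forall>i<length ys. \<forall>s. ts ! i \<le> s \<and> (Suc i < length ys \<longrightarrow> s < ts ! Suc i) \<longrightarrow> snd \<gamma> s = ys ! i) \<and>
     (\<forall>s<0. snd \<gamma> s = hd ys)"

definition skeleton :: "'v path \<Rightarrow> 'v list" where
  "skeleton \<gamma> = (THE ys. \<exists>ts. has_skeleton \<gamma> ts ys)"

text \<open>The sigma-algebra is generated by the lifetime and the evaluations.\<close>

definition path_space :: "'v path measure" where
  "path_space = restrict_space (borel \<Otimes>\<^sub>M (\<Pi>\<^sub>M s\<in>UNIV. count_space UNIV))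
     {\<gamma>. \<exists>ts ys. has_skeleton \<gamma> ts ys}"

definition local_time :: "'v path \<Rightarrow> 'v \<Rightarrow> real" where
  "local_time \<gamma> v = (LBINT t:{0..fst \<gamma>}. indicator {t. snd \<gamma> t = v} t)"

definition alive_at ::
  "('v::finite \<times> 'v) set \<Rightarrow> ('v \<Rightarrow> 'v \<Rightarrow> real) \<Rightarrow> ('v \<Rightarrow> real) \<Rightarrow> 'v \<Rightarrow> 'v \<Rightarrow> real
    \<Rightarrow> 'v sample set" where
  "alive_at E C \<kappa> x y t = {\<omega> \<in> space (sample_measure E C \<kappa>). position x \<omega> t = Some y}"

definition transition_prob ::
  "('v::finite \<times> 'v) set \<Rightarrow> ('v \<Rightarrow> 'v \<Rightarrow> real) \<Rightarrow> ('v \<Rightarrow> real) \<Rightarrow> real \<Rightarrow> 'v \<Rightarrow> 'v \<Rightarrow> real" where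
  "transition_prob E C \<kappa> t x y = measure (sample_measure E C \<kappa>) (alive_at E C \<kappa> x y t)"

definition path_upto :: "'v \<Rightarrow> real \<Rightarrow> 'v sample \<Rightarrow> 'v path" where
  "path_upto x t \<omega> = (t, \<lambda>s. the (position x \<omega> (max 0 (min s t))))"

definition bridge_law ::
  "('v::finite \<times> 'v) set \<Rightarrow> ('v \<Rightarrow> 'v \<Rightarrow> real) \<Rightarrow> ('v \<Rightarrow> real) \<Rightarrow> real \<Rightarrow> 'v \<Rightarrow> 'v
    \<Rightarrow> 'v path measure" where
  "bridge_law E C \<kappa> t x y =
     (let A = alive_at E C \<kappa> x y t
      in distr (restrict_space (uniform_measure (sample_measure E C \<kappa>) A) A) path_space
           (path_upto x t))"

definition path_measure ::
  "('v::finite \<times> 'v) set \<Rightarrow> ('v \<Rightarrow> 'v \<Rightarrow> real) \<Rightarrow> ('v \<Rightarrow> real) \<Rightarrow> 'v \<Rightarrow> 'v \<Rightarrow> 'v path measure" where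
  "path_measure E C \<kappa> x y = measure_of (space path_space) (sets path_space)
     (\<lambda>A. \<integral>\<^sup>+t\<in>{0<..}. emeasure (bridge_law E C \<kappa> t x y) A * ennreal (transition_prob E C \<kappa> t x y)
            \<partial>lborel)"


section \<open>Connections, holonomy and the twisted field\<close>

definition is_connection ::
  "nat \<Rightarrow> ('v \<times> 'v) set \<Rightarrow> ('v \<Rightarrow> 'v \<Rightarrow> quat^'n^'n) \<Rightarrow> bool" where
  "is_connection \<beta> E U \<longleftrightarrow>
     (\<forall>(x, y)\<in>E. U x y \<in> unitary_group \<beta> \<and> U y x = adj (U x y) \<and> U y x = matrix_inv (U x y))"

definition trivial_connection ::
  "nat \<Rightarrow> ('v \<times> 'v) set \<Rightarrow> ('v \<Rightarrow> 'v \<Rightarrow> quat^'n^'n) \<Rightarrow> bool" where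
  "trivial_connection \<beta> E U \<longleftrightarrow>
     (\<exists>g. (\<forall>x. g x \<in> unitary_group \<beta>) \<and> (\<forall>(x, y)\<in>E. U x y = matrix_inv (g x) ** g y))"

fun hol :: "('v \<Rightarrow> 'v \<Rightarrow> quat^'n^'n) \<Rightarrow> 'v list \<Rightarrow> quat^'n^'n" where
  "hol U (y # z # ys) = U y z ** hol U (z # ys)"
| "hol U ys = mat 1"

text \<open>
  For \<open>\<beta> = 2\<close> the trace, a quaternion with vanishing \<open>j, k\<close> parts, is read as a complex number;
  for \<open>\<beta> = 1\<close> it is real.
\<close>

definition wilson_loop :: "nat \<Rightarrow> ('v \<Rightarrow> 'v \<Rightarrow> quat^'n^'n) \<Rightarrow> 'v list \<Rightarrow> complex" where
  "wilson_loop \<beta> U ys =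
     (let t = trace (hol U ys) in if \<beta> = 4 then of_real (qRe t) else Complex (qRe t) (qI t))"

definition field_space :: "nat \<Rightarrow> (quat^'n^'n^'v) set" where
  "field_space \<beta> = {M. \<forall>x. M $ x \<in> hermitian_space \<beta>}"

text \<open>
  Lebesgue measure on a linear subspace, through coordinates in an orthonormal basis. On
  \<^const>\<open>hermitian_space\<close> the inner product of \<open>quat^'n^'n\<close> is the real part of the trace of \<open>M M'\<close>.
\<close>

definition subspace_lborel :: "'a::euclidean_space set \<Rightarrow> 'a measure" where
  "subspace_lborel S =
     (let B = (SOME B. B \<subseteq> S \<and> pairwise orthogonal B \<and> (\<forall>b\<in>B. norm b = 1) \<and> span B = S)
      in distr (\<Pi>\<^sub>M b\<in>B. lborel) borel (\<lambda>c. \<Sum>b\<in>B. c b *\<^sub>R b))"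

text \<open>
  The second sum is half the sum over the undirected edges, as \<open>E\<close> contains both orientations
  of an edge and these give equal terms. The traces are real.
\<close>

definition gff_energy ::
  "('v::finite \<times> 'v) set \<Rightarrow> ('v \<Rightarrow> 'v \<Rightarrow> real) \<Rightarrow> ('v \<Rightarrow> real) \<Rightarrow> ('v \<Rightarrow> 'v \<Rightarrow> quat^'n^'n)
    \<Rightarrow> quat^'n^'n^'v \<Rightarrow> real" where
  "gff_energy E C \<kappa> U M =
     1/2 * (\<Sum>x\<in>UNIV. \<kappa> x * qRe (trace (M $ x ** M $ x))) +
     1/4 * (\<Sum>(x, y)\<in>E. C x y *
       (let D = M $ y - U y x ** M $ x ** U x y in qRe (trace (D ** D))))"

definition twisted_gff ::
  "nat \<Rightarrow> ('v::finite \<times> 'v) set \<Rightarrow> ('v \<Rightarrow> 'v \<Rightarrow> real) \<Rightarrow> ('v \<Rightarrow> real)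
    \<Rightarrow> ('v \<Rightarrow> 'v \<Rightarrow> quat^'n^'n) \<Rightarrow> (quat^'n^'n^'v) measure" where
  "twisted_gff \<beta> E C \<kappa> U =
     (let L = subspace_lborel (field_space \<beta>);
          Z = (\<integral>M. exp (- gff_energy E C \<kappa> U M) \<partial>L)
      in density L (\<lambda>M. ennreal (exp (- gff_energy E C \<kappa> U M) / Z)))"

definition half_square :: "nat \<Rightarrow> quat^'n^'n^'v \<Rightarrow> real^'v" where
  "half_square \<beta> \<Phi> = (\<chi> v. 1/2 * (\<Sum>i=1..CARD('n). (eigval \<beta> (\<Phi> $ v) i)\<^sup>2))"


section \<open>Ribbon pairings\<close>

text \<open>\<open>\<nu> ! (l - 1)\<close> is the degree of the \<open>l\<close>-th vertex; half-edges are numbered from \<open>1\<close>.\<close>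

definition psum :: "nat list \<Rightarrow> nat \<Rightarrow> nat" where
  "psum \<nu> l = sum_list (take l \<nu>)"

definition vertex_of :: "nat list \<Rightarrow> nat \<Rightarrow> nat" where
  "vertex_of \<nu> k = (LEAST l. k \<le> psum \<nu> l)"

definition next_half_edge :: "nat list \<Rightarrow> nat \<Rightarrow> nat" where
  "next_half_edge \<nu> k =
     (if k = psum \<nu> (vertex_of \<nu> k) then psum \<nu> (vertex_of \<nu> k - 1) + 1 else k + 1)"

text \<open>A ribbon pairing is a partition in pairs together with the set of its twisted pairs.\<close>

type_synonym ribbon = "nat set set \<times> nat set set"

definition ribbon_pairings :: "nat list \<Rightarrow> ribbon set" where
  "ribbon_pairings \<nu> =
     {(P, S). partition_on {1..sum_list \<nu>} P \<and> (\<forall>p\<in>P. card p = 2) \<and> S \<subseteq> P}"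

text \<open>The side \<open>(k, +)\<close> is encoded as \<open>(k, True)\<close>, and \<open>(k, -)\<close> as \<open>(k, False)\<close>.\<close>

type_synonym side = "nat \<times> bool"

definition sides :: "nat list \<Rightarrow> side set" where
  "sides \<nu> = {1..sum_list \<nu>} \<times> UNIV"

definition join :: "nat list \<Rightarrow> side \<Rightarrow> side" where
  "join \<nu> s = (case s of (k, b) \<Rightarrow>
     if b then (next_half_edge \<nu> k, False)
     else (inv_into {1..sum_list \<nu>} (next_half_edge \<nu>) k, True))"

definition partner :: "ribbon \<Rightarrow> nat \<Rightarrow> nat" where
  "partner \<rho> k = (THE k'. {k, k'} \<in> fst \<rho>)"

definition glue :: "ribbon \<Rightarrow> side \<Rightarrow> side" where
  "glue \<rho> s = (case s of (k, b) \<Rightarrow>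
     (partner \<rho> k, if {k, partner \<rho> k} \<in> snd \<rho> then b else \<not> b))"

definition boundary_cycles :: "nat list \<Rightarrow> ribbon \<Rightarrow> side set set" where
  "boundary_cycles \<nu> \<rho> =
     sides \<nu> // ({(s, join \<nu> s) | s. s \<in> sides \<nu>} \<union> {(s, glue \<rho> s) | s. s \<in> sides \<nu>})\<^sup>*"

definition faces :: "nat list \<Rightarrow> ribbon \<Rightarrow> nat" where
  "faces \<nu> \<rho> = card (boundary_cycles \<nu> \<rho>)"

definition euler_char :: "nat list \<Rightarrow> ribbon \<Rightarrow> int" where
  "euler_char \<nu> \<rho> = int (length \<nu>) - int (sum_list \<nu> div 2) + int (faces \<nu> \<rho>)"

definition weight :: "nat list \<Rightarrow> nat \<Rightarrow> ribbon \<Rightarrow> real" where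
  "weight \<nu> \<beta> \<rho> =
     (if \<beta> = 1 then 2 powi (- int (sum_list \<nu> div 2))
      else if \<beta> = 2 then (if snd \<rho> = {} then 1 else 0)
      else (-2) powi euler_char \<nu> \<rho> * 2 powi (- 2 * int (length \<nu>) + int (sum_list \<nu> div 2)))"

text \<open>Concatenation of walks each of which starts at the endpoint of the previous one.\<close>

fun concat_walks :: "'v list list \<Rightarrow> 'v list" where
  "concat_walks [] = []"
| "concat_walks (w # ws) = w @ concat (map tl ws)"

text \<open>
  The paths are indexed by the pairs of the pairing, the path of \<open>{a, b}\<close> with \<open>a < b\<close> going from
  \<open>x a\<close> to \<open>x b\<close>. \<open>glued_walk\<close> is the walk along the gluing traversed from half-edge \<open>k\<close>.
\<close>

definition glued_walk :: "ribbon \<Rightarrow> (nat set \<Rightarrow> 'v path) \<Rightarrow> nat \<Rightarrow> 'v list" where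
  "glued_walk \<rho> \<gamma> k = (let k' = partner \<rho> k; w = skeleton (\<gamma> {k, k'}) in if k < k' then w else rev w)"

text \<open>
  The loop of the boundary cycle \<open>c\<close> traversed from its side \<open>s\<close>, starting with a gluing (so that
  \<open>s\<close> determines the direction too). A cycle with \<open>2 r\<close> sides has \<open>r\<close> gluings. If
  \<open>s = (k, -)\<close> and all pairs are straight, then the vertex-joins are traversed from \<open>(k, +)\<close> to
  \<open>(\<sigma> k, -)\<close>.
\<close>

definition cycle_loop ::
  "nat list \<Rightarrow> ribbon \<Rightarrow> (nat set \<Rightarrow> 'v path) \<Rightarrow> side set \<Rightarrow> side \<Rightarrow> 'v list" where
  "cycle_loop \<nu> \<rho> \<gamma> c s = concat_walks
     (map (\<lambda>j. glued_walk \<rho> \<gamma> (fst (((join \<nu> \<circ> glue \<rho>) ^^ j) s))) [0..<card c div 2])"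

definition wilson_product ::
  "nat list \<Rightarrow> nat \<Rightarrow> ('v \<Rightarrow> 'v \<Rightarrow> quat^'n^'n) \<Rightarrow> (side set \<Rightarrow> side) \<Rightarrow> ribbon
    \<Rightarrow> (nat set \<Rightarrow> 'v path) \<Rightarrow> complex" where
  "wilson_product \<nu> \<beta> U start \<rho> \<gamma> =
     (\<Prod>c\<in>boundary_cycles \<nu> \<rho>. wilson_loop \<beta> U (cycle_loop \<nu> \<rho> \<gamma> c (start c)))"

text \<open>Admissible starting sides; the restriction for \<open>\<beta> = 2\<close> prescribes the direction.\<close>

definition valid_start :: "nat list \<Rightarrow> nat \<Rightarrow> ribbon \<Rightarrow> (side set \<Rightarrow> side) \<Rightarrow> bool" where
  "valid_start \<nu> \<beta> \<rho> start \<longleftrightarrow>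
     (\<forall>c\<in>boundary_cycles \<nu> \<rho>. start c \<in> c \<and> (\<beta> = 2 \<longrightarrow> \<not> snd (start c)))"

definition paths_measure ::
  "('v::finite \<times> 'v) set \<Rightarrow> ('v \<Rightarrow> 'v \<Rightarrow> real) \<Rightarrow> ('v \<Rightarrow> real) \<Rightarrow> (nat \<Rightarrow> 'v) \<Rightarrow> ribbon
    \<Rightarrow> (nat set \<Rightarrow> 'v path) measure" where
  "paths_measure E C \<kappa> x \<rho> = (\<Pi>\<^sub>M p\<in>fst \<rho>. path_measure E C \<kappa> (x (Min p)) (x (Max p)))"

end

theory Submission
  imports Defs "HOL-Computational_Algebra.Polynomial"
begin

text \<open>For \<open>F(s) = exp(- \<Sum>\<^sub>v k(v) s(v))\<close> the left-hand side is a Gaussian moment with the killing measure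
  \<open>\<kappa>\<close> replaced by \<open>\<kappa> + k\<close>. Its covariance solves the Green equation of the twisted Laplacian, hence is the
  integral of \<open>A \<mapsto> hol(\<gamma>) A hol(\<gamma>)\<^sup>*\<close> against \<open>exp(- \<Sum>\<^sub>v k(v) L(\<gamma>)(v)) \<mu>(d\<gamma>)\<close>. Wick's theorem pairs the matrices
  in the product of traces; summing a pair over an orthonormal basis of the hermitian matrices joins or splits
  traces, with a straight and a twisted term, until one trace is left for each boundary cycle.
  Both sides are integrals of \<open>F\<close> against finite measures on the nonnegative orthant, so agreement on
  exponentials extends to all bounded measurable \<open>F\<close>.\<close>


subsection \<open>Quaternion matrices\<close>

text \<open>Weighting by exponentials of local times makes the law of the skeleton a product over
  the steps of the walk, so every path integral of holonomies is an absolutely convergent sum over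
  finite walks. On the field side such an exponential only changes the quadratic form, and its
  expectation is a common factor of both sides; hence no determinant is ever computed, and Wick's
  theorem is obtained from integration by parts with the covariance given implicitly by the solution
  of a linear equation. Quaternions do not commute, so only the real part of the trace is cyclic.
  For \<beta> = 2 the whole complex trace is needed, and reversing a loop conjugates it; therefore
  the contraction keeps track of the direction in which each boundary cycle is traversed. Wilson
  products are complex or of varying sign. The final extension to all bounded F therefore works with
  linear functionals that are continuous under bounded convergence, which replace positive
  measures.\<close>

lemma qcnj_sel [simp]: "qRe (qcnj q) = qRe q" "qI (qcnj q) = - qI q" "qJ (qcnj q) = - qJ q"
    "qK (qcnj q) = - qK q" by (simp_all add: qcnj_def)

lemma qcnj_simps [simp]: "qcnj (qcnj q) = q" "qcnj 0 = 0" "qcnj 1 = 1" "qcnj (p + q) = qcnj p + qcnj q"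
   "qcnj (p - q) = qcnj p - qcnj q" "qcnj (- q) = - qcnj q"
   "qcnj (p * q) = qcnj q * qcnj p" "qcnj (r *\<^sub>R q) = r *\<^sub>R qcnj q" by (simp_all add: quat_eq_iff algebra_simps)

lemma of_real_quat_sel [simp]: "qRe (of_real r) = r" "qI (of_real r) = 0" "qJ (of_real r) = 0" "qK (of_real r) = 0"
  by (simp_all add: of_real_def)

lemma qcnj_of_real [simp]: "qcnj (of_real r) = of_real r" by (simp add: quat_eq_iff)

lemma quat_sum_sel: "qRe (sum f A) = (\<Sum>a\<in>A. qRe (f a))" "qI (sum f A) = (\<Sum>a\<in>A. qI (f a))"
   "qJ (sum f A) = (\<Sum>a\<in>A. qJ (f a))" "qK (sum f A) = (\<Sum>a\<in>A. qK (f a))"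
  by (induction A rule: infinite_finite_induct) simp_all

lemma qcnj_sum: "qcnj (sum f A) = (\<Sum>a\<in>A. qcnj (f a))" by (induction A rule: infinite_finite_induct) simp_all

lemma norm_quat_sq: "(norm (q::quat))\<^sup>2 = (qRe q)\<^sup>2 + (qI q)\<^sup>2 + (qJ q)\<^sup>2 + (qK q)\<^sup>2"
  by (simp add: norm_quat_def inner_quat_def power2_eq_square)

lemma norm_quat_mult: "norm (p * q :: quat) = norm p * norm q"
proof -
  have "(norm (p * q))\<^sup>2 = (norm p * norm q)\<^sup>2" unfolding power_mult_distrib norm_quat_sq quat_sel_simps by algebra
  thus ?thesis by (simp add: power2_eq_iff_nonneg)
qed

instance quat :: real_normed_algebra_1
proof
  fix p q :: quat
  show "norm (p * q) \<le> norm p * norm q" by (simp add: norm_quat_mult)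
  show "norm (1::quat) = 1" by (simp add: norm_quat_def inner_quat_def)
qed

lemma norm_qcnj [simp]: "norm (qcnj q) = norm q" by (simp add: norm_quat_def inner_quat_def)

lemma qcnj_mult_self: "qcnj q * q = of_real ((norm q)\<^sup>2)" "q * qcnj q = of_real ((norm q)\<^sup>2)"
  unfolding norm_quat_sq by (simp_all add: quat_eq_iff power2_eq_square algebra_simps)

lemma qRe_mult_commute: "qRe (p * q) = qRe (q * p)" by (simp add: algebra_simps)

lemma of_real_quat_commute: "of_real r * (q::quat) = q * of_real r" by (simp add: quat_eq_iff)

lemma inner_quat_eq: "inner p q = qRe (p * qcnj q)" by (simp add: inner_quat_def)

lemma bounded_linear_quat_sel: "bounded_linear qRe" "bounded_linear qI" "bounded_linear qJ" "bounded_linear qK"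
    "bounded_linear qcnj" by (simp_all add: linear_conv_bounded_linear[symmetric] linear_iff)

lemmas continuous_on_quat_sel [continuous_intros] =
  bounded_linear.continuous_on[OF bounded_linear_quat_sel(1)]
  bounded_linear.continuous_on[OF bounded_linear_quat_sel(2)]
  bounded_linear.continuous_on[OF bounded_linear_quat_sel(3)]
  bounded_linear.continuous_on[OF bounded_linear_quat_sel(4)]
  bounded_linear.continuous_on[OF bounded_linear_quat_sel(5)]

lemma scalars_closed:
  "p \<in> scalars \<beta> ==> q \<in> scalars \<beta> ==> p + q \<in> scalars \<beta>"
  "p \<in> scalars \<beta> ==> q \<in> scalars \<beta> ==> p - q \<in> scalars \<beta>"
  "p \<in> scalars \<beta> ==> q \<in> scalars \<beta> ==> p * q \<in> scalars \<beta>"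
  "p \<in> scalars \<beta> ==> - p \<in> scalars \<beta>"
  "p \<in> scalars \<beta> ==> qcnj p \<in> scalars \<beta>"
  "p \<in> scalars \<beta> ==> r *\<^sub>R p \<in> scalars \<beta>"
  "of_real r \<in> scalars \<beta>" "0 \<in> scalars \<beta>" "1 \<in> scalars \<beta>"
  by (auto simp: scalars_def split: if_splits)

lemma scalars_sum: "(\<And>a. a \<in> A ==> f a \<in> scalars \<beta>) ==> sum f A \<in> scalars \<beta>"
  by (induction A rule: infinite_finite_induct) (auto intro: scalars_closed)

definition scalar_matrices :: "nat => (quat^'n^'n) set" where
  "scalar_matrices \<beta> = {M. \<forall>i j. M $ i $ j \<in> scalars \<beta>}"

lemma adj_nth [simp]: "adj M $ i $ j = qcnj (M $ j $ i)" by (simp add: adj_def)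

lemma mult_nth: "((A::'a::semiring_1^'n^'m) ** B) $ i $ j = (\<Sum>k\<in>UNIV. A $ i $ k * B $ k $ j)"
  by (simp add: matrix_matrix_mult_def)

lemma mat_nth: "mat c $ i $ j = (if i = j then c else 0)" by (simp add: mat_def)

lemma adj_mult: "adj (A ** B) = adj B ** adj (A::quat^'n^'n)" by (simp add: vec_eq_iff mult_nth qcnj_sum)

lemma adj_simps [simp]: "adj (adj A) = A" "adj (A + B) = adj A + adj B" "adj (A - B) = adj A - adj B"
   "adj 0 = 0" "adj (r *\<^sub>R A) = r *\<^sub>R adj A" "adj (mat 1) = mat 1" by (auto simp add: vec_eq_iff mat_nth)

lemma mult_scaleR: "(r *\<^sub>R A) ** B = r *\<^sub>R (A ** B)" "A ** (r *\<^sub>R B) = r *\<^sub>R (A ** (B::quat^'n^'n))"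
  by (simp_all add: vec_eq_iff mult_nth scaleR_sum_right)

lemma mult_matrix_diff: "(A - A') ** B = A ** B - A' ** (B::quat^'n^'n)" "A ** (B - B') = A ** B - A ** (B'::quat^'n^'n)"
  by (simp_all add: vec_eq_iff mult_nth sum_subtractf algebra_simps)

lemma quat_matrix_add_rdistrib: "(A + A') ** B = A ** B + A' ** (B::quat^'n^'n)"
  by (simp add: vec_eq_iff mult_nth sum.distrib algebra_simps)

lemma bilinear_matrix_mult: "bilinear ((**) :: quat^'n^'n => quat^'n^'n => quat^'n^'n)"
  by (auto simp: bilinear_def linear_iff matrix_add_ldistrib quat_matrix_add_rdistrib mult_scaleR)

lemma mult_sum_left: "sum f S ** B = (\<Sum>a\<in>S. f a ** (B::quat^'n^'n))"
  by (induction S rule: infinite_finite_induct) (auto simp: quat_matrix_add_rdistrib)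

lemma mult_sum_right: "B ** sum f S = (\<Sum>a\<in>S. B ** (f a::quat^'n^'n))"
  by (induction S rule: infinite_finite_induct) (auto simp: matrix_add_ldistrib)

lemma continuous_on_matrix_mult [continuous_intros]:
  fixes f g :: "'a::topological_space => quat^'n^'n"
  shows "continuous_on S f ==> continuous_on S g ==> continuous_on S (\<lambda>x. f x ** g x)"
  using bounded_bilinear.continuous_on[OF bilinear_conv_bounded_bilinear[THEN iffD1, OF bilinear_matrix_mult]] .

lemma linear_adj: "linear adj" by (simp add: linear_iff)

lemma continuous_on_adj [continuous_intros]:
  "continuous_on S f ==> continuous_on S (\<lambda>x. adj (f x :: quat^'n^'n))"
  using bounded_linear.continuous_on[OF linear_conv_bounded_linear[THEN iffD1, OF linear_adj]] .

lemma adj_sum: "adj (sum f A) = (\<Sum>a\<in>A. adj (f a))" using linear_sum[OF linear_adj, of f A] by (simp add: o_def)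

lemma trace_adj: "trace (adj M) = qcnj (trace M)" by (simp add: trace_def qcnj_sum)

abbreviation rtr :: "quat^'n^'n => real" where "rtr M \<equiv> qRe (trace M)"

text \<open>The quaternionic trace itself is not cyclic; its real part is, because the real part of
  a product of two quaternions does not depend on their order.\<close>

lemma rtr_commute: "rtr (A ** B) = rtr (B ** (A::quat^'n^'n))"
proof -
  have "rtr (A ** B) = (\<Sum>i\<in>UNIV. \<Sum>k\<in>UNIV. qRe (A $ i $ k * B $ k $ i))"
    unfolding trace_def mult_nth quat_sum_sel ..
  also have "\<dots> = (\<Sum>k\<in>UNIV. \<Sum>i\<in>UNIV. qRe (A $ i $ k * B $ k $ i))" by (rule sum.swap)
  also have "\<dots> = rtr (B ** A)" unfolding trace_def mult_nth quat_sum_sel by (intro sum.cong refl qRe_mult_commute)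
  finally show ?thesis .
qed

lemma rtr_adj: "rtr (adj M) = rtr M" by (simp add: trace_adj)

lemma inner_matrix_eq: "inner A B = rtr (A ** adj (B::quat^'n^'n))"
  by (simp add: inner_vec_def trace_def mult_nth quat_sum_sel inner_quat_eq del: quat_sel_simps)

lemma scalar_matrices_closed:
  "A \<in> scalar_matrices \<beta> ==> B \<in> scalar_matrices \<beta> ==> A + B \<in> scalar_matrices \<beta>"
  "A \<in> scalar_matrices \<beta> ==> B \<in> scalar_matrices \<beta> ==> A - B \<in> scalar_matrices \<beta>"
  "A \<in> scalar_matrices \<beta> ==> B \<in> scalar_matrices \<beta> ==> A ** B \<in> scalar_matrices \<beta>"
  "A \<in> scalar_matrices \<beta> ==> adj A \<in> scalar_matrices \<beta>"
  "A \<in> scalar_matrices \<beta> ==> r *\<^sub>R A \<in> scalar_matrices \<beta>"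
  "mat 1 \<in> scalar_matrices \<beta>" "0 \<in> scalar_matrices \<beta>"
  by (auto simp: scalar_matrices_def mult_nth mat_nth intro!: scalars_sum scalars_closed)

lemma unitary_group_iff: "Q \<in> unitary_group \<beta> \<longleftrightarrow> Q \<in> scalar_matrices \<beta> \<and> Q ** adj Q = mat 1"
  by (simp add: unitary_group_def scalar_matrices_def)

lemma hermitian_space_iff: "M \<in> hermitian_space \<beta> \<longleftrightarrow> M \<in> scalar_matrices \<beta> \<and> adj M = M"
  by (simp add: hermitian_space_def scalar_matrices_def)

text \<open>The quaternions are not commutative, so \<open>matrix_left_right_inverse\<close> does not apply; left
  multiplication is real-linear on a finite-dimensional space instead.\<close>

lemma quat_left_right_inverse:
  fixes A B :: "quat^'n^'n"
  assumes "A ** B = mat 1" shows "B ** A = mat 1"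
proof -
  let ?f = "\<lambda>X::quat^'n^'n. B ** X"
  have lin: "linear ?f" by (simp add: linear_iff matrix_add_ldistrib mult_scaleR)
  have "inj ?f"
  proof (rule injI)
    fix X Y assume "B ** X = B ** Y"
    hence "A ** (B ** X) = A ** (B ** Y)" by simp
    thus "X = Y" by (simp add: matrix_mul_assoc assms)
  qed
  hence "surj ?f" using linear_injective_imp_surjective[OF lin] by simp
  then obtain C where C: "B ** C = mat 1" by (metis surjD)
  have "C = (A ** B) ** C" by (simp add: assms)
  also have "\<dots> = A" by (simp add: matrix_mul_assoc[symmetric] C)
  finally show ?thesis using C by simp
qed

lemma unitary_left: "Q \<in> unitary_group \<beta> ==> adj Q ** Q = mat 1"
  unfolding unitary_group_iff using quat_left_right_inverse by blast

lemma unitary_closed: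
  "P \<in> unitary_group \<beta> ==> Q \<in> unitary_group \<beta> ==> P ** Q \<in> unitary_group \<beta>"
  "Q \<in> unitary_group \<beta> ==> adj Q \<in> unitary_group \<beta>" "mat 1 \<in> unitary_group \<beta>"
proof -
  assume a: "P \<in> unitary_group \<beta>" "Q \<in> unitary_group \<beta>"
  have "(P ** Q) ** adj (P ** Q) = P ** (Q ** adj Q) ** adj P" by (simp add: adj_mult matrix_mul_assoc)
  also have "\<dots> = mat 1" using a by (simp add: unitary_group_iff)
  finally show "P ** Q \<in> unitary_group \<beta>" using a by (simp add: unitary_group_iff scalar_matrices_closed)
next
  assume "Q \<in> unitary_group \<beta>" thus "adj Q \<in> unitary_group \<beta>"
    using unitary_left[of Q \<beta>] by (simp add: unitary_group_iff scalar_matrices_closed)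
qed (simp add: unitary_group_iff scalar_matrices_closed)

lemma norm_unitary_mult:
  assumes "Q \<in> unitary_group \<beta>" shows "norm (Q ** A) = norm A" "norm (A ** Q) = norm A"
proof -
  have "(norm (Q ** A))\<^sup>2 = rtr ((Q ** A) ** (adj A ** adj Q))" by (simp add: power2_norm_eq_inner inner_matrix_eq adj_mult)
  also have "\<dots> = rtr ((adj Q ** Q) ** (A ** adj A))"
    using rtr_commute[of "Q ** A ** adj A" "adj Q"] by (simp add: matrix_mul_assoc)
  also have "\<dots> = (norm A)\<^sup>2" by (simp add: unitary_left[OF assms] power2_norm_eq_inner inner_matrix_eq)
  finally show "norm (Q ** A) = norm A" by (simp add: power2_eq_iff_nonneg)
  have "(norm (A ** Q))\<^sup>2 = rtr (A ** (Q ** adj Q) ** adj A)"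
    by (simp add: power2_norm_eq_inner inner_matrix_eq adj_mult matrix_mul_assoc)
  also have "\<dots> = (norm A)\<^sup>2" using assms by (simp add: unitary_group_iff power2_norm_eq_inner inner_matrix_eq)
  finally show "norm (A ** Q) = norm A" by (simp add: power2_eq_iff_nonneg)
qed

lemma hermitian_conj:
  "M \<in> hermitian_space \<beta> ==> Q \<in> scalar_matrices \<beta> ==> Q ** M ** adj Q \<in> hermitian_space \<beta>"
  by (simp add: hermitian_space_iff adj_mult matrix_mul_assoc scalar_matrices_closed)

lemma closed_scalars: "closed (scalars \<beta>)"
proof -
  have "closed {q::quat. qI q = 0}" "closed {q. qJ q = 0}" "closed {q. qK q = 0}" by (intro closed_Collect_eq continuous_intros)+
  thus ?thesis unfolding scalars_def Collect_conj_eq by (auto intro!: closed_Int)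
qed

text \<open>Boundedness comes from invariance of the norm: a unitary matrix has the norm of the
  identity. Compactness supplies the maximiser on which the spectral theorem rests.\<close>

lemma compact_unitary_group: "compact (unitary_group \<beta> :: (quat^'n^'n) set)"
proof -
  have "closed (unitary_group \<beta> :: (quat^'n^'n) set)"
  proof -
    have "unitary_group \<beta> = (\<Inter>i j. (\<lambda>Q::quat^'n^'n. Q $ i $ j) -` scalars \<beta>) \<inter> {Q. Q ** adj Q = mat 1}"
      by (auto simp: unitary_group_def)
    moreover have "closed ((\<lambda>Q::quat^'n^'n. Q $ i $ j) -` scalars \<beta>)" for i j
      by (intro closed_vimage closed_scalars continuous_intros)
    moreover have "closed {Q::quat^'n^'n. Q ** adj Q = mat 1}" by (intro closed_Collect_eq continuous_intros)
    ultimately show ?thesis by (simp add: closed_Int closed_INT)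
  qed
  moreover have "bounded (unitary_group \<beta> :: (quat^'n^'n) set)"
  proof (rule boundedI)
    fix Q :: "quat^'n^'n" assume "Q \<in> unitary_group \<beta>"
    hence "norm (Q ** mat 1) = norm (mat 1 :: quat^'n^'n)" by (rule norm_unitary_mult)
    thus "norm Q \<le> norm (mat 1 :: quat^'n^'n)" by simp
  qed
  ultimately show ?thesis by (simp add: compact_eq_bounded_closed)
qed

subsection \<open>Spectral theorem\<close>

lemma diag_matrix_nth: "diag_matrix d $ i $ j = (if i = j then of_real (d i) else 0)" by (simp add: diag_matrix_def)

lemma norm_matrix_sq: "(norm (A::quat^'n^'n))\<^sup>2 = (\<Sum>i\<in>UNIV. \<Sum>j\<in>UNIV. (norm (A $ i $ j))\<^sup>2)"
  unfolding power2_norm_eq_inner inner_vec_def ..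

lemma hermitian_diag_real:
  assumes "M \<in> hermitian_space \<beta>" shows "M $ i $ i = of_real (qRe (M $ i $ i))"
proof -
  have "qcnj (M $ i $ i) = M $ i $ i" using assms by (metis adj_nth hermitian_space_iff)
  thus ?thesis by (simp add: quat_eq_iff)
qed

lemma sum_UNIV_pair:
  fixes f :: "'n::finite => 'a::comm_monoid_add"
  assumes "p \<noteq> q" "\<And>k. k \<noteq> p ==> k \<noteq> q ==> f k = 0"
  shows "sum f UNIV = f p + f q"
proof -
  have "sum f UNIV = sum f {p, q}" by (rule sum.mono_neutral_right) (use assms in auto)
  thus ?thesis using assms(1) by simp
qed

text \<open>A plane rotation with cosine \<open>c\<close> and sine \<open>s\<close>, combined with a
  phase \<open>u\<close> on the coordinate \<open>q\<close>: column \<open>p\<close> is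
  \<open>c\<close> at \<open>p\<close> and \<open>s *\<^sub>R u\<close> at \<open>q\<close>, column
  \<open>q\<close> is \<open>- s\<close> at \<open>p\<close> and \<open>c *\<^sub>R u\<close> at
  \<open>q\<close>. The phase serves to make an off-diagonal entry real.\<close>

definition jacobi :: "'n => 'n => quat => real => real => quat^'n^'n" where
  "jacobi p q u c s = (\<chi> i j. if j = p then (if i = p then of_real c else if i = q then s *\<^sub>R u else 0)
      else if j = q then (if i = p then of_real (- s) else if i = q then c *\<^sub>R u else 0) else if i = j then 1 else 0)"

lemma jacobi_unitary:
  fixes p q :: "'n::finite"
  assumes pq: "p \<noteq> q" and u: "u \<in> scalars \<beta>" "norm u = 1" and cs: "c\<^sup>2 + s\<^sup>2 = 1"
  shows "(jacobi p q u c s :: quat^'n^'n) \<in> unitary_group \<beta>"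
proof -
  let ?R = "jacobi p q u c s :: quat^'n^'n"
  have uu: "qcnj u * u = 1" using u(2) by (simp add: qcnj_mult_self)
  have *: "(adj ?R ** ?R) $ i $ j = (mat 1 :: quat^'n^'n) $ i $ j" for i j
  proof (cases "i \<in> {p, q} \<or> j \<in> {p, q}")
    case True
    have "(adj ?R ** ?R) $ i $ j = qcnj (?R $ p $ i) * ?R $ p $ j + qcnj (?R $ q $ i) * ?R $ q $ j"
      unfolding mult_nth adj_nth by (rule sum_UNIV_pair[OF pq]) (use True in \<open>auto simp: jacobi_def\<close>)
    also have "\<dots> = (mat 1 :: quat^'n^'n) $ i $ j"
    proof -
      have cs': "c * c + s * s = 1" "s * s + c * c = 1" using cs by (simp_all add: power2_eq_square)
      consider "i = p" "j = p" | "i = p" "j = q" | "i = q" "j = p" | "i = q" "j = q"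
        | "i \<in> {p, q}" "j \<notin> {p, q}" | "i \<notin> {p, q}" "j \<in> {p, q}" using True by blast
      thus ?thesis by cases (use pq uu in \<open>auto simp: cs' jacobi_def mat_nth of_real_def simp flip: scaleR_add_left\<close>)
    qed
    finally show ?thesis .
  next
    case False
    have "(adj ?R ** ?R) $ i $ j = (\<Sum>k\<in>UNIV. if k = i then qcnj (?R $ i $ i) * ?R $ i $ j else 0)"
      unfolding mult_nth adj_nth by (rule sum.cong) (use False in \<open>auto simp: jacobi_def\<close>)
    thus ?thesis using False by (simp add: jacobi_def mat_nth)
  qed
  have "adj ?R ** ?R = mat 1" using * by (simp add: vec_eq_iff)
  hence "?R ** adj ?R = mat 1" by (rule quat_left_right_inverse)
  moreover have "?R \<in> scalar_matrices \<beta>"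
    using u(1) by (auto simp: scalar_matrices_def jacobi_def intro!: scalars_closed scalars_closed(7)[of "- s", simplified])
  ultimately show ?thesis by (simp add: unitary_group_iff)
qed

text \<open>Once the phase has turned the entry at \<open>p\<close>, \<open>q\<close> into the real
  number \<open>h\<close>, conjugation acts on the two diagonal entries as a rotation acts on a real
  symmetric 2 by 2 matrix with off-diagonal entry \<open>h\<close>.\<close>

lemma jacobi_diag:
  fixes N :: "quat^'n^'n" and c s :: real
  assumes pq: "p \<noteq> q" and N: "N \<in> hermitian_space \<beta>" and h: "N $ p $ q * u = of_real h"
  defines "R \<equiv> jacobi p q u c s"
  assumes u: "norm u = 1"
  shows "qRe ((adj R ** N ** R) $ p $ p) = c\<^sup>2 * qRe (N $ p $ p) + s\<^sup>2 * qRe (N $ q $ q) + 2 * c * s * h"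
    and "qRe ((adj R ** N ** R) $ q $ q) = s\<^sup>2 * qRe (N $ p $ p) + c\<^sup>2 * qRe (N $ q $ q) - 2 * c * s * h"
    and "i \<noteq> p ==> i \<noteq> q ==> (adj R ** N ** R) $ i $ i = N $ i $ i"
proof -
  have herm: "N $ q $ p = qcnj (N $ p $ q)" using N by (metis adj_nth hermitian_space_iff)
  hence h': "qcnj u * N $ q $ p = of_real h" by (metis h qcnj_of_real qcnj_simps(7))
  obtain a b where ab: "N $ p $ p = of_real a" "N $ q $ q = of_real b" using hermitian_diag_real[OF N] by metis
  have uu: "qcnj u * u = 1" using u by (simp add: qcnj_mult_self)
  have uNu: "qcnj u * of_real b * u = of_real b"
    using uu by (simp add: of_real_quat_commute mult.assoc) (metis mult.assoc mult.left_neutral of_real_quat_commute)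
  have R: "R $ p $ p = of_real c" "R $ q $ p = s *\<^sub>R u" "R $ p $ q = - of_real s" "R $ q $ q = c *\<^sub>R u"
    using pq by (simp_all add: R_def jacobi_def)
  have *: "(adj R ** N ** R) $ j $ j = (\<Sum>l\<in>UNIV. (\<Sum>k\<in>UNIV. qcnj (R $ k $ j) * N $ k $ l) * R $ l $ j)" for j
    by (simp add: mult_nth)
  { fix j assume j: "j \<in> {p, q}"
    have "(\<Sum>k\<in>UNIV. qcnj (R $ k $ j) * N $ k $ l) = qcnj (R $ p $ j) * N $ p $ l + qcnj (R $ q $ j) * N $ q $ l" for l
      by (rule sum_UNIV_pair[OF pq]) (use j pq in \<open>auto simp: R_def jacobi_def\<close>)
    hence "(adj R ** N ** R) $ j $ j = (\<Sum>l\<in>UNIV. (qcnj (R $ p $ j) * N $ p $ l + qcnj (R $ q $ j) * N $ q $ l) * R $ l $ j)"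
      unfolding * by simp
    also have "\<dots> = (qcnj (R $ p $ j) * N $ p $ p + qcnj (R $ q $ j) * N $ q $ p) * R $ p $ j
        + (qcnj (R $ p $ j) * N $ p $ q + qcnj (R $ q $ j) * N $ q $ q) * R $ q $ j"
      by (rule sum_UNIV_pair[OF pq]) (use j pq in \<open>auto simp: R_def jacobi_def\<close>)
    finally have "(adj R ** N ** R) $ j $ j = \<dots>" . }
  note ** = this
  \<comment> \<open>Both cross terms equal \<open>h\<close>, by \<open>h\<close> and its conjugate
    form \<open>h'\<close>, and the phase cancels in the last term by \<open>uNu\<close>.\<close>
  have e1: "(of_real c * of_real a + (s *\<^sub>R qcnj u) * N $ q $ p) * of_real c
      + (of_real c * N $ p $ q + (s *\<^sub>R qcnj u) * of_real b) * (s *\<^sub>R u)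
      = of_real (c\<^sup>2 * a) + (s * c) *\<^sub>R (qcnj u * N $ q $ p) + (c * s) *\<^sub>R (N $ p $ q * u) + (s * s) *\<^sub>R (qcnj u * of_real b * u)"
    by (simp add: algebra_simps power2_eq_square of_real_def)
  show "qRe ((adj R ** N ** R) $ p $ p) = c\<^sup>2 * qRe (N $ p $ p) + s\<^sup>2 * qRe (N $ q $ q) + 2 * c * s * h"
    using **[of p] unfolding R ab qcnj_simps qcnj_of_real e1 h h' uNu
    by (simp add: ab power2_eq_square del: of_real_mult of_real_power)
  have e2: "(- of_real s * of_real a + (c *\<^sub>R qcnj u) * N $ q $ p) * (- of_real s)
      + (- of_real s * N $ p $ q + (c *\<^sub>R qcnj u) * of_real b) * (c *\<^sub>R u)
      = of_real (s\<^sup>2 * a) - (s * c) *\<^sub>R (qcnj u * N $ q $ p) - (c * s) *\<^sub>R (N $ p $ q * u) + (c * c) *\<^sub>R (qcnj u * of_real b * u)"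
    by (simp add: algebra_simps power2_eq_square of_real_def)
  show "qRe ((adj R ** N ** R) $ q $ q) = s\<^sup>2 * qRe (N $ p $ p) + c\<^sup>2 * qRe (N $ q $ q) - 2 * c * s * h"
    using **[of q] unfolding R ab qcnj_simps qcnj_of_real e2 h h' uNu
    by (simp add: ab power2_eq_square del: of_real_mult of_real_power)
  show "(adj R ** N ** R) $ i $ i = N $ i $ i" if i: "i \<noteq> p" "i \<noteq> q"
  proof -
    have Ri: "R $ k $ i = (if k = i then 1 else 0)" for k using i by (simp add: R_def jacobi_def)
    show ?thesis unfolding * Ri by (simp add: if_distrib[of qcnj] if_distrib[of "\<lambda>x. x * _"] if_distrib[of "\<lambda>x. _ * x"] cong: if_cong)
  qed
qed

text \<open>Variational argument: among all unitary conjugates of \<open>M\<close>, take one with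
  the largest sum of squared diagonal entries. A nonzero off-diagonal entry could be rotated onto
  the diagonal and would raise this sum, so the maximiser is diagonal. The argument is the same for
  all three kinds of scalars.\<close>

theorem hermitian_diagonalizable:
  fixes M :: "quat^'n^'n"
  assumes M: "M \<in> hermitian_space \<beta>"
  shows "\<exists>Q\<in>unitary_group \<beta>. \<exists>d. adj Q ** M ** Q = diag_matrix d"
proof -
  define g where "g Q = (\<Sum>i\<in>UNIV. (qRe ((adj Q ** M ** Q) $ i $ i))\<^sup>2)" for Q :: "quat^'n^'n"
  have "continuous_on (unitary_group \<beta>) g" unfolding g_def by (intro continuous_intros)
  moreover have "unitary_group \<beta> \<noteq> ({} :: (quat^'n^'n) set)" using unitary_closed(3) by auto
  ultimately obtain Q where Q: "Q \<in> unitary_group \<beta>" and max: "\<And>P. P \<in> unitary_group \<beta> ==> g P \<le> g Q"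
    using continuous_attains_sup[OF compact_unitary_group] by blast
  define N where "N = adj Q ** M ** Q"
  have N: "N \<in> hermitian_space \<beta>"
    using hermitian_conj[OF M, of "adj Q"] Q unitary_closed(2)[OF Q] by (simp add: N_def unitary_group_iff)
  have off: "N $ p $ q = 0" if pq: "p \<noteq> q" for p q
  proof (rule ccontr)
    assume nz: "N $ p $ q \<noteq> 0"
    define h where "h = norm (N $ p $ q)"
    have h0: "h > 0" using nz by (simp add: h_def)
    define u where "u = (1 / h) *\<^sub>R qcnj (N $ p $ q)"
    have us: "u \<in> scalars \<beta>"
      using N by (auto simp: u_def hermitian_space_iff scalar_matrices_def intro!: scalars_closed)
    have un: "norm u = 1" using h0 by (simp add: u_def h_def)
    have uh: "N $ p $ q * u = of_real h"
      using h0 by (simp add: u_def qcnj_mult_self h_def[symmetric] power2_eq_square of_real_def)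
    define a b where "a = qRe (N $ p $ p)" and "b = qRe (N $ q $ q)"
    define \<rho> where "\<rho> = sqrt ((a - b)\<^sup>2 + (2 * h)\<^sup>2)"
    have \<rho>: "\<rho>\<^sup>2 = (a - b)\<^sup>2 + (2 * h)\<^sup>2" by (simp add: \<rho>_def)
    have \<rho>0: "\<rho> > 0" using h0 by (simp add: \<rho>_def add_nonneg_pos)
    have "((a - b) / \<rho>)\<^sup>2 + (2 * h / \<rho>)\<^sup>2 = 1"
      using \<rho>0 unfolding power_divide add_divide_distrib[symmetric] \<rho>[symmetric] by simp
    then obtain t where t: "(a - b) / \<rho> = cos t" "2 * h / \<rho> = sin t" using sincos_total_2pi by metis
    \<comment> \<open>Half the polar angle of the point \<open>(a - b, 2 * h)\<close>: this rotation
      diagonalises the 2 by 2 block, whose diagonal becomes \<open>(a + b + \<rho>) / 2\<close> and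
      \<open>(a + b - \<rho>) / 2\<close>. The gain \<open>2 * h\<^sup>2\<close> is the mass of the
      two off-diagonal entries.\<close>
    define c s where "c = cos (t / 2)" and "s = sin (t / 2)"
    have cs: "c\<^sup>2 + s\<^sup>2 = 1" by (simp add: c_def s_def)
    have ct: "cos t = c\<^sup>2 - s\<^sup>2" "sin t = 2 * s * c"
      using cos_double[of "t / 2"] sin_double[of "t / 2"] by (simp_all add: c_def s_def)
    define R where "R = (jacobi p q u c s :: quat^'n^'n)"
    have QR: "Q ** R \<in> unitary_group \<beta>" unfolding R_def by (intro unitary_closed Q jacobi_unitary pq us un cs)
    have eq: "adj (Q ** R) ** M ** (Q ** R) = adj R ** N ** R" by (simp add: adj_mult N_def matrix_mul_assoc)
    let ?d = "\<lambda>A::quat^'n^'n. \<lambda>i. (qRe (A $ i $ i))\<^sup>2"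
    have split: "(\<Sum>i\<in>UNIV. ?d A i) = ?d A p + ?d A q + (\<Sum>i\<in>UNIV - {p, q}. ?d A i)" for A
      using pq by (subst sum.subset_diff[of "{p, q}"]) auto
    have "(\<Sum>i\<in>UNIV - {p, q}. ?d (adj R ** N ** R) i) = (\<Sum>i\<in>UNIV - {p, q}. ?d N i)"
      unfolding R_def using jacobi_diag(3)[OF pq N uh un] by (intro sum.cong) auto
    hence "g (Q ** R) - g Q = ?d (adj R ** N ** R) p + ?d (adj R ** N ** R) q - a\<^sup>2 - b\<^sup>2"
      unfolding g_def eq N_def[symmetric] split by (simp add: a_def b_def)
    also have "\<dots> = (c\<^sup>2 * a + s\<^sup>2 * b + 2 * c * s * h)\<^sup>2 + (s\<^sup>2 * a + c\<^sup>2 * b - 2 * c * s * h)\<^sup>2 - a\<^sup>2 - b\<^sup>2"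
      unfolding R_def jacobi_diag(1,2)[OF pq N uh un] a_def b_def ..
    also have "\<dots> = ((a + b)\<^sup>2 * (c\<^sup>2 + s\<^sup>2)\<^sup>2 + ((c\<^sup>2 - s\<^sup>2) * (a - b) + (2 * s * c) * (2 * h))\<^sup>2) / 2 - a\<^sup>2 - b\<^sup>2"
      by (simp add: power2_eq_square field_simps)
    also have "\<dots> = ((a + b)\<^sup>2 + (cos t * (a - b) + sin t * (2 * h))\<^sup>2) / 2 - a\<^sup>2 - b\<^sup>2"
      by (simp add: cs ct)
    also have "cos t * (a - b) + sin t * (2 * h) = \<rho>"
      using \<rho> \<rho>0 by (simp add: t[symmetric] field_simps power2_eq_square)
    also have "((a + b)\<^sup>2 + \<rho>\<^sup>2) / 2 - a\<^sup>2 - b\<^sup>2 = 2 * h\<^sup>2"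
      unfolding \<rho> by (simp add: power2_eq_square field_simps)
    finally have "g (Q ** R) - g Q = 2 * h\<^sup>2" .
    moreover have "2 * h\<^sup>2 > 0" using h0 by simp
    ultimately show False using max[OF QR] by linarith
  qed
  have "N = diag_matrix (\<lambda>i. qRe (N $ i $ i))"
    using off hermitian_diag_real[OF N] by (simp add: vec_eq_iff diag_matrix_nth)
  thus ?thesis using Q N_def by metis
qed

section \<open>Power sums of the eigenvalues as traces of powers\<close>

primrec mpow :: "quat^'n^'n => nat => quat^'n^'n" where
  "mpow M 0 = mat 1"
| "mpow M (Suc k) = M ** mpow M k"

lemma mpow_conj:
  assumes "Q \<in> unitary_group \<beta>" shows "mpow (adj Q ** M ** Q) k = adj Q ** mpow M k ** Q"
proof (induction k)
  case 0 thus ?case using unitary_left[OF assms] by simp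
next
  case (Suc k)
  have "mpow (adj Q ** M ** Q) (Suc k) = adj Q ** M ** (Q ** adj Q) ** mpow M k ** Q" by (simp add: Suc.IH matrix_mul_assoc)
  also have "Q ** adj Q = mat 1" using assms by (simp add: unitary_group_iff)
  finally show ?case by (simp add: matrix_mul_assoc)
qed

lemma mpow_diag: "mpow (diag_matrix d) k = diag_matrix (\<lambda>i. d i ^ k)"
proof (induction k)
  case (Suc k)
  show ?case by (auto simp: Suc vec_eq_iff mult_nth diag_matrix_nth if_distrib[of "\<lambda>x. x * _"] cong: if_cong)
qed (simp add: vec_eq_iff mat_nth diag_matrix_nth)

lemma rtr_mpow_diagonalized:
  assumes "Q \<in> unitary_group \<beta>" "adj Q ** M ** Q = diag_matrix d"
  shows "rtr (mpow M k) = (\<Sum>i\<in>UNIV. d i ^ k)"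
proof -
  have "(\<Sum>i\<in>UNIV. d i ^ k) = rtr (mpow (adj Q ** M ** Q) k)"
    unfolding assms(2) mpow_diag by (simp add: trace_def diag_matrix_nth quat_sum_sel flip: of_real_power)
  also have "\<dots> = rtr (Q ** adj Q ** mpow M k)"
    unfolding mpow_conj[OF assms(1)] using rtr_commute[of "adj Q ** mpow M k" Q] by (simp add: matrix_mul_assoc)
  finally show ?thesis using assms(1) by (simp add: unitary_group_iff)
qed

text \<open>Equal power sums give equal sums of every polynomial. A polynomial that vanishes at all
  occurring values except \<open>v\<close> then reads off the multiplicity of
  \<open>v\<close>.\<close>

lemma image_mset_eq_if_power_sums_eq:
  fixes d e :: "'n::finite => real"
  assumes "\<And>k. (\<Sum>i\<in>UNIV. d i ^ k) = (\<Sum>i\<in>UNIV. e i ^ k)"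
  shows "image_mset d (mset_set UNIV) = image_mset e (mset_set UNIV)"
proof (rule multiset_eqI)
  fix v
  have poly: "(\<Sum>i\<in>UNIV. poly p (d i)) = (\<Sum>i\<in>UNIV. poly p (e i))" for p
    unfolding poly_altdef by (subst (1 2) sum.swap) (simp add: sum_distrib_left[symmetric] assms)
  define p where "p = (\<Prod>w\<in>(range d \<union> range e) - {v}. [:- w, 1:])"
  have p: "poly p w = (if w = v then poly p v else 0)" if "w \<in> range d \<union> range e" for w
    using that by (auto simp: p_def poly_prod)
  have nz: "poly p v \<noteq> 0" by (auto simp: p_def poly_prod)
  have cnt: "count (image_mset f (mset_set UNIV)) v = card {i. f i = v}" for f :: "'n => real"
    by (simp add: count_image_mset vimage_def)
  have s: "(\<Sum>i\<in>UNIV. poly p (f i)) = real (card {i. f i = v}) * poly p v" if "range f \<subseteq> range d \<union> range e" for f :: "'n => real"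
  proof -
    have "(\<Sum>i\<in>UNIV. poly p (f i)) = (\<Sum>i\<in>UNIV. if f i = v then poly p v else 0)"
      by (intro sum.cong refl p) (use that in blast)
    also have "\<dots> = real (card {i. f i = v}) * poly p v" by (simp flip: sum.inter_filter)
    finally show ?thesis .
  qed
  show "count (image_mset d (mset_set UNIV)) v = count (image_mset e (mset_set UNIV)) v"
    unfolding cnt using poly[of p] nz by (simp add: s)
qed

text \<open>Any two diagonalisations have the same power sums, hence the same multiset of diagonal
  entries; this makes the definite description in \<open>eigval\<close> denote the sorted list of
  any one of them.\<close>

lemma sum_eigval_power:
  fixes M :: "quat^'n^'n"
  assumes M: "M \<in> hermitian_space \<beta>"
  shows "(\<Sum>i=1..CARD('n). eigval \<beta> M i ^ k) = rtr (mpow M k)"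
proof -
  obtain Q d where Q: "Q \<in> unitary_group \<beta>" and d: "adj Q ** M ** Q = diag_matrix d"
    using hermitian_diagonalizable[OF M] by blast
  define l where "l = rev (sorted_list_of_multiset (image_mset d (mset_set UNIV)))"
  have the: "(THE l. is_spectrum \<beta> M l) = l"
  proof (rule the_equality)
    show "is_spectrum \<beta> M l" using Q d unfolding is_spectrum_def l_def by blast
    fix l' assume "is_spectrum \<beta> M l'"
    then obtain Q' d' where "Q' \<in> unitary_group \<beta>" "adj Q' ** M ** Q' = diag_matrix d'"
      and l': "l' = rev (sorted_list_of_multiset (image_mset d' (mset_set UNIV)))" unfolding is_spectrum_def by blast
    hence "image_mset d' (mset_set UNIV) = image_mset d (mset_set UNIV)"
      using rtr_mpow_diagonalized[OF Q d] rtr_mpow_diagonalized[of Q' \<beta> M d']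
      by (intro image_mset_eq_if_power_sums_eq) metis
    thus "l' = l" by (simp add: l' l_def)
  qed
  have mset: "mset l = image_mset d (mset_set UNIV)" by (simp add: l_def)
  hence len: "length l = CARD('n)" by (metis size_image_mset size_mset size_mset_set)
  have "(\<Sum>i=1..CARD('n). eigval \<beta> M i ^ k) = (\<Sum>i<length l. (l ! i) ^ k)" unfolding eigval_def the len
    by (rule sum.reindex_bij_witness[of _ Suc "\<lambda>i. i - 1"]) auto
  also have "\<dots> = sum_list (map (\<lambda>x. x ^ k) l)" by (simp add: sum_list_sum_nth atLeast0LessThan)
  also have "\<dots> = sum_mset (image_mset (\<lambda>x. x ^ k) (mset l))" by (simp flip: sum_mset_sum_list)
  also have "\<dots> = (\<Sum>i\<in>UNIV. d i ^ k)" unfolding mset by (simp add: multiset.map_comp o_def sum_unfold_sum_mset)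
  finally show ?thesis using rtr_mpow_diagonalized[OF Q d] by simp
qed

lemma half_square_eq:
  fixes \<Phi> :: "quat^'n^'n^'v::finite"
  assumes "\<Phi> \<in> field_space \<beta>"
  shows "half_square \<beta> \<Phi> = (\<chi> v. (norm (\<Phi> $ v))\<^sup>2 / 2)"
proof -
  have "rtr (mpow (\<Phi> $ v) 2) = (norm (\<Phi> $ v))\<^sup>2" for v using assms unfolding power2_norm_eq_inner inner_matrix_eq
    by (simp add: field_space_def hermitian_space_iff numeral_2_eq_2)
  thus ?thesis using assms by (simp add: half_square_def sum_eigval_power[unfolded One_nat_def] field_space_def)
qed

subsection \<open>Contraction identities\<close>

text \<open>For \<open>\<beta> = 4\<close> the factor \<open>-2\<close> per loop turns the quaternionic contraction rules into those of
  \<open>\<beta> = 1\<close>, with constant \<open>-1\<close> in place of \<open>1/2\<close>; it produces the factor \<open>(-2)\<^bsup>\<chi>\<^esup>\<close> of the weight.\<close>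

definition loop_trace :: "nat => quat^'n^'n => complex" where
  "loop_trace \<beta> M = (if \<beta> = 4 then of_real (- 2 * rtr M) else Complex (rtr M) (qI (trace M)))"

text \<open>The straight coefficient. For real traces the projection onto hermitian matrices gives
  1/2 to each of the straight and twisted terms; rescaling every quaternionic loop by -2 turns 1/2
  into -1. For \<beta> = 2 the real and imaginary parts of the loops contribute equal straight terms
  and opposite twisted ones.\<close>

definition c_str :: "nat => complex" where
  "c_str \<beta> = (if \<beta> = 1 then 1/2 else if \<beta> = 2 then 1 else -1)"

definition c_twi :: "nat => complex" where
  "c_twi \<beta> = (if \<beta> = 1 then 1/2 else if \<beta> = 2 then 0 else -1)"

text \<open>Written exactly as the predicate chosen from in \<open>subspace_lborel\<close>, so that
  the two can be folded into each other.\<close>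

definition is_onb :: "'a::real_inner set => 'a set => bool" where
  "is_onb S B \<longleftrightarrow> B \<subseteq> S \<and> pairwise orthogonal B \<and> (\<forall>b\<in>B. norm b = 1) \<and> span B = S"

lemma is_onb_exists:
  assumes "subspace (S::'a::euclidean_space set)" shows "\<exists>B. is_onb S B"
proof -
  obtain B where "B \<subseteq> S" "pairwise orthogonal B" "\<And>x. x \<in> B ==> norm x = 1" "span B = S"
    using orthonormal_basis_subspace[OF assms] by metis
  thus ?thesis unfolding is_onb_def by blast
qed

lemma is_onb_inner: "is_onb S B ==> b \<in> B ==> c \<in> B ==> inner b c = (if b = c then 1 else 0)"
  unfolding is_onb_def pairwise_def orthogonal_def by (metis norm_eq_1)

lemma is_onb_finite: "is_onb S B ==> finite (B::'a::euclidean_space set)"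
  unfolding is_onb_def by (meson pairwise_orthogonal_imp_finite)

lemma is_onb_independent: "is_onb S B ==> independent (B::'a::euclidean_space set)"
  unfolding is_onb_def by (intro pairwise_orthogonal_independent) (auto simp: norm_eq_zero[symmetric] simp del: norm_eq_zero)

lemma is_onb_expand:
  assumes B: "is_onb S (B::'a::euclidean_space set)" and v: "v \<in> S"
  shows "(\<Sum>b\<in>B. inner v b *\<^sub>R b) = v"
proof -
  have fin: "finite B" using B by (rule is_onb_finite)
  have "v \<in> span B" using B v by (simp add: is_onb_def)
  then obtain u where u: "v = (\<Sum>b\<in>B. u b *\<^sub>R b)" using fin by (auto simp: span_finite)
  have "inner v c = u c" if "c \<in> B" for c
  proof -
    have "inner v c = (\<Sum>b\<in>B. u b * (if b = c then 1 else 0))"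
      unfolding u inner_sum_left using is_onb_inner[OF B _ that] by (intro sum.cong) auto
    thus ?thesis using fin that by (simp add: if_distrib cong: if_cong)
  qed
  thus ?thesis unfolding u by (intro sum.cong refl) (simp flip: u)
qed

lemma subspace_hermitian_space: "subspace (hermitian_space \<beta> :: (quat^'n^'n) set)"
  unfolding subspace_def by (auto simp: hermitian_space_iff scalar_matrices_closed)

text \<open>A hermitian \<open>b\<close> has the same inner product with \<open>X\<close> and with
  \<open>adj X\<close>, so it only sees the hermitian part of \<open>X\<close>, which the basis then
  reproduces.\<close>

lemma onb_hermitian_part:
  fixes B :: "(quat^'n^'n) set"
  assumes B: "is_onb (hermitian_space \<beta>) B" and X: "X \<in> scalar_matrices \<beta>"
  shows "(\<Sum>b\<in>B. inner b X *\<^sub>R b) = (1/2) *\<^sub>R (X + adj X)"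
proof -
  have *: "inner b X = inner ((1/2) *\<^sub>R (X + adj X)) b" if "b \<in> B" for b
  proof -
    have b: "adj b = b" using that B by (auto simp: is_onb_def hermitian_space_iff)
    have "inner X b = rtr (X ** b)" "inner (adj X) b = rtr (adj X ** b)" by (simp_all add: inner_matrix_eq b)
    moreover have "rtr (adj X ** b) = rtr (X ** b)" using rtr_adj[of "adj X ** b"] by (simp add: adj_mult b rtr_commute)
    ultimately show ?thesis by (simp add: inner_commute[of b] inner_add_left)
  qed
  have "(1/2) *\<^sub>R (X + adj X) \<in> hermitian_space \<beta>"
    using X by (auto simp: hermitian_space_iff scalar_matrices_closed add.commute)
  from is_onb_expand[OF B this] show ?thesis by (simp add: * cong: sum.cong)
qed

text \<open>Parseval's identity for the projection onto hermitian matrices: the real trace of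
  \<open>b ** X\<close> is the inner product of \<open>b\<close> with \<open>adj X\<close>.\<close>

lemma onb_rtr_rtr:
  fixes B :: "(quat^'n^'n) set"
  assumes B: "is_onb (hermitian_space \<beta>) B" and X: "X \<in> scalar_matrices \<beta>"
  shows "(\<Sum>b\<in>B. rtr (b ** X) * rtr (b ** Y)) = (rtr (X ** Y) + rtr (X ** adj Y)) / 2"
proof -
  have "(\<Sum>b\<in>B. rtr (b ** X) * rtr (b ** Y)) = (\<Sum>b\<in>B. inner b (adj X) * inner b (adj Y))"
    by (simp add: inner_matrix_eq)
  also have "\<dots> = inner (\<Sum>b\<in>B. inner b (adj X) *\<^sub>R b) (adj Y)" by (simp add: inner_sum_left)
  also have "\<dots> = (inner (adj X) (adj Y) + inner X (adj Y)) / 2"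
    by (simp add: onb_hermitian_part[OF B] X scalar_matrices_closed inner_add_left)
  also have "inner X (adj Y) = rtr (X ** Y)" by (simp add: inner_matrix_eq)
  also have "inner (adj X) (adj Y) = rtr (X ** adj Y)"
    using rtr_adj[of "adj X ** Y"] by (simp add: inner_matrix_eq adj_mult rtr_commute)
  finally show ?thesis by simp
qed

text \<open>For \<open>\<beta> = 2\<close> multiplication by this central element turns real into imaginary parts.\<close>

definition imag_matrix :: "quat^'n^'n" where "imag_matrix = mat (Quat 0 1 0 0)"

lemma imag_matrix_mult:
  "(imag_matrix ** X) $ i $ j = Quat 0 1 0 0 * (X::quat^'n^'n) $ i $ j"
  by (simp add: imag_matrix_def mult_nth mat_nth if_distrib[of "\<lambda>x. x * _"] cong: if_cong)

lemma imag_matrix_scalar: "X \<in> scalar_matrices 2 ==> imag_matrix ** X \<in> scalar_matrices 2"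
  by (auto simp: scalar_matrices_def imag_matrix_mult scalars_def)

lemma qI_trace: "qI (trace X) = - rtr (imag_matrix ** (X::quat^'n^'n))"
  by (simp add: trace_def quat_sum_sel imag_matrix_mult sum_negf)

lemma imag_matrix_commute:
  assumes "X \<in> scalar_matrices 2"
  shows "X ** (imag_matrix ** Y) = imag_matrix ** (X ** (Y::quat^'n^'n))"
proof -
  have "X ** imag_matrix = imag_matrix ** X"
    using assms by (auto simp: vec_eq_iff scalar_matrices_def scalars_def imag_matrix_mult)
      (auto simp: imag_matrix_def mult_nth mat_nth quat_eq_iff if_distrib[of "\<lambda>x. _ * x"] cong: if_cong)
  thus ?thesis by (simp add: matrix_mul_assoc)
qed

lemma adj_imag_matrix: "adj imag_matrix = - imag_matrix" by (auto simp: vec_eq_iff imag_matrix_def mat_nth quat_eq_iff)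

lemma imag_matrix_sq: "imag_matrix ** (imag_matrix ** X) = - (X::quat^'n^'n)"
  by (simp add: vec_eq_iff imag_matrix_mult quat_eq_iff)

lemma trace_scalars: "X \<in> scalar_matrices \<beta> ==> trace X \<in> scalars \<beta>"
  by (auto simp: trace_def scalar_matrices_def intro: scalars_sum)

lemma loop_trace_1:
  assumes "X \<in> scalar_matrices 1" shows "loop_trace 1 X = of_real (rtr X)"
  using trace_scalars[OF assms] by (simp add: loop_trace_def scalars_def complex_eq_iff)

lemma loop_trace_2: "loop_trace 2 X = Complex (rtr X) (- rtr (imag_matrix ** X))" by (simp add: loop_trace_def qI_trace)

text \<open>For \<beta> = 2 the imaginary part of a trace is, up to sign, the real trace after
  multiplication by the central element \<open>imag_matrix\<close>, so it inherits cyclicity. For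
  \<beta> = 4 only the real part enters, and for \<beta> = 1 there is no other part.\<close>

lemma loop_trace_commute:
  assumes "\<beta> \<in> {1, 2, 4}" "X \<in> scalar_matrices \<beta>" "Y \<in> scalar_matrices \<beta>"
  shows "loop_trace \<beta> (X ** Y) = loop_trace \<beta> (Y ** (X::quat^'n^'n))"
proof -
  have "rtr (imag_matrix ** (X ** Y)) = rtr (imag_matrix ** (Y ** X))" if "\<beta> = 2"
    using assms that rtr_commute[of "imag_matrix ** X" Y] imag_matrix_commute[of Y X] by (simp add: matrix_mul_assoc)
  thus ?thesis using assms rtr_commute[of X Y] loop_trace_1[of "X ** Y"] loop_trace_1[of "Y ** X"]
    by (auto simp: loop_trace_2 scalar_matrices_closed) (auto simp: loop_trace_def)
qed

text \<open>This is why a loop may be traversed in either direction for \<beta> in {1, 4}. For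
  \<beta> = 2 the reversal conjugates the trace, and a direction has to be prescribed.\<close>

lemma loop_trace_adj:
  assumes "\<beta> \<in> {1, 4}" "X \<in> scalar_matrices \<beta>"
  shows "loop_trace \<beta> (adj X) = loop_trace \<beta> (X::quat^'n^'n)" using assms loop_trace_1[of X] loop_trace_1[of "adj X"]
  by (auto simp: scalar_matrices_closed rtr_adj) (auto simp: loop_trace_def rtr_adj)

text \<open>The joining rule: two loops meeting in the contracted matrices merge into one, the
  second loop being run forwards in the straight term and backwards in the twisted term.\<close>

theorem onb_contract_two:
  fixes B :: "(quat^'n^'n) set"
  assumes \<beta>: "\<beta> \<in> {1, 2, 4}" and B: "is_onb (hermitian_space \<beta>) B"
    and X: "X \<in> scalar_matrices \<beta>" and Y: "Y \<in> scalar_matrices \<beta>"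
  shows "(\<Sum>b\<in>B. loop_trace \<beta> (b ** X) * loop_trace \<beta> (b ** Y))
    = c_str \<beta> * loop_trace \<beta> (X ** Y) + c_twi \<beta> * loop_trace \<beta> (X ** adj Y)"
proof -
  let ?L = "\<Sum>b\<in>B. loop_trace \<beta> (b ** X) * loop_trace \<beta> (b ** Y)" and ?r = "\<lambda>X Y. \<Sum>b\<in>B. rtr (b ** X) * rtr (b ** Y)"
  have bs: "b \<in> scalar_matrices \<beta>" if "b \<in> B" for b using B that by (auto simp: is_onb_def hermitian_space_iff)
  from \<beta> consider "\<beta> = 1" | "\<beta> = 2" | "\<beta> = 4" by auto
  thus ?thesis
  proof cases
    case 1
    have "?L = of_real (?r X Y)" unfolding of_real_sum using X Y bs
      by (intro sum.cong) (auto simp: 1 loop_trace_1[unfolded One_nat_def] scalar_matrices_closed)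
    also have "\<dots> = 1/2 * of_real (rtr (X ** Y)) + 1/2 * of_real (rtr (X ** adj Y))" unfolding onb_rtr_rtr[OF B X] by simp
    finally show ?thesis using X Y by (simp only: 1 loop_trace_1 scalar_matrices_closed c_str_def c_twi_def simp_thms if_True)
  next
    case 2
    let ?i = "imag_matrix :: quat^'n^'n"
    have comm: "?i ** (b ** Z) = b ** (?i ** Z)" if "b \<in> B" for b and Z :: "quat^'n^'n"
      using imag_matrix_commute[of b Z] bs[OF that] 2 by simp
    have R: "?r Z W = (rtr (Z ** W) + rtr (Z ** adj W)) / 2" if "Z \<in> scalar_matrices 2" for Z W
      using onb_rtr_rtr[of 2 B Z W] B that 2 by simp
    have iX: "?i ** X \<in> scalar_matrices 2" and X2: "X \<in> scalar_matrices 2" and iXY: "?i ** (X ** Y) = X ** (?i ** Y)"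
      using X 2 imag_matrix_scalar[of X] imag_matrix_commute[of X Y] by simp_all
    have neg: "Z ** (- W) = - (Z ** W)" for Z W :: "quat^'n^'n" by (simp add: vec_eq_iff mult_nth sum_negf)
    have Yi: "adj Y ** ?i = ?i ** adj Y"
      using imag_matrix_commute[of "adj Y" "mat 1 :: quat^'n^'n"] Y 2 by (simp add: scalar_matrices_closed)
    have adjY: "adj (?i ** Y) = - (?i ** adj Y)" unfolding adj_mult adj_imag_matrix neg Yi ..
    have rneg: "rtr (- W) = - rtr W" for W :: "quat^'n^'n" by (simp add: trace_def quat_sum_sel sum_negf)
    \<comment> \<open>Here \<open>c\<close> stands for the twisted trace. It cancels in the real and
      in the imaginary part, and only the straight trace \<open>a\<close> survives.\<close>
    have arith1: "(a + c) / 2 - (- a + - (- c)) / 2 = a" and arith2: "- ((a + - c) / 2) - (a + c) / 2 = - a" for a c :: real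
      by (simp_all add: field_simps)
    have "Re ?L = ?r X Y - ?r (?i ** X) (?i ** Y)"
      unfolding Re_sum sum_subtractf[symmetric] by (intro sum.cong refl) (simp add: 2 loop_trace_2 comm)
    also have "\<dots> = rtr (X ** Y)"
      unfolding R[OF X2] R[OF iX] adjY neg matrix_mul_assoc[symmetric] imag_matrix_commute[OF X2] imag_matrix_sq rneg
      by (rule arith1)
    finally have re: "Re ?L = rtr (X ** Y)" .
    have "Im ?L = - ?r X (?i ** Y) - ?r (?i ** X) Y"
      unfolding Im_sum sum_subtractf[symmetric] sum_negf[symmetric] by (intro sum.cong refl) (simp add: 2 loop_trace_2 comm)
    also have "\<dots> = - rtr (?i ** (X ** Y))"
      unfolding R[OF X2] R[OF iX] adjY neg matrix_mul_assoc[symmetric] imag_matrix_commute[OF X2] rneg by (rule arith2)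
    finally show ?thesis using re by (simp add: 2 c_str_def c_twi_def loop_trace_2 complex_eq_iff)
  next
    case 3
    have "?L = of_real (4 * ?r X Y)" by (simp add: 3 loop_trace_def sum_distrib_left mult.assoc)
    also have "\<dots> = - 1 * of_real (- 2 * rtr (X ** Y)) + - 1 * of_real (- 2 * rtr (X ** adj Y))"
      unfolding onb_rtr_rtr[OF B X] by (simp add: complex_eq_iff field_simps)
    finally show ?thesis by (simp add: 3 loop_trace_def c_str_def c_twi_def)
  qed
qed

section \<open>Contraction of two matrices within one loop\<close>

lemma scalars_basis_cases: "\<beta> \<in> {1, 2, 4} ==> Basis \<inter> scalars \<beta> =
    (if \<beta> = 1 then {Quat 1 0 0 0} else if \<beta> = 2 then {Quat 1 0 0 0, Quat 0 1 0 0} else Basis)"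
  by (auto simp: Basis_quat_def scalars_def)

lemma quat_expand: "q \<in> scalars \<beta> ==> \<beta> \<in> {1, 2, 4} ==> (\<Sum>e\<in>Basis \<inter> scalars \<beta>. inner q e *\<^sub>R e) = q"
  by (subst scalars_basis_cases) (auto simp: Basis_quat_def scalars_def quat_eq_iff inner_quat_def)

definition munit :: "'n => 'n => quat => quat^'n^'n" where
  "munit i j e = axis i (axis j e)"

lemma inner_munit: "inner b (munit i j e) = inner (b $ i $ j) e" by (simp add: munit_def inner_axis)

lemma munit_scalar: "e \<in> scalars \<beta> ==> munit i j e \<in> scalar_matrices \<beta>"
  by (auto simp: munit_def scalar_matrices_def axis_def scalars_closed)

lemma adj_munit: "adj (munit i j e) = munit j i (qcnj e)" by (auto simp: munit_def vec_eq_iff axis_def)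

lemma inner_munit_munit: "inner (munit i j e) (munit k l f) = (if i = k \<and> j = l then inner e f else 0)"
  by (auto simp: inner_munit) (auto simp: munit_def axis_def)

lemma quat_sum_product:
  "(\<Sum>e\<in>E. u e *\<^sub>R e) * x * (\<Sum>f\<in>E. v f *\<^sub>R f) = (\<Sum>e\<in>E. \<Sum>f\<in>E. (u e * v f) *\<^sub>R (e * x * (f::quat)))"
proof -
  have "(\<Sum>e\<in>E. u e *\<^sub>R e) * x = (\<Sum>e\<in>E. u e *\<^sub>R (e * x))" by (simp add: sum_distrib_right)
  thus ?thesis by (simp only: sum_product mult_scaleR_left mult_scaleR_right scaleR_scaleR mult.commute[where ?'a = real])
qed

lemma half_scaleR:
  fixes v :: "'a::real_vector"
  shows "(((if P then a else 0) + (if Q then b else 0)) / 2) *\<^sub>R v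
    = (1/2) *\<^sub>R ((if P then a *\<^sub>R v else 0) + (if Q then b *\<^sub>R v else 0))"
  by (cases P; cases Q) (simp_all add: add_divide_distrib scaleR_add_left scaleR_add_right)

lemma half_scaleR_sum:
  fixes G H :: "'b => 'c => 'a::real_vector"
  shows "(\<Sum>e\<in>E. \<Sum>f\<in>E'. (1/2) *\<^sub>R ((if P then G e f else 0) + (if Q then H e f else 0)))
    = (1/2) *\<^sub>R ((if P then \<Sum>e\<in>E. \<Sum>f\<in>E'. G e f else 0) + (if Q then \<Sum>e\<in>E. \<Sum>f\<in>E'. H e f else 0))"
  by (cases P; cases Q) (simp_all add: sum.distrib scaleR_add_right scaleR_sum_right)

text \<open>Covariance of two entries: both are expanded in the unit quaternions of the scalar
  field, and the covariance of their components is the projection of an elementary matrix onto the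
  hermitian ones, which yields one direct and one transposed term.\<close>

lemma onb_entry:
  fixes B :: "(quat^'n^'n) set"
  assumes \<beta>: "\<beta> \<in> {1, 2, 4}" and B: "is_onb (hermitian_space \<beta>) B"
  shows "(\<Sum>b\<in>B. b $ i $ j * x * b $ k $ l) = (1/2) *\<^sub>R
    ((if i = k \<and> j = l then \<Sum>e\<in>Basis \<inter> scalars \<beta>. e * x * e else 0)
    + (if j = k \<and> i = l then \<Sum>e\<in>Basis \<inter> scalars \<beta>. e * x * qcnj e else 0))"
proof -
  let ?E = "Basis \<inter> scalars \<beta> :: quat set"
  have finE: "finite ?E" by simp
  have on: "inner e f = (if e = f then 1 else 0)" if "e \<in> ?E" "f \<in> ?E" for e f using that by (simp add: inner_Basis)
  have bs: "b $ i $ j \<in> scalars \<beta>" if "b \<in> B" for b i j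
    using B that by (auto simp: is_onb_def hermitian_space_iff scalar_matrices_def)
  have cov: "(\<Sum>b\<in>B. inner (b $ i $ j) e * inner (b $ k $ l) f)
     = ((if i = k \<and> j = l then inner e f else 0) + (if j = k \<and> i = l then inner (qcnj e) f else 0)) / 2"
    if "e \<in> ?E" for e f
  proof -
    have "(\<Sum>b\<in>B. inner (b $ i $ j) e * inner (b $ k $ l) f) = inner (\<Sum>b\<in>B. inner b (munit i j e) *\<^sub>R b) (munit k l f)"
      by (simp add: inner_sum_left inner_munit)
    also have "\<dots> = (inner (munit i j e) (munit k l f) + inner (munit j i (qcnj e)) (munit k l f)) / 2"
      using that by (simp add: onb_hermitian_part[OF B] munit_scalar inner_add_left adj_munit)
    finally show ?thesis by (simp add: inner_munit_munit)
  qed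
  have "(\<Sum>b\<in>B. b $ i $ j * x * b $ k $ l)
    = (\<Sum>b\<in>B. (\<Sum>e\<in>?E. inner (b $ i $ j) e *\<^sub>R e) * x * (\<Sum>f\<in>?E. inner (b $ k $ l) f *\<^sub>R f))"
    by (intro sum.cong refl) (simp add: quat_expand[OF bs \<beta>])
  also have "\<dots> = (\<Sum>b\<in>B. \<Sum>e\<in>?E. \<Sum>f\<in>?E. (inner (b $ i $ j) e * inner (b $ k $ l) f) *\<^sub>R (e * x * f))"
    unfolding quat_sum_product ..
  also have "\<dots> = (\<Sum>e\<in>?E. \<Sum>f\<in>?E. (\<Sum>b\<in>B. inner (b $ i $ j) e * inner (b $ k $ l) f) *\<^sub>R (e * x * f))"
    unfolding scaleR_sum_left by (subst sum.swap, intro sum.cong refl, rule sum.swap)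
  also have "\<dots> = (\<Sum>e\<in>?E. \<Sum>f\<in>?E. (1/2) *\<^sub>R ((if i = k \<and> j = l then inner e f *\<^sub>R (e * x * f) else 0) +
       (if j = k \<and> i = l then inner (qcnj e) f *\<^sub>R (e * x * f) else 0)))"
    by (intro sum.cong refl, subst half_scaleR[symmetric], subst cov, assumption) (rule refl)
  also have "\<dots> = (1/2) *\<^sub>R ((if i = k \<and> j = l then \<Sum>e\<in>?E. \<Sum>f\<in>?E. inner e f *\<^sub>R (e * x * f) else 0)
    + (if j = k \<and> i = l then \<Sum>e\<in>?E. \<Sum>f\<in>?E. inner (qcnj e) f *\<^sub>R (e * x * f) else 0))"
    by (rule half_scaleR_sum)
  also have "(\<Sum>e\<in>?E. \<Sum>f\<in>?E. inner e f *\<^sub>R (e * x * f)) = (\<Sum>e\<in>?E. e * x * (\<Sum>f\<in>?E. inner e f *\<^sub>R f))"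
    by (simp add: sum_distrib_left)
  also have "\<dots> = (\<Sum>e\<in>?E. e * x * e)" by (intro sum.cong refl) (simp add: quat_expand[OF _ \<beta>])
  also have "(\<Sum>e\<in>?E. \<Sum>f\<in>?E. inner (qcnj e) f *\<^sub>R (e * x * f)) = (\<Sum>e\<in>?E. e * x * (\<Sum>f\<in>?E. inner (qcnj e) f *\<^sub>R f))"
    by (simp add: sum_distrib_left)
  also have "\<dots> = (\<Sum>e\<in>?E. e * x * qcnj e)" by (intro sum.cong refl) (simp add: quat_expand[OF _ \<beta>] scalars_closed)
  finally show ?thesis .
qed

lemma onb_sandwich:
  fixes B :: "(quat^'n^'n) set"
  assumes \<beta>: "\<beta> \<in> {1, 2, 4}" and B: "is_onb (hermitian_space \<beta>) B"
  shows "(\<Sum>b\<in>B. b ** X ** b) = (\<chi> i l. (1/2) *\<^sub>R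
     ((\<Sum>e\<in>Basis \<inter> scalars \<beta>. e * X $ l $ i * e) +
      (if i = l then \<Sum>j\<in>UNIV. \<Sum>e\<in>Basis \<inter> scalars \<beta>. e * X $ j $ j * qcnj e else 0)))"
proof -
  let ?r = "\<lambda>i l. (\<Sum>e\<in>Basis \<inter> scalars \<beta>. e * X $ l $ i * e) +
      (if i = l then \<Sum>j\<in>UNIV. \<Sum>e\<in>Basis \<inter> scalars \<beta>. e * X $ j $ j * qcnj e else 0)"
  have "(\<Sum>b\<in>B. b ** X ** b) $ i $ l = (1/2) *\<^sub>R ?r i l" for i l
  proof -
    have "(\<Sum>b\<in>B. b ** X ** b) $ i $ l = (\<Sum>b\<in>B. \<Sum>k\<in>UNIV. \<Sum>j\<in>UNIV. b $ i $ j * X $ j $ k * b $ k $ l)"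
      by (simp add: mult_nth sum_distrib_right)
    also have "\<dots> = (\<Sum>k\<in>UNIV. \<Sum>j\<in>UNIV. \<Sum>b\<in>B. b $ i $ j * X $ j $ k * b $ k $ l)"
      by (subst sum.swap, intro sum.cong refl, rule sum.swap)
    also have "\<dots> = (\<Sum>k\<in>UNIV. \<Sum>j\<in>UNIV. (1/2) *\<^sub>R (if j = l then if k = i then \<Sum>e\<in>Basis \<inter> scalars \<beta>. e * X $ j $ k * e else 0 else 0))
      + (\<Sum>k\<in>UNIV. \<Sum>j\<in>UNIV. (1/2) *\<^sub>R (if j = k then if i = l then \<Sum>e\<in>Basis \<inter> scalars \<beta>. e * X $ j $ k * qcnj e else 0 else 0))"
      unfolding onb_entry[OF \<beta> B] sum.distrib[symmetric] scaleR_add_right[symmetric] by (intro sum.cong refl) auto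
    also have "\<dots> = (1/2) *\<^sub>R ?r i l" unfolding half_scaleR_sum[where P = True and Q = True, simplified]
      by (simp add: scaleR_sum_right scaleR_add_right if_distrib[of "scaleR _"] cong: if_cong)
    finally show ?thesis .
  qed
  thus ?thesis by (simp add: vec_eq_iff)
qed

text \<open>The splitting rule: a loop through both contracted matrices is cut into two, or has one
  of its arcs reversed. The constants come from the sums of \<open>e * x * e\<close> and
  \<open>e * x * qcnj e\<close> over the unit quaternions \<open>e\<close>: these are
  \<open>x\<close> and \<open>x\<close> for real \<open>x\<close>, 0 and twice \<open>x\<close> in
  the complex case, and -2 times the conjugate and 4 times the real part for quaternions.\<close>

theorem onb_contract_one:
  fixes B :: "(quat^'n^'n) set"
  assumes \<beta>: "\<beta> \<in> {1, 2, 4}" and B: "is_onb (hermitian_space \<beta>) B"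
    and X: "X \<in> scalar_matrices \<beta>" and Y: "Y \<in> scalar_matrices \<beta>"
  shows "(\<Sum>b\<in>B. loop_trace \<beta> (b ** X ** b ** Y))
    = c_str \<beta> * (loop_trace \<beta> X * loop_trace \<beta> Y) + c_twi \<beta> * loop_trace \<beta> (adj X ** Y)"
proof -
  have lin: "(\<Sum>b\<in>B. loop_trace \<beta> (b ** X ** b ** Y)) = loop_trace \<beta> ((\<Sum>b\<in>B. b ** X ** b) ** Y)"
  proof -
    have "loop_trace \<beta> (sum f A) = (\<Sum>a\<in>A. loop_trace \<beta> (f a))" for f :: "quat^'n^'n => quat^'n^'n" and A
      by (induction A rule: infinite_finite_induct) (auto simp: loop_trace_def trace_def complex_eq_iff algebra_simps sum.distrib)
    thus ?thesis by (simp add: mult_sum_left)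
  qed
  note bc = scalars_basis_cases[OF \<beta>]
  from \<beta> consider "\<beta> = 1" | "\<beta> = 2" | "\<beta> = 4" by auto
  thus ?thesis
  proof cases
    case 1
    have "(\<Sum>b\<in>B. b ** X ** b) = (1/2) *\<^sub>R (adj X + rtr X *\<^sub>R mat 1)"
      unfolding onb_sandwich[OF \<beta> B] bc using X
      by (auto simp: 1 vec_eq_iff mat_nth scalar_matrices_def scalars_def quat_eq_iff trace_def quat_sum_sel)
    hence "loop_trace \<beta> ((\<Sum>b\<in>B. b ** X ** b) ** Y) = of_real (rtr ((1/2) *\<^sub>R (adj X + rtr X *\<^sub>R mat 1) ** Y))"
      using X Y 1 by (simp only: 1 loop_trace_1 scalar_matrices_closed)
    also have "rtr ((1/2) *\<^sub>R (adj X + rtr X *\<^sub>R mat 1) ** Y) = 1/2 * (rtr X * rtr Y) + 1/2 * rtr (adj X ** Y)"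
      by (simp add: quat_matrix_add_rdistrib mult_scaleR trace_def quat_sum_sel sum.distrib sum_distrib_left sum_divide_distrib[symmetric] field_simps)
    also have "complex_of_real \<dots> = 1/2 * (of_real (rtr X) * of_real (rtr Y)) + 1/2 * of_real (rtr (adj X ** Y))" by simp
    finally show ?thesis unfolding lin
      using X Y by (simp only: 1 loop_trace_1 scalar_matrices_closed c_str_def c_twi_def simp_thms if_True)
  next
    case 2
    have "(\<Sum>b\<in>B. b ** X ** b) = rtr X *\<^sub>R mat 1 + qI (trace X) *\<^sub>R imag_matrix"
      unfolding onb_sandwich[OF \<beta> B] bc using X
      by (auto simp: 2 vec_eq_iff mat_nth scalar_matrices_def scalars_def quat_eq_iff trace_def quat_sum_sel imag_matrix_def sum_distrib_left[symmetric])
    hence "loop_trace \<beta> ((\<Sum>b\<in>B. b ** X ** b) ** Y) = loop_trace \<beta> (rtr X *\<^sub>R Y + qI (trace X) *\<^sub>R (imag_matrix ** Y))"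
      by (simp add: quat_matrix_add_rdistrib mult_scaleR)
    also have "\<dots> = loop_trace \<beta> X * loop_trace \<beta> Y"
      by (simp add: 2 loop_trace_def trace_def quat_sum_sel complex_eq_iff sum.distrib sum_negf imag_matrix_mult sum_distrib_left[symmetric])
    finally show ?thesis unfolding lin by (simp add: 2 c_str_def c_twi_def)
  next
    case 3
    have "(\<Sum>b\<in>B. b ** X ** b) = (2 * rtr X) *\<^sub>R mat 1 - adj X" unfolding onb_sandwich[OF \<beta> B] bc
      by (auto simp: 3 vec_eq_iff mat_nth quat_eq_iff trace_def quat_sum_sel Basis_quat_def sum_distrib_left[symmetric] sum.distrib sum_negf field_simps)
    hence "loop_trace \<beta> ((\<Sum>b\<in>B. b ** X ** b) ** Y) = loop_trace \<beta> ((2 * rtr X) *\<^sub>R Y - adj X ** Y)"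
      by (simp add: mult_matrix_diff mult_scaleR)
    also have "\<dots> = of_real (- 4 * (rtr X * rtr Y) + 2 * rtr (adj X ** Y))"
      by (simp add: 3 loop_trace_def trace_def quat_sum_sel sum_subtractf sum_distrib_left[symmetric])
    finally show ?thesis unfolding lin by (simp add: 3 c_str_def c_twi_def loop_trace_def)
  qed
qed

subsection \<open>Pairings and Wick's theorem\<close>

definition pairings :: "nat set => nat set set set" where
  "pairings I = {P. partition_on I P \<and> (\<forall>p\<in>P. card p = 2)}"

lemma finite_pairings: "finite I ==> finite (pairings I)"
  unfolding pairings_def by (rule finite_subset[of _ "Pow (Pow I)"]) (auto simp: partition_on_def)

lemma pairings_empty: "pairings {} = {{}}" by (auto simp: pairings_def partition_on_empty)

lemma pairings_insert_mem:
  assumes "P \<in> pairings (I - {i, j})" "i \<in> I" "j \<in> I" "i \<noteq> j"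
  shows "insert {i, j} P \<in> pairings I" "{i, j} \<notin> P"
proof -
  have P: "partition_on (I - {i, j}) P" using assms by (simp add: pairings_def)
  hence "\<Union> P = I - {i, j}" by (simp add: partition_on_def)
  hence d: "disjnt {i, j} (\<Union> P)" by (auto simp: disjnt_def)
  thus "insert {i, j} P \<in> pairings I" "{i, j} \<notin> P"
    using assms P by (auto simp: pairings_def partition_on_insert disjnt_def)
qed

lemma pairings_member:
  assumes P: "P \<in> pairings I" and i: "i \<in> I"
  obtains j where "j \<in> I - {i}" "{i, j} \<in> P" "P - {{i, j}} \<in> pairings (I - {i, j})"
proof -
  have part: "partition_on I P" using P by (simp add: pairings_def)
  hence U: "\<Union> P = I" and disj: "disjoint P" by (auto simp: partition_on_def)
  then obtain p where p: "p \<in> P" "i \<in> p" using i by auto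
  hence "card p = 2" using P by (simp add: pairings_def)
  then obtain j where j: "p = {i, j}" "i \<noteq> j" using p(2) by (metis card_2_iff doubleton_eq_iff insert_iff singletonD)
  have "disjnt {i, j} (\<Union> (P - {{i, j}}))" using disj p(1) unfolding j(1) by (force simp: disjnt_def disjoint_def)
  moreover have "insert {i, j} (P - {{i, j}}) = P" using p(1) j(1) by auto
  ultimately have "partition_on (I - {i, j}) (P - {{i, j}})" using part partition_on_insert[of "{i, j}" "P - {{i, j}}" I] by simp
  hence "P - {{i, j}} \<in> pairings (I - {i, j})" using P by (auto simp: pairings_def)
  thus ?thesis using that[of j] p(1) j U by blast
qed

text \<open>A pairing amounts to the partner of the fixed label \<open>i\<close> together with a
  pairing of the remaining labels.\<close>

lemma sum_pairings:
  fixes f :: "nat set set => 'a::comm_monoid_add"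
  assumes fin: "finite I" and i: "i \<in> I"
  shows "(\<Sum>P\<in>pairings I. f P) = (\<Sum>j\<in>I - {i}. \<Sum>P\<in>pairings (I - {i, j}). f (insert {i, j} P))"
proof -
  have "(\<Sum>j\<in>I - {i}. \<Sum>P\<in>pairings (I - {i, j}). f (insert {i, j} P))
      = (\<Sum>(j, P)\<in>(SIGMA j:I - {i}. pairings (I - {i, j})). f (insert {i, j} P))"
    using fin by (intro sum.Sigma) (auto intro: finite_pairings)
  also have "\<dots> = (\<Sum>P\<in>pairings I. f P)"
  proof -
    have "bij_betw (\<lambda>(j, P). insert {i, j} P) (SIGMA j:I - {i}. pairings (I - {i, j})) (pairings I)"
      unfolding bij_betw_def
    proof
      show "inj_on (\<lambda>(j, P). insert {i, j} P) (SIGMA j:I - {i}. pairings (I - {i, j}))"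
      proof (rule inj_onI)
        fix x y
        assume xy: "x \<in> (SIGMA j:I - {i}. pairings (I - {i, j}))" "y \<in> (SIGMA j:I - {i}. pairings (I - {i, j}))"
          "(case x of (j, P) => insert {i, j} P) = (case y of (j, P) => insert {i, j} P)"
        obtain j P j' P' where [simp]: "x = (j, P)" "y = (j', P')" by (metis surj_pair)
        have a: "insert {i, j} P = insert {i, j'} P'" "j \<in> I" "j \<noteq> i" "j' \<in> I" "j' \<noteq> i"
          "P \<in> pairings (I - {i, j})" "P' \<in> pairings (I - {i, j'})" using xy by auto
        have U: "\<Union> P = I - {i, j}" "\<Union> P' = I - {i, j'}" using a by (auto simp: pairings_def partition_on_def)
        have "{i, j} = {i, j'}"
        proof (rule ccontr)
          assume "{i, j} \<noteq> {i, j'}"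
          hence "{i, j} \<in> P'" using a(1) by auto
          thus False using U(2) by auto
        qed
        hence "j = j'" using a by (auto simp: doubleton_eq_iff)
        moreover have "{i, j} \<notin> P" "{i, j} \<notin> P'" using U \<open>j = j'\<close> by auto
        ultimately show "x = y" using a(1) by (auto simp: insert_eq_iff)
      qed
      show "(\<lambda>(j, P). insert {i, j} P) ` (SIGMA j:I - {i}. pairings (I - {i, j})) = pairings I"
      proof (intro equalityI subsetI)
        fix P assume "P \<in> pairings I"
        then obtain j where "j \<in> I - {i}" "{i, j} \<in> P" "P - {{i, j}} \<in> pairings (I - {i, j})"
          using i by (rule pairings_member)
        thus "P \<in> (\<lambda>(j, P). insert {i, j} P) ` (SIGMA j:I - {i}. pairings (I - {i, j}))"
          by (intro image_eqI[of _ _ "(j, P - {{i, j}})"]) auto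
      qed (use i pairings_insert_mem in auto)
    qed
    from sum.reindex_bij_betw[OF this, of f] show ?thesis by (simp add: case_prod_beta')
  qed
  finally show ?thesis ..
qed

text \<open>Contracting the least label first keeps the order convention for the arguments of the covariance.\<close>

lemma wick_from_recursion:
  fixes M :: "nat set => real"
  assumes rec: "\<And>I i. finite I ==> I \<subseteq> I0 ==> i \<in> I ==> M I = (\<Sum>j\<in>I - {i}. \<kappa> i j * M (I - {i, j}))"
    and "finite I" "I \<subseteq> I0"
  shows "M I = M {} * (\<Sum>P\<in>pairings I. \<Prod>p\<in>P. \<kappa> (Min p) (Max p))" using assms(2,3)
proof (induction "card I" arbitrary: I rule: less_induct)
  case less
  show ?case
  proof (cases "I = {}")
    case True thus ?thesis by (simp add: pairings_empty)
  next
    case False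
    define i where "i = Min I"
    have i: "i \<in> I" and le: "\<And>j. j \<in> I ==> i \<le> j" using less.prems False by (auto simp: i_def)
    have "M I = (\<Sum>j\<in>I - {i}. \<kappa> i j * (M {} * (\<Sum>P\<in>pairings (I - {i, j}). \<Prod>p\<in>P. \<kappa> (Min p) (Max p))))"
      unfolding rec[OF less.prems i]
    proof (intro sum.cong refl arg_cong2[where f = "(*)"])
      fix j assume "j \<in> I - {i}"
      hence "card (I - {i, j}) < card I" using less.prems(1) i by (intro psubset_card_mono) auto
      thus "M (I - {i, j}) = M {} * (\<Sum>P\<in>pairings (I - {i, j}). \<Prod>p\<in>P. \<kappa> (Min p) (Max p))"
        using less.prems by (intro less.hyps) auto
    qed
    also have "\<dots> = M {} * (\<Sum>j\<in>I - {i}. \<Sum>P\<in>pairings (I - {i, j}). \<kappa> i j * (\<Prod>p\<in>P. \<kappa> (Min p) (Max p)))"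
      by (simp add: sum_distrib_left mult.left_commute)
    also have "(\<Sum>j\<in>I - {i}. \<Sum>P\<in>pairings (I - {i, j}). \<kappa> i j * (\<Prod>p\<in>P. \<kappa> (Min p) (Max p)))
        = (\<Sum>j\<in>I - {i}. \<Sum>P\<in>pairings (I - {i, j}). \<Prod>p\<in>insert {i, j} P. \<kappa> (Min p) (Max p))"
    proof (intro sum.cong refl)
      fix j P assume j: "j \<in> I - {i}" and P: "P \<in> pairings (I - {i, j})"
      have "finite P" using P less.prems(1) by (auto simp: pairings_def intro: finite_elements)
      moreover have "{i, j} \<notin> P" using pairings_insert_mem(2)[OF P i] j by auto
      moreover have "Min {i, j} = i" "Max {i, j} = j" using le[of j] j by auto
      ultimately show "\<kappa> i j * (\<Prod>p\<in>P. \<kappa> (Min p) (Max p)) = (\<Prod>p\<in>insert {i, j} P. \<kappa> (Min p) (Max p))"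
        by simp
    qed
    also have "\<dots> = (\<Sum>P\<in>pairings I. \<Prod>p\<in>P. \<kappa> (Min p) (Max p))"
      by (rule sum_pairings[symmetric, OF less.prems(1) i])
    finally show ?thesis .
  qed
qed

subsection \<open>Gaussian integrals on a subspace\<close>

definition onb_embed :: "'a::real_vector set => ('a => real) => 'a" where
  "onb_embed B c = (\<Sum>b\<in>B. c b *\<^sub>R b)"

definition onb_lborel :: "'a::euclidean_space set => 'a measure" where
  "onb_lborel B = distr (\<Pi>\<^sub>M b\<in>B. lborel) borel (onb_embed B)"

lemma subspace_lborel_onb:
  assumes "subspace (S :: 'a::euclidean_space set)"
  shows "\<exists>B. is_onb S B \<and> subspace_lborel S = onb_lborel B"
proof -
  have "is_onb S (SOME B. is_onb S B)" using is_onb_exists[OF assms] by (rule someI_ex)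
  thus ?thesis unfolding subspace_lborel_def Let_def onb_lborel_def onb_embed_def[abs_def] is_onb_def[symmetric] by blast
qed

lemma integrable_gaussian:
  assumes "a > 0" shows "integrable lborel (\<lambda>x::real. exp (- (a * x\<^sup>2)))"
proof -
  define s where "s = sqrt (1 / (2 * a))"
  have s: "s > 0" "s\<^sup>2 = 1 / (2 * a)" using assms by (simp_all add: s_def)
  have "exp (- (a * x\<^sup>2)) = sqrt (2 * pi * s\<^sup>2) * normal_density 0 s x" for x :: real
    using s assms by (simp add: normal_density_def)
  hence "(\<lambda>x::real. exp (- (a * x\<^sup>2))) = (\<lambda>x. sqrt (2 * pi * s\<^sup>2) * normal_density 0 s x)" by blast
  thus ?thesis using integrable_mult_right[OF integrable_normal_density[OF s(1), of 0]] by (simp only:)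
qed

text \<open>Since \<open>1 + r \<le> exp r\<close>, it suffices to bound \<open>N * r\<close> by a
  constant plus a quarter of the quadratic term times \<open>e\<close>; the constant
  \<open>N\<^sup>2 / e\<close> results from completing the square.\<close>

lemma poly_exp_bound:
  fixes r :: real assumes "r \<ge> 0" "e > 0"
  shows "(1 + r) ^ N * exp (- (e * r\<^sup>2 / 2)) \<le> exp ((real N)\<^sup>2 / e) * exp (- (e / 4 * r\<^sup>2))"
proof -
  have "(1 + r) ^ N \<le> exp r ^ N" using assms exp_ge_add_one_self[of r] by (intro power_mono) auto
  also have "\<dots> = exp (real N * r)" by (simp add: exp_of_nat_mult)
  finally have "(1 + r) ^ N * exp (- (e * r\<^sup>2 / 2)) \<le> exp (real N * r) * exp (- (e * r\<^sup>2 / 2))" by simp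
  also have "\<dots> = exp (real N * r - e * r\<^sup>2 / 2)" by (simp add: mult_exp_exp)
  also have "\<dots> \<le> exp ((real N)\<^sup>2 / e - e / 4 * r\<^sup>2)"
  proof -
    have "0 \<le> (2 * real N - e * r)\<^sup>2 / (4 * e)" using assms by simp
    also have "\<dots> = (real N)\<^sup>2 / e - real N * r + e * r\<^sup>2 / 4"
      using assms by (simp add: power2_eq_square field_simps)
    finally show ?thesis by simp
  qed
  finally show ?thesis by (simp add: mult_exp_exp)
qed

lemma abs_prod_inner_le:
  assumes "finite I"
  shows "\<bar>\<Prod>i\<in>I. inner x (g i)\<bar> \<le> (\<Prod>i\<in>I. norm (g i)) * (1 + norm x) ^ card I"
proof -
  have "\<bar>\<Prod>i\<in>I. inner x (g i)\<bar> \<le> (\<Prod>i\<in>I. norm (g i) * (1 + norm x))" unfolding abs_prod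
  proof (rule prod_mono, safe)
    fix i
    have "\<bar>inner x (g i)\<bar> \<le> norm x * norm (g i)" by (rule Cauchy_Schwarz_ineq2)
    also have "\<dots> \<le> norm (g i) * (1 + norm x)" by (simp add: algebra_simps)
    finally show "\<bar>inner x (g i)\<bar> \<le> norm (g i) * (1 + norm x)" .
  qed simp
  thus ?thesis by (simp add: prod.distrib)
qed

text \<open>The centred Gaussian weight with quadratic form \<open>Q\<close> on \<open>S\<close>, in
  coordinates of an orthonormal basis. \<open>Q\<close> is never inverted: a covariance enters
  through a vector \<open>h\<close> that solves the equation with right-hand side
  \<open>g\<close>.\<close>

locale gaussian_form =
  fixes S B :: "'a::euclidean_space set" and Q :: "'a => 'a" and \<epsilon> :: real
  assumes onb: "is_onb S B" and linear_Q: "linear Q"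
    and sym_Q: "\<And>x y. x \<in> S ==> y \<in> S ==> inner (Q x) y = inner x (Q y)"
    and \<epsilon>_pos: "\<epsilon> > 0" and coercive: "\<And>x. x \<in> S ==> inner (Q x) x \<ge> \<epsilon> * (norm x)\<^sup>2"
begin

abbreviation "PB \<equiv> \<Pi>\<^sub>M b\<in>B. lborel :: real measure"

definition gw :: "'a => real" where "gw x = exp (- (inner (Q x) x / 2))"

lemma finite_B: "finite B" using onb by (rule is_onb_finite)

lemma embed_S: "onb_embed B c \<in> S"
proof -
  have "onb_embed B c \<in> span B" unfolding onb_embed_def by (intro span_sum span_scale span_base)
  thus ?thesis using onb by (simp add: is_onb_def)
qed

lemma subspace_S: "subspace S"
proof -
  have "span B = S" using onb by (simp add: is_onb_def)
  thus ?thesis using subspace_span[of B] by simp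
qed

lemma measurable_embed [measurable]: "onb_embed B \<in> PB \<rightarrow>\<^sub>M borel" unfolding onb_embed_def[abs_def]
  by (intro borel_measurable_sum borel_measurable_scaleR measurable_component_singleton borel_measurable_const) auto

lemma continuous_Q: "continuous_on A Q" using linear_Q by (simp add: linear_continuous_on linear_conv_bounded_linear)

lemma sets_L [measurable_cong, simp]: "sets (onb_lborel B) = sets borel" by (simp add: onb_lborel_def)

lemma integral_L: "f \<in> borel_measurable borel ==> integral\<^sup>L (onb_lborel B) f = (\<integral>c. f (onb_embed B c) \<partial>PB)"
  for f :: "'a => real" unfolding onb_lborel_def by (rule integral_distr) auto

lemma norm_embed: "(norm (onb_embed B c))\<^sup>2 = (\<Sum>b\<in>B. (c b)\<^sup>2)"
proof -
  have "(norm (onb_embed B c))\<^sup>2 = (\<Sum>b\<in>B. \<Sum>d\<in>B. c b * (c d * inner b d))"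
    unfolding power2_norm_eq_inner onb_embed_def by (simp add: inner_sum_left inner_sum_right sum_distrib_left inner_commute mult.left_commute)
  also have "\<dots> = (\<Sum>b\<in>B. \<Sum>d\<in>B. if b = d then (c b)\<^sup>2 else 0)"
    using is_onb_inner[OF onb] by (intro sum.cong) (auto simp: power2_eq_square)
  finally show ?thesis using finite_B by simp
qed

sublocale PB: product_sigma_finite "\<lambda>_::'a. lborel :: real measure" ..

lemma sigma_finite_PB: "sigma_finite_measure PB" by (rule PB.sigma_finite[OF finite_B])

lemma integrable_gauss_PB: "integrable PB (\<lambda>c. exp (- (\<epsilon> / 4 * (norm (onb_embed B c))\<^sup>2)))"
proof -
  have "integrable PB (\<lambda>c. \<Prod>b\<in>B. exp (- (\<epsilon> / 4 * (c b)\<^sup>2)))"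
    using \<epsilon>_pos finite_B by (intro PB.product_integrable_prod integrable_gaussian) auto
  thus ?thesis using finite_B by (simp add: norm_embed exp_sum[symmetric] sum_negf sum_distrib_left sum_divide_distrib)
qed

text \<open>By coercivity the weight decays like a Gaussian, and half of its exponent absorbs the
  polynomial factor.\<close>

lemma integrable_polynomial_growth:
  assumes [measurable]: "f \<in> borel_measurable borel"
    and b: "\<And>x. x \<in> S ==> \<bar>f x\<bar> \<le> K * (1 + norm x) ^ N"
  shows "integrable PB (\<lambda>c. f (onb_embed B c) * gw (onb_embed B c))"
proof (rule Bochner_Integration.integrable_bound)
  let ?K = "\<bar>K\<bar> * exp ((real N)\<^sup>2 / \<epsilon>)"
  show "integrable PB (\<lambda>c. ?K * exp (- (\<epsilon> / 4 * (norm (onb_embed B c))\<^sup>2)))"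
    using integrable_gauss_PB by (rule integrable_mult_right)
  have [measurable]: "gw \<in> borel_measurable borel"
    unfolding gw_def[abs_def] by (intro borel_measurable_continuous_onI continuous_intros continuous_Q) auto
  show "(\<lambda>c. f (onb_embed B c) * gw (onb_embed B c)) \<in> borel_measurable PB" by measurable
  show "AE c in PB. norm (f (onb_embed B c) * gw (onb_embed B c)) \<le> norm (?K * exp (- (\<epsilon> / 4 * (norm (onb_embed B c))\<^sup>2)))"
  proof (rule AE_I2)
    fix c :: "'a => real"
    let ?x = "onb_embed B c"
    have x: "?x \<in> S" by (rule embed_S)
    have "\<bar>f ?x\<bar> * gw ?x \<le> (\<bar>K\<bar> * (1 + norm ?x) ^ N) * exp (- (\<epsilon> * (norm ?x)\<^sup>2 / 2))"
    proof (rule mult_mono)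
      have "K * (1 + norm ?x) ^ N \<le> \<bar>K\<bar> * (1 + norm ?x) ^ N" by (rule mult_right_mono) auto
      thus "\<bar>f ?x\<bar> \<le> \<bar>K\<bar> * (1 + norm ?x) ^ N" using b[OF x] by linarith
      show "gw ?x \<le> exp (- (\<epsilon> * (norm ?x)\<^sup>2 / 2))" using coercive[OF x] by (simp add: gw_def)
    qed (auto simp: gw_def)
    also have "\<dots> \<le> \<bar>K\<bar> * (exp ((real N)\<^sup>2 / \<epsilon>) * exp (- (\<epsilon> / 4 * (norm ?x)\<^sup>2)))"
      unfolding mult.assoc by (intro mult_left_mono poly_exp_bound \<epsilon>_pos) auto
    finally show "norm (f ?x * gw ?x) \<le> norm (?K * exp (- (\<epsilon> / 4 * (norm ?x)\<^sup>2)))"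
      by (simp add: abs_mult gw_def mult.assoc)
  qed
qed

lemma PB_translate: "distr PB PB (\<lambda>c. \<lambda>b\<in>B. c b + h b) = PB"
proof (rule PB.PiM_eqI)
  fix A :: "'a => real set" assume A: "\<And>i. i \<in> B ==> A i \<in> sets lborel"
  have "(\<lambda>c. \<lambda>b\<in>B. c b + h b) -` Pi\<^sub>E B A \<inter> space PB = Pi\<^sub>E B (\<lambda>b. (+) (h b) -` A b)"
    by (auto simp: space_PiM PiE_iff add.commute)
  moreover have "emeasure lborel ((+) (h b) -` A b) = emeasure lborel (A b)" if "b \<in> B" for b
  proof -
    have "emeasure (distr lborel borel ((+) (h b))) (A b) = emeasure lborel ((+) (h b) -` A b)"
      using A[OF that] by (subst emeasure_distr) auto
    thus ?thesis by (simp add: lborel_distr_plus)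
  qed
  moreover have "(+) (h b) -` A b \<in> sets lborel" if "b \<in> B" for b
    using measurable_sets[of "(+) (h b)" borel borel "A b"] A[OF that] by simp
  ultimately show "emeasure (distr PB PB (\<lambda>c. \<lambda>b\<in>B. c b + h b)) (Pi\<^sub>E B A) = (\<Prod>i\<in>B. emeasure lborel (A i))"
    using A finite_B by (subst emeasure_distr) (auto simp: PB.emeasure_PiM sets_PiM_I_finite)
qed (use finite_B in auto)

lemma integral_translate:
  fixes f :: "'a => real"
  assumes h: "h \<in> S" and [measurable]: "f \<in> borel_measurable borel"
  shows "(\<integral>c. f (onb_embed B c + h) \<partial>PB) = (\<integral>c. f (onb_embed B c) \<partial>PB)"
    and "integrable PB (\<lambda>c. f (onb_embed B c)) ==> integrable PB (\<lambda>c. f (onb_embed B c + h))"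
proof -
  let ?T = "\<lambda>c. \<lambda>b\<in>B. c b + inner h b"
  have eq: "onb_embed B (?T c) = onb_embed B c + h" for c
    using is_onb_expand[OF onb h] by (simp add: onb_embed_def scaleR_add_left sum.distrib)
  have [measurable]: "?T \<in> PB \<rightarrow>\<^sub>M PB" by measurable
  have "(\<integral>c. f (onb_embed B c) \<partial>PB) = (\<integral>c. f (onb_embed B c) \<partial>distr PB PB ?T)"
    by (simp only: PB_translate)
  also have "\<dots> = (\<integral>c. f (onb_embed B (?T c)) \<partial>PB)" by (rule integral_distr) auto
  finally show "(\<integral>c. f (onb_embed B c + h) \<partial>PB) = (\<integral>c. f (onb_embed B c) \<partial>PB)" by (simp only: eq)
  assume "integrable PB (\<lambda>c. f (onb_embed B c))"
  hence "integrable (distr PB PB ?T) (\<lambda>c. f (onb_embed B c))" by (simp only: PB_translate)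
  thus "integrable PB (\<lambda>c. f (onb_embed B c + h))" by (subst (asm) integrable_distr_eq) (auto simp only: eq, measurable)
qed

text \<open>A directional derivative integrates to zero: the increment of \<open>\<psi>\<close> along \<open>h\<close> is the integral of the
  derivative over the segment, and both are averaged over all translates.\<close>

lemma integral_derivative_zero:
  fixes \<psi> D :: "'a => real"
  assumes h: "h \<in> S" and cont: "continuous_on UNIV \<psi>" "continuous_on UNIV D"
    and der: "\<And>x t. ((\<lambda>t. \<psi> (x + t *\<^sub>R h)) has_real_derivative D (x + t *\<^sub>R h)) (at t)"
    and int: "integrable PB (\<lambda>c. \<psi> (onb_embed B c))" "integrable PB (\<lambda>c. D (onb_embed B c))"
  shows "(\<integral>c. D (onb_embed B c) \<partial>PB) = 0"
proof -
  interpret PBs: sigma_finite_measure PB by (rule sigma_finite_PB)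
  interpret P: pair_sigma_finite "lborel :: real measure" PB ..
  have [measurable]: "\<psi> \<in> borel_measurable borel" "D \<in> borel_measurable borel"
    using cont by (auto intro: borel_measurable_continuous_onI)
  let ?e = "onb_embed B"
  let ?F = "\<lambda>t c. D (?e c + t *\<^sub>R h) * indicator {0..1::real} t"
  have th: "t *\<^sub>R h \<in> S" for t using subspace_S h by (simp add: subspace_scale)
  have intD: "integrable PB (\<lambda>c. D (?e c + t *\<^sub>R h))" for t by (rule integral_translate(2)[OF th]) (use int in auto)
  have norm: "(\<integral>c. norm (?F t c) \<partial>PB) = (\<integral>c. \<bar>D (?e c)\<bar> \<partial>PB) * indicator {0..1} t" for t
    using integral_translate(1)[OF th, of "\<lambda>x. \<bar>D x\<bar>" t] by (simp add: abs_mult)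
  have F: "integrable (lborel \<Otimes>\<^sub>M PB) (\<lambda>(t, c). ?F t c)"
  proof (rule P.Fubini_integrable)
    show "(\<lambda>(t, c). ?F t c) \<in> borel_measurable (lborel \<Otimes>\<^sub>M PB)" by measurable
    show "integrable lborel (\<lambda>t. \<integral>c. norm (case (t, c) of (t, c) => ?F t c) \<partial>PB)"
      unfolding prod.case norm by (intro integrable_mult_right) simp
    show "AE t in lborel. integrable PB (\<lambda>c. case (t, c) of (t, c) => ?F t c)"
      unfolding prod.case by (intro AE_I2 integrable_mult_left intD)
  qed
  have "(\<integral>t. ?F t c \<partial>lborel) = \<psi> (?e c + h) - \<psi> (?e c)" for c
  proof -
    have "isCont (\<lambda>t. D (?e c + t *\<^sub>R h)) t" for t
      by (rule continuous_on_interior[of UNIV], rule continuous_on_compose2[OF cont(2)]) (auto intro!: continuous_intros)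
    hence "(\<integral>t. ?F t c \<partial>lborel) = \<psi> (?e c + 1 *\<^sub>R h) - \<psi> (?e c + 0 *\<^sub>R h)"
      by (intro integral_FTC_Icc_real der) auto
    thus ?thesis by simp
  qed
  hence "(\<integral>c. \<psi> (?e c + h) - \<psi> (?e c) \<partial>PB) = (\<integral>c. \<integral>t. ?F t c \<partial>lborel \<partial>PB)" by simp
  also have "\<dots> = (\<integral>t. \<integral>c. ?F t c \<partial>PB \<partial>lborel)" by (rule P.Fubini_integral[OF F])
  also have "\<dots> = (\<integral>t. (\<integral>c. D (?e c) \<partial>PB) * indicator {0..1::real} t \<partial>lborel)"
    using integral_translate(1)[OF th, of D] by simp
  also have "\<dots> = (\<integral>c. D (?e c) \<partial>PB)" by simp
  finally show ?thesis using integral_translate[OF h, of \<psi>] int by (simp add: Bochner_Integration.integral_diff)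
qed

definition moment :: "(nat => 'a) => nat set => real" where
  "moment g I = (\<integral>x. (\<Prod>i\<in>I. inner x (g i)) * gw x \<partial>onb_lborel B)"

lemma continuous_gw: "continuous_on A gw" unfolding gw_def[abs_def] by (intro continuous_intros continuous_Q) auto

lemma borel_gw [measurable]: "gw \<in> borel_measurable borel" using continuous_gw by (rule borel_measurable_continuous_onI)

lemma integrable_moment:
  assumes "finite I"
  shows "integrable PB (\<lambda>c. (\<Prod>i\<in>I. inner (onb_embed B c) (g i)) * gw (onb_embed B c))"
  by (rule integrable_polynomial_growth[where f = "\<lambda>x. \<Prod>i\<in>I. inner x (g i)"])
    (auto intro!: abs_prod_inner_le assms)

lemma moment_PB: "moment g I = (\<integral>c. (\<Prod>i\<in>I. inner (onb_embed B c) (g i)) * gw (onb_embed B c) \<partial>PB)"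
  unfolding moment_def by (rule integral_L) measurable

text \<open>The derivative along \<open>h\<close> of the product times the weight has integral zero.
  Differentiating the weight gives the left-hand side, differentiating the product gives the sum
  over the removed factors.\<close>

lemma gaussian_ibp:
  assumes h: "h \<in> S" and fin: "finite I"
  shows "(\<integral>c. inner (Q (onb_embed B c)) h * (\<Prod>i\<in>I. inner (onb_embed B c) (g i)) * gw (onb_embed B c) \<partial>PB)
     = (\<Sum>j\<in>I. inner h (g j) * moment g (I - {j}))"
proof -
  let ?e = "onb_embed B"
  let ?f = "\<lambda>x. \<Prod>i\<in>I. inner x (g i)"
  \<comment> \<open>With \<open>Q\<close> moved onto the fixed vector, the factor is linear in
    \<open>x\<close> with an explicit norm, which gives measurability and the growth bound.\<close>
  define hQ where "hQ = adjoint Q h"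
  have hQ: "inner (Q x) h = inner x hQ" for x unfolding hQ_def by (simp add: adjoint_works[OF linear_Q])
  define D1 where "D1 x = (\<Sum>j\<in>I. inner h (g j) * (\<Prod>i\<in>I - {j}. inner x (g i)))" for x
  let ?D = "\<lambda>x. D1 x * gw x - inner (Q x) h * ?f x * gw x"
  have i1: "integrable PB (\<lambda>c. D1 (?e c) * gw (?e c))" unfolding D1_def sum_distrib_right mult.assoc
    by (intro Bochner_Integration.integrable_sum integrable_mult_right integrable_moment) (use fin in auto)
  have i2: "integrable PB (\<lambda>c. inner (Q (?e c)) h * ?f (?e c) * gw (?e c))"
  proof (rule integrable_polynomial_growth[where f = "\<lambda>x. inner (Q x) h * ?f x"])
    show "(\<lambda>x. inner (Q x) h * ?f x) \<in> borel_measurable borel" unfolding hQ by measurable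
    fix x :: 'a
    have "\<bar>inner (Q x) h\<bar> \<le> norm hQ * (1 + norm x)"
      unfolding hQ by (rule order_trans[OF Cauchy_Schwarz_ineq2]) (simp add: algebra_simps)
    hence "\<bar>inner (Q x) h * ?f x\<bar> \<le> (norm hQ * (1 + norm x)) * ((\<Prod>i\<in>I. norm (g i)) * (1 + norm x) ^ card I)"
      unfolding abs_mult by (intro mult_mono abs_prod_inner_le fin) auto
    thus "\<bar>inner (Q x) h * ?f x\<bar> \<le> (norm hQ * (\<Prod>i\<in>I. norm (g i))) * (1 + norm x) ^ Suc (card I)"
      by (simp add: algebra_simps)
  qed
  have Q_lin: "Q (x + t *\<^sub>R h) = Q x + t *\<^sub>R Q h" for x t using linear_Q by (simp add: linear_add linear_scale)
  have bil: "inner (Q x) h = inner (Q h) x" if "x \<in> S" for x using sym_Q[OF that h] by (simp add: inner_commute)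
  \<comment> \<open>The derivative of the quadratic form along \<open>h\<close> has the two halves
    \<open>inner (Q x) h\<close> and \<open>inner (Q h) x\<close>. They are known to agree on
    \<open>S\<close> only, while the derivative rule is required at every point, so the symmetrised
    form is kept until the integrand is evaluated on embedded points.\<close>
  let ?Ds = "\<lambda>x. D1 x * gw x - (inner (Q x) h + inner (Q h) x) / 2 * ?f x * gw x"
  have "(\<integral>c. ?Ds (?e c) \<partial>PB) = 0"
  proof (rule integral_derivative_zero[OF h, where \<psi> = "\<lambda>x. ?f x * gw x"])
    show "continuous_on UNIV (\<lambda>x. ?f x * gw x)" by (intro continuous_intros continuous_gw)
    show "continuous_on UNIV ?Ds" unfolding D1_def by (intro continuous_intros continuous_gw continuous_Q) auto
    show "integrable PB (\<lambda>c. ?f (?e c) * gw (?e c))" by (rule integrable_moment[OF fin])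
    show "integrable PB (\<lambda>c. ?Ds (?e c))" using Bochner_Integration.integrable_diff[OF i1 i2] by (simp add: bil embed_S)
    fix x t
    have "((\<lambda>t. \<Prod>i\<in>I. inner (x + t *\<^sub>R h) (g i)) has_derivative
       (\<lambda>y. \<Sum>i\<in>I. (inner (y *\<^sub>R h) (g i)) * (\<Prod>j\<in>I - {i}. inner (x + t *\<^sub>R h) (g j)))) (at t)"
      by (rule has_derivative_prod) (auto intro!: derivative_eq_intros)
    hence d1: "((\<lambda>t. ?f (x + t *\<^sub>R h)) has_real_derivative D1 (x + t *\<^sub>R h)) (at t)"
      unfolding has_field_derivative_def
    proof (rule has_derivative_eq_rhs)
      show "(\<lambda>y. \<Sum>i\<in>I. inner (y *\<^sub>R h) (g i) * (\<Prod>j\<in>I - {i}. inner (x + t *\<^sub>R h) (g j)))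
        = (*) (D1 (x + t *\<^sub>R h))" by (rule ext, unfold D1_def sum_distrib_right) (auto intro!: sum.cong)
    qed
    have "((\<lambda>t. inner (Q (x + t *\<^sub>R h)) (x + t *\<^sub>R h)) has_real_derivative
        inner (Q (x + t *\<^sub>R h)) h + inner (Q h) (x + t *\<^sub>R h)) (at t)"
      unfolding Q_lin has_field_derivative_def by (auto intro!: derivative_eq_intros simp: algebra_simps inner_simps)
    hence d2: "((\<lambda>t. gw (x + t *\<^sub>R h)) has_real_derivative
        gw (x + t *\<^sub>R h) * (- ((inner (Q (x + t *\<^sub>R h)) h + inner (Q h) (x + t *\<^sub>R h)) / 2))) (at t)"
      unfolding gw_def by (auto intro!: derivative_eq_intros)
    show "((\<lambda>t. ?f (x + t *\<^sub>R h) * gw (x + t *\<^sub>R h)) has_real_derivative ?Ds (x + t *\<^sub>R h)) (at t)"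
      using DERIV_mult[OF d1 d2] by (simp add: algebra_simps)
  qed
  hence "(\<integral>c. D1 (?e c) * gw (?e c) - inner (Q (?e c)) h * ?f (?e c) * gw (?e c) \<partial>PB) = 0"
    by (simp add: bil embed_S)
  hence "(\<integral>c. inner (Q (?e c)) h * ?f (?e c) * gw (?e c) \<partial>PB) = (\<integral>c. D1 (?e c) * gw (?e c) \<partial>PB)"
    using Bochner_Integration.integral_diff[OF i1 i2] by simp
  also have "\<dots> = (\<Sum>j\<in>I. inner h (g j) * moment g (I - {j}))"
    unfolding D1_def sum_distrib_right mult.assoc moment_PB
    by (subst Bochner_Integration.integral_sum) (use fin in \<open>auto intro!: integrable_mult_right integrable_moment\<close>)
  finally show ?thesis .
qed

text \<open>The vector \<open>h i\<close> solves, tested against \<open>S\<close>, the equation with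
  right-hand side \<open>g i\<close>; thus \<open>inner (h i) (g j)\<close> is the covariance of the
  linear forms given by \<open>g i\<close> and \<open>g j\<close>. Integration by parts along
  \<open>h i\<close> removes the factor \<open>i\<close> together with a partner, which is the
  recursion for pairings. The moments are not normalised, hence the factor
  \<open>moment g {}\<close>.\<close>

theorem wick:
  assumes "finite I"
    and h: "\<And>i. i \<in> I ==> h i \<in> S" "\<And>i x. i \<in> I ==> x \<in> S ==> inner (Q x) (h i) = inner x (g i)"
  shows "moment g I = moment g {} * (\<Sum>P\<in>pairings I. \<Prod>p\<in>P. inner (h (Min p)) (g (Max p)))"
proof (rule wick_from_recursion[where I0 = I and \<kappa> = "\<lambda>i j. inner (h i) (g j)"])
  fix J i assume J: "finite J" "J \<subseteq> I" "i \<in> J"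
  have "moment g J = (\<integral>c. inner (onb_embed B c) (g i) * (\<Prod>i\<in>J - {i}. inner (onb_embed B c) (g i)) * gw (onb_embed B c) \<partial>PB)"
    using J by (simp add: moment_PB prod.remove)
  also have "\<dots> = (\<integral>c. inner (Q (onb_embed B c)) (h i) * (\<Prod>i\<in>J - {i}. inner (onb_embed B c) (g i)) * gw (onb_embed B c) \<partial>PB)"
    using J h(2)[of i, OF _ embed_S] by (intro Bochner_Integration.integral_cong) auto
  also have "\<dots> = (\<Sum>j\<in>J - {i}. inner (h i) (g j) * moment g (J - {i} - {j}))"
    using J h(1)[of i] by (intro gaussian_ibp) auto
  finally show "moment g J = (\<Sum>j\<in>J - {i}. inner (h i) (g j) * moment g (J - {i, j}))"
    by (simp add: Diff_insert2[symmetric] insert_commute)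
qed (use assms in auto)

end

subsection \<open>Traversals of boundary cycles\<close>

text \<open>\<open>trav J g a xs e\<close>: starting from the side \<open>a\<close> and alternately gluing (\<open>g\<close>) and joining (\<open>J\<close>), one
  meets the sides \<open>xs\<close> and then arrives at \<open>e\<close>.\<close>

fun trav :: "('s => 's) => ('s => 's) => 's => 's list => 's => bool" where
  "trav J g a [] e \<longleftrightarrow> a = e"
| "trav J g a (s # u) e \<longleftrightarrow> s = a \<and> trav J g (J (g s)) u e"

lemma trav_append: "trav J g a (u @ v) e \<longleftrightarrow> (\<exists>m. trav J g a u m \<and> trav J g m v e)"
  by (induction u arbitrary: a) auto

lemma trav_cong: "(\<And>s. s \<in> set u ==> g s = g' s) ==> trav J g a u e = trav J g' a u e"
  by (induction u arbitrary: a) auto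

definition involution_on :: "'s set => ('s => 's) => bool" where
  "involution_on S f \<longleftrightarrow> (\<forall>s\<in>S. f s \<in> S \<and> f (f s) = s)"

text \<open>Run backwards, each gluing is entered from the other of its two sides, so the sides met
  are the glued partners in reverse order, and the joins at the two ends exchange their
  roles.\<close>

lemma trav_rev:
  assumes "involution_on S J" "involution_on S g" "a \<in> S" "set u \<subseteq> S"
  shows "trav J g a u e ==> e \<in> S \<and> trav J g (J e) (map g (rev u)) (J a)" using assms
proof (induction u arbitrary: a)
  case (Cons s u)
  have a: "J (J (g a)) = g a" "J (g a) \<in> S" "g (g a) = a" and tr: "trav J g (J (g a)) u e" "s = a"
    using Cons.prems by (auto simp: involution_on_def)
  show ?case using Cons.IH[OF tr(1) Cons.prems(2,3) a(2)] Cons.prems(5) a tr(2) by (simp add: trav_append)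
qed simp

definition cycle_list :: "('s => 's) => ('s => 's) => 's list => bool" where
  "cycle_list J g xs \<longleftrightarrow> xs \<noteq> [] \<and> trav J g (hd xs) xs (hd xs)"

lemma cycle_list_Cons: "cycle_list J g (p # u) \<longleftrightarrow> trav J g (J (g p)) u p" by (simp add: cycle_list_def)

lemma cycle_list_rotate: "cycle_list J g (a @ p # b) ==> cycle_list J g (p # b @ a)"
  by (cases a) (auto simp: cycle_list_def trav_append)

text \<open>A list records only the sides from which a gluing is traversed; the sides at which the
  gluings arrive are their images under \<open>g\<close>. The multiset equation says that every side
  of \<open>S\<close> occurs exactly once among listed sides and images, so each cycle comes with a
  chosen direction.\<close>

definition cycle_system :: "('s => 's) => ('s => 's) => 's set => 's list list => bool" where
  "cycle_system J g S XS \<longleftrightarrow> (\<forall>xs\<in>set XS. cycle_list J g xs) \<and>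
     mset (concat XS) + image_mset g (mset (concat XS)) = mset_set S"

fun loopm :: "('s => quat^'n^'n) => 's list => quat^'n^'n" where
  "loopm B [] = mat 1"
| "loopm B (s # u) = B s ** loopm B u"

lemma loopm_append: "loopm B (u @ v) = loopm B u ** loopm B v" by (induction u) (auto simp: matrix_mul_assoc)

lemma loopm_cong: "(\<And>s. s \<in> set u ==> B s = B' s) ==> loopm B u = loopm B' u"
  by (induction u) auto

lemma loopm_rev: "(\<And>s. s \<in> set u ==> B (g s) = adj (B s)) ==> loopm B (map g (rev u)) = adj (loopm B u)"
  by (induction u) (auto simp: loopm_append adj_mult)

lemma loopm_scalar: "(\<And>s. s \<in> set u ==> B s \<in> scalar_matrices \<beta>) ==> loopm B u \<in> scalar_matrices \<beta>"
  by (induction u) (auto simp: scalar_matrices_closed)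

definition cycles_value :: "nat => ('s => quat^'n^'n) => 's list list => complex" where
  "cycles_value \<beta> B XS = prod_list (map (\<lambda>xs. loop_trace \<beta> (loopm B xs)) XS)"

lemma cycles_value_Cons: "cycles_value \<beta> B (xs # XS) = loop_trace \<beta> (loopm B xs) * cycles_value \<beta> B XS"
  by (simp add: cycles_value_def)

lemma cycles_value_cong: "(\<And>s. s \<in> set (concat XS) ==> B s = B' s) ==> cycles_value \<beta> B XS = cycles_value \<beta> B' XS"
  unfolding cycles_value_def by (intro arg_cong[where f = prod_list] map_cong refl arg_cong[where f = "loop_trace \<beta>"] loopm_cong) auto

lemma cycle_system_facts:
  assumes "cycle_system J g S XS" "finite S"
  shows "distinct (concat XS)" "set (concat XS) \<union> g ` set (concat XS) = S"
    "set (concat XS) \<inter> g ` set (concat XS) = {}" "inj_on g (set (concat XS))"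
proof -
  have "mset (concat XS @ map g (concat XS)) = mset_set S" using assms by (simp add: cycle_system_def)
  hence "distinct (concat XS @ map g (concat XS))" "set (concat XS @ map g (concat XS)) = S"
    by (metis assms(2) count_mset_set(1,3) distinct_count_atmost_1 finite_set_mset_mset_set set_mset_mset)+
  thus "distinct (concat XS)" "set (concat XS) \<union> g ` set (concat XS) = S"
    "set (concat XS) \<inter> g ` set (concat XS) = {}" "inj_on g (set (concat XS))" by (auto simp: distinct_map)
qed

text \<open>Rotating one cyclic list and moving it to the front changes neither the listed sides
  nor, by cyclicity of the loop trace, the value.\<close>

lemma cycle_system_front:
  assumes \<beta>: "\<beta> \<in> {1, 2, 4}" and XS: "cycle_system J g S XS" and p: "p \<in> set (concat XS)"
  obtains u YS where "cycle_system J g S ((p # u) # YS)" "mset (concat ((p # u) # YS)) = mset (concat XS)"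
    "\<And>B :: 's => quat^'n^'n. (\<And>s. B s \<in> scalar_matrices \<beta>) ==> cycles_value \<beta> B ((p # u) # YS) = cycles_value \<beta> B XS"
proof -
  obtain xs where xs: "xs \<in> set XS" "p \<in> set xs" using p by auto
  then obtain A C where XSs: "XS = A @ xs # C" by (meson split_list)
  obtain a b where ab: "xs = a @ p # b" using xs(2) by (meson split_list)
  have m: "mset (concat ((p # b @ a) # A @ C)) = mset (concat XS)" by (simp add: XSs ab)
  show ?thesis
  proof (rule that[of "b @ a" "A @ C"])
    show "mset (concat ((p # b @ a) # A @ C)) = mset (concat XS)" by (rule m)
    show "cycle_system J g S ((p # b @ a) # A @ C)"
      using XS cycle_list_rotate[of J g a p b] unfolding cycle_system_def m by (auto simp: XSs ab)
    fix B :: "'s => quat^'n^'n" assume B: "\<And>s. B s \<in> scalar_matrices \<beta>"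
    have "loop_trace \<beta> (loopm B a ** loopm B (p # b)) = loop_trace \<beta> (loopm B (p # b) ** loopm B a)"
      by (intro loop_trace_commute \<beta> loopm_scalar B)
    thus "cycles_value \<beta> B ((p # b @ a) # A @ C) = cycles_value \<beta> B XS"
      by (simp add: cycles_value_def XSs ab loopm_append matrix_mul_assoc)
  qed
qed

section \<open>Contraction along a path with holonomy V\<close>

lemma loop_trace_linear:
  "loop_trace \<beta> (X + Y) = loop_trace \<beta> X + loop_trace \<beta> Y"
  "loop_trace \<beta> (r *\<^sub>R X) = of_real r * loop_trace \<beta> (X :: quat^'n^'n)"
  by (auto simp: loop_trace_def trace_def complex_eq_iff sum.distrib quat_sum_sel sum_distrib_left algebra_simps)

lemma loop_trace_sum: "loop_trace \<beta> (sum f A) = (\<Sum>a\<in>A. loop_trace \<beta> (f a :: quat^'n^'n))"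
proof (induction A rule: infinite_finite_induct)
  case (insert x F) thus ?case by (simp add: loop_trace_linear)
qed (auto simp: loop_trace_def trace_def complex_eq_iff)

lemma onb_collapse:
  fixes N :: "(quat^'n^'n) set"
  assumes N: "is_onb (hermitian_space \<beta>) N" and W: "W \<in> hermitian_space \<beta>"
  shows "(\<Sum>b\<in>N. of_real (inner b W) * loop_trace \<beta> (b ** X)) = loop_trace \<beta> (W ** X)"
proof -
  have "loop_trace \<beta> (W ** X) = loop_trace \<beta> ((\<Sum>b\<in>N. inner W b *\<^sub>R b) ** X)"
    by (simp add: is_onb_expand[OF N W])
  thus ?thesis by (simp add: mult_sum_left mult_scaleR loop_trace_sum loop_trace_linear inner_commute)
qed

text \<open>The weight \<open>inner b (V ** b' ** adj V)\<close> is the covariance transported along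
  a path with holonomy \<open>V\<close>. Summing over one of the two basis elements replaces it by
  the transport of the other; cyclicity moves \<open>V\<close> into the arc, and the joining rule
  applies.\<close>

lemma contract_two_loops:
  fixes N :: "(quat^'n^'n) set"
  assumes \<beta>: "\<beta> \<in> {1, 2, 4}" and N: "is_onb (hermitian_space \<beta>) N"
    and s: "V \<in> scalar_matrices \<beta>" "A \<in> scalar_matrices \<beta>" "A' \<in> scalar_matrices \<beta>"
  shows "(\<Sum>b\<in>N. \<Sum>b'\<in>N. of_real (inner b (V ** b' ** adj V)) * (loop_trace \<beta> (b ** A) * loop_trace \<beta> (b' ** A')))
    = c_str \<beta> * loop_trace \<beta> (V ** A' ** adj V ** A) + c_twi \<beta> * loop_trace \<beta> (V ** adj A' ** adj V ** A)"
proof -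
  have Nh: "b \<in> hermitian_space \<beta>" "b \<in> scalar_matrices \<beta>" if "b \<in> N" for b
    using N that by (auto simp: is_onb_def hermitian_space_iff)
  have "(\<Sum>b\<in>N. \<Sum>b'\<in>N. of_real (inner b (V ** b' ** adj V)) * (loop_trace \<beta> (b ** A) * loop_trace \<beta> (b' ** A')))
    = (\<Sum>b'\<in>N. (\<Sum>b\<in>N. of_real (inner b (V ** b' ** adj V)) * loop_trace \<beta> (b ** A)) * loop_trace \<beta> (b' ** A'))"
    by (subst sum.swap) (simp add: sum_distrib_right mult.assoc)
  also have "\<dots> = (\<Sum>b\<in>N. loop_trace \<beta> (b ** (adj V ** A ** V)) * loop_trace \<beta> (b ** A'))"
  proof (intro sum.cong refl)
    fix b assume b: "b \<in> N"
    have "loop_trace \<beta> (V ** b ** adj V ** A) = loop_trace \<beta> (b ** (adj V ** A ** V))"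
      using loop_trace_commute[OF \<beta>, of V "b ** adj V ** A"] b s Nh by (simp add: matrix_mul_assoc scalar_matrices_closed)
    thus "(\<Sum>b'\<in>N. of_real (inner b' (V ** b ** adj V)) * loop_trace \<beta> (b' ** A)) * loop_trace \<beta> (b ** A')
      = loop_trace \<beta> (b ** (adj V ** A ** V)) * loop_trace \<beta> (b ** A')"
      using onb_collapse[OF N hermitian_conj[OF Nh(1)[OF b] s(1)]] by simp
  qed
  also have "\<dots> = c_str \<beta> * loop_trace \<beta> ((adj V ** A ** V) ** A') + c_twi \<beta> * loop_trace \<beta> ((adj V ** A ** V) ** adj A')"
    by (intro onb_contract_two \<beta> N) (use s in \<open>auto simp: scalar_matrices_closed\<close>)
  also have "loop_trace \<beta> ((adj V ** A ** V) ** A') = loop_trace \<beta> (V ** A' ** adj V ** A)"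
    using loop_trace_commute[OF \<beta>, of "adj V ** A" "V ** A'"] s by (simp add: matrix_mul_assoc scalar_matrices_closed)
  also have "loop_trace \<beta> ((adj V ** A ** V) ** adj A') = loop_trace \<beta> (V ** adj A' ** adj V ** A)"
    using loop_trace_commute[OF \<beta>, of "adj V ** A" "V ** adj A'"] s by (simp add: matrix_mul_assoc scalar_matrices_closed)
  finally show ?thesis .
qed

text \<open>The same reduction for two matrices on one loop: after one sum is collapsed,
  \<open>V\<close> and \<open>adj V\<close> are absorbed into the two arcs and the splitting rule
  applies.\<close>

lemma contract_one_loop:
  fixes N :: "(quat^'n^'n) set"
  assumes \<beta>: "\<beta> \<in> {1, 2, 4}" and N: "is_onb (hermitian_space \<beta>) N"
    and s: "V \<in> scalar_matrices \<beta>" "A \<in> scalar_matrices \<beta>" "A' \<in> scalar_matrices \<beta>"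
  shows "(\<Sum>b\<in>N. \<Sum>b'\<in>N. of_real (inner b (V ** b' ** adj V)) * loop_trace \<beta> (b ** A ** b' ** A'))
    = c_str \<beta> * (loop_trace \<beta> (V ** A') * loop_trace \<beta> (adj V ** A)) + c_twi \<beta> * loop_trace \<beta> (V ** adj A ** V ** A')"
proof -
  have Nh: "b \<in> hermitian_space \<beta>" "b \<in> scalar_matrices \<beta>" if "b \<in> N" for b
    using N that by (auto simp: is_onb_def hermitian_space_iff)
  have "(\<Sum>b\<in>N. \<Sum>b'\<in>N. of_real (inner b (V ** b' ** adj V)) * loop_trace \<beta> (b ** A ** b' ** A'))
    = (\<Sum>b'\<in>N. \<Sum>b\<in>N. of_real (inner b (V ** b' ** adj V)) * loop_trace \<beta> (b ** (A ** b' ** A')))"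
    by (subst sum.swap) (simp add: matrix_mul_assoc)
  also have "\<dots> = (\<Sum>b\<in>N. loop_trace \<beta> (b ** (adj V ** A) ** b ** (A' ** V)))"
  proof (intro sum.cong refl)
    fix b assume b: "b \<in> N"
    have "loop_trace \<beta> (V ** b ** adj V ** (A ** b ** A')) = loop_trace \<beta> (b ** (adj V ** A) ** b ** (A' ** V))"
      using loop_trace_commute[OF \<beta>, of V "b ** adj V ** (A ** b ** A')"] b s Nh by (simp add: matrix_mul_assoc scalar_matrices_closed)
    thus "(\<Sum>b'\<in>N. of_real (inner b' (V ** b ** adj V)) * loop_trace \<beta> (b' ** (A ** b ** A')))
      = loop_trace \<beta> (b ** (adj V ** A) ** b ** (A' ** V))"
      using onb_collapse[OF N hermitian_conj[OF Nh(1)[OF b] s(1)]] by simp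
  qed
  also have "\<dots> = c_str \<beta> * (loop_trace \<beta> (adj V ** A) * loop_trace \<beta> (A' ** V)) + c_twi \<beta> * loop_trace \<beta> (adj (adj V ** A) ** (A' ** V))"
    by (intro onb_contract_one \<beta> N) (use s in \<open>auto simp: scalar_matrices_closed\<close>)
  also have "loop_trace \<beta> (A' ** V) = loop_trace \<beta> (V ** A')" using loop_trace_commute[OF \<beta>, of A' V] s by simp
  also have "loop_trace \<beta> (adj (adj V ** A) ** (A' ** V)) = loop_trace \<beta> (V ** adj A ** V ** A')"
    using loop_trace_commute[OF \<beta>, of "adj A ** V ** A'" V] s by (simp add: adj_mult matrix_mul_assoc scalar_matrices_closed)
  finally show ?thesis by (simp add: mult.commute mult.left_commute)
qed

text \<open>Contraction of the half-edges carrying the sides \<open>p\<close>, \<open>g p\<close> and \<open>q\<close>, \<open>g q\<close>: either two cycles are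
  merged, or a cycle is cut (first gluing) or partly reversed (second gluing).\<close>

lemma cycle_system_contract:
  fixes J g0 :: "'s => 's" and N :: "(quat^'n^'n) set"
  assumes \<beta>: "\<beta> \<in> {1, 2, 4}" and N: "is_onb (hermitian_space \<beta>) N" and fin: "finite S"
    and J: "involution_on S J" and g0: "involution_on S g0" and XS: "cycle_system J g0 S XS"
    and p: "p \<in> set (concat XS)" and q: "q \<in> set (concat XS)" and pq: "p \<noteq> q"
  defines "p' \<equiv> g0 p" and "q' \<equiv> g0 q"
  defines "g1 \<equiv> g0(p := q', q' := p, p' := q, q := p')"
    and "g2 \<equiv> g0(p := q, q := p, p' := q', q' := p')"
  shows "\<exists>XS1 XS2. cycle_system J g1 S XS1 \<and> set (concat XS1) = set (concat XS) \<and> cycle_system J g2 S XS2 \<and>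
    (\<forall>B V. (\<forall>s. B s \<in> scalar_matrices \<beta>) \<and> V \<in> scalar_matrices \<beta> \<and> (\<forall>s\<in>S - {p, p', q, q'}. B (g0 s) = adj (B s)) \<longrightarrow>
      (\<Sum>b\<in>N. \<Sum>b'\<in>N. of_real (inner b (V ** b' ** adj V)) *
          cycles_value \<beta> (B(p := b, p' := b, q := b', q' := b')) XS)
      = c_str \<beta> * cycles_value \<beta> (B(p := V, p' := V, q := adj V, q' := adj V)) XS1
      + c_twi \<beta> * cycles_value \<beta> (B(p := V, p' := V, q := adj V, q' := adj V)) XS2)"
proof -
  have Nh: "b \<in> scalar_matrices \<beta>" if "b \<in> N" for b using N that by (auto simp: is_onb_def hermitian_space_iff)
  have gg: "g0 (g0 s) = s" "g0 s \<in> S" if "s \<in> S" for s using g0 that by (auto simp: involution_on_def)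
  have JJ: "J (J s) = s" "J s \<in> S" if "s \<in> S" for s using J that by (auto simp: involution_on_def)
  obtain u YS where f: "cycle_system J g0 S ((p # u) # YS)" "mset (concat ((p # u) # YS)) = mset (concat XS)"
    "\<And>B :: 's => quat^'n^'n. (\<And>s. B s \<in> scalar_matrices \<beta>) ==> cycles_value \<beta> B ((p # u) # YS) = cycles_value \<beta> B XS"
    using cycle_system_front[OF \<beta> XS p, where ?'n = 'n] by metis
  have setX: "set (concat ((p # u) # YS)) = set (concat XS)" using f(2) by (metis set_mset_mset)
  note F = cycle_system_facts[OF f(1) fin]
  have Sx: "set (concat XS) \<subseteq> S" using F(2) setX by auto
  have pS: "p \<in> S" "q \<in> S" "p' \<in> S" "q' \<in> S" using Sx p q gg by (auto simp: p'_def q'_def)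
  have qin: "q \<in> set (concat ((p # u) # YS))" using q setX by simp
  have four: "p \<noteq> p'" "p \<noteq> q'" "q \<noteq> p'" "q \<noteq> q'" "p' \<noteq> q'"
  proof -
    have "a \<noteq> g0 b" if "a \<in> set (concat XS)" "b \<in> set (concat XS)" for a b using F(3) that unfolding setX by blast
    thus "p \<noteq> p'" "p \<noteq> q'" "q \<noteq> p'" "q \<noteq> q'" using p q unfolding p'_def q'_def by blast+
    show "p' \<noteq> q'" using pq gg(1)[OF pS(1)] gg(1)[OF pS(2)] unfolding p'_def q'_def by metis
  qed
  have p'g: "g0 p' = p" "g0 q' = q" using gg pS by (auto simp: p'_def q'_def)
  have g1v: "g1 p = q'" "g1 q' = p" "g1 p' = q" "g1 q = p'" and g2v: "g2 p = q" "g2 q = p" "g2 p' = q'" "g2 q' = p'"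
    using four pq by (auto simp: g1_def g2_def)
  let ?Q = "{p, p', q, q'}" and ?u = "\<lambda>B w1 w2 w3 w4. B(p := w1, p' := w2, q := w3, q' := w4)"
  let ?ok = "\<lambda>B V. (\<forall>s. B s \<in> scalar_matrices \<beta>) \<and> V \<in> scalar_matrices \<beta> \<and> (\<forall>s\<in>S - ?Q. B (g0 s) = adj (B s))"
  let ?lhs = "\<lambda>B V. \<Sum>b\<in>N. \<Sum>b'\<in>N. of_real (inner b (V ** b' ** adj V)) * cycles_value \<beta> (?u B b b b' b') XS"
  let ?rhs = "\<lambda>B V XS1 XS2. c_str \<beta> * cycles_value \<beta> (?u B V V (adj V) (adj V)) XS1 + c_twi \<beta> * cycles_value \<beta> (?u B V V (adj V) (adj V)) XS2"
  have goth: "g1 s = g0 s" "g2 s = g0 s" if "s \<notin> ?Q" for s using that by (auto simp: g1_def g2_def)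
  \<comment> \<open>\<open>p'\<close> and \<open>q'\<close> are glued images of listed sides, hence
    not listed themselves. Away from the four special sides the old gluing coincides with both new
    ones.\<close>
  have free: "s \<in> S - ?Q" if "s \<in> set (concat ((p # u) # YS))" "s \<noteq> p" "s \<noteq> q" for s
    using that F(3) p q Sx unfolding p'_def q'_def setX by blast
  have g0Q: "g0 s \<in> S - ?Q" if s: "s \<in> S - ?Q" for s
  proof -
    have "g0 s \<noteq> t" if "t \<in> ?Q" for t using gg(1)[of s] s that p'g p'_def q'_def by auto
    thus ?thesis using gg(2)[of s] s by blast
  qed
  have tr: "trav J g1 a zs e = trav J g0 a zs e" "trav J g2 a zs e = trav J g0 a zs e"
    "trav J g2 a (map g0 (rev zs)) e = trav J g0 a (map g0 (rev zs)) e" if "set zs \<subseteq> S - ?Q" for a zs e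
    by (rule trav_cong; use goth g0Q that in auto)+
  have imu: "image_mset g1 (mset zs) = image_mset g0 (mset zs)" "image_mset g2 (mset zs) = image_mset g0 (mset zs)"
    "image_mset g2 (image_mset g0 (mset zs)) = mset zs" if zs: "set zs \<subseteq> S - ?Q" for zs
  proof -
    have "image_mset g2 (image_mset g0 (mset zs)) = image_mset id (mset zs)"
      unfolding multiset.map_comp by (rule image_mset_cong) (use goth(2)[of "g0 _"] g0Q gg zs in force)
    thus "image_mset g2 (image_mset g0 (mset zs)) = mset zs" by simp
  qed (rule image_mset_cong; use goth zs in auto)+
  have lu: "loopm (?u B w1 w2 w3 w4) zs = loopm B zs"
    "(\<And>s. s \<in> S - ?Q ==> B (g0 s) = adj (B s)) ==> loopm (?u B w1 w2 w3 w4) (map g0 (rev zs)) = adj (loopm B zs)"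
    if zs: "set zs \<subseteq> S - ?Q" for B :: "'s => quat^'n^'n" and w1 w2 w3 w4 zs
  proof -
    have n: "?u B w1 w2 w3 w4 s = B s" if "s \<in> S - ?Q" for s using that by auto
    show "loopm (?u B w1 w2 w3 w4) zs = loopm B zs" by (rule loopm_cong, rule n) (use zs in blast)
    assume Bg: "\<And>s. s \<in> S - ?Q ==> B (g0 s) = adj (B s)"
    have "loopm (?u B w1 w2 w3 w4) (map g0 (rev zs)) = loopm B (map g0 (rev zs))"
      by (rule loopm_cong, rule n) (use zs g0Q in auto)
    also have "\<dots> = adj (loopm B zs)" by (rule loopm_rev) (use zs Bg in auto)
    finally show "loopm (?u B w1 w2 w3 w4) (map g0 (rev zs)) = adj (loopm B zs)" .
  qed
  have cu: "cycles_value \<beta> (?u B w1 w2 w3 w4) ZS = cycles_value \<beta> B ZS" if "set (concat ZS) \<subseteq> S - ?Q"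
    for B :: "'s => quat^'n^'n" and w1 w2 w3 w4 ZS by (rule cycles_value_cong) (use that in auto)
  have cZ: "cycle_list J g1 xs \<and> cycle_list J g2 xs" if "cycle_list J g0 xs" "set xs \<subseteq> S - ?Q" for xs
    using that tr(1,2)[OF that(2)] by (simp add: cycle_list_def)
  have sc: "?u B b b b' b' s \<in> scalar_matrices \<beta>" if "?ok B V" "b \<in> N" "b' \<in> N" for B V b b' s
    using that Nh by simp
  consider (one) "q \<in> set u" | (two) "q \<in> set (concat YS)" using qin pq by auto
  thus ?thesis
  proof cases
    case two
    \<comment> \<open>The cycles other than the first form a system on their own sides, so
      \<open>q\<close> can be brought to the front of one of them without disturbing the cycle of
      \<open>p\<close>.\<close>
    have "cycle_system J g0 (set (concat YS) \<union> g0 ` set (concat YS)) YS"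
    proof -
      have sub: "set (concat YS) \<subseteq> set (concat ((p # u) # YS))" by auto
      have "distinct (concat YS)" using F(1) by simp
      moreover have "inj_on g0 (set (concat YS))" using F(4) sub by (rule inj_on_subset)
      moreover have "set (concat YS) \<inter> g0 ` set (concat YS) = {}" using F(3) sub by blast
      ultimately have "distinct (concat YS @ map g0 (concat YS))" by (simp only: distinct_append distinct_map set_map simp_thms)
      hence "mset_set (set (concat YS @ map g0 (concat YS))) = mset (concat YS @ map g0 (concat YS))" by (rule mset_set_set)
      hence "mset (concat YS) + image_mset g0 (mset (concat YS)) = mset_set (set (concat YS) \<union> g0 ` set (concat YS))"
        by (simp only: set_append set_map mset_append mset_map)
      thus ?thesis using f(1) unfolding cycle_system_def by simp
    qed
    from cycle_system_front[OF \<beta> this two, where ?'n = 'n] obtain v ZS where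
      h: "cycle_system J g0 (set (concat YS) \<union> g0 ` set (concat YS)) ((q # v) # ZS)" "mset (concat ((q # v) # ZS)) = mset (concat YS)"
      "\<And>B :: 's => quat^'n^'n. (\<And>s. B s \<in> scalar_matrices \<beta>) ==> cycles_value \<beta> B ((q # v) # ZS) = cycles_value \<beta> B YS"
      by metis
    let ?C = "(p # u) # (q # v) # ZS"
    have mC: "mset (concat ?C) = mset (concat XS)" using f(2) h(2) by simp
    have dC: "distinct (concat ?C)" "set (concat ?C) = set (concat ((p # u) # YS))"
      using mC F(1) f(2) by (metis mset_eq_imp_distinct_iff, metis set_mset_mset)
    have cyc: "cycle_list J g0 (p # u)" "cycle_list J g0 (q # v)" "\<And>xs. xs \<in> set ZS ==> cycle_list J g0 xs"
      using f(1) h(1) by (auto simp: cycle_system_def)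
    have nin: "s \<in> S - ?Q" if "s \<in> set u \<union> set v \<union> set (concat ZS)" for s
    proof (rule free)
      show "s \<in> set (concat ((p # u) # YS))" using that unfolding dC(2)[symmetric] by auto
    qed (use that dC(1) in auto)
    have sub: "set u \<subseteq> S - ?Q" "set v \<subseteq> S - ?Q" "set (concat ZS) \<subseteq> S - ?Q" using nin by blast+
    have tu: "trav J g0 (J p') u p" and tv: "trav J g0 (J q') v q" using cyc by (simp_all add: cycle_list_Cons p'_def q'_def)
    have trv: "trav J g0 (J q) (map g0 (rev v)) q'" using trav_rev[OF J g0 _ _ tv] JJ pS sub by auto
    \<comment> \<open>With \<open>g1\<close> the gluing from \<open>p\<close> arrives at
      \<open>q'\<close>, continues along \<open>v\<close> to \<open>q\<close>, and from there
      returns along \<open>u\<close>. With \<open>g2\<close> it arrives at \<open>q\<close>, so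
      \<open>v\<close> is run backwards up to \<open>q'\<close>.\<close>
    let ?X1 = "(p # v @ q # u) # ZS" and ?X2 = "(p # map g0 (rev v) @ q' # u) # ZS"
    have base: "mset (concat ?C) + image_mset g0 (mset (concat ?C)) = mset_set S" using XS mC by (simp add: cycle_system_def)
    have cZZ: "cycle_list J g1 xs \<and> cycle_list J g2 xs" if "xs \<in> set ZS" for xs
      using cyc(3)[OF that] sub(3) that by (intro cZ) auto
    have X1: "cycle_system J g1 S ?X1" unfolding cycle_system_def
      by (rule conjI) (use tu tv cZZ in \<open>auto simp: cycle_list_Cons g1v trav_append tr(1)[OF sub(1)] tr(1)[OF sub(2)]\<close>,
        use base in \<open>simp add: g1v imu(1)[OF sub(1)] imu(1)[OF sub(2)] imu(1)[OF sub(3)] p'_def[symmetric] q'_def[symmetric] ac_simps add_mset_commute\<close>)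
    have X2: "cycle_system J g2 S ?X2" unfolding cycle_system_def
      by (rule conjI) (use tu trv cZZ in \<open>auto simp: cycle_list_Cons g2v trav_append tr(2)[OF sub(1)] tr(3)[OF sub(2)]\<close>,
        use base in \<open>simp add: g2v imu(2)[OF sub(1)] imu(3)[OF sub(2)] imu(2)[OF sub(3)] p'_def[symmetric] q'_def[symmetric] ac_simps add_mset_commute\<close>)
    have sX1: "set (concat ?X1) = set (concat XS)" unfolding setX[symmetric] dC(2)[symmetric] by auto
    have id: "?lhs B V = ?rhs B V ?X1 ?X2" if B: "?ok B V" for B V
    proof -
      define A A' R where "A = loopm B u" and "A' = loopm B v" and "R = cycles_value \<beta> B ZS"
      have As: "A \<in> scalar_matrices \<beta>" "A' \<in> scalar_matrices \<beta>" unfolding A_def A'_def by (rule loopm_scalar, use B in blast)+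
      have lr: "loopm (?u B w1 w2 w3 w4) (map g0 (rev v)) = adj A'" for w1 w2 w3 w4
        unfolding A'_def by (rule lu(2)[OF sub(2)]) (use B in blast)
      note lu' = lu(1)[OF sub(1), of B, folded A_def] lu(1)[OF sub(2), of B, folded A'_def] lr cu[OF sub(3), of B, folded R_def]
      have v: "cycles_value \<beta> (?u B b b b' b') XS = loop_trace \<beta> (b ** A) * loop_trace \<beta> (b' ** A') * R"
        if "b \<in> N" "b' \<in> N" for b b'
        unfolding f(3)[OF sc[OF B that], symmetric] cycles_value_Cons[of \<beta> _ "p # u"] h(3)[OF sc[OF B that], symmetric]
          cycles_value_Cons[of \<beta> _ "q # v"] loopm.simps lu' using four pq by simp
      have "?lhs B V = (\<Sum>b\<in>N. \<Sum>b'\<in>N. of_real (inner b (V ** b' ** adj V)) * (loop_trace \<beta> (b ** A) * loop_trace \<beta> (b' ** A'))) * R"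
        unfolding sum_distrib_right by (intro sum.cong refl) (simp add: v)
      also have "\<dots> = (c_str \<beta> * loop_trace \<beta> (V ** A' ** adj V ** A) + c_twi \<beta> * loop_trace \<beta> (V ** adj A' ** adj V ** A)) * R"
        using B by (simp only: contract_two_loops[OF \<beta> N _ As])
      finally show ?thesis unfolding cycles_value_Cons loopm_append loopm.simps using four pq B
        by (simp add: lu' matrix_mul_assoc distrib_right)
    qed
    show ?thesis using X1 X2 sX1 id by blast
  next
    case one
    then obtain w v where u: "u = w @ q # v" by (meson split_list)
    have cyc: "cycle_list J g0 (p # w @ q # v)" "\<And>xs. xs \<in> set YS ==> cycle_list J g0 xs"
      using f(1) by (auto simp: cycle_system_def u)
    have nin: "s \<in> S - ?Q" if "s \<in> set w \<union> set v \<union> set (concat YS)" for s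
      by (rule free) (use that F(1) in \<open>auto simp: u\<close>)
    have sub: "set w \<subseteq> S - ?Q" "set v \<subseteq> S - ?Q" "set (concat YS) \<subseteq> S - ?Q" using nin by blast+
    have tw: "trav J g0 (J p') w q" and tv: "trav J g0 (J q') v p"
      using cyc(1) by (auto simp: cycle_list_Cons p'_def q'_def trav_append)
    have trw: "trav J g0 (J q) (map g0 (rev w)) p'" using trav_rev[OF J g0 _ _ tw] JJ pS sub by auto
    \<comment> \<open>With \<open>g1\<close> the gluing from \<open>p\<close> arrives at
      \<open>q'\<close> and skips the arc \<open>w\<close>, which closes up with \<open>q\<close>
      into a cycle of its own. With \<open>g2\<close> it arrives at \<open>q\<close> and runs
      \<open>w\<close> backwards up to \<open>p'\<close>, before continuing along
      \<open>v\<close>.\<close>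
    let ?X1 = "(p # v) # (q # w) # YS" and ?X2 = "(p # map g0 (rev w) @ p' # v) # YS"
    have base: "mset (concat ((p # w @ q # v) # YS)) + image_mset g0 (mset (concat ((p # w @ q # v) # YS))) = mset_set S"
      using f(1) by (simp add: cycle_system_def u)
    have cZZ: "cycle_list J g1 xs \<and> cycle_list J g2 xs" if "xs \<in> set YS" for xs
      using cyc(2)[OF that] sub(3) that by (intro cZ) auto
    have X1: "cycle_system J g1 S ?X1" unfolding cycle_system_def
      by (rule conjI) (use tw tv cZZ in \<open>auto simp: cycle_list_Cons g1v trav_append tr(1)[OF sub(1)] tr(1)[OF sub(2)]\<close>,
        use base in \<open>simp add: g1v imu(1)[OF sub(1)] imu(1)[OF sub(2)] imu(1)[OF sub(3)] p'_def[symmetric] q'_def[symmetric] ac_simps add_mset_commute\<close>)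
    have X2: "cycle_system J g2 S ?X2" unfolding cycle_system_def
      by (rule conjI) (use tv trw cZZ in \<open>auto simp: cycle_list_Cons g2v trav_append tr(2)[OF sub(2)] tr(3)[OF sub(1)]\<close>,
        use base in \<open>simp add: g2v imu(3)[OF sub(1)] imu(2)[OF sub(2)] imu(2)[OF sub(3)] p'_def[symmetric] q'_def[symmetric] ac_simps add_mset_commute\<close>)
    have sX1: "set (concat ?X1) = set (concat XS)" unfolding setX[symmetric] by (auto simp: u)
    have id: "?lhs B V = ?rhs B V ?X1 ?X2" if B: "?ok B V" for B V
    proof -
      define A A' R where "A = loopm B w" and "A' = loopm B v" and "R = cycles_value \<beta> B YS"
      have As: "A \<in> scalar_matrices \<beta>" "A' \<in> scalar_matrices \<beta>" unfolding A_def A'_def by (rule loopm_scalar, use B in blast)+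
      have lr: "loopm (?u B w1 w2 w3 w4) (map g0 (rev w)) = adj A" for w1 w2 w3 w4
        unfolding A_def by (rule lu(2)[OF sub(1)]) (use B in blast)
      note lu' = lu(1)[OF sub(1), of B, folded A_def] lu(1)[OF sub(2), of B, folded A'_def] lr cu[OF sub(3), of B, folded R_def]
      have v: "cycles_value \<beta> (?u B b b b' b') XS = loop_trace \<beta> (b ** A ** b' ** A') * R" if "b \<in> N" "b' \<in> N" for b b'
        unfolding f(3)[OF sc[OF B that], symmetric] cycles_value_Cons u loopm_append loopm.simps lu'
        using four pq by (simp add: matrix_mul_assoc)
      have "?lhs B V = (\<Sum>b\<in>N. \<Sum>b'\<in>N. of_real (inner b (V ** b' ** adj V)) * loop_trace \<beta> (b ** A ** b' ** A')) * R"
        unfolding sum_distrib_right by (intro sum.cong refl) (simp add: v)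
      also have "\<dots> = (c_str \<beta> * (loop_trace \<beta> (V ** A') * loop_trace \<beta> (adj V ** A)) + c_twi \<beta> * loop_trace \<beta> (V ** adj A ** V ** A')) * R"
        using B by (simp only: contract_one_loop[OF \<beta> N _ As])
      finally show ?thesis unfolding cycles_value_Cons loopm_append loopm.simps using four pq B
        by (simp add: lu' matrix_mul_assoc distrib_right)
    qed
    show ?thesis using X1 X2 sX1 id by blast
  qed
qed

section \<open>Traversals and the equivalence classes of sides\<close>

lemma cycle_list_front:
  assumes \<beta>: "\<beta> \<in> {1, 2, 4}" and xs: "cycle_list J g xs" and x: "x \<in> set xs"
  obtains u where "cycle_list J g (x # u)" "mset (x # u) = mset xs"
    "\<And>B :: 's => quat^'n^'n. (\<And>s. B s \<in> scalar_matrices \<beta>) ==> loop_trace \<beta> (loopm B (x # u)) = loop_trace \<beta> (loopm B xs)"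
proof -
  obtain a b where ab: "xs = a @ x # b" using x by (meson split_list)
  show ?thesis
  proof (rule that[of "b @ a"])
    show "cycle_list J g (x # b @ a)" using xs cycle_list_rotate unfolding ab by fast
    fix B :: "'s => quat^'n^'n" assume B: "\<And>s. B s \<in> scalar_matrices \<beta>"
    have "loop_trace \<beta> (loopm B a ** loopm B (x # b)) = loop_trace \<beta> (loopm B (x # b) ** loopm B a)"
      by (intro loop_trace_commute \<beta> loopm_scalar B)
    thus "loop_trace \<beta> (loopm B (x # b @ a)) = loop_trace \<beta> (loopm B xs)"
      by (simp add: ab loopm_append matrix_mul_assoc)
  qed (simp add: ab)
qed

lemma trav_iterate: "trav J g a u e ==> map (\<lambda>j. ((J \<circ> g) ^^ j) a) [0..<length u] = u"
proof (induction u arbitrary: a)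
  case (Cons s u)
  have t: "trav J g (J (g a)) u e" "s = a" using Cons.prems by auto
  have "map (\<lambda>j. ((J \<circ> g) ^^ j) a) [0..<length (s # u)] = a # map (\<lambda>j. ((J \<circ> g) ^^ Suc j) a) [0..<length u]"
    unfolding list.size add_Suc_right add_0_right map_upt_Suc by simp
  also have "\<dots> = s # u" unfolding funpow_Suc_right comp_apply[of "(J \<circ> g) ^^ _"] comp_apply[of J g] Cons.IH[OF t(1)] t(2) ..
  finally show ?case .
qed simp

text \<open>With \<open>J\<close> the vertex-joins and \<open>g\<close> the gluings of a ribbon
  pairing, the classes of its closure are the boundary cycles.\<close>

definition side_rel :: "('s => 's) => ('s => 's) => 's set => ('s \<times> 's) set" where
  "side_rel J g S = {(s, J s) | s. s \<in> S} \<union> {(s, g s) | s. s \<in> S}"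

lemma trav_reachable:
  assumes "involution_on S J" "involution_on S g"
  shows "trav J g a u e ==> a \<in> S ==> y \<in> set u ==> (a, y) \<in> (side_rel J g S)\<^sup>*"
proof (induction u arbitrary: a)
  case (Cons s u)
  have g: "g a \<in> S" "J (g a) \<in> S" using Cons.prems(2) assms by (auto simp: involution_on_def)
  hence r: "(a, g a) \<in> side_rel J g S" "(g a, J (g a)) \<in> side_rel J g S" using Cons.prems(2) by (auto simp: side_rel_def)
  show ?case
  proof (cases "y = s")
    case False
    hence "(J (g a), y) \<in> (side_rel J g S)\<^sup>*" using Cons g by (intro Cons.IH) auto
    thus ?thesis using r by (meson converse_rtrancl_into_rtrancl)
  qed (use Cons.prems in auto)
qed simp

text \<open>The listed sides and their glued partners are closed under both involutions: the join of
  a partner is the next listed side, and the join of a listed side is the partner of the preceding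
  one. Conversely a traversal from any listed side reaches all of them.\<close>

lemma cycle_class:
  assumes J: "involution_on S J" and g: "involution_on S g" and xs: "cycle_list J g xs" "set xs \<subseteq> S"
    and s: "s \<in> set xs \<union> g ` set xs"
  shows "(side_rel J g S)\<^sup>* `` {s} = set xs \<union> g ` set xs"
proof -
  let ?R = "side_rel J g S" and ?c = "set xs \<union> g ` set xs"
  have JJ: "J (J y) = y" "J y \<in> S" "g (g y) = y" "g y \<in> S" if "y \<in> S" for y
    using J g that by (auto simp: involution_on_def)
  have front: "\<exists>u. cycle_list J g (x # u) \<and> set (x # u) = set xs" if x: "x \<in> set xs" for x
  proof -
    obtain a b where "xs = a @ x # b" using x by (meson split_list)
    thus ?thesis using xs(1) cycle_list_rotate[of J g a x b] by (intro exI[of _ "b @ a"]) auto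
  qed
  have closed: "J y \<in> ?c" "g y \<in> ?c" if y: "y \<in> ?c" for y
  proof -
    have "g x \<in> ?c \<and> J x \<in> ?c \<and> J (g x) \<in> ?c \<and> g (g x) \<in> ?c" if x: "x \<in> set xs" for x
    proof -
      obtain u where u: "cycle_list J g (x # u)" "set (x # u) = set xs" using front[OF x] by blast
      have t: "trav J g (J (g x)) u x" using u(1) by (simp add: cycle_list_Cons)
      have xS: "x \<in> S" using x xs by auto
      have "J (g x) \<in> set xs" using t u(2) by (cases u) auto
      moreover have "J x \<in> g ` set xs"
      proof (cases u rule: rev_cases)
        case Nil hence "J x = g x" using t JJ[of "g x"] JJ[OF xS] by auto
        thus ?thesis using x by auto
      next
        case (snoc u' z)
        hence "J (g z) = x" "z \<in> set xs" using t u(2) by (auto simp: trav_append)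
        hence "J x = g z" using JJ xs by (metis subsetD)
        thus ?thesis using \<open>z \<in> set xs\<close> by auto
      qed
      ultimately show ?thesis using x JJ[OF xS] by auto
    qed
    thus "J y \<in> ?c" "g y \<in> ?c" using y by auto
  qed
  have sub: "?R\<^sup>* `` {s} \<subseteq> ?c"
  proof
    fix y assume "y \<in> ?R\<^sup>* `` {s}"
    hence "(s, y) \<in> ?R\<^sup>*" by simp
    thus "y \<in> ?c"
    proof (induction rule: rtrancl_induct)
      case (step y z)
      from step(2) have "z = J y \<or> z = g y" by (auto simp: side_rel_def)
      with step(3) show ?case using closed by blast
    qed (rule s)
  qed
  have reach: "(x, y) \<in> ?R\<^sup>*" if xy: "x \<in> set xs" "y \<in> ?c" for x y
  proof -
    obtain u where u: "cycle_list J g (x # u)" "set (x # u) = set xs" using front[OF xy(1)] by blast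
    have *: "(x, z) \<in> ?R\<^sup>*" if "z \<in> set xs" for z
      using u xs that by (intro trav_reachable[OF J g, of x "x # u" x]) (auto simp: cycle_list_def)
    show ?thesis
    proof (cases "y \<in> set xs")
      case False
      then obtain z where z: "y = g z" "z \<in> set xs" using xy by auto
      hence "(z, y) \<in> ?R" using xs by (auto simp: side_rel_def)
      thus ?thesis using *[OF z(2)] by (meson rtrancl.rtrancl_into_rtrancl)
    qed (rule *)
  qed
  have "(s, y) \<in> ?R\<^sup>*" if y: "y \<in> ?c" for y
  proof (cases "s \<in> set xs")
    case False
    then obtain x where x: "s = g x" "x \<in> set xs" using s by auto
    have xS: "x \<in> S" using x(2) xs(2) by blast
    hence "(g x, g (g x)) \<in> ?R" using JJ(4)[OF xS] unfolding side_rel_def by blast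
    hence "(s, x) \<in> ?R" unfolding JJ(3)[OF xS] x(1) .
    thus ?thesis using reach[OF x(2) y] by (meson converse_rtrancl_into_rtrancl)
  qed (use reach y in blast)
  thus ?thesis using sub by blast
qed

text \<open>From a listed side the iteration gives a rotation of \<open>xs\<close>. From a glued
  partner it runs the cycle backwards and gives the adjoint product, whose loop trace is the same
  for \<beta> in {1, 4}; for \<beta> = 2 such a start is excluded.\<close>

lemma cycle_trace_start:
  fixes B :: "'s => quat^'n^'n"
  assumes \<beta>: "\<beta> \<in> {1, 2, 4}" and J: "involution_on S J" and g: "involution_on S g"
    and xs: "cycle_list J g xs" "set xs \<subseteq> S"
    and B: "\<And>s. B s \<in> scalar_matrices \<beta>" "\<And>s. s \<in> S ==> B (g s) = adj (B s)"
    and s: "s \<in> set xs \<union> g ` set xs" "\<beta> = 2 ==> s \<in> set xs"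
  shows "loop_trace \<beta> (loopm B (map (\<lambda>j. ((J \<circ> g) ^^ j) s) [0..<length xs])) = loop_trace \<beta> (loopm B xs)"
proof (cases "s \<in> set xs")
  case True
  obtain u where u: "cycle_list J g (s # u)" "mset (s # u) = mset xs" "loop_trace \<beta> (loopm B (s # u)) = loop_trace \<beta> (loopm B xs)"
    using cycle_list_front[OF \<beta> xs(1) True] B(1) by metis
  have "length (s # u) = length xs" using u(2) by (metis size_mset)
  moreover have "trav J g s (s # u) s" using u(1) by (simp add: cycle_list_def)
  ultimately show ?thesis using trav_iterate[of J g s "s # u" s] u(3) by simp
next
  case False
  hence \<beta>': "\<beta> \<in> {1, 4}" using s \<beta> by auto
  obtain x where x: "s = g x" "x \<in> set xs" using s(1) False by auto
  obtain u where u: "cycle_list J g (x # u)" "mset (x # u) = mset xs" "loop_trace \<beta> (loopm B (x # u)) = loop_trace \<beta> (loopm B xs)"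
    using cycle_list_front[OF \<beta> xs(1) x(2)] B(1) by metis
  have len: "length (x # u) = length xs" using u(2) by (metis size_mset)
  have uS: "set (x # u) \<subseteq> S" using u(2) xs(2) by (metis set_mset_mset)
  hence gx: "g x \<in> S" "g (g x) = x" using g by (auto simp: involution_on_def)
  hence Jgx: "J (g x) \<in> S" "J (J (g x)) = g x" using J by (auto simp: involution_on_def)
  have t: "trav J g (J (g x)) u x" using u(1) by (simp add: cycle_list_Cons)
  have "trav J g (J x) (map g (rev u)) (g x)" using trav_rev[OF J g Jgx(1) _ t] uS Jgx(2) by auto
  hence "trav J g s (s # map g (rev u)) s" by (simp add: x(1) gx(2))
  moreover have l: "length (s # map g (rev u)) = length xs" using len by simp
  ultimately have "map (\<lambda>j. ((J \<circ> g) ^^ j) s) [0..<length xs] = s # map g (rev u)"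
    using trav_iterate unfolding l[symmetric] by fast
  moreover have "loop_trace \<beta> (loopm B (s # map g (rev u))) = loop_trace \<beta> (loopm B xs)"
  proof -
    have "loopm B (s # map g (rev u)) = adj (B x) ** adj (loopm B u)"
    proof -
      have "B (g x) = adj (B x)" using B(2) uS by auto
      moreover have "loopm B (map g (rev u)) = adj (loopm B u)" by (rule loopm_rev) (use B(2) uS in auto)
      ultimately show ?thesis by (simp only: loopm.simps x(1))
    qed
    also have "\<dots> = adj (loopm B u ** B x)" by (simp add: adj_mult)
    finally have "loop_trace \<beta> (loopm B (s # map g (rev u))) = loop_trace \<beta> (adj (loopm B u ** B x))" by simp
    also have "\<dots> = loop_trace \<beta> (loopm B u ** B x)"
      by (intro loop_trace_adj \<beta>' scalar_matrices_closed loopm_scalar B)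
    also have "\<dots> = loop_trace \<beta> (B x ** loopm B u)" by (intro loop_trace_commute \<beta> loopm_scalar B)
    finally show ?thesis using u(3) by simp
  qed
  ultimately show ?thesis by simp
qed

text \<open>Connects the lists with the formulation by quotient classes: each class is one list
  together with its glued partners, so it has twice as many sides as the list, and half its
  cardinality is the number of gluings.\<close>

lemma cycle_system_value:
  fixes B :: "'s => quat^'n^'n"
  assumes \<beta>: "\<beta> \<in> {1, 2, 4}" and fin: "finite S" and J: "involution_on S J" and g: "involution_on S g"
    and XS: "cycle_system J g S XS"
    and B: "\<And>s. B s \<in> scalar_matrices \<beta>" "\<And>s. s \<in> S ==> B (g s) = adj (B s)"
    and start: "\<And>c. c \<in> S // (side_rel J g S)\<^sup>* ==> start c \<in> c"
    and ori: "\<And>c. \<beta> = 2 ==> c \<in> S // (side_rel J g S)\<^sup>* ==> start c \<notin> g ` set (concat XS)"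
  shows "(\<Prod>c\<in>S // (side_rel J g S)\<^sup>*. loop_trace \<beta> (loopm B (map (\<lambda>j. ((J \<circ> g) ^^ j) (start c)) [0..<card c div 2])))
    = cycles_value \<beta> B XS"
proof -
  note F = cycle_system_facts[OF XS fin]
  let ?cl = "\<lambda>xs. set xs \<union> g ` set xs" and ?Q = "S // (side_rel J g S)\<^sup>*"
  have cyc: "cycle_list J g xs" "set xs \<subseteq> S" "set xs \<subseteq> set (concat XS)" "xs \<noteq> []" if "xs \<in> set XS" for xs
    using XS F(2) that by (auto simp: cycle_system_def cycle_list_def)
  have cls: "(side_rel J g S)\<^sup>* `` {s} = ?cl xs" if "xs \<in> set XS" "s \<in> ?cl xs" for xs s
    using cycle_class[OF J g cyc(1,2)[OF that(1)] that(2)] .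
  have Q: "?Q = ?cl ` set XS"
  proof (intro equalityI subsetI)
    fix c assume "c \<in> ?Q"
    then obtain s where s: "s \<in> S" "c = (side_rel J g S)\<^sup>* `` {s}" by (auto simp: quotient_def)
    then obtain xs where "xs \<in> set XS" "s \<in> ?cl xs" using F(2) by auto
    thus "c \<in> ?cl ` set XS" using s(2) cls by blast
  next
    fix c assume "c \<in> ?cl ` set XS"
    then obtain xs where xs: "xs \<in> set XS" "c = ?cl xs" by auto
    have h: "hd xs \<in> set xs" using cyc(4)[OF xs(1)] by simp
    hence "c = (side_rel J g S)\<^sup>* `` {hd xs}" using cls[OF xs(1), of "hd xs"] xs(2) by auto
    thus "c \<in> ?Q" using cyc(2)[OF xs(1)] h by (auto simp: quotient_def)
  qed
  have dis: "set xs \<inter> set ys = {}" if "xs \<in> set XS" "ys \<in> set XS" "xs \<noteq> ys" for xs ys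
    using F(1) that by (auto simp: distinct_concat_iff)
  have distXS: "distinct XS"
  proof -
    have "removeAll [] XS = XS" using cyc(4) by (simp add: removeAll_filter_not_eq filter_id_conv) (metis filter_id_conv)
    thus ?thesis using F(1) by (metis distinct_concat_iff)
  qed
  have inj: "inj_on ?cl (set XS)"
  proof (rule inj_onI, rule ccontr)
    fix xs ys assume a: "xs \<in> set XS" "ys \<in> set XS" "?cl xs = ?cl ys" "xs \<noteq> ys"
    have h: "hd xs \<in> set xs" using cyc(4)[OF a(1)] by simp
    hence "hd xs \<in> ?cl ys" using a(3) by blast
    hence "hd xs \<in> g ` set ys" using dis[OF a(1,2,4)] h by blast
    thus False using F(3) cyc(3)[OF a(1)] cyc(3)[OF a(2)] h by blast
  qed
  have card: "card (?cl xs) = 2 * length xs" if "xs \<in> set XS" for xs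
  proof -
    have "distinct xs" using F(1) that by (auto simp: distinct_concat_iff)
    moreover have "inj_on g (set xs)" using F(4) cyc(3)[OF that] by (rule inj_on_subset)
    moreover have "set xs \<inter> g ` set xs = {}" using F(3) cyc(3)[OF that] by blast
    ultimately show ?thesis by (simp add: card_Un_disjoint card_image distinct_card)
  qed
  have "(\<Prod>c\<in>?Q. loop_trace \<beta> (loopm B (map (\<lambda>j. ((J \<circ> g) ^^ j) (start c)) [0..<card c div 2])))
    = (\<Prod>xs\<in>set XS. loop_trace \<beta> (loopm B (map (\<lambda>j. ((J \<circ> g) ^^ j) (start (?cl xs))) [0..<card (?cl xs) div 2])))"
    unfolding Q by (simp add: prod.reindex[OF inj])
  also have "\<dots> = (\<Prod>xs\<in>set XS. loop_trace \<beta> (loopm B xs))"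
  proof (intro prod.cong refl)
    fix xs assume xs: "xs \<in> set XS"
    hence "?cl xs \<in> ?Q" unfolding Q by blast
    hence s: "start (?cl xs) \<in> ?cl xs" "\<beta> = 2 ==> start (?cl xs) \<in> set xs"
      using start[of "?cl xs"] ori[of "?cl xs"] cyc(3)[OF xs] by blast+
    show "loop_trace \<beta> (loopm B (map (\<lambda>j. ((J \<circ> g) ^^ j) (start (?cl xs))) [0..<card (?cl xs) div 2])) = loop_trace \<beta> (loopm B xs)"
    proof -
      have l: "card (?cl xs) div 2 = length xs" unfolding card[OF xs] by simp
      show ?thesis unfolding l by (rule cycle_trace_start[OF \<beta> J g cyc(1,2)[OF xs], where s = "start (?cl xs)"]) (fact B s)+
    qed
  qed
  also have "\<dots> = cycles_value \<beta> B XS" unfolding cycles_value_def using distXS by (rule prod.distinct_set_conv_list)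
  finally show ?thesis .
qed

subsection \<open>Contracting all pairs\<close>

text \<open>The intermediate stage in which only the pairs in \<open>D\<close> are contracted. A
  half-edge of another pair has its own two sides glued to each other, so that a traversal simply
  passes through it; with \<open>D\<close> empty the cycles go once around each vertex.\<close>

definition partial_glue :: "nat set set => nat set set => nat set set => side => side" where
  "partial_glue P D tw s = (let k = fst s; k' = partner (P, {}) k in
     if {k, k'} \<in> D then (k', if {k, k'} \<in> tw then snd s else \<not> snd s) else (k, \<not> snd s))"

text \<open>A contracted half-edge carries the holonomy of its path, which runs from the smaller to
  the larger label, hence the adjoint at the larger one; an uncontracted half-edge carries its
  matrix from \<open>b\<close>.\<close>

definition partial_mats ::
  "nat set set => nat set set => (nat set => quat^'n^'n) => (nat => quat^'n^'n) => side => quat^'n^'n" where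
  "partial_mats P D V b s = (let k = fst s; p = {k, partner (P, {}) k} in
     if p \<in> D then (if k = Min p then V p else adj (V p)) else b k)"

lemma pairings_partner:
  assumes P: "P \<in> pairings I" and k: "k \<in> I"
  shows "{k, partner (P, tw) k} \<in> P" "partner (P, tw) k \<in> I" "partner (P, tw) k \<noteq> k"
    "partner (P, tw) (partner (P, tw) k) = k" "{k, j} \<in> P ==> partner (P, tw) k = j"
proof -
  have disj: "disjoint P" using P by (simp add: pairings_def partition_on_def)
  have uniq: "j = j'" if a: "{i, j} \<in> P" "{i, j'} \<in> P" for i j j'
  proof -
    have "{i, j} \<inter> {i, j'} \<noteq> {}" by simp
    hence "{i, j} = {i, j'}" using disjointD[OF disj a] by metis
    thus ?thesis by (auto simp: doubleton_eq_iff)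
  qed
  have the: "partner (P, tw) i = j" if "{i, j} \<in> P" for i j unfolding partner_def using that uniq by (intro the_equality) auto
  thus "{k, j} \<in> P ==> partner (P, tw) k = j" by blast
  obtain j where j: "j \<in> I - {k}" "{k, j} \<in> P" using pairings_member[OF P k] by metis
  thus "{k, partner (P, tw) k} \<in> P" "partner (P, tw) k \<in> I" "partner (P, tw) k \<noteq> k" using the[OF j(2)] by auto
  have "{j, k} \<in> P" using j(2) by (simp add: insert_commute)
  thus "partner (P, tw) (partner (P, tw) k) = k" using the[OF j(2)] the by simp
qed

lemma glue_eq_partial_glue:
  assumes "P \<in> pairings I" "s \<in> I \<times> UNIV"
  shows "partial_glue P P tw s = glue (P, tw) s"
proof -
  have "partner (P, tw) = partner (P, {})" by (simp add: partner_def fun_eq_iff)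
  thus ?thesis
    using pairings_partner(1)[OF assms(1), of "fst s" "{}"] assms(2) by (auto simp: partial_glue_def glue_def split: prod.splits)
qed

lemma partial_glue_involution:
  assumes P: "P \<in> pairings I" shows "involution_on (I \<times> UNIV) (partial_glue P D tw)" unfolding involution_on_def
proof
  fix s assume "s \<in> I \<times> (UNIV :: bool set)"
  then obtain k x where s: "s = (k, x)" and k: "k \<in> I" by auto
  note pp = pairings_partner[OF P k, where tw = "{}"]
  have "{partner (P, {}) k, k} = {k, partner (P, {}) k}" by auto
  thus "partial_glue P D tw s \<in> I \<times> UNIV \<and> partial_glue P D tw (partial_glue P D tw s) = s"
    using pp(2,4) k unfolding s by (simp add: partial_glue_def Let_def)
qed

lemma partial_mats_adj:
  assumes P: "P \<in> pairings I" and s: "s \<in> I \<times> UNIV" and b: "\<And>k. b k \<in> hermitian_space \<beta>"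
  shows "partial_mats P D V b (partial_glue P D tw s) = adj (partial_mats P D V b s)"
proof -
  obtain k x where sk: "s = (k, x)" by (cases s)
  have k: "k \<in> I" using s sk by simp
  note pp = pairings_partner[OF P k, where tw = "{}"]
  define k' where "k' = partner (P, {}) k"
  have k': "partner (P, {}) k = k'" "partner (P, {}) k' = k" "k' \<noteq> k" "{k', k} = {k, k'}"
    using pp(3,4) by (auto simp: k'_def)
  have "adj (b k) = b k" using b by (simp add: hermitian_space_iff)
  moreover have "k < k' \<or> k' < k" using k'(3) by linarith
  ultimately show ?thesis by (cases "{k, k'} \<in> D") (auto simp: partial_mats_def partial_glue_def sk k' min_def)
qed

lemma sum_PiE_insert:
  assumes "x \<notin> S"
  shows "(\<Sum>c\<in>PiE (insert x S) T. f c) = (\<Sum>y\<in>T x. \<Sum>c\<in>PiE S T. f (c(x := y)))"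
proof -
  have "(\<Sum>c\<in>PiE (insert x S) T. f c) = (\<Sum>(y, c)\<in>T x \<times> PiE S T. f (c(x := y)))"
    unfolding PiE_insert_eq by (subst sum.reindex[OF inj_combinator[OF assms]]) (simp add: case_prod_beta' o_def)
  thus ?thesis by (simp add: sum.cartesian_product)
qed

text \<open>Which of the two new gluings is the straight one depends on the listed sides
  \<open>(k, x)\<close> and \<open>(k', y)\<close>: the first if \<open>x = y\<close>, the second
  otherwise. The exchange is harmless when \<open>c_str\<close> and \<open>c_twi\<close> agree; for
  \<beta> = 2 they differ, but there all listed sides are minus sides, so that
  \<open>x = y\<close>.\<close>

lemma contract_pair:
  fixes N :: "(quat^'n^'n) set"
  assumes \<beta>: "\<beta> \<in> {1, 2, 4}" and N: "is_onb (hermitian_space \<beta>) N" and I: "finite I" and P: "P \<in> pairings I"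
    and J: "involution_on (I \<times> UNIV) J" and p0: "p0 \<in> P" "p0 \<notin> D" "D \<subseteq> P" "p0 \<notin> tw"
    and XS: "cycle_system J (partial_glue P D tw) (I \<times> UNIV) XS"
    and ori: "\<beta> = 2 ==> set (concat XS) \<subseteq> {s. \<not> snd s}"
  shows "\<exists>XS1 XS2. cycle_system J (partial_glue P (insert p0 D) tw) (I \<times> UNIV) XS1
     \<and> cycle_system J (partial_glue P (insert p0 D) (insert p0 tw)) (I \<times> UNIV) XS2
     \<and> (\<beta> = 2 \<longrightarrow> set (concat XS1) \<subseteq> {s. \<not> snd s})
     \<and> (\<forall>V b. (\<forall>p. V p \<in> scalar_matrices \<beta>) \<and> (\<forall>k. b k \<in> hermitian_space \<beta>) \<longrightarrow>
      (\<Sum>b1\<in>N. \<Sum>b2\<in>N. of_real (inner b1 (V p0 ** b2 ** adj (V p0))) *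
         cycles_value \<beta> (partial_mats P D V (b(Min p0 := b1, Max p0 := b2))) XS)
       = c_str \<beta> * cycles_value \<beta> (partial_mats P (insert p0 D) V b) XS1
       + c_twi \<beta> * cycles_value \<beta> (partial_mats P (insert p0 D) V b) XS2)"
proof -
  define k k' where "k = Min p0" and "k' = Max p0"
  have "card p0 = 2" "\<Union> P = I" using P p0(1) by (simp_all add: pairings_def partition_on_def)
  then obtain a c where ac: "p0 = {a, c}" "a \<noteq> c" by (meson card_2_iff)
  have kk: "p0 = {k, k'}" "k < k'" unfolding k_def k'_def ac(1) using ac(2) by (auto simp: min_def max_def insert_commute)
  have kI: "k \<in> I" "k' \<in> I" using \<open>\<Union> P = I\<close> p0(1) kk(1) by auto
  have part: "partner (P, {}) k = k'" "partner (P, {}) k' = k"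
    using pairings_partner(5)[OF P] kI p0(1) unfolding kk(1) by (auto simp: insert_commute)
  let ?S = "I \<times> (UNIV :: bool set)"
  let ?g0 = "partial_glue P D tw"
  have fin: "finite ?S" using I by simp
  have g0: "involution_on ?S ?g0" by (rule partial_glue_involution[OF P])
  note F = cycle_system_facts[OF XS fin]
  have kcross: "?g0 (k, x) = (k, \<not> x)" "?g0 (k', x) = (k', \<not> x)" for x
    using p0(2) part kk(1) by (auto simp: partial_glue_def insert_commute)
  \<comment> \<open>The two sides of an uncontracted half-edge are glued to each other, so exactly
    one of them is listed, and it marks where the half-edge sits on its cycle.\<close>
  have ex: "\<exists>x. (j, x) \<in> set (concat XS)" if j: "j \<in> I" "\<And>x. ?g0 (j, x) = (j, \<not> x)" for j
  proof (rule ccontr)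
    assume no: "\<nexists>x. (j, x) \<in> set (concat XS)"
    have "(j, True) \<in> set (concat XS) \<union> ?g0 ` set (concat XS)" using F(2) j by auto
    then obtain s where s: "(j, True) = ?g0 s" "s \<in> set (concat XS)" using no by blast
    hence "s \<in> ?S" using F(2) by blast
    hence "?g0 (?g0 s) = s" using g0 unfolding involution_on_def by blast
    hence "s = ?g0 (j, True)" by (simp only: s(1))
    thus False using s(2) no j(2) by auto
  qed
  obtain x where x: "(k, x) \<in> set (concat XS)" using ex[OF kI(1) kcross(1)] by blast
  obtain y where y: "(k', y) \<in> set (concat XS)" using ex[OF kI(2) kcross(2)] by blast
  let ?p = "(k, x)" and ?q = "(k', y)" and ?p' = "(k, \<not> x)" and ?q' = "(k', \<not> y)"
  have neq: "?p \<noteq> ?q" using kk by auto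
  define g1 where "g1 = ?g0(?p := ?q', ?q' := ?p, ?p' := ?q, ?q := ?p')"
  define g2 where "g2 = ?g0(?p := ?q, ?q := ?p, ?p' := ?q', ?q' := ?p')"
  have g1_eq: "?g0(?p := ?q', ?q' := ?p, ?p' := ?q, ?q := ?p') = g1" and g2_eq: "?g0(?p := ?q, ?q := ?p, ?p' := ?q', ?q' := ?p') = g2"
    by (simp_all only: g1_def g2_def)
  note cc = cycle_system_contract[OF \<beta> N fin J g0 XS x y neq, unfolded kcross, unfolded g1_eq g2_eq]
  obtain XS1 XS2 where X: "cycle_system J g1 ?S XS1" "set (concat XS1) = set (concat XS)" "cycle_system J g2 ?S XS2"
    and id: "\<forall>B V. (\<forall>s. B s \<in> scalar_matrices \<beta>) \<and> V \<in> scalar_matrices \<beta> \<and> (\<forall>s\<in>?S - {?p, ?p', ?q, ?q'}. B (?g0 s) = adj (B s)) \<longrightarrow>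
      (\<Sum>b\<in>N. \<Sum>b'\<in>N. of_real (inner b (V ** b' ** adj V)) *
          cycles_value \<beta> (B(?p := b, ?p' := b, ?q := b', ?q' := b')) XS)
      = c_str \<beta> * cycles_value \<beta> (B(?p := V, ?p' := V, ?q := adj V, ?q' := adj V)) XS1
      + c_twi \<beta> * cycles_value \<beta> (B(?p := V, ?p' := V, ?q := adj V, ?q' := adj V)) XS2"
    using cc by (elim exE conjE) (rule that)
  let ?s = "partial_glue P (insert p0 D) tw" and ?t = "partial_glue P (insert p0 D) (insert p0 tw)"
  have other: "{j, partner (P, {}) j} \<noteq> p0" if "j \<notin> {k, k'}" for j using that kk(1) by auto
  have pk: "{k, k'} = p0" "{k', k} = p0" using kk(1) by auto
  have eqs: "(if x = y then ?s else ?t) = g1" "(if x = y then ?t else ?s) = g2"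
  proof -
    have *: "(if x = y then ?s else ?t) (j, z) = g1 (j, z) \<and> (if x = y then ?t else ?s) (j, z) = g2 (j, z)" for j z
    proof (cases "j \<in> {k, k'}")
      case True
      thus ?thesis using kk(2) p0(4) part pk
        by (cases "x = y"; cases "z = x"; cases "z = y") (auto simp: g1_def g2_def partial_glue_def)
    next
      case False
      thus ?thesis using other[OF False] by (auto simp: g1_def g2_def partial_glue_def Let_def)
    qed
    thus "(if x = y then ?s else ?t) = g1" "(if x = y then ?t else ?s) = g2" by auto
  qed
  have id': "(\<Sum>b1\<in>N. \<Sum>b2\<in>N. of_real (inner b1 (V p0 ** b2 ** adj (V p0))) *
         cycles_value \<beta> (partial_mats P D V (b(Min p0 := b1, Max p0 := b2))) XS)
       = c_str \<beta> * cycles_value \<beta> (partial_mats P (insert p0 D) V b) XS1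
       + c_twi \<beta> * cycles_value \<beta> (partial_mats P (insert p0 D) V b) XS2"
    if V: "\<And>p. V p \<in> scalar_matrices \<beta>" and b: "\<And>k. b k \<in> hermitian_space \<beta>" for V b
  proof -
    let ?B = "partial_mats P D V b"
    have e1: "partial_mats P D V (b(Min p0 := b1, Max p0 := b2)) = ?B(?p := b1, ?p' := b1, ?q := b2, ?q' := b2)" for b1 b2
    proof
      fix s :: side
      obtain j z where s: "s = (j, z)" by (cases s)
      show "partial_mats P D V (b(Min p0 := b1, Max p0 := b2)) s = (?B(?p := b1, ?p' := b1, ?q := b2, ?q' := b2)) s"
        unfolding k_def[symmetric] k'_def[symmetric] s
        using kk(2) part pk p0(2) by (cases "j = k"; cases "j = k'") (auto simp: partial_mats_def Let_def)
    qed
    have e2: "partial_mats P (insert p0 D) V b = ?B(?p := V p0, ?p' := V p0, ?q := adj (V p0), ?q' := adj (V p0))"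
    proof
      fix s :: side
      obtain j z where s: "s = (j, z)" by (cases s)
      have kM: "Min p0 = k" by (simp only: k_def)
      show "partial_mats P (insert p0 D) V b s = (?B(?p := V p0, ?p' := V p0, ?q := adj (V p0), ?q' := adj (V p0))) s"
      proof (cases "j \<in> {k, k'}")
        case True
        have v: "partial_mats P (insert p0 D) V b (k, z) = V p0" "partial_mats P (insert p0 D) V b (k', z) = adj (V p0)"
          using kk(2) by (simp_all add: partial_mats_def Let_def part pk kM)
        show ?thesis using True v kk(2) unfolding s by (cases "z = x"; cases "z = y") auto
      next
        case False thus ?thesis using other[OF False] s by (auto simp: partial_mats_def Let_def)
      qed
    qed
    have sc: "?B s \<in> scalar_matrices \<beta>" for s
      using V b by (auto simp: partial_mats_def Let_def scalar_matrices_closed hermitian_space_iff)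
    show ?thesis unfolding e1 e2 by (rule id[rule_format]) (use sc V partial_mats_adj[OF P _ b] in auto)
  qed
  show ?thesis
  proof (cases "x = y")
    case True
    thus ?thesis using X eqs id' ori by (intro exI[of _ XS1] exI[of _ XS2]) auto
  next
    case False
    have "\<beta> \<noteq> 2"
    proof
      assume "\<beta> = 2"
      hence "\<not> x" "\<not> y" using ori x y by (metis (mono_tags, lifting) mem_Collect_eq snd_conv subsetD)+
      thus False using False by simp
    qed
    hence "c_str \<beta> = c_twi \<beta>" using \<beta> by (auto simp: c_str_def c_twi_def)
    thus ?thesis using False X eqs id' \<open>\<beta> \<noteq> 2\<close> by (intro exI[of _ XS2] exI[of _ XS1]) (auto simp: add.commute)
  qed
qed

lemma sum_swap3:
  fixes w :: "'a => 'b => 'c::comm_semiring_0"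
  shows "(\<Sum>b1\<in>M. \<Sum>b2\<in>M'. w b1 b2 * (\<Sum>t\<in>T. v t * x t b1 b2))
    = (\<Sum>t\<in>T. v t * (\<Sum>b1\<in>M. \<Sum>b2\<in>M'. w b1 b2 * x t b1 b2))"
proof -
  have "(\<Sum>b1\<in>M. \<Sum>b2\<in>M'. w b1 b2 * (\<Sum>t\<in>T. v t * x t b1 b2))
    = (\<Sum>b1\<in>M. \<Sum>b2\<in>M'. \<Sum>t\<in>T. v t * (w b1 b2 * x t b1 b2))"
    by (simp add: sum_distrib_left mult.left_commute)
  also have "\<dots> = (\<Sum>b1\<in>M. \<Sum>t\<in>T. \<Sum>b2\<in>M'. v t * (w b1 b2 * x t b1 b2))"
    by (intro sum.cong refl sum.swap)
  also have "\<dots> = (\<Sum>t\<in>T. \<Sum>b1\<in>M. \<Sum>b2\<in>M'. v t * (w b1 b2 * x t b1 b2))" by (rule sum.swap)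
  finally show ?thesis by (simp add: sum_distrib_left)
qed

text \<open>Induction on the set \<open>D\<close> of contracted pairs. The claim is made for
  arbitrary matrices \<open>b\<close> on the remaining half-edges, because the induction step
  inserts the two matrices of the new pair there. For \<beta> = 2 cycle systems are only asserted
  without twisted pairs; the other terms have coefficient zero.\<close>

theorem contract_pairs:
  fixes N :: "(quat^'n^'n) set"
  assumes \<beta>: "\<beta> \<in> {1, 2, 4}" and N: "is_onb (hermitian_space \<beta>) N" and I: "finite I" and P: "P \<in> pairings I"
    and J: "involution_on (I \<times> UNIV) J"
    and XS0: "cycle_system J (\<lambda>(k, x). (k, \<not> x)) (I \<times> UNIV) XS0"
    and ori0: "\<beta> = 2 ==> set (concat XS0) \<subseteq> {s. \<not> snd s}"
    and D: "D \<subseteq> P"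
  shows "\<exists>XS. (\<forall>tw. tw \<subseteq> D \<and> (\<beta> = 2 \<longrightarrow> tw = {}) \<longrightarrow> cycle_system J (partial_glue P D tw) (I \<times> UNIV) (XS tw)
        \<and> (\<beta> = 2 \<longrightarrow> set (concat (XS tw)) \<subseteq> {s. \<not> snd s}))
     \<and> (\<forall>V b. (\<forall>p. V p \<in> scalar_matrices \<beta>) \<and> (\<forall>k. b k \<in> hermitian_space \<beta>) \<longrightarrow>
      (\<Sum>c\<in>PiE (\<Union> D) (\<lambda>_. N). (\<Prod>p\<in>D. of_real (inner (c (Min p)) (V p ** c (Max p) ** adj (V p)))) *
         cycles_value \<beta> (\<lambda>s. if fst s \<in> \<Union> D then c (fst s) else b (fst s)) XS0)
       = (\<Sum>tw\<in>Pow D. (\<Prod>p\<in>D. if p \<in> tw then c_twi \<beta> else c_str \<beta>) * cycles_value \<beta> (partial_mats P D V b) (XS tw)))"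
proof -
  have finP: "finite P" using P I by (auto simp: pairings_def intro: finite_elements)
  have "finite D" using D finP by (rule finite_subset)
  thus ?thesis using D
  proof (induction D)
    case empty
    have g: "partial_glue P {} {} = (\<lambda>(k, x). (k, \<not> x))" by (auto simp: partial_glue_def)
    have m: "partial_mats P {} V b = (\<lambda>s. b (fst s))" for V and b :: "nat => quat^'n^'n" by (auto simp: partial_mats_def Let_def)
    show ?case using XS0 ori0 by (intro exI[of _ "\<lambda>_. XS0"]) (auto simp: g m)
  next
    case (insert p0 D)
    have p0: "p0 \<in> P" "p0 \<notin> D" "D \<subseteq> P" using insert by auto
    obtain XS where XS: "\<And>tw. tw \<subseteq> D \<and> (\<beta> = 2 \<longrightarrow> tw = {}) ==> cycle_system J (partial_glue P D tw) (I \<times> UNIV) (XS tw)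
        \<and> (\<beta> = 2 \<longrightarrow> set (concat (XS tw)) \<subseteq> {s. \<not> snd s})"
      and IH: "\<And>V b. (\<forall>p. V p \<in> scalar_matrices \<beta>) \<and> (\<forall>k. b k \<in> hermitian_space \<beta>) ==>
      (\<Sum>c\<in>PiE (\<Union> D) (\<lambda>_. N). (\<Prod>p\<in>D. of_real (inner (c (Min p)) (V p ** c (Max p) ** adj (V p)))) *
         cycles_value \<beta> (\<lambda>s. if fst s \<in> \<Union> D then c (fst s) else b (fst s)) XS0)
       = (\<Sum>tw\<in>Pow D. (\<Prod>p\<in>D. if p \<in> tw then c_twi \<beta> else c_str \<beta>) * cycles_value \<beta> (partial_mats P D V b) (XS tw))"
      using insert.IH p0(3) by blast
    let ?good = "\<lambda>tw. tw \<subseteq> D \<and> (\<beta> = 2 \<longrightarrow> tw = {})"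
    let ?m = "\<lambda>V b. cycles_value \<beta> (partial_mats P (insert p0 D) V b)"
    let ?n = "\<lambda>V b b1 b2 tw. cycles_value \<beta> (partial_mats P D V (b(Min p0 := b1, Max p0 := b2))) (XS tw)"
    let ?e = "\<lambda>V b1 b2. complex_of_real (inner b1 (V p0 ** b2 ** adj (V p0)))"
    let ?g = "\<lambda>tw p. if p \<in> tw then c_twi \<beta> else c_str \<beta>"
    let ?ok = "\<lambda>V b. (\<forall>p. V p \<in> scalar_matrices \<beta>) \<and> (\<forall>k. b k \<in> hermitian_space \<beta>)"
    define R where "R tw XS1 XS2 \<longleftrightarrow> cycle_system J (partial_glue P (insert p0 D) tw) (I \<times> UNIV) XS1
     \<and> cycle_system J (partial_glue P (insert p0 D) (insert p0 tw)) (I \<times> UNIV) XS2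
     \<and> (\<beta> = 2 \<longrightarrow> set (concat XS1) \<subseteq> {s. \<not> snd s})
     \<and> (\<forall>V b. ?ok V b \<longrightarrow> (\<Sum>b1\<in>N. \<Sum>b2\<in>N. ?e V b1 b2 * ?n V b b1 b2 tw)
       = c_str \<beta> * cycles_value \<beta> (partial_mats P (insert p0 D) V b) XS1
       + c_twi \<beta> * cycles_value \<beta> (partial_mats P (insert p0 D) V b) XS2)" for tw XS1 XS2
    have "\<exists>XS1 XS2. ?good tw \<longrightarrow> R tw XS1 XS2" for tw
    proof (cases "?good tw")
      case True
      hence "p0 \<notin> tw" using p0 by auto
      from contract_pair[OF \<beta> N I P J p0 this, of "XS tw"] XS[OF True]
      show ?thesis unfolding R_def[symmetric] by simp
    qed auto
    then obtain Y1 Y2 where R: "\<And>tw. ?good tw ==> R tw (Y1 tw) (Y2 tw)" by metis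
    have Y: "cycle_system J (partial_glue P (insert p0 D) tw) (I \<times> UNIV) (Y1 tw)
     \<and> cycle_system J (partial_glue P (insert p0 D) (insert p0 tw)) (I \<times> UNIV) (Y2 tw)
     \<and> (\<beta> = 2 \<longrightarrow> set (concat (Y1 tw)) \<subseteq> {s. \<not> snd s})" if "?good tw" for tw
      using R[OF that] unfolding R_def by (elim conjE) (intro conjI)
    have Yid: "(\<Sum>b1\<in>N. \<Sum>b2\<in>N. ?e V b1 b2 * ?n V b b1 b2 tw) = c_str \<beta> * ?m V b (Y1 tw)
       + c_twi \<beta> * ?m V b (Y2 tw)"
      if "?good tw" "?ok V b" for tw V b
      using R[OF that(1)] that(2) unfolding R_def by (elim conjE allE[of _ V] allE[of _ b]) blast
    \<comment> \<open>Whether the new pair is twisted is read off from \<open>tw\<close>, and the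
      cycles are those obtained by contracting it after the remaining pairs.\<close>
    define XS' where "XS' tw = (if p0 \<in> tw then Y2 (tw - {p0}) else Y1 tw)" for tw
    have sys: "cycle_system J (partial_glue P (insert p0 D) tw) (I \<times> UNIV) (XS' tw)
        \<and> (\<beta> = 2 \<longrightarrow> set (concat (XS' tw)) \<subseteq> {s. \<not> snd s})" if "tw \<subseteq> insert p0 D \<and> (\<beta> = 2 \<longrightarrow> tw = {})" for tw
    proof (cases "p0 \<in> tw")
      case True
      hence "?good (tw - {p0})" "insert p0 (tw - {p0}) = tw" "\<beta> \<noteq> 2" using that by auto
      thus ?thesis using Y[of "tw - {p0}"] True by (simp add: XS'_def)
    next
      case False
      hence "?good tw" using that by auto
      thus ?thesis using Y[of tw] False by (simp add: XS'_def)
    qed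
    have part: "partition_on I P" and card: "card p0 = 2" and Nfin: "finite N"
      using P p0(1) is_onb_finite[OF N] by (auto simp: pairings_def)
    define k k' where "k = Min p0" and "k' = Max p0"
    obtain a c where ac: "p0 = {a, c}" "a \<noteq> c" using card by (meson card_2_iff)
    have kk: "p0 = {k, k'}" "k \<noteq> k'" unfolding k_def k'_def ac(1) using ac(2) by (auto simp: min_def max_def insert_commute)
    have "disjoint P" using part by (simp add: partition_on_def)
    have pD: "p0 \<inter> d = {}" if "d \<in> D" for d
    proof -
      have "d \<in> P" "p0 \<noteq> d" using that p0 by auto
      thus ?thesis by (rule disjointD[OF \<open>disjoint P\<close> p0(1)])
    qed
    have kD: "k \<notin> \<Union> D" "k' \<notin> \<Union> D" using pD kk(1) by auto
    have mm: "Min p \<in> \<Union> D" "Max p \<in> \<Union> D" if "p \<in> D" for p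
    proof -
      have "card p = 2" using P p0(3) that by (auto simp: pairings_def)
      hence "finite p" "p \<noteq> {}" by (auto intro: card_ge_0_finite)
      thus "Min p \<in> \<Union> D" "Max p \<in> \<Union> D" using that Min_in Max_in by blast+
    qed
    have id: "(\<Sum>c\<in>PiE (\<Union> (insert p0 D)) (\<lambda>_. N). (\<Prod>p\<in>insert p0 D. of_real (inner (c (Min p)) (V p ** c (Max p) ** adj (V p)))) *
         cycles_value \<beta> (\<lambda>s. if fst s \<in> \<Union> (insert p0 D) then c (fst s) else b (fst s)) XS0)
       = (\<Sum>tw\<in>Pow (insert p0 D). (\<Prod>p\<in>insert p0 D. ?g tw p) * ?m V b (XS' tw))"
      if V: "\<And>p. V p \<in> scalar_matrices \<beta>" and b: "\<And>k. b k \<in> hermitian_space \<beta>" for V b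
    proof -
      let ?w = "\<lambda>c p. complex_of_real (inner (c (Min p)) (V p ** c (Max p) ** adj (V p)))"
      let ?v = "\<lambda>tw. \<Prod>p\<in>D. if p \<in> tw then c_twi \<beta> else c_str \<beta>"
      have U: "\<Union> (insert p0 D) = insert k (insert k' (\<Union> D))" using kk(1) by auto
      have "(\<Sum>c\<in>PiE (\<Union> (insert p0 D)) (\<lambda>_. N). (\<Prod>p\<in>insert p0 D. ?w c p) *
         cycles_value \<beta> (\<lambda>s. if fst s \<in> \<Union> (insert p0 D) then c (fst s) else b (fst s)) XS0)
        = (\<Sum>b1\<in>N. \<Sum>b2\<in>N. \<Sum>c\<in>PiE (\<Union> D) (\<lambda>_. N). (\<Prod>p\<in>insert p0 D. ?w (c(k' := b2, k := b1)) p) *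
         cycles_value \<beta> (\<lambda>s. if fst s \<in> insert k (insert k' (\<Union> D)) then (c(k' := b2, k := b1)) (fst s) else b (fst s)) XS0)"
        unfolding U using kD kk(2) by (subst sum_PiE_insert, simp, subst sum_PiE_insert, simp, simp)
      also have "\<dots> = (\<Sum>b1\<in>N. \<Sum>b2\<in>N. ?e V b1 b2 * (\<Sum>tw\<in>Pow D. ?v tw * ?n V b b1 b2 tw))"
      proof (intro sum.cong refl)
        fix b1 b2 assume bN: "b1 \<in> N" "b2 \<in> N"
        let ?b = "b(k := b1, k' := b2)"
        have bh: "?b j \<in> hermitian_space \<beta>" for j using bN N b by (auto simp: is_onb_def)
        have f: "(\<lambda>s. if fst s \<in> insert k (insert k' (\<Union> D)) then (c(k' := b2, k := b1)) (fst s) else b (fst s))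
           = (\<lambda>s::side. if fst s \<in> \<Union> D then c (fst s) else ?b (fst s))" for c
          using kD kk(2) by (auto simp: fun_eq_iff)
        have pr: "(\<Prod>p\<in>insert p0 D. ?w (c(k' := b2, k := b1)) p) = ?e V b1 b2 * (\<Prod>p\<in>D. ?w c p)" for c
        proof -
          have "?w (c(k' := b2, k := b1)) p = ?w c p" if "p \<in> D" for p using mm[OF that] kD by (metis fun_upd_other)
          hence "(\<Prod>p\<in>D. ?w (c(k' := b2, k := b1)) p) = (\<Prod>p\<in>D. ?w c p)" by (rule prod.cong[OF refl])
          thus ?thesis using insert.hyps kk(2) by (simp add: k_def[symmetric] k'_def[symmetric])
        qed
        show "(\<Sum>c\<in>PiE (\<Union> D) (\<lambda>_. N). (\<Prod>p\<in>insert p0 D. ?w (c(k' := b2, k := b1)) p) *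
         cycles_value \<beta> (\<lambda>s. if fst s \<in> insert k (insert k' (\<Union> D)) then (c(k' := b2, k := b1)) (fst s) else b (fst s)) XS0)
         = ?e V b1 b2 * (\<Sum>tw\<in>Pow D. ?v tw * ?n V b b1 b2 tw)"
          unfolding f pr mult.assoc sum_distrib_left[symmetric] k_def[symmetric] k'_def[symmetric] using IH[of V ?b] V bh by simp
      qed
      also have "\<dots> = (\<Sum>tw\<in>Pow D. ?v tw * (\<Sum>b1\<in>N. \<Sum>b2\<in>N. ?e V b1 b2 * ?n V b b1 b2 tw))"
        by (rule sum_swap3)
      also have "\<dots> = (\<Sum>tw\<in>Pow D. ?v tw * (c_str \<beta> * ?m V b (Y1 tw) + c_twi \<beta> * ?m V b (Y2 tw)))"
      proof (intro sum.cong refl)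
        fix tw assume tw: "tw \<in> Pow D"
        show "?v tw * (\<Sum>b1\<in>N. \<Sum>b2\<in>N. ?e V b1 b2 * ?n V b b1 b2 tw) = ?v tw * (c_str \<beta> * ?m V b (Y1 tw)
       + c_twi \<beta> * ?m V b (Y2 tw))"
        proof (cases "?good tw")
          case True thus ?thesis using Yid[OF True] V b by simp
        next
          case False
          \<comment> \<open>A twisted pair for \<beta> = 2 brings in the factor
            \<open>c_twi\<close>, which is zero.\<close>
          then obtain p where "p \<in> D" "p \<in> tw" "\<beta> = 2" using tw by auto
          hence "?v tw = 0" using \<open>finite D\<close> by (intro prod_zero bexI[of _ p]) (auto simp: c_twi_def)
          thus ?thesis by simp
        qed
      qed
      also have "\<dots> = (\<Sum>tw\<in>Pow D. (\<Prod>p\<in>insert p0 D. ?g tw p) * ?m V b (XS' tw))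
        + (\<Sum>tw\<in>Pow D. (\<Prod>p\<in>insert p0 D. ?g (insert p0 tw) p) * ?m V b (XS' (insert p0 tw)))"
        unfolding sum.distrib[symmetric]
      proof (intro sum.cong refl)
        fix tw assume "tw \<in> Pow D"
        hence n: "p0 \<notin> tw" using p0 by auto
        have "(\<Prod>p\<in>D. if p \<in> insert p0 tw then c_twi \<beta> else c_str \<beta>) = ?v tw"
          using p0(2) by (intro prod.cong) auto
        thus "?v tw * (c_str \<beta> * ?m V b (Y1 tw) + c_twi \<beta> * ?m V b (Y2 tw))
         = (\<Prod>p\<in>insert p0 D. ?g tw p) * ?m V b (XS' tw)
         + (\<Prod>p\<in>insert p0 D. ?g (insert p0 tw) p) * ?m V b (XS' (insert p0 tw))"
          using insert.hyps n by (simp add: XS'_def distrib_left mult.assoc mult.left_commute)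
      qed
      also have "\<dots> = (\<Sum>tw\<in>Pow (insert p0 D). (\<Prod>p\<in>insert p0 D. ?g tw p) * ?m V b (XS' tw))"
      proof -
        have "inj_on (insert p0) (Pow D)" using p0(2) by (auto simp: inj_on_def)
        moreover have "Pow D \<inter> insert p0 ` Pow D = {}" using p0(2) by auto
        ultimately show ?thesis unfolding Pow_insert using insert.hyps by (subst sum.union_disjoint) (auto simp: sum.reindex)
      qed
      finally show ?thesis .
    qed
    show ?case using sys id by (intro exI[of _ XS']) blast
  qed
qed

subsection \<open>Vertices\<close>

lemma psum_0 [simp]: "psum \<nu> 0 = 0" by (simp add: psum_def)

lemma psum_Suc: "l < length \<nu> ==> psum \<nu> (Suc l) = psum \<nu> l + \<nu> ! l"
  by (simp add: psum_def take_Suc_conv_app_nth)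

lemma psum_length [simp]: "psum \<nu> (length \<nu>) = sum_list \<nu>" by (simp add: psum_def)

lemma psum_mono: "i \<le> j ==> psum \<nu> i \<le> psum \<nu> j"
proof (induction j rule: dec_induct)
  case (step j)
  have "psum \<nu> j \<le> psum \<nu> (Suc j)" by (cases "j < length \<nu>") (simp_all add: psum_Suc, simp add: psum_def)
  thus ?case using step by simp
qed simp

text \<open>Only minus sides are listed, in the cyclic order around each vertex. This fixes the
  direction from \<open>(k, +)\<close> to the minus side of the next half-edge, which for \<beta> =
  2 persists through all contractions.\<close>

definition vertex_cycles :: "nat list => side list list" where
  "vertex_cycles \<nu> = map (\<lambda>l. map (\<lambda>k. (k, False)) [psum \<nu> l + 1..<psum \<nu> (Suc l) + 1]) [0..<length \<nu>]"

text \<open>The factor by which \<open>loop_trace\<close> differs from the Wilson loop: one for each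
  vertex on the left-hand side, one for each boundary cycle on the right-hand side.\<close>

definition loop_sign :: "nat => complex" where "loop_sign \<beta> = (if \<beta> = 4 then -2 else 1)"

definition block_constant :: "nat list => (nat => 'v) => bool" where
  "block_constant \<nu> x \<longleftrightarrow> (\<forall>l\<in>{1..length \<nu>}. \<forall>k\<in>{psum \<nu> (l - 1) + 1..psum \<nu> l}.
     \<forall>k'\<in>{psum \<nu> (l - 1) + 1..psum \<nu> l}. x k = x k')"

lemma block_constantD:
  "block_constant \<nu> x ==> l \<in> {1..length \<nu>} ==> k \<in> {psum \<nu> (l - 1) + 1..psum \<nu> l} ==>
    k' \<in> {psum \<nu> (l - 1) + 1..psum \<nu> l} ==> x k = x k'" unfolding block_constant_def by blast

context
  fixes \<nu> :: "nat list"
  assumes pos: "\<forall>d\<in>set \<nu>. d > 0"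
begin

lemma vertex_exists:
  assumes "k \<in> {1..sum_list \<nu>}"
  obtains l where "l < length \<nu>" "psum \<nu> l < k" "k \<le> psum \<nu> (Suc l)"
proof -
  let ?P = "\<lambda>l. k \<le> psum \<nu> l"
  have ex: "?P (length \<nu>)" using assms by simp
  define m where "m = (LEAST l. ?P l)"
  have m: "?P m" unfolding m_def using ex by (rule LeastI)
  have "m \<noteq> 0" using m assms by (cases m) auto
  then obtain l where l: "m = Suc l" by (cases m) auto
  have "\<not> ?P l" using not_less_Least[of l ?P] l by (simp add: m_def)
  moreover have "m \<le> length \<nu>" unfolding m_def using ex by (rule Least_le)
  ultimately show ?thesis using that[of l] m l by auto
qed

lemma vertex_of_eq:
  assumes "psum \<nu> l < k" "k \<le> psum \<nu> (Suc l)"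
  shows "vertex_of \<nu> k = Suc l" unfolding vertex_of_def
proof (rule Least_equality)
  fix y assume y: "k \<le> psum \<nu> y"
  show "Suc l \<le> y"
  proof (rule ccontr)
    assume "\<not> Suc l \<le> y"
    hence "psum \<nu> y \<le> psum \<nu> l" by (intro psum_mono) simp
    thus False using y assms by simp
  qed
qed (use assms in simp)

lemma next_half_edge_eq:
  assumes "psum \<nu> l < k" "k \<le> psum \<nu> (Suc l)"
  shows "next_half_edge \<nu> k = (if k = psum \<nu> (Suc l) then psum \<nu> l + 1 else k + 1)"
  unfolding next_half_edge_def vertex_of_eq[OF assms] by simp

lemma next_half_edge_block:
  assumes "psum \<nu> l < k" "k \<le> psum \<nu> (Suc l)"
  shows "psum \<nu> l < next_half_edge \<nu> k" "next_half_edge \<nu> k \<le> psum \<nu> (Suc l)"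
  using assms unfolding next_half_edge_eq[OF assms] by auto

text \<open>\<open>next_half_edge\<close> preserves each block of half-edges, so equal images come
  from the same block, where it is a cyclic shift.\<close>

lemma next_half_edge_bij: "bij_betw (next_half_edge \<nu>) {1..sum_list \<nu>} {1..sum_list \<nu>}"
proof -
  let ?I = "{1..sum_list \<nu>}"
  have maps: "next_half_edge \<nu> k \<in> ?I" if k: "k \<in> ?I" for k
  proof -
    obtain l where l: "l < length \<nu>" "psum \<nu> l < k" "k \<le> psum \<nu> (Suc l)" using vertex_exists[OF k] .
    have "psum \<nu> (Suc l) \<le> sum_list \<nu>" using psum_mono[of "Suc l" "length \<nu>" \<nu>] l(1) by simp
    thus ?thesis using next_half_edge_block[OF l(2,3)] by simp
  qed
  have "inj_on (next_half_edge \<nu>) ?I"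
  proof (rule inj_onI)
    fix j k assume jk: "j \<in> ?I" "k \<in> ?I" "next_half_edge \<nu> j = next_half_edge \<nu> k"
    obtain l where l: "l < length \<nu>" "psum \<nu> l < k" "k \<le> psum \<nu> (Suc l)" using vertex_exists[OF jk(2)] .
    obtain m where m: "m < length \<nu>" "psum \<nu> m < j" "j \<le> psum \<nu> (Suc m)" using vertex_exists[OF jk(1)] .
    have "l = m" using next_half_edge_block[OF l(2,3)] next_half_edge_block[OF m(2,3)] jk(3)
        vertex_of_eq[of l "next_half_edge \<nu> k"] vertex_of_eq[of m "next_half_edge \<nu> k"] by simp
    thus "j = k" using jk(3) l m next_half_edge_eq[OF l(2,3)] next_half_edge_eq[of m j] by (auto split: if_splits)
  qed
  moreover have "next_half_edge \<nu> ` ?I = ?I" using maps calculation by (intro endo_inj_surj) auto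
  ultimately show ?thesis by (simp add: bij_betw_def)
qed

lemma join_involution: "involution_on ({1..sum_list \<nu>} \<times> UNIV) (join \<nu>)"
proof -
  let ?I = "{1..sum_list \<nu>}" and ?\<sigma> = "next_half_edge \<nu>"
  have inj: "inj_on ?\<sigma> ?I" and img: "?\<sigma> ` ?I = ?I" using next_half_edge_bij by (auto simp: bij_betw_def)
  have "join \<nu> s \<in> ?I \<times> UNIV \<and> join \<nu> (join \<nu> s) = s" if s: "s \<in> ?I \<times> UNIV" for s
  proof -
    obtain k b where kb: "s = (k, b)" "k \<in> ?I" using s by auto
    show ?thesis
    proof (cases b)
      case True
      have "?\<sigma> k \<in> ?I" using img kb(2) by blast
      moreover have "inv_into ?I ?\<sigma> (?\<sigma> k) = k" using inj kb(2) by (rule inv_into_f_f)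
      ultimately show ?thesis using True kb by (simp add: join_def)
    next
      case False
      have "k \<in> ?\<sigma> ` ?I" using img kb(2) by blast
      hence "inv_into ?I ?\<sigma> k \<in> ?I" "?\<sigma> (inv_into ?I ?\<sigma> k) = k"
        by (auto intro: inv_into_into f_inv_into_f simp del: atLeastAtMost_iff)
      thus ?thesis using False kb by (simp add: join_def)
    qed
  qed
  thus ?thesis by (auto simp: involution_on_def)
qed

text \<open>Ensures that the walk along one gluing ends where the walk along the next one starts, so
  that their concatenation is a walk.\<close>

lemma join_same_vertex:
  assumes x: "block_constant \<nu> x"
    and s: "s \<in> {1..sum_list \<nu>} \<times> UNIV"
  shows "x (fst (join \<nu> s)) = x (fst s)"
proof -
  have next_eq: "x (next_half_edge \<nu> k) = x k" if k: "k \<in> {1..sum_list \<nu>}" for k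
  proof -
    obtain l where l: "l < length \<nu>" "psum \<nu> l < k" "k \<le> psum \<nu> (Suc l)" using vertex_exists[OF k] .
    show ?thesis using block_constantD[OF x, of "Suc l" "next_half_edge \<nu> k" k] l next_half_edge_block[OF l(2,3)] by simp
  qed
  obtain k b where kb: "s = (k, b)" "k \<in> {1..sum_list \<nu>}" using s by auto
  have jS: "join \<nu> s \<in> {1..sum_list \<nu>} \<times> UNIV" and jj: "join \<nu> (join \<nu> s) = s"
    using join_involution s unfolding involution_on_def by blast+
  obtain k' b' where j: "join \<nu> s = (k', b')" "k' \<in> {1..sum_list \<nu>}" using jS by (cases "join \<nu> s") auto
  show ?thesis
  proof (cases b)
    case True thus ?thesis using next_eq[OF kb(2)] kb by (simp add: join_def)
  next
    case False
    have "b'" using False j(1) kb by (simp add: join_def)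
    with jj have "next_half_edge \<nu> k' = k" using kb j(1) by (simp add: join_def)
    thus ?thesis using next_eq[OF j(2)] kb j(1) by simp
  qed
qed

lemma concat_vertex_cycles: "concat (vertex_cycles \<nu>) = map (\<lambda>k. (k, False)) [1..<sum_list \<nu> + 1]"
proof -
  have "concat (map (\<lambda>l. map (\<lambda>k. (k, False)) [psum \<nu> l + 1..<psum \<nu> (Suc l) + 1]) [0..<n]) = map (\<lambda>k. (k, False)) [1..<psum \<nu> n + 1]" for n
  proof (induction n)
    case (Suc n)
    have "[1..<psum \<nu> n + 1] @ [psum \<nu> n + 1..<psum \<nu> (Suc n) + 1] = [1..<psum \<nu> (Suc n) + 1]"
      using psum_mono[of n "Suc n" \<nu>] upt_add_eq_append[of 1 "psum \<nu> n + 1" "psum \<nu> (Suc n) - psum \<nu> n"]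
      by (simp del: upt_Suc)
    moreover have "concat (map f [0..<Suc n]) = concat (map f [0..<n]) @ f n" for f :: "nat => side list" by simp
    ultimately show ?case by (simp only: Suc.IH map_append[symmetric])
  qed simp
  from this[of "length \<nu>"] show ?thesis by (simp add: vertex_cycles_def)
qed

text \<open>With the sides of each half-edge glued to each other, one step leads from a minus side
  through the plus side to the minus side of the next half-edge; from the last half-edge of the
  block it returns to the first.\<close>

lemma trav_vertex:
  assumes "psum \<nu> l < k" "k \<le> psum \<nu> (Suc l)"
  shows "trav (join \<nu>) (\<lambda>(k, x). (k, \<not> x)) (k, False) (map (\<lambda>k. (k, False)) [k..<psum \<nu> (Suc l) + 1]) (psum \<nu> l + 1, False)"
  using assms(2,1)
proof (induction k rule: inc_induct)
  case base
  thus ?case by (simp add: join_def next_half_edge_eq[of l])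
next
  case (step k)
  have "[k..<psum \<nu> (Suc l) + 1] = k # [Suc k..<psum \<nu> (Suc l) + 1]" using step by (simp add: upt_conv_Cons)
  moreover have "next_half_edge \<nu> k = Suc k" using step by (simp add: next_half_edge_eq[of l])
  ultimately show ?case using step.IH step.prems by (simp add: join_def del: upt_Suc)
qed

lemma vertex_cycle_system:
  "cycle_system (join \<nu>) (\<lambda>(k, x). (k, \<not> x)) ({1..sum_list \<nu>} \<times> UNIV) (vertex_cycles \<nu>)"
  unfolding cycle_system_def
proof
  show "\<forall>xs\<in>set (vertex_cycles \<nu>). cycle_list (join \<nu>) (\<lambda>(k, x). (k, \<not> x)) xs"
  proof
    fix xs assume "xs \<in> set (vertex_cycles \<nu>)"
    then obtain l where l: "l < length \<nu>" "xs = map (\<lambda>k. (k, False)) [psum \<nu> l + 1..<psum \<nu> (Suc l) + 1]"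
      by (auto simp: vertex_cycles_def)
    have "\<nu> ! l > 0" using pos l(1) by simp
    hence lt: "psum \<nu> l < psum \<nu> l + 1" "psum \<nu> l + 1 \<le> psum \<nu> (Suc l)" using psum_Suc[OF l(1)] by auto
    have "hd xs = (psum \<nu> l + 1, False)" "xs \<noteq> []" using lt by (auto simp: l(2) upt_conv_Cons hd_map simp del: upt_Suc)
    thus "cycle_list (join \<nu>) (\<lambda>(k, x). (k, \<not> x)) xs" using trav_vertex[OF lt] by (simp add: cycle_list_def l(2))
  qed
  let ?A = "map (\<lambda>k. (k, False)) [1..<sum_list \<nu> + 1]" and ?B = "map (\<lambda>k. (k, True)) [1..<sum_list \<nu> + 1]"
  have "distinct (?A @ ?B)" by (auto simp: distinct_map inj_on_def)
  hence "mset (?A @ ?B) = mset_set (set (?A @ ?B))" by (rule mset_set_set[symmetric])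
  also have "set (?A @ ?B) = {1..sum_list \<nu>} \<times> UNIV"
  proof (intro equalityI subsetI)
    fix s :: side assume "s \<in> {1..sum_list \<nu>} \<times> UNIV"
    thus "s \<in> set (?A @ ?B)" by (cases s; cases "snd s") auto
  qed auto
  finally show "mset (concat (vertex_cycles \<nu>)) + image_mset (\<lambda>(k, x). (k, \<not> x)) (mset (concat (vertex_cycles \<nu>))) = mset_set ({1..sum_list \<nu>} \<times> UNIV)"
    unfolding concat_vertex_cycles mset_append mset_map[symmetric] by (simp add: o_def)
qed

lemma vertex_cycles_orient: "set (concat (vertex_cycles \<nu>)) \<subseteq> {s. \<not> snd s}"
  unfolding concat_vertex_cycles by auto

lemma mpow_hermitian: "M \<in> hermitian_space \<beta> ==> mpow M k \<in> hermitian_space \<beta> \<and> M ** mpow M k = mpow M k ** M"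
proof (induction k)
  case (Suc k)
  hence IH: "mpow M k \<in> hermitian_space \<beta>" "M ** mpow M k = mpow M k ** M" by auto
  have "adj (M ** mpow M k) = M ** mpow M k" using IH Suc.prems by (simp add: adj_mult hermitian_space_iff)
  thus ?case using IH Suc.prems by (simp add: hermitian_space_iff scalar_matrices_closed) (simp add: matrix_mul_assoc)
qed (simp add: hermitian_space_iff scalar_matrices_closed)

lemma loop_trace_mpow:
  assumes "M \<in> hermitian_space \<beta>"
  shows "loop_trace \<beta> (mpow M k) = loop_sign \<beta> * of_real (rtr (mpow M k))"
proof -
  have "adj (mpow M k) = mpow M k" using mpow_hermitian[OF assms] by (simp add: hermitian_space_iff)
  hence "qcnj (trace (mpow M k)) = trace (mpow M k)" by (metis trace_adj)
  hence "qI (trace (mpow M k)) = 0" by (simp add: quat_eq_iff)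
  thus ?thesis by (simp add: loop_trace_def loop_sign_def complex_eq_iff)
qed

text \<open>All half-edges of a vertex carry the same hermitian matrix, so its cycle gives a power
  of this matrix, whose trace is real.\<close>

lemma vertex_cycles_value:
  fixes M :: "'v => quat^'n^'n" and x :: "nat => 'v"
  assumes x: "block_constant \<nu> x"
    and M: "\<And>v. M v \<in> hermitian_space \<beta>"
  shows "cycles_value \<beta> (\<lambda>s. M (x (fst s))) (vertex_cycles \<nu>)
    = loop_sign \<beta> ^ length \<nu> * of_real (\<Prod>l=1..length \<nu>. rtr (mpow (M (x (psum \<nu> l))) (\<nu> ! (l - 1))))"
proof -
  have lm: "loopm (\<lambda>s. M (x (fst s))) (map (\<lambda>k. (k, False)) [psum \<nu> l + 1..<psum \<nu> (Suc l) + 1])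
    = mpow (M (x (psum \<nu> (Suc l)))) (\<nu> ! l)" if l: "l < length \<nu>" for l
  proof -
    have pl: "\<nu> ! l > 0" using pos l by simp
    have gen: "loopm (\<lambda>s. M (x (fst s))) (map (\<lambda>k. (k, False)) ks) = mpow A (length ks)"
      if "\<And>k. k \<in> set ks ==> M (x k) = A" for ks :: "nat list" and A using that by (induction ks) auto
    have xk: "M (x k) = M (x (psum \<nu> (Suc l)))" if k: "k \<in> set [psum \<nu> l + 1..<psum \<nu> (Suc l) + 1]" for k
    proof -
      have "x k = x (psum \<nu> (Suc l))"
      proof (rule block_constantD[OF x, of "Suc l"])
        show "k \<in> {psum \<nu> (Suc l - 1) + 1..psum \<nu> (Suc l)}" using k by (simp del: upt_Suc)
        show "psum \<nu> (Suc l) \<in> {psum \<nu> (Suc l - 1) + 1..psum \<nu> (Suc l)}" using psum_Suc[OF l] pl by simp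
      qed (use l in simp)
      thus ?thesis by simp
    qed
    have len: "length [psum \<nu> l + 1..<psum \<nu> (Suc l) + 1] = \<nu> ! l" using psum_Suc[OF l] by simp
    show ?thesis using gen[OF xk, of "[psum \<nu> l + 1..<psum \<nu> (Suc l) + 1]"] unfolding len by blast
  qed
  have "cycles_value \<beta> (\<lambda>s. M (x (fst s))) (vertex_cycles \<nu>)
    = prod_list (map (\<lambda>l. loop_trace \<beta> (mpow (M (x (psum \<nu> (Suc l)))) (\<nu> ! l))) [0..<length \<nu>])"
    unfolding cycles_value_def vertex_cycles_def map_map o_def
    by (intro arg_cong[where f = prod_list] map_cong refl) (use lm in auto)
  also have "\<dots> = (\<Prod>l<length \<nu>. loop_trace \<beta> (mpow (M (x (psum \<nu> (Suc l)))) (\<nu> ! l)))"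
    by (subst prod.distinct_set_conv_list[symmetric]) (simp_all add: atLeast0LessThan)
  also have "\<dots> = loop_sign \<beta> ^ length \<nu> * of_real (\<Prod>l<length \<nu>. rtr (mpow (M (x (psum \<nu> (Suc l)))) (\<nu> ! l)))"
    by (simp add: loop_trace_mpow[OF M] prod.distrib)
  also have "(\<Prod>l<length \<nu>. rtr (mpow (M (x (psum \<nu> (Suc l)))) (\<nu> ! l))) = (\<Prod>l=1..length \<nu>. rtr (mpow (M (x (psum \<nu> l))) (\<nu> ! (l - 1))))"
    by (rule prod.reindex_bij_witness[of _ "\<lambda>i. i - 1" Suc]) auto
  finally show ?thesis .
qed

end

subsection \<open>Holonomies of the glued walks\<close>

definition walk_on :: "('v \<times> 'v) set => 'v list => bool" where
  "walk_on E w \<longleftrightarrow> w \<noteq> [] \<and> successively (\<lambda>a b. (a, b) \<in> E) w"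

lemma hol_append:
  fixes U :: "'v => 'v => quat^'n^'n"
  assumes "w \<noteq> []" "v \<noteq> []" "last w = hd v"
  shows "hol U (w @ tl v) = hol U w ** hol U v" using assms
proof (induction w rule: list_nonempty_induct)
  case (single a) thus ?case by (cases v) auto
next
  case (cons a w)
  then obtain b w' where "w = b # w'" by (cases w) auto
  thus ?case using cons by (simp add: matrix_mul_assoc)
qed

lemma hol_unitary:
  fixes U :: "'v => 'v => quat^'n^'n"
  assumes "is_connection \<beta> E U" "successively (\<lambda>a b. (a, b) \<in> E) w"
  shows "hol U w \<in> unitary_group \<beta>" using assms(2)
proof (induction w rule: induct_list012)
  case (3 a b w)
  hence "U a b \<in> unitary_group \<beta>" using assms(1) by (auto simp: is_connection_def)
  thus ?case using 3 by (auto intro: unitary_closed)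
qed (auto intro: unitary_closed)

lemma hol_rev:
  fixes U :: "'v => 'v => quat^'n^'n"
  assumes "is_connection \<beta> E U" "successively (\<lambda>a b. (a, b) \<in> E) w"
  shows "hol U (rev w) = adj (hol U w)" using assms(2)
proof (induction w rule: induct_list012)
  case (3 a b w)
  hence U: "U b a = adj (U a b)" using assms(1) by (auto simp: is_connection_def)
  have "hol U (rev (b # w) @ tl [b, a]) = hol U (rev (b # w)) ** hol U [b, a]" by (rule hol_append) auto
  hence "hol U (rev (a # b # w)) = hol U (rev (b # w)) ** hol U [b, a]" by simp
  thus ?case using 3 U by (simp add: adj_mult)
qed auto

lemma hol_concat_walks:
  fixes U :: "'v => 'v => quat^'n^'n"
  assumes "\<And>w. w \<in> set ws ==> w \<noteq> []" "successively (\<lambda>w v. last w = hd v) ws"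
  shows "hol U (concat_walks ws) = foldr (\<lambda>w M. hol U w ** M) ws (mat 1)"
proof (cases ws)
  case (Cons w ws')
  have "hol U (w @ concat (map tl ws')) = hol U w ** foldr (\<lambda>w M. hol U w ** M) ws' (mat 1)"
    if "w \<noteq> []" "\<And>w. w \<in> set ws' ==> w \<noteq> []" "successively (\<lambda>w v. last w = hd v) (w # ws')" for w
    using that
  proof (induction ws' arbitrary: w)
    case (Cons v ws')
    have v: "v \<noteq> []" "last w = hd v" using Cons.prems by auto
    have l: "last (w @ tl v) = last v" using v Cons.prems(1) by (cases v; cases "tl v") auto
    have "hol U ((w @ tl v) @ concat (map tl ws')) = hol U (w @ tl v) ** foldr (\<lambda>w M. hol U w ** M) ws' (mat 1)"
      using Cons.prems v l by (intro Cons.IH) (auto simp: successively_Cons)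
    thus ?case using hol_append[OF Cons.prems(1) v, of U] by (simp add: matrix_mul_assoc)
  qed simp
  from this[of w] show ?thesis using assms Cons by simp
qed simp

lemma foldr_hol_loopm:
  fixes U :: "'v => 'v => quat^'n^'n"
  assumes "\<And>j. hol U (w j) = B (it j)"
  shows "foldr (\<lambda>w M. hol U w ** M) (map w js) (mat 1) = loopm B (map it js)" by (induction js) (simp_all add: assms)

section \<open>Weights and Wilson products of a ribbon pairing\<close>

lemma cycle_system_cong:
  assumes "cycle_system J g S XS" "finite S" "\<And>s. s \<in> S ==> g s = g' s"
  shows "cycle_system J g' S XS"
proof -
  have sub: "set (concat XS) \<subseteq> S" using cycle_system_facts(2)[OF assms(1,2)] by blast
  have "cycle_list J g' xs" if xs: "xs \<in> set XS" for xs
  proof -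
    have "trav J g a xs e = trav J g' a xs e" for a e by (rule trav_cong) (use sub xs assms(3) in auto)
    thus ?thesis using assms(1) xs by (auto simp: cycle_system_def cycle_list_def)
  qed
  moreover have "image_mset g' (mset (concat XS)) = image_mset g (mset (concat XS))"
    by (rule image_mset_cong) (use sub assms(3) in auto)
  ultimately show ?thesis using assms(1) by (simp add: cycle_system_def)
qed

lemma involution_funpow:
  assumes "involution_on S J" "involution_on S g" "s \<in> S"
  shows "((J \<circ> g) ^^ j) s \<in> S" using assms by (induction j) (auto simp: involution_on_def)

lemma boundary_cycles_eq: "boundary_cycles \<nu> \<rho> = ({1..sum_list \<nu>} \<times> UNIV) // (side_rel (join \<nu>) (glue \<rho>) ({1..sum_list \<nu>} \<times> UNIV))\<^sup>*"
  by (simp add: boundary_cycles_def side_rel_def sides_def)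

lemma pairings_card:
  assumes "P \<in> pairings I" "finite I" shows "card I = 2 * card P"
proof -
  have "card (\<Union> P) = sum card P"
    using assms by (intro card_Union_disjoint) (auto simp: pairings_def partition_on_def disjoint_def pairwise_def disjnt_def intro: card_ge_0_finite)
  also have "\<dots> = 2 * card P" using assms by (simp add: pairings_def)
  finally show ?thesis using assms by (simp add: pairings_def partition_on_def)
qed

text \<open>Bookkeeping of constants. For \<beta> = 4 with m vertices, r pairs and f faces, the
  left-hand side is \<open>(-1)^r * (-2)^f\<close>; dividing by \<open>(-2)^m\<close> gives
  \<open>(-2)^(m - r + f) * 2^(r - 2 * m)\<close>, where the first exponent is the Euler
  characteristic.\<close>

lemma weight_eq:
  assumes \<beta>: "\<beta> \<in> {1, 2, 4}" and P: "P \<in> pairings {1..sum_list \<nu>}" and tw: "tw \<subseteq> P"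
  shows "(\<Prod>p\<in>P. if p \<in> tw then c_twi \<beta> else c_str \<beta>) * loop_sign \<beta> ^ faces \<nu> (P, tw)
    = loop_sign \<beta> ^ length \<nu> * complex_of_real (weight \<nu> \<beta> (P, tw))"
proof -
  have finP: "finite P" using P by (auto simp: pairings_def intro: finite_elements)
  have card: "sum_list \<nu> = 2 * card P" using pairings_card[OF P] by simp
  from \<beta> consider "\<beta> = 1" | "\<beta> = 2" | "\<beta> = 4" by auto
  thus ?thesis
  proof cases
    case 1
    have "(\<Prod>p\<in>P. if p \<in> tw then c_twi \<beta> else c_str \<beta>) = (1/2) ^ card P"
    proof -
      have e: "c_twi \<beta> = 1/2" "c_str \<beta> = 1/2" by (simp_all add: 1 c_twi_def c_str_def)
      show ?thesis unfolding e by simp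
    qed
    moreover have "weight \<nu> \<beta> (P, tw) = (1/2) ^ card P"
      unfolding weight_def by (simp add: 1 card power_int_minus power_one_over inverse_eq_divide)
    moreover have "loop_sign \<beta> = 1" by (simp add: 1 loop_sign_def)
    ultimately show ?thesis by simp
  next
    case 2
    show ?thesis
    proof (cases "tw = {}")
      case True thus ?thesis by (simp add: 2 c_str_def loop_sign_def weight_def)
    next
      case False
      then obtain p where "p \<in> tw" "p \<in> P" using tw by auto
      hence "(\<Prod>p\<in>P. if p \<in> tw then c_twi \<beta> else c_str \<beta>) = 0"
        using finP by (intro prod_zero bexI[of _ p]) (auto simp: 2 c_twi_def)
      thus ?thesis using False by (simp add: 2 weight_def)
    qed
  next
    case 3
    have pr: "(\<Prod>p\<in>P. if p \<in> tw then c_twi \<beta> else c_str \<beta>) = (-1) ^ card P"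
    proof -
      have e: "c_twi \<beta> = -1" "c_str \<beta> = -1" by (simp_all add: 3 c_twi_def c_str_def)
      show ?thesis unfolding e by simp
    qed
    let ?m = "length \<nu>" and ?f = "faces \<nu> (P, tw)" and ?r = "card P"
    have "weight \<nu> \<beta> (P, tw) = (-2) powi (int ?m - int ?r + int ?f) * 2 powi (- 2 * int ?m + int ?r)"
      by (simp add: 3 weight_def euler_char_def card)
    also have "\<dots> = ((-2) ^ ?m / (-2) ^ ?r * (-2) ^ ?f) * (2 ^ ?r / 2 ^ (2 * ?m))"
    proof -
      have "(-2::real) powi (int ?m - int ?r + int ?f) = (-2) ^ ?m / (-2) ^ ?r * (-2) ^ ?f"
        by (simp only: power_int_add power_int_diff power_int_of_nat neg_numeral_neq_zero simp_thms)
      moreover have "(2::real) powi (int ?r - int (2 * ?m)) = 2 ^ ?r / 2 ^ (2 * ?m)"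
        by (subst power_int_diff, simp, simp only: power_int_of_nat)
      moreover have "- 2 * int ?m + int ?r = int ?r - int (2 * ?m)" by simp
      ultimately show ?thesis by (simp only:)
    qed
    finally have w: "weight \<nu> \<beta> (P, tw) = ((-2) ^ ?m / (-2) ^ ?r * (-2) ^ ?f) * (2 ^ ?r / 2 ^ (2 * ?m))" .
    have e: "(-2::real) ^ ?m * (-2) ^ ?m = 2 ^ (2 * ?m)" unfolding power_mult power_mult_distrib[symmetric] by simp
    have e2: "(2::real) ^ ?r / (-2) ^ ?r = (-1) ^ ?r" unfolding power_divide[symmetric] by simp
    have "(-2) ^ ?m * weight \<nu> \<beta> (P, tw) = ((-2) ^ ?m * (-2) ^ ?m / 2 ^ (2 * ?m)) * (2 ^ ?r / (-2) ^ ?r) * (-2) ^ ?f"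
      by (simp add: w mult_ac)
    also have "\<dots> = (-1) ^ ?r * (-2) ^ ?f" unfolding e e2 by simp
    finally have "complex_of_real ((-2) ^ ?m * weight \<nu> \<beta> (P, tw)) = complex_of_real ((-1) ^ ?r * (-2) ^ ?f)" by (simp only:)
    thus ?thesis unfolding pr by (simp add: 3 loop_sign_def)
  qed
qed

text \<open>Each traversed gluing contributes the holonomy of its path, or the adjoint when it is
  left from the larger label and the walk is reversed; this is the matrix
  \<open>partial_mats\<close> at the side of departure. Vertex-joins keep the position, so the walks
  can be concatenated.\<close>

lemma hol_cycle_loop:
  fixes U :: "'v => 'v => quat^'n^'n"
  assumes pos: "\<forall>d\<in>set \<nu>. d > 0" and conn: "is_connection \<beta> E U"
    and x: "block_constant \<nu> x"
    and P: "P \<in> pairings {1..sum_list \<nu>}" and tw: "tw \<subseteq> P"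
    and \<gamma>: "\<And>p. p \<in> P ==> walk_on E (skeleton (\<gamma> p)) \<and> hd (skeleton (\<gamma> p)) = x (Min p) \<and> last (skeleton (\<gamma> p)) = x (Max p)"
    and V: "\<And>p. p \<in> P ==> V p = hol U (skeleton (\<gamma> p))"
    and c: "c \<in> boundary_cycles \<nu> (P, tw)" and s0: "s0 \<in> c"
  shows "hol U (cycle_loop \<nu> (P, tw) \<gamma> c s0)
     = loopm (partial_mats P P V b) (map (\<lambda>j. ((join \<nu> \<circ> glue (P, tw)) ^^ j) s0) [0..<card c div 2])"
proof -
  let ?S = "{1..sum_list \<nu>} \<times> (UNIV :: bool set)" and ?B = "partial_mats P P V b" and ?g = "glue (P, tw)" and ?J = "join \<nu>"
  have geq: "partial_glue P P tw s = ?g s" if "s \<in> ?S" for s using glue_eq_partial_glue[OF P that] .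
  have invg: "involution_on ?S ?g" using partial_glue_involution[OF P, of P tw] geq unfolding involution_on_def by metis
  have invJ: "involution_on ?S ?J" by (rule join_involution[OF pos])
  have gl: "glued_walk (P, tw) \<gamma> k \<noteq> [] \<and> hol U (glued_walk (P, tw) \<gamma> k) = ?B (k, z) \<and>
      hd (glued_walk (P, tw) \<gamma> k) = x k \<and> last (glued_walk (P, tw) \<gamma> k) = x (fst (?g (k, z)))" if k: "k \<in> {1..sum_list \<nu>}" for k z
  proof -
    define k' where "k' = partner (P, tw) k"
    have k'2: "partner (P, {}) k = k'" by (simp add: k'_def partner_def)
    note pp = pairings_partner[OF P k, where tw = tw, folded k'_def]
    let ?w = "skeleton (\<gamma> {k, k'})"
    have w: "walk_on E ?w" "hd ?w = x (Min {k, k'})" "last ?w = x (Max {k, k'})" "V {k, k'} = hol U ?w"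
      using \<gamma>[OF pp(1)] V(1)[OF pp(1)] by auto
    have ne: "?w \<noteq> []" and su: "successively (\<lambda>a b. (a, b) \<in> E) ?w" using w(1) by (auto simp: walk_on_def)
    have gk: "fst (?g (k, z)) = k'" by (simp add: glue_def k'_def)
    have Bk: "?B (k, z) = (if k = Min {k, k'} then V {k, k'} else adj (V {k, k'}))"
      using pp(1) by (simp add: partial_mats_def k'2 Let_def)
    have gw: "glued_walk (P, tw) \<gamma> k = (if k < k' then ?w else rev ?w)"
      by (simp add: glued_walk_def k'_def[symmetric] Let_def)
    show ?thesis
    proof (cases "k < k'")
      case True
      hence "Min {k, k'} = k" "Max {k, k'} = k'" by auto
      thus ?thesis using w ne by (simp add: gw Bk gk True)
    next
      case False
      hence "Min {k, k'} = k'" "Max {k, k'} = k" using pp(3) by auto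
      moreover have "k \<noteq> k'" using pp(3) by simp
      ultimately show ?thesis using w ne hol_rev[OF conn su] False by (simp add: gw Bk gk hd_rev last_rev)
    qed
  qed
  have "c \<subseteq> ?S"
  proof -
    have m: "?J s \<in> ?S \<and> ?g s \<in> ?S" if "s \<in> ?S" for s using invJ invg that unfolding involution_on_def by blast
    have step: "t \<in> ?S" if st: "(s, t) \<in> side_rel ?J ?g ?S" for s t
    proof -
      from st have "s \<in> ?S" "t = ?J s \<or> t = ?g s" unfolding side_rel_def by blast+
      thus ?thesis using m by metis
    qed
    have "t \<in> ?S" if "s \<in> ?S" "(s, t) \<in> (side_rel ?J ?g ?S)\<^sup>*" for s t
      using that(2,1) by (induction rule: rtrancl_induct) (use step in blast)+
    thus ?thesis using c unfolding boundary_cycles_eq quotient_def by blast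
  qed
  hence s: "s0 \<in> ?S" using s0 by blast
  let ?it = "\<lambda>j. ((?J \<circ> ?g) ^^ j) (s0)"
  have itS: "?it j \<in> ?S" for j by (rule involution_funpow[OF invJ invg s])
  let ?ws = "map (\<lambda>j. glued_walk (P, tw) \<gamma> (fst (?it j))) [0..<card c div 2]"
  have fI: "fst (?it j) \<in> {1..sum_list \<nu>}" for j using itS[of j] by auto
  have holw: "hol U (glued_walk (P, tw) \<gamma> (fst (?it j))) = ?B (?it j)" for j using gl[OF fI, of j "snd (?it j)"] by simp
  have "successively (\<lambda>w v. last w = hd v) ?ws"
  proof -
    have "last (glued_walk (P, tw) \<gamma> (fst (?it j))) = hd (glued_walk (P, tw) \<gamma> (fst (?it (Suc j))))" for j
    proof -
      have gS: "?g (?it j) \<in> ?S" using invg itS unfolding involution_on_def by blast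
      have "last (glued_walk (P, tw) \<gamma> (fst (?it j))) = x (fst (?g (?it j)))" using gl[OF fI, of j "snd (?it j)"] by simp
      also have "\<dots> = x (fst (?J (?g (?it j))))" by (rule join_same_vertex[OF pos x gS, symmetric])
      also have "\<dots> = x (fst (?it (Suc j)))" by simp
      also have "\<dots> = hd (glued_walk (P, tw) \<gamma> (fst (?it (Suc j))))"
        using conjunct1[OF conjunct2[OF conjunct2[OF gl[OF fI[of "Suc j"], of True]]]] by (rule sym)
      finally show ?thesis .
    qed
    thus ?thesis unfolding successively_map by (simp add: successively_conv_nth)
  qed
  hence "hol U (cycle_loop \<nu> (P, tw) \<gamma> c (s0)) = foldr (\<lambda>w M. hol U w ** M) ?ws (mat 1)"
    unfolding cycle_loop_def by (intro hol_concat_walks) (use gl[OF fI] in auto)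
  also have "\<dots> = loopm ?B (map ?it [0..<card c div 2])" by (rule foldr_hol_loopm) (rule holw)
  finally show ?thesis .
qed

text \<open>For \<beta> = 2 all gluings are straight and lead from listed minus sides to plus sides,
  so the minus sides prescribed by \<open>valid_start\<close> are exactly listed ones and the
  directions agree.\<close>

lemma wilson_product_eq:
  fixes U :: "'v => 'v => quat^'n^'n"
  assumes \<beta>: "\<beta> \<in> {1, 2, 4}" and pos: "\<forall>d\<in>set \<nu>. d > 0" and conn: "is_connection \<beta> E U"
    and x: "block_constant \<nu> x"
    and P: "P \<in> pairings {1..sum_list \<nu>}" and tw: "tw \<subseteq> P"
    and start: "valid_start \<nu> \<beta> (P, tw) start"
    and \<gamma>: "\<And>p. p \<in> P ==> walk_on E (skeleton (\<gamma> p)) \<and> hd (skeleton (\<gamma> p)) = x (Min p) \<and> last (skeleton (\<gamma> p)) = x (Max p)"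
    and V: "\<And>p. p \<in> P ==> V p = hol U (skeleton (\<gamma> p))" "\<And>p. V p \<in> scalar_matrices \<beta>" and b: "\<And>k. b k \<in> hermitian_space \<beta>"
    and XS: "cycle_system (join \<nu>) (partial_glue P P tw) ({1..sum_list \<nu>} \<times> UNIV) XS"
    and ori: "\<beta> = 2 ==> set (concat XS) \<subseteq> {s. \<not> snd s} \<and> tw = {}"
  shows "cycles_value \<beta> (partial_mats P P V b) XS = loop_sign \<beta> ^ faces \<nu> (P, tw) * wilson_product \<nu> \<beta> U start (P, tw) \<gamma>"
proof -
  let ?S = "{1..sum_list \<nu>} \<times> (UNIV :: bool set)" and ?B = "partial_mats P P V b" and ?g = "glue (P, tw)" and ?J = "join \<nu>"
  have fin: "finite ?S" by simp
  have geq: "partial_glue P P tw s = ?g s" if "s \<in> ?S" for s using glue_eq_partial_glue[OF P that] .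
  have XS': "cycle_system ?J ?g ?S XS" using XS fin geq by (rule cycle_system_cong)
  have invg: "involution_on ?S ?g" using partial_glue_involution[OF P, of P tw] geq unfolding involution_on_def by metis
  have invJ: "involution_on ?S ?J" by (rule join_involution[OF pos])
  have Badj: "?B (?g s) = adj (?B s)" if "s \<in> ?S" for s
    using partial_mats_adj[OF P that b, where D = P and V = V and tw = tw] geq[OF that] by simp
  have Bsc: "?B s \<in> scalar_matrices \<beta>" for s
    using V(2) b by (auto simp: partial_mats_def Let_def scalar_matrices_closed hermitian_space_iff)
  have loop: "loop_trace \<beta> (loopm ?B (map (\<lambda>j. ((?J \<circ> ?g) ^^ j) (start c)) [0..<card c div 2]))
     = loop_sign \<beta> * wilson_loop \<beta> U (cycle_loop \<nu> (P, tw) \<gamma> c (start c))" if c: "c \<in> boundary_cycles \<nu> (P, tw)" for c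
  proof -
    have "start c \<in> c" using start c by (auto simp: valid_start_def)
    hence "hol U (cycle_loop \<nu> (P, tw) \<gamma> c (start c)) = loopm ?B (map (\<lambda>j. ((?J \<circ> ?g) ^^ j) (start c)) [0..<card c div 2])"
      by (intro hol_cycle_loop[OF pos conn x P tw \<gamma> V(1) c])
    thus ?thesis by (simp add: wilson_loop_def Let_def loop_trace_def loop_sign_def)
  qed
  have "cycles_value \<beta> ?B XS = (\<Prod>c\<in>boundary_cycles \<nu> (P, tw). loop_trace \<beta> (loopm ?B (map (\<lambda>j. ((?J \<circ> ?g) ^^ j) (start c)) [0..<card c div 2])))"
    unfolding boundary_cycles_eq
  proof (rule cycle_system_value[OF \<beta> fin invJ invg XS', where B = "?B" and start = start, symmetric])
    show "?B s \<in> scalar_matrices \<beta>" for s by (rule Bsc)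
    show "?B (?g s) = adj (?B s)" if "s \<in> ?S" for s using that by (rule Badj)
  next
    fix c assume c: "c \<in> ?S // (side_rel ?J ?g ?S)\<^sup>*"
    thus "start c \<in> c" using start by (auto simp: valid_start_def boundary_cycles_eq)
    assume "\<beta> = 2"
    hence "\<not> snd (start c)" using start c by (auto simp: valid_start_def boundary_cycles_eq)
    moreover have "snd (?g s)" if "s \<in> set (concat XS)" for s
      using that ori[OF \<open>\<beta> = 2\<close>] by (auto simp: glue_def split: prod.splits)
    ultimately show "start c \<notin> ?g ` set (concat XS)" by (metis imageE)
  qed
  also have "\<dots> = (\<Prod>c\<in>boundary_cycles \<nu> (P, tw). loop_sign \<beta> * wilson_loop \<beta> U (cycle_loop \<nu> (P, tw) \<gamma> c (start c)))"
    by (rule prod.cong[OF refl loop])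
  finally show ?thesis by (simp add: prod.distrib wilson_product_def faces_def)
qed

lemma norm_wilson_loop_le:
  fixes U :: "'v => 'v => quat^'n^'n"
  assumes "hol U ys \<in> unitary_group \<beta>"
  shows "norm (wilson_loop \<beta> U ys) \<le> 2 * (real CARD('n) * norm (mat 1 :: quat^'n^'n))"
proof -
  let ?Q = "hol U ys"
  have n: "norm ?Q = norm (mat 1 :: quat^'n^'n)" using norm_unitary_mult(1)[OF assms, of "mat 1"] by simp
  have "norm (?Q $ i $ i) \<le> norm ?Q" for i by (rule order_trans[OF Finite_Cartesian_Product.norm_nth_le Finite_Cartesian_Product.norm_nth_le])
  hence "norm (trace ?Q) \<le> (\<Sum>i\<in>(UNIV :: 'n set). norm ?Q)" unfolding trace_def by (rule sum_norm_le)
  hence t: "norm (trace ?Q) \<le> real CARD('n) * norm (mat 1 :: quat^'n^'n)" by (simp add: n)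
  have comp: "\<bar>qRe q\<bar> \<le> norm q" "\<bar>qI q\<bar> \<le> norm q" for q
    by (auto simp: norm_quat_def inner_quat_def power2_eq_square[symmetric] intro!: real_le_rsqrt)
  have "norm (wilson_loop \<beta> U ys) \<le> \<bar>qRe (trace ?Q)\<bar> + \<bar>qI (trace ?Q)\<bar>"
    unfolding wilson_loop_def Let_def using cmod_le[of "Complex (qRe (trace ?Q)) (qI (trace ?Q))"] by auto
  thus ?thesis using comp[of "trace ?Q"] t by linarith
qed

text \<open>Each loop has a unitary holonomy, whose norm is that of the identity. The bound depends
  on the pairing only, which makes Wilson products integrable against finite path measures.\<close>

lemma wilson_product_bound:
  fixes U :: "'v => 'v => quat^'n^'n"
  assumes pos: "\<forall>d\<in>set \<nu>. d > 0" and conn: "is_connection \<beta> E U"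
    and x: "block_constant \<nu> x"
    and P: "P \<in> pairings {1..sum_list \<nu>}" and tw: "tw \<subseteq> P"
    and start: "valid_start \<nu> \<beta> (P, tw) start"
    and \<gamma>: "\<And>p. p \<in> P ==> walk_on E (skeleton (\<gamma> p)) \<and> hd (skeleton (\<gamma> p)) = x (Min p) \<and> last (skeleton (\<gamma> p)) = x (Max p)"
  shows "norm (wilson_product \<nu> \<beta> U start (P, tw) \<gamma>) \<le> (2 * (real CARD('n) * norm (mat 1 :: quat^'n^'n))) ^ faces \<nu> (P, tw)"
proof -
  let ?K = "2 * (real CARD('n) * norm (mat 1 :: quat^'n^'n))"
  define V where "V p = (if p \<in> P then hol U (skeleton (\<gamma> p)) else mat 1)" for p
  have Vu: "V p \<in> unitary_group \<beta>" for p
    using hol_unitary[OF conn, of "skeleton (\<gamma> p)"] \<gamma>[of p] by (auto simp: V_def walk_on_def unitary_closed)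
  have Bu: "partial_mats P P V (\<lambda>_. mat 1) s \<in> unitary_group \<beta>" for s
    using Vu by (simp add: partial_mats_def Let_def unitary_closed)
  have lu: "loopm (partial_mats P P V (\<lambda>_. mat 1)) u \<in> unitary_group \<beta>" for u
    by (induction u) (simp_all add: unitary_closed Bu)
  have w: "norm (wilson_loop \<beta> U (cycle_loop \<nu> (P, tw) \<gamma> c (start c))) \<le> ?K" if c: "c \<in> boundary_cycles \<nu> (P, tw)" for c
  proof (rule norm_wilson_loop_le)
    have "start c \<in> c" using start c by (auto simp: valid_start_def)
    hence "hol U (cycle_loop \<nu> (P, tw) \<gamma> c (start c)) = loopm (partial_mats P P V (\<lambda>_. mat 1)) (map (\<lambda>j. ((join \<nu> \<circ> glue (P, tw)) ^^ j) (start c)) [0..<card c div 2])"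
      by (intro hol_cycle_loop[OF pos conn x P tw \<gamma> _ c]) (simp_all add: V_def)
    thus "hol U (cycle_loop \<nu> (P, tw) \<gamma> c (start c)) \<in> unitary_group \<beta>" using lu by simp
  qed
  have "norm (wilson_product \<nu> \<beta> U start (P, tw) \<gamma>) \<le> (\<Prod>c\<in>boundary_cycles \<nu> (P, tw). ?K)"
    unfolding wilson_product_def prod_norm[symmetric] by (rule prod_mono) (use w in auto)
  thus ?thesis by (simp add: faces_def)
qed

text \<open>The contraction with \<open>D\<close> equal to all of \<open>P\<close>: no free
  half-edge is left, each cycle has become a Wilson loop, and the constants combine to the weight.
  The paths are fixed here; integration over them comes later.\<close>

theorem ribbon_expansion:
  fixes U :: "'v => 'v => quat^'n^'n" and N :: "(quat^'n^'n) set"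
  assumes \<beta>: "\<beta> \<in> {1, 2, 4}" and N: "is_onb (hermitian_space \<beta>) N"
    and pos: "\<forall>d\<in>set \<nu>. d > 0" and conn: "is_connection \<beta> E U"
    and x: "block_constant \<nu> x"
    and P: "P \<in> pairings {1..sum_list \<nu>}"
    and start: "\<And>tw. tw \<subseteq> P ==> valid_start \<nu> \<beta> (P, tw) (start (P, tw))"
    and \<gamma>: "\<And>p. p \<in> P ==> walk_on E (skeleton (\<gamma> p)) \<and> hd (skeleton (\<gamma> p)) = x (Min p) \<and> last (skeleton (\<gamma> p)) = x (Max p)"
  shows "(\<Sum>c\<in>PiE {1..sum_list \<nu>} (\<lambda>_. N). (\<Prod>p\<in>P. of_real (inner (c (Min p))
        (hol U (skeleton (\<gamma> p)) ** c (Max p) ** adj (hol U (skeleton (\<gamma> p)))))) * cycles_value \<beta> (\<lambda>s. c (fst s)) (vertex_cycles \<nu>))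
    = loop_sign \<beta> ^ length \<nu> * (\<Sum>tw\<in>Pow P. of_real (weight \<nu> \<beta> (P, tw)) * wilson_product \<nu> \<beta> U (start (P, tw)) (P, tw) \<gamma>)"
proof -
  let ?I = "{1..sum_list \<nu>}"
  have U: "\<Union> P = ?I" using P by (simp add: pairings_def partition_on_def)
  have finP: "finite P" using P by (auto simp: pairings_def intro: finite_elements)
  define V where "V p = (if p \<in> P then hol U (skeleton (\<gamma> p)) else 0)" for p
  define b where "b k = (0 :: quat^'n^'n)" for k :: nat
  have Vs: "V p \<in> scalar_matrices \<beta>" for p
    using hol_unitary[OF conn, of "skeleton (\<gamma> p)"] \<gamma>[of p] by (auto simp: V_def walk_on_def unitary_group_iff scalar_matrices_closed)
  have bh: "b k \<in> hermitian_space \<beta>" for k by (simp add: b_def hermitian_space_iff scalar_matrices_closed)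
  obtain XS where XS: "\<forall>tw. tw \<subseteq> P \<and> (\<beta> = 2 \<longrightarrow> tw = {}) \<longrightarrow> cycle_system (join \<nu>) (partial_glue P P tw) (?I \<times> UNIV) (XS tw)
        \<and> (\<beta> = 2 \<longrightarrow> set (concat (XS tw)) \<subseteq> {s. \<not> snd s})"
     and id: "\<forall>V b. (\<forall>p. V p \<in> scalar_matrices \<beta>) \<and> (\<forall>k. b k \<in> hermitian_space \<beta>) \<longrightarrow>
      (\<Sum>c\<in>PiE (\<Union> P) (\<lambda>_. N). (\<Prod>p\<in>P. of_real (inner (c (Min p)) (V p ** c (Max p) ** adj (V p)))) *
         cycles_value \<beta> (\<lambda>s. if fst s \<in> \<Union> P then c (fst s) else b (fst s)) (vertex_cycles \<nu>))
       = (\<Sum>tw\<in>Pow P. (\<Prod>p\<in>P. if p \<in> tw then c_twi \<beta> else c_str \<beta>) * cycles_value \<beta> (partial_mats P P V b) (XS tw))"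
    using contract_pairs[OF \<beta> N finite_atLeastAtMost P join_involution[OF pos] vertex_cycle_system[OF pos] vertex_cycles_orient[OF pos] order_refl]
    by (elim exE conjE) (rule that)
  have "(\<Sum>c\<in>PiE ?I (\<lambda>_. N). (\<Prod>p\<in>P. complex_of_real (inner (c (Min p))
        (hol U (skeleton (\<gamma> p)) ** c (Max p) ** adj (hol U (skeleton (\<gamma> p)))))) * cycles_value \<beta> (\<lambda>s. c (fst s)) (vertex_cycles \<nu>))
    = (\<Sum>c\<in>PiE (\<Union> P) (\<lambda>_. N). (\<Prod>p\<in>P. of_real (inner (c (Min p)) (V p ** c (Max p) ** adj (V p)))) *
         cycles_value \<beta> (\<lambda>s. if fst s \<in> \<Union> P then c (fst s) else b (fst s)) (vertex_cycles \<nu>))"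
    unfolding U
  proof (intro sum.cong refl arg_cong2[where f = "(*)"] prod.cong cycles_value_cong)
    fix c :: "nat => quat^'n^'n" and s assume "s \<in> set (concat (vertex_cycles \<nu>))"
    hence "fst s \<in> ?I" unfolding concat_vertex_cycles[OF pos] by auto
    thus "c (fst s) = (if fst s \<in> ?I then c (fst s) else b (fst s))" by simp
  qed (simp add: V_def)
  also have "\<dots> = (\<Sum>tw\<in>Pow P. (\<Prod>p\<in>P. if p \<in> tw then c_twi \<beta> else c_str \<beta>) * cycles_value \<beta> (partial_mats P P V b) (XS tw))"
    using id Vs bh by blast
  also have "\<dots> = (\<Sum>tw\<in>Pow P. loop_sign \<beta> ^ length \<nu> * (of_real (weight \<nu> \<beta> (P, tw)) * wilson_product \<nu> \<beta> U (start (P, tw)) (P, tw) \<gamma>))"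
  proof (intro sum.cong refl)
    fix tw assume "tw \<in> Pow P"
    hence tw: "tw \<subseteq> P" by simp
    show "(\<Prod>p\<in>P. if p \<in> tw then c_twi \<beta> else c_str \<beta>) * cycles_value \<beta> (partial_mats P P V b) (XS tw)
       = loop_sign \<beta> ^ length \<nu> * (of_real (weight \<nu> \<beta> (P, tw)) * wilson_product \<nu> \<beta> U (start (P, tw)) (P, tw) \<gamma>)"
    proof (cases "\<beta> = 2 \<longrightarrow> tw = {}")
      case True
      have "cycles_value \<beta> (partial_mats P P V b) (XS tw) = loop_sign \<beta> ^ faces \<nu> (P, tw) * wilson_product \<nu> \<beta> U (start (P, tw)) (P, tw) \<gamma>"
        by (rule wilson_product_eq[OF \<beta> pos conn x P tw start[OF tw] \<gamma>]) (use XS True tw Vs bh in \<open>auto simp: V_def\<close>)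
      thus ?thesis using weight_eq[OF \<beta> P tw] by (simp add: mult.assoc[symmetric])
    next
      case False
      then obtain p where "p \<in> tw" "p \<in> P" using tw by auto
      hence "(\<Prod>p\<in>P. if p \<in> tw then c_twi \<beta> else c_str \<beta>) = 0"
        using finP False by (intro prod_zero bexI[of _ p]) (auto simp: c_twi_def)
      moreover have "weight \<nu> \<beta> (P, tw) = 0" using False by (simp add: weight_def)
      ultimately show ?thesis by simp
    qed
  qed
  finally show ?thesis by (simp add: sum_distrib_left)
qed

subsection \<open>Skeletons and local times of paths\<close>

text \<open>The index of the segment that contains the time \<open>q\<close>. The inserted 0
  together with the restriction to positive indices assigns negative times to the first segment, in
  accordance with the extension of paths to the left.\<close>

definition seg_index :: "real list => real => nat" where
  "seg_index ts q = Max (insert 0 {j\<in>{1..<length ts}. ts ! j \<le> q})"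

lemma seg_index_mono: "q \<le> q' ==> seg_index ts q \<le> seg_index ts q'"
  unfolding seg_index_def by (rule Max_mono) auto

lemma seg_index_props:
  assumes "ts \<noteq> []"
  shows "seg_index ts q < length ts" "seg_index ts q \<noteq> 0 ==> ts ! seg_index ts q \<le> q"
    "Suc (seg_index ts q) < length ts ==> q < ts ! Suc (seg_index ts q)"
proof -
  let ?A = "insert 0 {j\<in>{1..<length ts}. ts ! j \<le> q}"
  have "Max ?A \<in> ?A" by (rule Max_in) auto
  thus "seg_index ts q < length ts" "seg_index ts q \<noteq> 0 ==> ts ! seg_index ts q \<le> q"
    using assms unfolding seg_index_def by auto
  assume l: "Suc (seg_index ts q) < length ts"
  show "q < ts ! Suc (seg_index ts q)"
  proof (rule ccontr)
    assume "\<not> q < ts ! Suc (seg_index ts q)"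
    hence "Suc (seg_index ts q) \<in> ?A" using l by auto
    hence "Suc (seg_index ts q) \<le> seg_index ts q" unfolding seg_index_def by (intro Max_ge) auto
    thus False by simp
  qed
qed

lemma has_skeleton_value:
  assumes "has_skeleton \<gamma> ts ys"
  shows "snd \<gamma> q = ys ! seg_index ts q" "seg_index ts q < length ys"
proof -
  have s: "ys \<noteq> []" "length ts = length ys" "hd ts = 0"
    "\<And>i s. i < length ys ==> ts ! i \<le> s \<and> (Suc i < length ys \<longrightarrow> s < ts ! Suc i) ==> snd \<gamma> s = ys ! i"
    "\<And>s. s < 0 ==> snd \<gamma> s = hd ys" using assms by (auto simp: has_skeleton_def)
  have ne: "ts \<noteq> []" using s by auto
  note p = seg_index_props[OF ne, of q]
  show "seg_index ts q < length ys" using p(1) s(2) by simp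
  show "snd \<gamma> q = ys ! seg_index ts q"
  proof (cases "seg_index ts q = 0 \<and> q < 0")
    case True thus ?thesis using s(1,5) by (simp add: hd_conv_nth)
  next
    case False
    have "ts ! seg_index ts q \<le> q" using False p(2) s(3) ne by (cases "seg_index ts q = 0") (auto simp: hd_conv_nth)
    thus ?thesis using p(1,3) s(2) by (intro s(4)) auto
  qed
qed

text \<open>Distinct successive vertices seen at increasing times lie in strictly increasing
  segments. Hence no such sequence is longer than the skeleton, and one of equal length is the
  skeleton itself.\<close>

lemma has_skeleton_visits:
  assumes sk: "has_skeleton \<gamma> ts ys" and ws: "distinct_adj ws" "length qs = length ws" "sorted_wrt (<) qs"
    and v: "\<And>i. i < length ws ==> snd \<gamma> (qs ! i) = ws ! i"
  shows "length ws \<le> length ys" "length ws = length ys ==> ws = ys"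
proof -
  define f where "f i = seg_index ts (qs ! i)" for i
  have val: "ys ! f i = ws ! i" "f i < length ys" if "i < length ws" for i
    using has_skeleton_value[OF sk, of "qs ! i"] v[OF that] by (auto simp: f_def)
  have step: "Suc (f i) \<le> f (Suc i)" if i: "Suc i < length ws" for i
  proof -
    have "qs ! i < qs ! Suc i" using ws(2,3) i by (simp add: sorted_wrt_iff_nth_less)
    hence "f i \<le> f (Suc i)" unfolding f_def by (intro seg_index_mono) simp
    moreover have "ws ! i \<noteq> ws ! Suc i" using ws(1) i by (simp add: distinct_adj_conv_nth)
    hence "f i \<noteq> f (Suc i)" using val(1)[of i] val(1)[of "Suc i"] i by auto
    ultimately show ?thesis by simp
  qed
  have grow: "j < length ws ==> f i + (j - i) \<le> f j" if "i \<le> j" for i j using that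
  proof (induction j rule: dec_induct)
    case (step j) thus ?case using \<open>\<And>i. Suc i < length ws ==> Suc (f i) \<le> f (Suc i)\<close>[of j] by simp
  qed simp
  show "length ws \<le> length ys"
  proof (cases "ws = []")
    case False
    hence "length ws - 1 < length ws" by simp
    thus ?thesis using grow[of 0 "length ws - 1"] val(2)[of "length ws - 1"] by simp
  qed simp
  assume len: "length ws = length ys"
  have "f i = i" if i: "i < length ws" for i
  proof -
    have "i \<le> f i" using grow[of 0 i] i by simp
    moreover have "f i + (length ws - 1 - i) \<le> f (length ws - 1)" using i by (intro grow) auto
    moreover have "f (length ws - 1) < length ws" using val(2)[of "length ws - 1"] i len by simp
    ultimately show ?thesis using i by simp
  qed
  thus "ws = ys" using len val(1) by (intro nth_equalityI) auto
qed

text \<open>Every segment has nonempty interior; rational times make the family of patterns to be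
  tested countable.\<close>

lemma has_skeleton_rational_visits:
  assumes sk: "has_skeleton \<gamma> ts ys"
  obtains qs where "length qs = length ys" "sorted_wrt (<) qs" "set qs \<subseteq> \<rat>" "\<And>i. i < length ys ==> snd \<gamma> (qs ! i) = ys ! i"
proof -
  have s: "ys \<noteq> []" "length ts = length ys" "sorted_wrt (<) ts"
    "\<And>i s. i < length ys ==> ts ! i \<le> s \<and> (Suc i < length ys \<longrightarrow> s < ts ! Suc i) ==> snd \<gamma> s = ys ! i"
    using sk by (auto simp: has_skeleton_def)
  have "\<exists>q\<in>\<rat>. ts ! i < q \<and> (Suc i < length ys \<longrightarrow> q < ts ! Suc i)" if i: "i < length ys" for i
  proof (cases "Suc i < length ys")
    case True
    hence "ts ! i < ts ! Suc i" using s by (simp add: sorted_wrt_iff_nth_less)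
    thus ?thesis using Rats_dense_in_real by blast
  next
    case False
    thus ?thesis using Rats_dense_in_real[of "ts ! i" "ts ! i + 1"] by auto
  qed
  then obtain q where q: "\<And>i. i < length ys ==> q i \<in> \<rat> \<and> ts ! i < q i \<and> (Suc i < length ys \<longrightarrow> q i < ts ! Suc i)" by metis
  have mono: "q i < q j" if "i < j" "j < length ys" for i j
  proof -
    have "q i < ts ! Suc i" using q[of i] that by simp
    also have "\<dots> \<le> ts ! j" using s that by (cases "Suc i = j") (auto simp: sorted_wrt_iff_nth_less intro: less_imp_le)
    also have "\<dots> < q j" using q that by simp
    finally show ?thesis .
  qed
  show ?thesis
  proof (rule that[of "map q [0..<length ys]"])
    show "sorted_wrt (<) (map q [0..<length ys])" by (simp add: sorted_wrt_iff_nth_less mono)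
    show "set (map q [0..<length ys]) \<subseteq> \<rat>" using q by auto
    show "snd \<gamma> (map q [0..<length ys] ! i) = ys ! i" if "i < length ys" for i
      using q[OF that] that by (intro s(4)) (auto intro: less_imp_le)
  qed simp
qed

lemma skeleton_eq:
  assumes sk: "has_skeleton \<gamma> ts ys" shows "skeleton \<gamma> = ys" unfolding skeleton_def
proof (rule the_equality)
  show "\<exists>ts. has_skeleton \<gamma> ts ys" using sk by blast
  fix zs assume "\<exists>ts. has_skeleton \<gamma> ts zs"
  then obtain ts' where sk': "has_skeleton \<gamma> ts' zs" by blast
  obtain qs where q: "length qs = length ys" "sorted_wrt (<) qs" "\<And>i. i < length ys ==> snd \<gamma> (qs ! i) = ys ! i"
    using has_skeleton_rational_visits[OF sk] by metis
  obtain qs' where q': "length qs' = length zs" "sorted_wrt (<) qs'" "\<And>i. i < length zs ==> snd \<gamma> (qs' ! i) = zs ! i"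
    using has_skeleton_rational_visits[OF sk'] by metis
  have d: "distinct_adj ys" "distinct_adj zs" using sk sk' by (auto simp: has_skeleton_def)
  show "zs = ys" using has_skeleton_visits[OF sk d(2) q'(1,2) q'(3)] has_skeleton_visits[OF sk' d(1) q(1,2) q(3)] by simp
qed

section \<open>Measurability of the skeleton and of local times\<close>

definition visits :: "real list => 'v list => 'v path set" where
  "visits qs ws = {\<gamma>. \<forall>i<length ws. snd \<gamma> (qs ! i) = ws ! i}"

definition time_lists :: "'v list => real list set" where
  "time_lists ws = {qs \<in> lists \<rat>. length qs = length ws \<and> sorted_wrt (<) qs}"

lemma countable_time_lists: "countable (time_lists ws)"
  unfolding time_lists_def by (rule countable_subset[of _ "lists \<rat>"]) (auto intro: countable_lists countable_rat)

text \<open>The skeleton is the longest repetition-free pattern visible at rational times. This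
  expresses the event by countably many evaluations, which are measurable by definition of the path
  space.\<close>

lemma skeleton_iff_visits:
  assumes \<gamma>: "\<gamma> \<in> space path_space"
  shows "skeleton \<gamma> = ys \<longleftrightarrow>
    ys \<noteq> [] \<and> distinct_adj ys \<and> (\<exists>qs\<in>time_lists ys. \<gamma> \<in> visits qs ys) \<and>
    (\<forall>ws. distinct_adj ws \<and> length ys < length ws \<longrightarrow> (\<forall>qs\<in>time_lists ws. \<gamma> \<notin> visits qs ws))" (is "_ \<longleftrightarrow> ?rhs")
proof -
  obtain ts zs where sk: "has_skeleton \<gamma> ts zs" using \<gamma> by (auto simp: path_space_def space_restrict_space)
  have z: "zs \<noteq> []" "distinct_adj zs" using sk by (auto simp: has_skeleton_def)
  have zv: "\<exists>qs\<in>time_lists zs. \<gamma> \<in> visits qs zs"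
  proof -
    obtain qs where "length qs = length zs" "sorted_wrt (<) qs" "set qs \<subseteq> \<rat>" "\<And>i. i < length zs ==> snd \<gamma> (qs ! i) = zs ! i"
      using has_skeleton_rational_visits[OF sk] by metis
    thus ?thesis by (intro bexI[of _ qs]) (auto simp: visits_def time_lists_def)
  qed
  have le: "length ws \<le> length zs \<and> (length ws = length zs \<longrightarrow> ws = zs)" if "distinct_adj ws" "qs \<in> time_lists ws" "\<gamma> \<in> visits qs ws" for ws qs
    using has_skeleton_visits[OF sk that(1), of qs] that(2,3) by (auto simp: time_lists_def visits_def)
  show ?thesis unfolding skeleton_eq[OF sk]
  proof
    assume [simp]: "zs = ys"
    show "?rhs" using z zv le by fastforce
  next
    assume a: "?rhs"
    hence "length ys \<le> length zs \<and> (length ys = length zs \<longrightarrow> ys = zs)" using le by blast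
    moreover have "\<not> length ys < length zs" using a zv z by blast
    ultimately show "zs = ys" by auto
  qed
qed

lemma measurable_eval [measurable]: "(\<lambda>\<gamma>. snd \<gamma> s) \<in> path_space \<rightarrow>\<^sub>M count_space UNIV"
proof -
  have "(\<lambda>\<gamma>. snd \<gamma> s) \<in> (borel \<Otimes>\<^sub>M (\<Pi>\<^sub>M s\<in>UNIV. count_space UNIV)) \<rightarrow>\<^sub>M count_space UNIV"
    by (rule measurable_compose[OF measurable_snd measurable_component_singleton]) simp
  thus ?thesis unfolding path_space_def by (rule measurable_restrict_space1)
qed

lemma measurable_lifetime [measurable]: "fst \<in> path_space \<rightarrow>\<^sub>M borel"
  unfolding path_space_def by (rule measurable_restrict_space1) simp

lemma sets_visits: "visits qs ws \<inter> space path_space \<in> sets path_space"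
proof -
  have "{\<gamma> \<in> space path_space. \<forall>i<length ws. snd \<gamma> (qs ! i) = ws ! i} \<in> sets path_space"
    by measurable
  moreover have "visits qs ws \<inter> space path_space = {\<gamma> \<in> space path_space. \<forall>i<length ws. snd \<gamma> (qs ! i) = ws ! i}"
    by (auto simp: visits_def)
  ultimately show ?thesis by simp
qed

lemma measurable_skeleton [measurable]:
  "skeleton \<in> (path_space :: 'v::finite path measure) \<rightarrow>\<^sub>M count_space UNIV"
proof (subst measurable_count_space_eq2_countable)
  have "skeleton -` {ys} \<inter> space path_space \<in> sets path_space" for ys :: "'v list"
  proof (cases "ys \<noteq> [] \<and> distinct_adj ys")
    case True
    have "skeleton -` {ys} \<inter> space path_space = (\<Union>qs\<in>time_lists ys. visits qs ys \<inter> space path_space)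
      - (\<Union>ws\<in>{ws. distinct_adj ws \<and> length ys < length ws}. \<Union>qs\<in>time_lists ws. visits qs ws \<inter> space path_space)"
    proof (rule set_eqI)
      fix \<gamma> :: "'v path"
      show "\<gamma> \<in> skeleton -` {ys} \<inter> space path_space \<longleftrightarrow> \<gamma> \<in> (\<Union>qs\<in>time_lists ys. visits qs ys \<inter> space path_space)
        - (\<Union>ws\<in>{ws. distinct_adj ws \<and> length ys < length ws}. \<Union>qs\<in>time_lists ws. visits qs ws \<inter> space path_space)"
      proof (cases "\<gamma> \<in> space path_space")
        case g: True
        show ?thesis using True skeleton_iff_visits[OF g, of ys] g by blast
      qed auto
    qed
    moreover have "\<dots> \<in> sets path_space"
      by (intro sets.Diff sets.countable_UN'' countable_time_lists sets_visits) (auto intro: countable_subset[OF subset_UNIV] countable_time_lists sets_visits sets.countable_UN'')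
    ultimately show ?thesis by simp
  next
    case False
    hence "skeleton -` {ys} \<inter> space path_space = {}" using skeleton_iff_visits by blast
    thus ?thesis by simp
  qed
  thus "skeleton \<in> space path_space \<rightarrow> UNIV \<and> (\<forall>ys\<in>UNIV. skeleton -` {ys} \<inter> (space path_space :: 'v path set) \<in> sets path_space)"
    by simp
qed

lemma right_constant:
  assumes "\<gamma> \<in> space path_space"
  shows "\<exists>e>0. \<forall>s. t \<le> s \<and> s < t + e \<longrightarrow> snd \<gamma> s = snd \<gamma> t"
proof -
  obtain ts ys where sk: "has_skeleton \<gamma> ts ys" using assms by (auto simp: path_space_def space_restrict_space)
  have ne: "ts \<noteq> []" using sk by (auto simp: has_skeleton_def)
  define A where "A = {j\<in>{1..<length ts}. ts ! j > t}"
  define e where "e = (if A = {} then 1 else Min ((\<lambda>j. ts ! j - t) ` A))"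
  have "finite A" by (simp add: A_def)
  have e: "e > 0"
  proof (cases "A = {}")
    case False
    hence "Min ((\<lambda>j. ts ! j - t) ` A) \<in> (\<lambda>j. ts ! j - t) ` A" using \<open>finite A\<close> by (intro Min_in) auto
    thus ?thesis using False by (auto simp: e_def A_def)
  qed (simp add: e_def)
  have "snd \<gamma> s = snd \<gamma> t" if s: "t \<le> s" "s < t + e" for s
  proof -
    have "{j\<in>{1..<length ts}. ts ! j \<le> s} = {j\<in>{1..<length ts}. ts ! j \<le> t}"
    proof (intro Collect_cong conj_cong refl iffI)
      fix j assume j: "j \<in> {1..<length ts}" "ts ! j \<le> s"
      show "ts ! j \<le> t"
      proof (rule ccontr)
        assume "\<not> ts ! j \<le> t"
        hence jA: "j \<in> A" using j by (simp add: A_def)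
        hence "e \<le> ts ! j - t" using \<open>finite A\<close> by (auto simp: e_def)
        thus False using s j by simp
      qed
    qed (use s in simp)
    hence "seg_index ts s = seg_index ts t" by (simp add: seg_index_def)
    thus ?thesis using has_skeleton_value(1)[OF sk] by simp
  qed
  thus ?thesis using e by blast
qed

text \<open>Joint measurability in path and time: by right-continuity the value at a real time is
  the eventual value at grid points that approach it from the right.\<close>

lemma measurable_path_value [measurable]:
  "Measurable.pred (path_space \<Otimes>\<^sub>M lborel) (\<lambda>(\<gamma>, t). snd \<gamma> t = v)"
proof -
  \<comment> \<open>The right end of the cell of width \<open>1 / (n + 1)\<close> containing
    \<open>t\<close>. It lies strictly to the right of \<open>t\<close>, which is the side on which
    the path is known to be constant for a while.\<close>
  define d where "d n t = (real_of_int \<lfloor>t * real (Suc n)\<rfloor> + 1) / real (Suc n)" for n t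
  have d: "t < d n t" "d n t \<le> t + 1 / real (Suc n)" for n t
  proof -
    have "t * real (Suc n) < real_of_int \<lfloor>t * real (Suc n)\<rfloor> + 1" "real_of_int \<lfloor>t * real (Suc n)\<rfloor> \<le> t * real (Suc n)"
      by linarith+
    hence "t < d n t" "real_of_int \<lfloor>t * real (Suc n)\<rfloor> / real (Suc n) \<le> t"
      by (simp_all only: d_def pos_less_divide_eq pos_divide_le_eq of_nat_0_less_iff zero_less_Suc)
    thus "t < d n t" "d n t \<le> t + 1 / real (Suc n)" by (simp_all add: d_def add_divide_distrib)
  qed
  have iff: "snd \<gamma> t = v \<longleftrightarrow> (\<exists>N. \<forall>n\<ge>N. snd \<gamma> (d n t) = v)" if \<gamma>: "\<gamma> \<in> space path_space" for \<gamma> t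
  proof -
    obtain e where e: "e > 0" "\<And>s. t \<le> s \<and> s < t + e ==> snd \<gamma> s = snd \<gamma> t" using right_constant[OF \<gamma>] by blast
    obtain N where N: "1 / real (Suc N) < e" using e(1) by (rule nat_approx_posE)
    have "snd \<gamma> (d n t) = snd \<gamma> t" if "n \<ge> N" for n
    proof (rule e(2))
      have "1 / real (Suc n) \<le> 1 / real (Suc N)" using that by (intro divide_left_mono) auto
      thus "t \<le> d n t \<and> d n t < t + e" using d[where n = n and t = t] N by linarith
    qed
    thus ?thesis by (metis le_cases order_refl max.cobounded1 max.cobounded2)
  qed
  have [measurable]: "Measurable.pred (path_space \<Otimes>\<^sub>M lborel) (\<lambda>(\<gamma>, t). snd \<gamma> (d n t) = v)" for n
  proof -
    \<comment> \<open>The grid point takes countably many values; for each of them the evaluation is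
      at a fixed time.\<close>
    have eq: "(case w of (\<gamma>, t) => snd \<gamma> (d n t) = v) \<longleftrightarrow>
       (\<exists>i::int. \<lfloor>snd w * real (Suc n)\<rfloor> = i \<and> snd (fst w) ((real_of_int i + 1) / real (Suc n)) = v)" for w
      by (auto simp: d_def split: prod.splits)
    show ?thesis unfolding eq by measurable
  qed
  have m: "Measurable.pred (path_space \<Otimes>\<^sub>M lborel) (\<lambda>w. \<exists>N. \<forall>n\<ge>N. case w of (\<gamma>, t) => snd \<gamma> (d n t) = v)"
    by measurable
  have c: "(case w of (\<gamma>, t) => snd \<gamma> t = v) \<longleftrightarrow> (\<exists>N. \<forall>n\<ge>N. case w of (\<gamma>, t) => snd \<gamma> (d n t) = v)"
    if "w \<in> space (path_space \<Otimes>\<^sub>M lborel)" for w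
  proof -
    obtain \<gamma> t where w: "w = (\<gamma>, t)" by (cases w)
    hence "\<gamma> \<in> space path_space" using that by (simp add: space_pair_measure)
    thus ?thesis unfolding w prod.case by (rule iff)
  qed
  show ?thesis by (subst measurable_cong, erule c, rule m)
qed

lemma measurable_local_time [measurable]: "(\<lambda>\<gamma>. local_time \<gamma> v) \<in> borel_measurable path_space"
proof -
  have eq: "local_time \<gamma> v = (\<integral>t. (if 0 \<le> t \<and> t \<le> fst \<gamma> \<and> snd \<gamma> t = v then 1 else 0) \<partial>lborel)" for \<gamma>
    unfolding local_time_def set_lebesgue_integral_def by (intro Bochner_Integration.integral_cong) (auto simp: indicator_def)
  have [measurable]: "Measurable.pred (path_space \<Otimes>\<^sub>M lborel) (\<lambda>x. snd (fst x) (snd x) = v)"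
    using measurable_path_value[of v] by (simp add: case_prod_beta')
  show ?thesis unfolding eq by measurable
qed

lemma local_time_skeleton:
  assumes sk: "has_skeleton \<gamma> ts ys"
  shows "local_time \<gamma> v = (\<Sum>i<length ys. if ys ! i = v then (if Suc i < length ys then ts ! Suc i else fst \<gamma>) - ts ! i else 0)"
proof -
  have s: "ys \<noteq> []" "length ts = length ys" "hd ts = 0" "sorted_wrt (<) ts" "last ts \<le> fst \<gamma>"
    using sk by (auto simp: has_skeleton_def)
  have ne: "ts \<noteq> []" using s by auto
  define u where "u i = (if Suc i < length ys then ts ! Suc i else fst \<gamma>)" for i
  \<comment> \<open>Half-open pieces, except the last one, which is closed because local time is
    integrated up to and including the lifetime.\<close>
  define A where "A i = (if Suc i < length ys then {ts ! i..<ts ! Suc i} else {ts ! i..fst \<gamma>})" for i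
  let ?a = "\<lambda>i t. if ys ! i = v then indicator (A i) t else (0::real)"
  have incr: "ts ! i < ts ! j" if "i < j" "j < length ys" for i j using s(2,4) that by (simp add: sorted_wrt_iff_nth_less)
  have t0: "ts ! 0 = 0" using s(3) ne by (simp add: hd_conv_nth)
  have le: "ts ! i \<le> u i" if "i < length ys" for i
  proof (cases "Suc i < length ys")
    case False
    hence "i = length ts - 1" using that s(2) by simp
    thus ?thesis using s(5) ne False by (simp add: u_def last_conv_nth)
  qed (use incr in \<open>auto simp: u_def intro: less_imp_le\<close>)
  have mA: "measure lborel (A i) = u i - ts ! i" "emeasure lborel (A i) < \<infinity>" if "i < length ys" for i
    using le[OF that] by (cases "Suc i < length ys"; simp add: A_def u_def)+
  have sA: "A i \<in> sets lborel" for i by (simp add: A_def)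
  have ind: "indicator {0..fst \<gamma>} t * indicator {t. snd \<gamma> t = v} t = (\<Sum>i<length ys. ?a i t)" for t
  proof -
    let ?k = "seg_index ts t"
    note p = seg_index_props[OF ne, of t]
    have k: "?k < length ys" using p(1) s(2) by simp
    have inA: "t \<in> A i \<longleftrightarrow> i = ?k \<and> 0 \<le> t \<and> t \<le> fst \<gamma>" if i: "i < length ys" for i
    proof
      assume "i = ?k \<and> 0 \<le> t \<and> t \<le> fst \<gamma>"
      thus "t \<in> A i" using p s(2) t0 by (cases "?k = 0") (auto simp: A_def)
    next
      assume t: "t \<in> A i"
      have ti: "ts ! i \<le> t" "Suc i < length ys ==> t < ts ! Suc i" using t by (auto simp: A_def split: if_splits)
      have "0 \<le> ts ! i" using incr[of 0 i] i t0 by (cases "i = 0") auto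
      moreover have "t \<le> fst \<gamma>"
      proof (cases "Suc i < length ys")
        case True
        hence "t < ts ! Suc i" by (rule ti)
        also have "\<dots> \<le> last ts" using incr[of "Suc i" "length ys - 1"] True s(2) ne
          by (cases "Suc i = length ys - 1") (auto simp: last_conv_nth intro: less_imp_le)
        finally show ?thesis using s(5) by simp
      qed (use t in \<open>simp add: A_def\<close>)
      moreover have "i = ?k"
      proof (rule antisym)
        show "i \<le> ?k"
        proof (rule ccontr)
          assume "\<not> i \<le> ?k"
          hence "Suc ?k \<le> i" "Suc ?k < length ts" using i s(2) by auto
          hence "t < ts ! i" using p(3) incr[of "Suc ?k" i] i by (cases "Suc ?k = i") auto
          thus False using ti by simp
        qed
        show "?k \<le> i"
        proof (rule ccontr)
          assume "\<not> ?k \<le> i"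
          hence "Suc i \<le> ?k" "Suc i < length ys" using k by auto
          hence "t < ts ! ?k" using ti(2) incr[of "Suc i" ?k] k by (cases "Suc i = ?k") auto
          thus False using p(2) \<open>Suc i \<le> ?k\<close> by simp
        qed
      qed
      ultimately show "i = ?k \<and> 0 \<le> t \<and> t \<le> fst \<gamma>" using ti(1) by simp
    qed
    have "(\<Sum>i<length ys. ?a i t)
      = (\<Sum>i<length ys. if i = ?k then (if ys ! i = v \<and> 0 \<le> t \<and> t \<le> fst \<gamma> then 1 else 0) else 0)"
      by (intro sum.cong refl) (auto simp: indicator_def inA)
    also have "\<dots> = (if ys ! ?k = v \<and> 0 \<le> t \<and> t \<le> fst \<gamma> then 1 else 0)" using k by simp
    finally show ?thesis unfolding has_skeleton_value(1)[OF sk, of t, symmetric] by (auto simp: indicator_def)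
  qed
  have "local_time \<gamma> v = (\<integral>t. (\<Sum>i<length ys. ?a i t) \<partial>lborel)"
    unfolding local_time_def set_lebesgue_integral_def real_scaleR_def ind ..
  also have "\<dots> = (\<Sum>i<length ys. \<integral>t. (?a i t) \<partial>lborel)"
  proof (rule Bochner_Integration.integral_sum)
    fix i assume "i \<in> {..<length ys}"
    thus "integrable lborel (\<lambda>t. ?a i t)" using sA[of i] mA(2)[of i] by (cases "ys ! i = v") (simp_all add: less_top)
  qed
  also have "\<dots> = (\<Sum>i<length ys. if ys ! i = v then u i - ts ! i else 0)" using mA sA by (intro sum.cong refl) auto
  finally show ?thesis unfolding u_def .
qed

text \<open>A path whose successive vertices are not all distinct is brought into the form of \<open>has_skeleton\<close> by
  dropping repetitions.\<close>

lemma has_skeleton_exists: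
  assumes "ys \<noteq> []" "length ts = length ys" "hd ts = 0" "sorted_wrt (<) ts" "last ts \<le> fst \<gamma>"
    and "\<And>i s. i < length ys ==> ts ! i \<le> s ==> (Suc i < length ys ==> s < ts ! Suc i) ==> snd \<gamma> s = ys ! i"
    and "\<And>s. s < 0 ==> snd \<gamma> s = hd ys"
  shows "\<exists>ts ys. has_skeleton \<gamma> ts ys" using assms
proof (induction "length ys" arbitrary: ts ys rule: less_induct)
  case less
  show ?case
  proof (cases "distinct_adj ys")
    case True
    thus ?thesis using less.prems by (intro exI[of _ ts] exI[of _ ys]) (auto simp: has_skeleton_def)
  next
    case False
    then obtain i where i: "Suc i < length ys" "ys ! i = ys ! Suc i" by (auto simp: distinct_adj_conv_nth)
    \<comment> \<open>Skips the position after \<open>i\<close>, whose vertex repeats the one at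
      \<open>i\<close>: the two segments are merged, and the arrival time of the first is
      kept.\<close>
    define dr where "dr = (\<lambda>j. if j \<le> i then j else Suc j)"
    define ts' ys' where "ts' = map (\<lambda>j. ts ! dr j) [0..<length ts - 1]" and "ys' = map (\<lambda>j. ys ! dr j) [0..<length ys - 1]"
    have len: "length ts' = length ys - 1" "length ys' = length ys - 1" using less.prems(2) by (auto simp: ts'_def ys'_def)
    have n': "ts' ! j = ts ! dr j" "ys' ! j = ys ! dr j" if "j < length ys - 1" for j
      using that less.prems(2) by (auto simp: ts'_def ys'_def)
    have incr: "ts ! i < ts ! j" if "i < j" "j < length ys" for i j
      using less.prems(2,4) that by (simp add: sorted_wrt_iff_nth_less)
    have ne: "ts \<noteq> []" "ts' \<noteq> []" "ys' \<noteq> []" using i less.prems(2) len by auto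
    show ?thesis
    proof (rule less.hyps[of ys' ts'])
      show "length ys' < length ys" using i len by simp
      show "ys' \<noteq> []" "length ts' = length ys'" using ne len by auto
      show "hd ts' = 0" using ne n'(1)[of 0] i less.prems(3) by (simp add: hd_conv_nth dr_def)
      show "sorted_wrt (<) ts'" unfolding sorted_wrt_iff_nth_less len using n'(1) incr by (auto simp: dr_def)
      have drl: "dr j < length ys" if "j < length ys - 1" for j using that by (auto simp: dr_def)
      have "last ts' = ts ! dr (length ys - 2)"
        using ne len i n'(1)[of "length ys - 2"] by (simp add: last_conv_nth numeral_2_eq_2)
      also have "\<dots> \<le> last ts"
      proof -
        have "dr (length ys - 2) < length ys" using drl[of "length ys - 2"] i by simp
        hence "dr (length ys - 2) = length ys - 1 \<or> dr (length ys - 2) < length ys - 1" by linarith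
        hence "ts ! dr (length ys - 2) \<le> ts ! (length ys - 1)"
          using incr[of "dr (length ys - 2)" "length ys - 1"] i by fastforce
        thus ?thesis using ne less.prems(2) by (simp add: last_conv_nth)
      qed
      finally show "last ts' \<le> fst \<gamma>" using less.prems(5) by simp
      show "snd \<gamma> s = hd ys'" if "s < 0" for s
        using less.prems(7)[OF that] ne n'(2)[of 0] i less.prems(1) by (simp add: hd_conv_nth dr_def)
      fix j s assume j: "j < length ys'" and s: "ts' ! j \<le> s" "Suc j < length ys' ==> s < ts' ! Suc j"
      have jl: "j < length ys - 1" using j len by simp
      show "snd \<gamma> s = ys' ! j"
      proof (cases "j = i")
        case False
        have "Suc (dr j) = dr (Suc j)" using False by (auto simp: dr_def)
        moreover have "s < ts ! Suc (dr j)" if "Suc (dr j) < length ys"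
          using s(2) n'(1)[of "Suc j"] that len i(1) \<open>Suc (dr j) = dr (Suc j)\<close> by (auto simp: dr_def split: if_splits)
        ultimately show ?thesis using s(1) n'[OF jl] drl[OF jl] less.prems(6)[of "dr j" s] by simp
      next
        case True
        show ?thesis
        proof (cases "s < ts ! Suc i")
          case True
          thus ?thesis using \<open>j = i\<close> s(1) n'[OF jl] less.prems(6)[of i s] i by (simp add: dr_def)
        next
          case False
          have "s < ts ! Suc (Suc i)" if "Suc (Suc i) < length ys"
            using s(2) n'(1)[of "Suc j"] that len \<open>j = i\<close> by (auto simp: dr_def)
          thus ?thesis using False \<open>j = i\<close> n'[OF jl] less.prems(6)[of "Suc i" s] i by (simp add: dr_def)
        qed
      qed
    qed
  qed
qed

subsection \<open>The jump process\<close>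

text \<open>Such a function vanishes at a vertex with killing, and connectedness spreads the value.
  It is applied to the squared norm of a field of zero energy.\<close>

lemma connected_constant_zero:
  fixes f :: "'v::finite => real"
  assumes "network E C \<kappa>" "\<And>x. \<kappa> x * f x = 0" "\<And>x y. (x, y) \<in> E ==> f x = f y"
  shows "f x = 0"
proof -
  interpret network E C \<kappa> by fact
  obtain z where z: "\<kappa> z \<noteq> 0" using killing_nonzero by blast
  hence "f z = 0" using assms(2)[of z] by simp
  moreover have "f x = f z" using connected[of x z] by (induction rule: rtrancl_induct) (auto dest: assms(3))
  ultimately show ?thesis by simp
qed

context network
begin

abbreviation "jr \<equiv> jump_rate E C"
abbreviation "tr \<equiv> total_rate E C \<kappa>"
abbreviation "HL \<equiv> holding_law E C \<kappa>"
abbreviation "JL \<equiv> jump_law E C \<kappa>"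
abbreviation "SM \<equiv> sample_measure E C \<kappa>"

lemma jr_nonneg: "jr x y \<ge> 0" by (simp add: jump_rate_def conductance_pos less_imp_le)

lemma jr_self: "jr x x = 0" using no_loops by (auto simp: jump_rate_def irrefl_def)

lemma jr_sym: "jr x y = jr y x" using sym_edges conductance_sym by (auto simp: jump_rate_def sym_def)

text \<open>A vertex without killing differs from some vertex with killing, so connectedness
  provides it with a neighbour.\<close>

lemma tr_pos: "tr x > 0"
proof -
  have s: "(\<Sum>y\<in>UNIV. jr x y) \<ge> 0" by (intro sum_nonneg jr_nonneg)
  show ?thesis
  proof (cases "\<kappa> x = 0")
    case False
    hence "\<kappa> x > 0" using killing_nonneg[of x] by simp
    thus ?thesis using s by (simp add: total_rate_def)
  next
    case True
    obtain z where z: "\<kappa> z \<noteq> 0" using killing_nonzero by blast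
    hence "z \<noteq> x" using True by auto
    then obtain y where y: "(x, y) \<in> E" using connected[of x z] by (metis converse_rtranclE)
    have "0 < jr x y" using y by (simp add: jump_rate_def conductance_pos)
    also have "\<dots> \<le> (\<Sum>y\<in>UNIV. jr x y)" by (rule member_le_sum) (auto intro: jr_nonneg)
    finally show ?thesis using killing_nonneg[of x] by (simp add: total_rate_def)
  qed
qed

lemma pmf_JL: "pmf (JL x) z = (case z of None => \<kappa> x | Some y => jr x y) / tr x"
  unfolding jump_law_def
proof (rule pmf_embed_pmf)
  let ?f = "\<lambda>z. (case z of None => \<kappa> x | Some y => jr x y) / tr x"
  show nn: "0 \<le> ?f z" for z using tr_pos[of x] jr_nonneg killing_nonneg by (auto split: option.splits)
  have "(\<Sum>z\<in>UNIV. ?f z) = (\<kappa> x + (\<Sum>y\<in>UNIV. jr x y)) / tr x"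
    unfolding UNIV_option_conv by (simp add: sum.reindex add_divide_distrib sum_divide_distrib)
  also have "\<dots> = 1" using tr_pos[of x] by (simp add: total_rate_def)
  finally show "(\<integral>\<^sup>+z. ennreal (?f z) \<partial>count_space UNIV) = 1"
    by (simp add: nn_integral_count_space_finite nn sum_ennreal)
qed

section \<open>Exponential holding times\<close>

lemma sets_HL: "sets (HL x) = sets (restrict_space borel {0<..})" by (simp add: holding_law_def sets_restrict_space)

lemma space_HL: "space (HL x) = {0<..}" by (simp add: holding_law_def space_restrict_space)

lemma HL_borel [measurable]: "(\<lambda>h. h) \<in> HL x \<rightarrow>\<^sub>M borel"
  by (subst measurable_cong_sets[OF sets_HL refl]) (rule measurable_restrict_space1, simp)

lemma nn_integral_HL:
  assumes [measurable]: "f \<in> borel_measurable borel"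
  shows "(\<integral>\<^sup>+h. f h \<partial>HL x) = (\<integral>\<^sup>+h. ennreal (tr x * exp (- (tr x * h))) * f h * indicator {0<..} h \<partial>lborel)"
proof -
  have [measurable]: "f \<in> borel_measurable (restrict_space lborel {0<..})" by (rule measurable_restrict_space1) simp
  have [measurable]: "(\<lambda>h. ennreal (exponential_density (tr x) h)) \<in> borel_measurable (restrict_space lborel {0<..})"
    by (rule measurable_restrict_space1) simp
  have "(\<integral>\<^sup>+h. f h \<partial>HL x) = (\<integral>\<^sup>+h. ennreal (exponential_density (tr x) h) * f h \<partial>restrict_space lborel {0<..})"
    unfolding holding_law_def by (rule nn_integral_density) measurable
  also have "\<dots> = (\<integral>\<^sup>+h. ennreal (exponential_density (tr x) h) * f h * indicator {0<..} h \<partial>lborel)"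
    by (rule nn_integral_restrict_space) simp
  also have "\<dots> = (\<integral>\<^sup>+h. ennreal (tr x * exp (- (tr x * h))) * f h * indicator {0<..} h \<partial>lborel)"
    by (intro nn_integral_cong) (auto simp: exponential_density_def indicator_def mult.commute)
  finally show ?thesis .
qed

lemma nn_integral_exp:
  assumes "a > 0"
  shows "(\<integral>\<^sup>+h. ennreal (exp (- (a * h))) * indicator {0<..} h \<partial>lborel) = ennreal (1 / a)"
proof -
  interpret prob_space "density lborel (exponential_density a)" by (rule prob_space_exponential_density[OF assms])
  have "1 = (\<integral>\<^sup>+h. ennreal (exponential_density a h) \<partial>lborel)"
    using emeasure_space_1 by (simp add: emeasure_density)
  also have "\<dots> = (\<integral>\<^sup>+h. ennreal a * (ennreal (exp (- (a * h))) * indicator {0<..} h) \<partial>lborel)"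
  proof (rule nn_integral_cong_AE)
    have "AE h in lborel. h \<noteq> (0::real)" by (rule AE_lborel_singleton)
    thus "AE h in lborel. ennreal (exponential_density a h) = ennreal a * (ennreal (exp (- (a * h))) * indicator {0<..} h)"
      by eventually_elim (use assms in \<open>auto simp: exponential_density_def indicator_def mult.commute ennreal_mult\<close>)
  qed
  also have "\<dots> = ennreal a * (\<integral>\<^sup>+h. ennreal (exp (- (a * h))) * indicator {0<..} h \<partial>lborel)"
    by (rule nn_integral_cmult) simp
  finally have e: "ennreal a * (\<integral>\<^sup>+h. ennreal (exp (- (a * h))) * indicator {0<..} h \<partial>lborel) = 1" ..
  have "ennreal (1 / a) * (ennreal a * X) = X" for X using assms by (simp add: mult.assoc[symmetric] ennreal_mult[symmetric])
  from this[of "\<integral>\<^sup>+h. ennreal (exp (- (a * h))) * indicator {0<..} h \<partial>lborel"] show ?thesis unfolding e by simp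
qed

lemma nn_integral_HL_exp:
  assumes "k \<ge> 0"
  shows "(\<integral>\<^sup>+h. ennreal (exp (- (k * h))) \<partial>HL x) = ennreal (tr x / (tr x + k))"
proof -
  have "(\<integral>\<^sup>+h. ennreal (exp (- (k * h))) \<partial>HL x)
    = (\<integral>\<^sup>+h. ennreal (tr x) * (ennreal (exp (- ((tr x + k) * h))) * indicator {0<..} h) \<partial>lborel)"
  proof (subst nn_integral_HL, measurable, rule nn_integral_cong)
    fix h :: real
    have "exp (- ((tr x + k) * h)) = exp (- (tr x * h)) * exp (- (k * h))" unfolding mult_exp_exp by (simp add: algebra_simps)
    thus "ennreal (tr x * exp (- (tr x * h))) * ennreal (exp (- (k * h))) * indicator {0<..} h
      = ennreal (tr x) * (ennreal (exp (- ((tr x + k) * h))) * indicator {0<..} h)"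
      using tr_pos[of x] by (simp add: ennreal_mult mult_ac)
  qed
  also have "\<dots> = ennreal (tr x) * ennreal (1 / (tr x + k))"
    using tr_pos[of x] assms by (subst nn_integral_cmult) (simp_all add: nn_integral_exp)
  finally show ?thesis using tr_pos[of x] assms by (simp add: ennreal_mult[symmetric])
qed

text \<open>The contribution of the last vertex of a path: the lifetime falls at a time
  \<open>s\<close> within the last holding interval and is integrated against Lebesgue measure. The
  probability that the holding time exceeds \<open>s\<close> turns the integral into that of
  \<open>exp (- ((tr x + k) * s))\<close>.\<close>

lemma nn_integral_HL_truncated:
  assumes k: "k \<ge> 0"
  shows "(\<integral>\<^sup>+h. (\<integral>\<^sup>+s. ennreal (exp (- (k * s))) * indicator {0..<h} s \<partial>lborel) \<partial>HL x) = ennreal (1 / (tr x + k))"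
proof -
  let ?K = "\<lambda>h s. ennreal (tr x * exp (- (tr x * h))) * (ennreal (exp (- (k * s))) * (indicator {0..} s * indicator {0<..} (h - s)))"
  let ?I = "\<lambda>h s. ennreal (exp (- (k * s))) * indicator {0..<h} s" and ?R = "\<lambda>s. ennreal (exp (- ((tr x + k) * s))) * indicator {0<..} s"
  have ind: "indicator {0..<h} s * indicator {0<..} h = (indicator {0..} s * indicator {0<..} (h - s) :: ennreal)" for h s :: real
    by (auto simp: indicator_def)
  have [measurable]: "(\<lambda>h. \<integral>\<^sup>+s. ?I h s \<partial>lborel) \<in> borel_measurable borel"
  proof -
    have "(\<lambda>p. ennreal (exp (- (k * snd p))) * indicator {p. 0 \<le> snd p \<and> snd p < fst p} p) \<in> borel_measurable (borel \<Otimes>\<^sub>M (lborel :: real measure))"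
      by measurable
    hence "(\<lambda>h. \<integral>\<^sup>+s. ennreal (exp (- (k * snd (h, s)))) * indicator {p. 0 \<le> snd p \<and> snd p < fst p} (h, s) \<partial>lborel) \<in> borel_measurable borel"
      by (rule lborel.borel_measurable_nn_integral_fst)
    moreover have "ennreal (exp (- (k * snd (h, s)))) * indicator {p. 0 \<le> snd p \<and> snd p < fst p} (h, s) = ?I h s" for h s
      by (auto simp: indicator_def)
    ultimately show ?thesis by (simp only:)
  qed
  have "(\<integral>\<^sup>+h. (\<integral>\<^sup>+s. ?I h s \<partial>lborel) \<partial>HL x)
    = (\<integral>\<^sup>+h. (\<integral>\<^sup>+s. ?K h s \<partial>lborel) \<partial>lborel)"
    unfolding nn_integral_HL[OF \<open>(\<lambda>h. _) \<in> borel_measurable borel\<close>]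
    by (intro nn_integral_cong) (simp add: nn_integral_cmult[symmetric] nn_integral_multc[symmetric] mult.assoc ind)
  \<comment> \<open>After the exchange each \<open>s\<close> sees the holding times beyond it.
    Substituting \<open>h = s + u\<close> splits off the tail probability, and the density in
    \<open>u\<close> integrates to one.\<close>
  also have "\<dots> = (\<integral>\<^sup>+s. (\<integral>\<^sup>+h. ?K h s \<partial>lborel) \<partial>lborel)"
    by (rule lborel_pair.Fubini') simp
  also have "\<dots> = (\<integral>\<^sup>+s. ?R s \<partial>lborel)"
  proof (rule nn_integral_cong_AE)
    have "AE s in lborel. s \<noteq> (0::real)" by (rule AE_lborel_singleton)
    thus "AE s in lborel. (\<integral>\<^sup>+h. ?K h s \<partial>lborel) = ?R s"
    proof eventually_elim
      fix s :: real assume s0: "s \<noteq> 0"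
      have "(\<integral>\<^sup>+h. ?K h s \<partial>lborel) = (\<integral>\<^sup>+u. ?K (s + 1 * u) s \<partial>lborel)"
        by (subst nn_integral_real_affine[of _ 1 s]) auto
      also have "\<dots> = (\<integral>\<^sup>+u. (ennreal (tr x) * (?R s)) * (ennreal (exp (- (tr x * u))) * indicator {0<..} u) \<partial>lborel)"
      proof (rule nn_integral_cong)
        fix u :: real
        have "exp (- (tr x * (s + 1 * u))) * exp (- (k * s)) = exp (- ((tr x + k) * s)) * exp (- (tr x * u))"
          unfolding mult_exp_exp by (simp add: algebra_simps)
        hence e: "ennreal (exp (- (tr x * (s + 1 * u)))) * ennreal (exp (- (k * s))) = ennreal (exp (- ((tr x + k) * s))) * ennreal (exp (- (tr x * u)))"
          by (simp add: ennreal_mult[symmetric])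
        have i: "indicator {0..} s = (indicator {0<..} s :: ennreal)" "indicator {0<..} ((s + 1 * u) - s) = (indicator {0<..} u :: ennreal)"
          using s0 by (auto simp: indicator_def)
        have "ennreal (tr x * exp (- (tr x * (s + 1 * u)))) * (ennreal (exp (- (k * s))) * (indicator {0<..} s * indicator {0<..} u))
          = ennreal (tr x) * (ennreal (exp (- (tr x * (s + 1 * u)))) * ennreal (exp (- (k * s)))) * (indicator {0<..} s * indicator {0<..} u)"
          using tr_pos[of x] by (simp only: ennreal_mult less_imp_le exp_ge_zero mult.assoc)
        thus "?K (s + 1 * u) s = (ennreal (tr x) * (?R s)) * (ennreal (exp (- (tr x * u))) * indicator {0<..} u)"
          unfolding i e by (simp only: mult_ac)
      qed
      also have "\<dots> = (ennreal (tr x) * (?R s)) * ennreal (1 / tr x)"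
        using tr_pos[of x] by (subst nn_integral_cmult) (simp_all add: nn_integral_exp)
      also have "\<dots> = ?R s" using tr_pos[of x] by (auto simp: indicator_def ennreal_mult[symmetric])
      finally show "(\<integral>\<^sup>+h. ?K h s \<partial>lborel) = ?R s" .
    qed
  qed
  also have "\<dots> = ennreal (1 / (tr x + k))" using tr_pos[of x] k by (intro nn_integral_exp) simp
  finally show ?thesis .
qed

lemma prob_space_HL: "prob_space (HL x)"
proof
  have "emeasure (HL x) (space (HL x)) = (\<integral>\<^sup>+h. 1 \<partial>HL x)" by simp
  also have "\<dots> = 1" using nn_integral_HL_exp[of 0 x] tr_pos[of x] by simp
  finally show "emeasure (HL x) (space (HL x)) = 1" .
qed

section \<open>The sample space and the paths of the process\<close>

definition FM :: "nat \<times> 'v => (real \<times> 'v option) measure" where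
  "FM = (\<lambda>(k, y). HL y \<Otimes>\<^sub>M measure_pmf (JL y))"

lemma SM_eq: "SM = PiM UNIV FM" by (simp add: sample_measure_def FM_def)

lemma prob_space_FM: "prob_space (FM i)"
proof -
  obtain k y where "i = (k, y)" by (cases i)
  interpret h: prob_space "HL y" by (rule prob_space_HL)
  interpret p: prob_space "measure_pmf (JL y)" by (rule prob_space_measure_pmf)
  interpret pair_prob_space "HL y" "measure_pmf (JL y)" ..
  show ?thesis using \<open>i = (k, y)\<close> by (simp add: FM_def) unfold_locales
qed

sublocale FM: product_prob_space FM UNIV
proof -
  interpret product_sigma_finite FM by (simp add: product_sigma_finite_def prob_space_FM prob_space_imp_sigma_finite)
  show "product_prob_space FM" by unfold_locales (simp_all add: prob_space.emeasure_space_1[OF prob_space_FM])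
qed

lemma prob_space_SM: "prob_space SM" unfolding SM_eq by unfold_locales

lemma measurable_hold [measurable]: "(\<lambda>\<omega>. fst (\<omega> (k, y))) \<in> SM \<rightarrow>\<^sub>M borel"
proof -
  have "(\<lambda>\<omega>. \<omega> (k, y)) \<in> SM \<rightarrow>\<^sub>M (HL y \<Otimes>\<^sub>M measure_pmf (JL y))"
    unfolding SM_eq using measurable_component_singleton[of "(k, y)" UNIV FM] by (simp add: FM_def)
  from measurable_compose[OF measurable_compose[OF this measurable_fst] HL_borel] show ?thesis .
qed

lemma measurable_next [measurable]: "(\<lambda>\<omega>. snd (\<omega> (k, y))) \<in> SM \<rightarrow>\<^sub>M count_space UNIV"
proof -
  have "(\<lambda>\<omega>. \<omega> (k, y)) \<in> SM \<rightarrow>\<^sub>M (HL y \<Otimes>\<^sub>M measure_pmf (JL y))"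
    unfolding SM_eq using measurable_component_singleton[of "(k, y)" UNIV FM] by (simp add: FM_def)
  from measurable_compose[OF this measurable_snd] show ?thesis by simp
qed

lemma hold_pos: "\<omega> \<in> space SM ==> fst (\<omega> (k, y)) > 0"
proof -
  assume "\<omega> \<in> space SM"
  hence "\<omega> (k, y) \<in> space (FM (k, y))" by (simp add: SM_eq space_PiM PiE_iff)
  thus ?thesis by (auto simp: FM_def space_pair_measure space_HL)
qed

lemma measurable_chain [measurable]: "(\<lambda>\<omega>. jump_chain x \<omega> k) \<in> SM \<rightarrow>\<^sub>M count_space UNIV"
proof (induction k)
  case (Suc k)
  have "(\<lambda>\<omega>. (\<lambda>i \<omega>. case i of None => None | Some y => snd (\<omega> (k, y))) (jump_chain x \<omega> k) \<omega>) \<in> SM \<rightarrow>\<^sub>M count_space UNIV"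
  proof (rule measurable_compose_countable[OF _ Suc])
    fix i :: "'v option"
    show "(\<lambda>\<omega>. case i of None => None | Some y => snd (\<omega> (k, y))) \<in> SM \<rightarrow>\<^sub>M count_space UNIV"
      by (cases i) auto
  qed
  thus ?case by simp
qed simp

lemma measurable_holding_time [measurable]: "(\<lambda>\<omega>. holding_time x \<omega> k) \<in> borel_measurable SM"
proof -
  have "(\<lambda>\<omega>. (\<lambda>i \<omega>. case i of None => 0 | Some y => fst (\<omega> (k, y))) (jump_chain x \<omega> k) \<omega>) \<in> borel_measurable SM"
  proof (rule measurable_compose_countable[OF _ measurable_chain])
    fix i :: "'v option"
    show "(\<lambda>\<omega>. case i of None => 0 | Some y => fst (\<omega> (k, y))) \<in> borel_measurable SM"
      by (cases i) auto
  qed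
  thus ?thesis by (simp add: holding_time_def)
qed

lemma measurable_jump_time [measurable]: "(\<lambda>\<omega>. jump_time x \<omega> k) \<in> borel_measurable SM"
  unfolding jump_time_def by measurable

lemma holding_time_nonneg: "\<omega> \<in> space SM ==> holding_time x \<omega> k \<ge> 0"
  using hold_pos by (auto simp: holding_time_def less_imp_le split: option.splits)

lemma jump_time_mono: "\<omega> \<in> space SM ==> i \<le> j ==> jump_time x \<omega> i \<le> jump_time x \<omega> j"
  unfolding jump_time_def by (rule sum_mono2) (auto intro: holding_time_nonneg)

lemma jump_chain_None: "jump_chain x \<omega> i = None ==> i \<le> j ==> jump_chain x \<omega> j = None"
  by (rotate_tac 1, induction j rule: dec_induct) auto

lemma jump_time_strict:
  assumes "\<omega> \<in> space SM" "i < j" "jump_chain x \<omega> i \<noteq> None"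
  shows "jump_time x \<omega> i < jump_time x \<omega> j"
proof -
  obtain y where "jump_chain x \<omega> i = Some y" using assms(3) by auto
  hence "holding_time x \<omega> i > 0" using hold_pos[OF assms(1)] by (simp add: holding_time_def)
  hence "jump_time x \<omega> i < jump_time x \<omega> (Suc i)" by (simp add: jump_time_def)
  also have "\<dots> \<le> jump_time x \<omega> j" using assms by (intro jump_time_mono) auto
  finally show ?thesis .
qed

lemma position_eq:
  assumes \<omega>: "\<omega> \<in> space SM" and k: "jump_time x \<omega> k \<le> t" "t < jump_time x \<omega> (Suc k)"
  shows "position x \<omega> t = jump_chain x \<omega> k"
proof -
  have uniq: "k' = k" if "jump_time x \<omega> k' \<le> t" "t < jump_time x \<omega> (Suc k')" for k'
  proof (rule antisym; rule ccontr)
    assume "\<not> k' \<le> k"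
    hence "jump_time x \<omega> (Suc k) \<le> jump_time x \<omega> k'" by (intro jump_time_mono \<omega>) simp
    thus False using that k by simp
  next
    assume "\<not> k \<le> k'"
    hence "jump_time x \<omega> (Suc k') \<le> jump_time x \<omega> k" by (intro jump_time_mono \<omega>) simp
    thus False using that k by simp
  qed
  have l: "(LEAST k. jump_time x \<omega> k \<le> t \<and> t < jump_time x \<omega> (Suc k)) = k"
  proof (rule Least_equality)
    fix j assume "jump_time x \<omega> j \<le> t \<and> t < jump_time x \<omega> (Suc j)"
    hence "j = k" by (elim conjE) (rule uniq)
    thus "k \<le> j" by simp
  qed (intro conjI k)
  have "\<exists>k. jump_time x \<omega> k \<le> t \<and> t < jump_time x \<omega> (Suc k)" using k by blast
  thus ?thesis unfolding position_def l by (rule if_P)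
qed

lemma alive_chain:
  assumes "t < jump_time x \<omega> (Suc k)" "jump_time x \<omega> k \<le> t"
  shows "jump_chain x \<omega> k \<noteq> None"
proof
  assume "jump_chain x \<omega> k = None"
  hence "jump_time x \<omega> (Suc k) = jump_time x \<omega> k" by (simp add: jump_time_def holding_time_def)
  thus False using assms by simp
qed

lemma position_Some_iff:
  assumes \<omega>: "\<omega> \<in> space SM"
  shows "position x \<omega> t = Some y \<longleftrightarrow> (\<exists>k. jump_time x \<omega> k \<le> t \<and> t < jump_time x \<omega> (Suc k) \<and> jump_chain x \<omega> k = Some y)"
proof
  assume p: "position x \<omega> t = Some y"
  hence "\<exists>k. jump_time x \<omega> k \<le> t \<and> t < jump_time x \<omega> (Suc k)" unfolding position_def by (metis option.distinct(1))
  then obtain k where k: "jump_time x \<omega> k \<le> t" "t < jump_time x \<omega> (Suc k)" by blast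
  thus "\<exists>k. jump_time x \<omega> k \<le> t \<and> t < jump_time x \<omega> (Suc k) \<and> jump_chain x \<omega> k = Some y"
    using position_eq[OF \<omega> k] p by auto
next
  assume "\<exists>k. jump_time x \<omega> k \<le> t \<and> t < jump_time x \<omega> (Suc k) \<and> jump_chain x \<omega> k = Some y"
  then obtain k where "jump_time x \<omega> k \<le> t" "t < jump_time x \<omega> (Suc k)" "jump_chain x \<omega> k = Some y" by blast
  thus "position x \<omega> t = Some y" using position_eq[OF \<omega>, of x k t] by (simp only:)
qed

lemma measurable_position [measurable]:
  "(\<lambda>(t, \<omega>). position x \<omega> t) \<in> borel \<Otimes>\<^sub>M SM \<rightarrow>\<^sub>M count_space UNIV"
proof (subst measurable_count_space_eq2_countable)
  let ?M = "borel \<Otimes>\<^sub>M SM :: (real \<times> 'v sample) measure"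
  let ?A = "\<lambda>y. {w \<in> space ?M. \<exists>k. jump_time x (snd w) k \<le> fst w \<and> fst w < jump_time x (snd w) (Suc k) \<and> jump_chain x (snd w) k = Some y}" and ?p = "\<lambda>(t, \<omega>). position x \<omega> t"
  have S: "?p -` {Some y} \<inter> space ?M \<in> sets ?M" for y
  proof -
    have "?A y \<in> sets ?M" by measurable
    moreover have "?p -` {Some y} \<inter> space ?M = ?A y" by (auto simp: space_pair_measure position_Some_iff)
    ultimately show ?thesis by simp
  qed
  have "?p -` {z} \<inter> space ?M \<in> sets ?M" for z
  proof (cases z)
    case None
    have "?p -` {None} \<inter> space ?M = space ?M - (\<Union>y. ?p -` {Some y} \<inter> space ?M)" by auto
    also have "\<dots> \<in> sets ?M" by (intro sets.Diff sets.finite_UN S) auto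
    finally show ?thesis using None by simp
  qed (use S in simp)
  thus "?p \<in> space ?M \<rightarrow> UNIV \<and> (\<forall>z\<in>UNIV. ?p -` {z} \<inter> space ?M \<in> sets ?M)" by simp
qed

definition chain_list :: "'v => 'v sample => nat => 'v list" where
  "chain_list x \<omega> m = map (\<lambda>j. the (jump_chain x \<omega> j)) [0..<Suc m]"

definition time_list :: "'v => 'v sample => nat => real list" where
  "time_list x \<omega> m = map (jump_time x \<omega>) [0..<Suc m]"

lemma chain_list_nth: "j \<le> m ==> chain_list x \<omega> m ! j = the (jump_chain x \<omega> j)" "length (chain_list x \<omega> m) = Suc m"
  by (simp_all add: chain_list_def del: upt_Suc)

lemma time_list_nth: "j \<le> m ==> time_list x \<omega> m ! j = jump_time x \<omega> j" "length (time_list x \<omega> m) = Suc m"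
  by (simp_all add: time_list_def del: upt_Suc)

text \<open>All requirements of \<open>has_skeleton\<close> except that successive vertices differ,
  which may fail on the null set where the chain jumps to its present vertex. For such samples
  repetitions are removed afterwards, so the path lies in \<open>path_space\<close> for every sample
  alive at \<open>t\<close>.\<close>

lemma path_upto_pre_skeleton:
  assumes \<omega>: "\<omega> \<in> space SM" and t: "t \<ge> 0" "jump_time x \<omega> m \<le> t" "t < jump_time x \<omega> (Suc m)"
  defines "ts \<equiv> time_list x \<omega> m" and "ys \<equiv> chain_list x \<omega> m" and "\<gamma> \<equiv> path_upto x t \<omega>"
  shows "ys \<noteq> []" "length ts = length ys" "hd ts = 0" "sorted_wrt (<) ts" "last ts \<le> fst \<gamma>"
    "\<And>i s. i < length ys ==> ts ! i \<le> s ==> (Suc i < length ys ==> s < ts ! Suc i) ==> snd \<gamma> s = ys ! i"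
    "\<And>s. s < 0 ==> snd \<gamma> s = hd ys" "jump_chain x \<omega> j \<noteq> None \<or> m < j"
proof -
  have ne: "ys \<noteq> []" "ts \<noteq> []" using chain_list_nth(2)[of x \<omega> m] time_list_nth(2)[of x \<omega> m] by (auto simp: ys_def ts_def)
  have len: "length ts = Suc m" "length ys = Suc m" by (simp_all add: ts_def ys_def chain_list_nth time_list_nth)
  have alive: "jump_chain x \<omega> j \<noteq> None" if "j \<le> m" for j
  proof
    assume "jump_chain x \<omega> j = None"
    hence "jump_chain x \<omega> m = None" using that by (rule jump_chain_None)
    thus False using alive_chain[OF t(3,2)] by simp
  qed
  thus "jump_chain x \<omega> j \<noteq> None \<or> m < j" by (cases "j \<le> m") auto
  have J0: "jump_time x \<omega> 0 = 0" by (simp add: jump_time_def)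
  have nonneg: "0 \<le> jump_time x \<omega> i" for i using jump_time_mono[OF \<omega>, of 0 i x] J0 by simp
  show "ys \<noteq> []" "length ts = length ys" using ne len by auto
  show "hd ts = 0" using ne J0 by (simp add: hd_conv_nth ts_def time_list_nth)
  show "sorted_wrt (<) ts" unfolding sorted_wrt_iff_nth_less len
  proof (intro allI impI)
    fix i j assume "i < j" "j < Suc m"
    thus "ts ! i < ts ! j" using alive[of i] by (simp add: ts_def time_list_nth jump_time_strict[OF \<omega>])
  qed
  show "last ts \<le> fst \<gamma>" using ne t len by (simp add: last_conv_nth \<gamma>_def path_upto_def ts_def time_list_nth)
  show "snd \<gamma> s = ys ! i" if i: "i < length ys" and s: "ts ! i \<le> s" "Suc i < length ys ==> s < ts ! Suc i" for i s
  proof -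
    have im: "i \<le> m" using i len by simp
    have Ji: "jump_time x \<omega> i \<le> s" using s(1) im by (simp add: ts_def time_list_nth)
    have Jit: "jump_time x \<omega> i \<le> t" using jump_time_mono[OF \<omega> im, of x] t(2) by simp
    have "max 0 (min s t) < jump_time x \<omega> (Suc i)"
    proof (cases "i = m")
      case True thus ?thesis using t by simp
    next
      case False
      hence "s < jump_time x \<omega> (Suc i)" using s(2) len im by (simp add: ts_def time_list_nth)
      moreover have "0 < jump_time x \<omega> (Suc i)" using nonneg[of i] jump_time_strict[OF \<omega>, of i "Suc i" x] alive[OF im] by simp
      ultimately show ?thesis by simp
    qed
    moreover have "jump_time x \<omega> i \<le> max 0 (min s t)" using Ji Jit by simp
    ultimately have "position x \<omega> (max 0 (min s t)) = jump_chain x \<omega> i" by (intro position_eq[OF \<omega>]) auto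
    thus ?thesis using im by (simp add: \<gamma>_def path_upto_def ys_def chain_list_nth)
  qed
  show "snd \<gamma> s = hd ys" if "s < 0" for s
  proof -
    have "jump_chain x \<omega> 0 \<noteq> None" by simp
    hence "0 < jump_time x \<omega> (Suc 0)" using jump_time_strict[OF \<omega>, of 0 "Suc 0" x] J0 by simp
    hence "position x \<omega> 0 = jump_chain x \<omega> 0" using J0 by (intro position_eq[OF \<omega>]) auto
    moreover have "max 0 (min s t) = 0" using that by simp
    ultimately have "snd \<gamma> s = the (jump_chain x \<omega> 0)" by (simp add: \<gamma>_def path_upto_def)
    thus ?thesis using ne by (simp add: ys_def hd_conv_nth chain_list_nth del: jump_chain.simps)
  qed
qed

lemma path_upto_space:
  assumes "\<omega> \<in> space SM" "t \<ge> 0" "position x \<omega> t = Some y"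
  shows "path_upto x t \<omega> \<in> space path_space"
proof -
  obtain m where m: "jump_time x \<omega> m \<le> t" "t < jump_time x \<omega> (Suc m)"
    using assms position_Some_iff[OF assms(1)] by blast
  note p = path_upto_pre_skeleton[OF assms(1,2) m]
  have "\<exists>ts ys. has_skeleton (path_upto x t \<omega>) ts ys" by (rule has_skeleton_exists[OF p(1-7)])
  thus ?thesis by (simp add: path_space_def space_restrict_space space_pair_measure space_PiM)
qed

lemma path_upto_skeleton:
  assumes "\<omega> \<in> space SM" "t \<ge> 0" "jump_time x \<omega> m \<le> t" "t < jump_time x \<omega> (Suc m)" "distinct_adj (chain_list x \<omega> m)"
  shows "has_skeleton (path_upto x t \<omega>) (time_list x \<omega> m) (chain_list x \<omega> m)"
  using path_upto_pre_skeleton[OF assms(1-4)] assms(5) unfolding has_skeleton_def by blast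

definition alive :: "'v => 'v => (real \<times> 'v sample) set" where
  "alive x y = {w \<in> space (lborel \<Otimes>\<^sub>M SM). 0 < fst w \<and> position x (snd w) (fst w) = Some y}"

lemma sets_alive [measurable]: "alive x y \<in> sets (lborel \<Otimes>\<^sub>M SM)"
proof -
  have [measurable]: "(\<lambda>w. position x (snd w) (fst w)) \<in> (lborel \<Otimes>\<^sub>M SM) \<rightarrow>\<^sub>M count_space UNIV"
    using measurable_position[of x] by (simp add: case_prod_beta' cong: measurable_cong_sets)
  show ?thesis unfolding alive_def by measurable
qed

lemma measurable_path_upto:
  "(\<lambda>(t, \<omega>). path_upto x t \<omega>) \<in> restrict_space (lborel \<Otimes>\<^sub>M SM) (alive x y) \<rightarrow>\<^sub>M path_space"
  unfolding path_space_def
proof (rule measurable_restrict_space2)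
  show "(\<lambda>(t, \<omega>). path_upto x t \<omega>) \<in> space (restrict_space (lborel \<Otimes>\<^sub>M SM) (alive x y)) \<rightarrow> {\<gamma>. \<exists>ts ys. has_skeleton \<gamma> ts ys}"
    using path_upto_space by (fastforce simp: space_restrict_space alive_def space_pair_measure path_space_def)
  have "(\<lambda>w. (fst w, \<lambda>s. the (position x (snd w) (max 0 (min s (fst w)))))) \<in> (lborel \<Otimes>\<^sub>M SM) \<rightarrow>\<^sub>M (borel \<Otimes>\<^sub>M (\<Pi>\<^sub>M s\<in>UNIV. count_space UNIV))"
  proof (rule measurable_Pair)
    show "(\<lambda>w. \<lambda>s. the (position x (snd w) (max 0 (min s (fst w))))) \<in> (lborel \<Otimes>\<^sub>M SM) \<rightarrow>\<^sub>M (\<Pi>\<^sub>M s\<in>UNIV. count_space UNIV)"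
    proof (rule measurable_PiM_single')
      fix s :: real
      have "(\<lambda>w. (max 0 (min s (fst w)), snd w)) \<in> (lborel \<Otimes>\<^sub>M SM) \<rightarrow>\<^sub>M (borel \<Otimes>\<^sub>M SM)" by measurable
      from measurable_compose[OF measurable_compose[OF this measurable_position[of x]], of the "count_space UNIV"]
      show "(\<lambda>w. the (position x (snd w) (max 0 (min s (fst w))))) \<in> (lborel \<Otimes>\<^sub>M SM) \<rightarrow>\<^sub>M count_space UNIV" by simp
    qed auto
  qed simp
  moreover have "(\<lambda>(t, \<omega>). path_upto x t \<omega>) = (\<lambda>w. (fst w, \<lambda>s. the (position x (snd w) (max 0 (min s (fst w))))))"
    by (auto simp: path_upto_def)
  ultimately show "(\<lambda>(t, \<omega>). path_upto x t \<omega>) \<in> restrict_space (lborel \<Otimes>\<^sub>M SM) (alive x y) \<rightarrow>\<^sub>M (borel \<Otimes>\<^sub>M (\<Pi>\<^sub>M s\<in>UNIV. count_space UNIV))"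
    by (simp add: measurable_restrict_space1)
qed

end

subsection \<open>The twisted quadratic form\<close>

lemma inner_conj: "inner (V ** A ** adj V) B = inner A (adj V ** B ** V)"
  for V :: "quat^'n^'n"
proof -
  have "inner (V ** A ** adj V) B = rtr (V ** (A ** adj V ** adj B))" by (simp add: inner_matrix_eq matrix_mul_assoc)
  also have "\<dots> = rtr ((A ** adj V ** adj B) ** V)" by (rule rtr_commute)
  also have "\<dots> = inner A (adj V ** B ** V)" by (simp add: inner_matrix_eq adj_mult matrix_mul_assoc)
  finally show ?thesis .
qed

text \<open>The covariant Laplacian on matrix fields, a neighbour's matrix being transported by
  conjugation with the connection. With \<open>q\<close> the total rate it is minus the generator of
  the twisted walk; a further summand in \<open>q\<close> acts as additional killing.\<close>

definition twisted_op ::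
  "('v::finite \<times> 'v) set => ('v => 'v => real) => ('v => real) => ('v => 'v => quat^'n^'n)
    => quat^'n^'n^'v => quat^'n^'n^'v" where
  "twisted_op E C q U \<Phi> = (\<chi> x. q x *\<^sub>R \<Phi> $ x - (\<Sum>y\<in>UNIV. jump_rate E C x y *\<^sub>R (U x y ** \<Phi> $ y ** U y x)))"

lemma linear_twisted_op: "linear (twisted_op E C q U)" by (rule linearI; rule vec_eq_iff[THEN iffD2])
    (simp_all add: twisted_op_def matrix_add_ldistrib quat_matrix_add_rdistrib mult_scaleR
     scaleR_add_right sum.distrib scaleR_diff_right scaleR_sum_right mult.commute)

lemma inner_twisted_op:
  "inner (twisted_op E C q U A) B = (\<Sum>x\<in>UNIV. q x * inner (A $ x) (B $ x))
    - (\<Sum>x\<in>UNIV. \<Sum>y\<in>UNIV. jump_rate E C x y * inner (U x y ** A $ y ** U y x) (B $ x))"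
  unfolding inner_vec_def[of "twisted_op E C q U A"] by (simp add: twisted_op_def inner_diff_left inner_sum_left sum_subtractf)

context network
begin

context
  fixes \<beta> and U :: "'v => 'v => quat^'n^'n"
  assumes conn: "is_connection \<beta> E U"
begin

lemma connection_adj: "(x, y) \<in> E ==> U y x = adj (U x y)" "(x, y) \<in> E ==> U x y = adj (U y x)"
    "(x, y) \<in> E ==> U x y \<in> unitary_group \<beta>" using conn by (auto simp: is_connection_def)

lemma inner_transport:
  "jr x y * inner (U x y ** A ** U y x) B = jr x y * inner (U y x ** B ** U x y) A"
  using inner_conj[of "U x y" A B] connection_adj[of x y] by (auto simp: jump_rate_def inner_commute)

lemma twisted_op_sym: "inner (twisted_op E C q U A) B = inner A (twisted_op E C q U B)"
proof -
  have "(\<Sum>x\<in>UNIV. \<Sum>y\<in>UNIV. jr x y * inner (U x y ** A $ y ** U y x) (B $ x))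
    = (\<Sum>x\<in>UNIV. \<Sum>y\<in>UNIV. jr y x * inner (U x y ** B $ y ** U y x) (A $ x))"
    by (subst sum.swap) (intro sum.cong refl, rule trans[OF inner_transport], simp add: jr_sym)
  thus ?thesis unfolding inner_twisted_op inner_commute[of A "twisted_op E C q U B"] by (simp add: inner_commute jr_sym)
qed

lemma norm_transport_diff:
  assumes "(x, y) \<in> E"
  shows "(norm (B - U y x ** A ** U x y))\<^sup>2 = (norm B)\<^sup>2 + (norm A)\<^sup>2 - 2 * inner (U y x ** A ** U x y) B"
proof -
  have u: "U y x \<in> unitary_group \<beta>" "U x y \<in> unitary_group \<beta>"
    using connection_adj(3)[OF assms] connection_adj(1)[OF assms] unitary_closed(2) by auto
  have "norm (U y x ** A ** U x y) = norm A"
    using norm_unitary_mult(1)[OF u(1), of A] norm_unitary_mult(2)[OF u(2), of "U y x ** A"] by simp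
  moreover have "(norm (B - X))\<^sup>2 = (norm B)\<^sup>2 + (norm X)\<^sup>2 - 2 * inner X B" for X
    unfolding power2_norm_eq_inner by (simp add: inner_diff_left inner_diff_right inner_commute)
  ultimately show ?thesis by simp
qed

text \<open>Summation by parts with an isometric transport. The factor 1/2 is there because each
  edge occurs in both orientations.\<close>

lemma twisted_op_quadratic:
  "inner (twisted_op E C (\<lambda>x. tr x + k x) U A) A = (\<Sum>x\<in>UNIV. (\<kappa> x + k x) * (norm (A $ x))\<^sup>2)
    + (\<Sum>x\<in>UNIV. \<Sum>y\<in>UNIV. jr x y * (norm (A $ y - U y x ** A $ x ** U x y))\<^sup>2) / 2"
proof -
  let ?S = "\<lambda>f. \<Sum>x\<in>UNIV. \<Sum>y\<in>UNIV. jr x y * (f x y :: real)" and ?i = "\<lambda>x y. inner (U x y ** A $ y ** U y x) (A $ x)"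
  let ?d = "\<lambda>x y. (norm (A $ y - U y x ** A $ x ** U x y))\<^sup>2" and ?X = "\<Sum>x\<in>UNIV. \<Sum>y\<in>UNIV. jr x y * (norm (A $ x))\<^sup>2"
  have "jr x y * ?d x y = jr x y * (norm (A $ y))\<^sup>2 + jr x y * (norm (A $ x))\<^sup>2 - 2 * (jr x y * ?i x y)" for x y
  proof -
    have t: "jr x y * ?i x y = jr x y * inner (U y x ** A $ x ** U x y) (A $ y)" by (rule inner_transport)
    show ?thesis unfolding t using norm_transport_diff[of x y "A $ y" "A $ x"]
      by (cases "(x, y) \<in> E") (simp_all add: jump_rate_def ring_distribs)
  qed
  hence "(?S ?d) = (?S (\<lambda>x y. (norm (A $ y))\<^sup>2)) + ?X - 2 * (?S ?i)"
    by (simp add: sum.distrib sum_subtractf sum_distrib_left)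
  also have "(?S (\<lambda>x y. (norm (A $ y))\<^sup>2)) = ?X" by (subst sum.swap) (simp add: jr_sym)
  finally have e: "(?S ?d) = 2 * ?X - 2 * (?S ?i)" by simp
  have t: "(\<Sum>x\<in>UNIV. (tr x + k x) * inner (A $ x) (A $ x))
     = (\<Sum>x\<in>UNIV. (\<kappa> x + k x) * (norm (A $ x))\<^sup>2) + ?X"
    unfolding sum.distrib[symmetric] power2_norm_eq_inner[symmetric]
    by (intro sum.cong refl) (simp add: total_rate_def distrib_right sum_distrib_right)
  show ?thesis unfolding e inner_twisted_op t by (simp add: diff_divide_distrib)
qed

text \<open>Zero energy forces each matrix to be the transport of its neighbours, so the norm is
  constant along edges; it vanishes at a vertex with killing and therefore everywhere.\<close>

lemma twisted_op_pos:
  assumes k: "\<And>x. k x \<ge> 0" and A: "A \<noteq> 0"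
  shows "inner (twisted_op E C (\<lambda>x. tr x + k x) U A) A > 0"
proof (rule ccontr)
  let ?s1 = "\<lambda>x. (\<kappa> x + k x) * (norm (A $ x))\<^sup>2"
  let ?s2 = "\<lambda>x y. jr x y * (norm (A $ y - U y x ** A $ x ** U x y))\<^sup>2"
  assume "\<not> ?thesis"
  hence le: "(\<Sum>x\<in>UNIV. ?s1 x) + (\<Sum>x\<in>UNIV. \<Sum>y\<in>UNIV. ?s2 x y) / 2 \<le> 0"
    unfolding twisted_op_quadratic by simp
  have n1: "0 \<le> ?s1 x" and n2: "0 \<le> ?s2 x y" for x y using killing_nonneg k jr_nonneg by auto
  have n3: "0 \<le> (\<Sum>y\<in>UNIV. ?s2 x y)" for x by (rule sum_nonneg) (rule n2)
  have "0 \<le> (\<Sum>x\<in>UNIV. ?s1 x)" "0 \<le> (\<Sum>x\<in>UNIV. \<Sum>y\<in>UNIV. ?s2 x y)"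
    by (rule sum_nonneg, rule n1, rule sum_nonneg, rule n3)
  hence z: "(\<Sum>x\<in>UNIV. ?s1 x) = 0" "(\<Sum>x\<in>UNIV. \<Sum>y\<in>UNIV. ?s2 x y) = 0" using le by linarith+
  have a1: "?s1 x = 0" for x using z(1) sum_nonneg_eq_0_iff[of UNIV ?s1] n1 by auto
  have "(\<Sum>y\<in>UNIV. ?s2 x y) = 0" for x using z(2) sum_nonneg_eq_0_iff[of UNIV "\<lambda>x. \<Sum>y\<in>UNIV. ?s2 x y"] n3 by auto
  hence a2: "?s2 x y = 0" for x y using sum_nonneg_eq_0_iff[of UNIV "?s2 x"] n2 by auto
  have "(norm (A $ x))\<^sup>2 = 0" for x
  proof (rule connected_constant_zero[OF network_axioms])
    show "\<kappa> x * (norm (A $ x))\<^sup>2 = 0" for x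
    proof -
      have "\<kappa> x * (norm (A $ x))\<^sup>2 + k x * (norm (A $ x))\<^sup>2 = 0" using a1[of x] by (simp add: distrib_right)
      moreover have "\<kappa> x * (norm (A $ x))\<^sup>2 \<ge> 0" "k x * (norm (A $ x))\<^sup>2 \<ge> 0" using killing_nonneg k by auto
      ultimately show ?thesis by linarith
    qed
    show "(norm (A $ x))\<^sup>2 = (norm (A $ y))\<^sup>2" if e: "(x, y) \<in> E" for x y
    proof -
      have u: "U y x \<in> unitary_group \<beta>" "U x y \<in> unitary_group \<beta>"
        using connection_adj(3)[OF e] connection_adj(1)[OF e] unitary_closed(2) by auto
      have "A $ y = U y x ** A $ x ** U x y" using a2[of x y] e conductance_pos[OF e] by (simp add: jump_rate_def)
      thus ?thesis using norm_unitary_mult(1)[OF u(1), of "A $ x"] norm_unitary_mult(2)[OF u(2), of "U y x ** A $ x"] by simp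
    qed
  qed
  hence "A = 0" by (simp add: vec_eq_iff[of A])
  thus False using A by simp
qed

end


text \<open>The solution bounds the total weight of the walks, as it satisfies the recursion of the partial sums.\<close>

lemma exists_mean_lifetime:
  "\<exists>u. (\<forall>x. u x \<ge> 0) \<and> (\<forall>x. tr x * u x = 1 + (\<Sum>y\<in>UNIV. jr x y * u y))"
proof -
  \<comment> \<open>With 1 by 1 matrices and identity transport, \<open>twisted_op\<close> acts on
    every quaternionic component as the untwisted operator, so its positivity yields the solvability
    of the scalar equation. The solution is the mean lifetime as a function of the starting
    point.\<close>
  let ?U = "\<lambda>_ _. mat 1 :: quat^1^1" and ?Q = "twisted_op E C (\<lambda>x. tr x + 0) (\<lambda>_ _. mat 1 :: quat^1^1)"
  have "matrix_inv (mat 1 :: quat^1^1) = mat 1" unfolding matrix_inv_def by (rule some_equality) auto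
  hence conn: "is_connection 4 E ?U" by (auto simp: is_connection_def unitary_closed)
  have "M = 0" if "?Q M = 0" for M using twisted_op_pos[OF conn, of "\<lambda>_. 0" M] that by (cases "M = 0") auto
  hence "inj ?Q" using linear_injective_0[OF linear_twisted_op] by blast
  hence "surj ?Q" using linear_twisted_op linear_injective_imp_surjective by blast
  then obtain M where M: "?Q M = (\<chi> x. mat 1)" by (metis surj_def)
  define f where "f x = qRe (M $ x $ 1 $ 1)" for x
  have eq: "tr x * f x - (\<Sum>y\<in>UNIV. jr x y * f y) = 1" for x
  proof -
    have "qRe (?Q M $ x $ 1 $ 1) = 1" unfolding M by (simp add: mat_nth)
    thus ?thesis by (simp add: twisted_op_def f_def quat_sum_sel)
  qed
  have tr: "tr x * a - (\<Sum>y\<in>UNIV. jr x y * b y) = \<kappa> x * a + (\<Sum>y\<in>UNIV. jr x y * (a - b y))" for x a b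
    by (simp add: total_rate_def algebra_simps sum_subtractf sum_distrib_left)
  have "f x \<ge> 0" for x
  proof -
    \<comment> \<open>Minimum principle: at a minimiser \<open>m\<close> the differences to the
      neighbours are nonpositive, so the equation makes \<open>\<kappa> m * f m\<close>
      positive.\<close>
    have "Min (range (f)) \<in> range (f)" by (rule Min_in) auto
    then obtain m where m: "Min (range (f)) = f m" by (rule rangeE)
    have le: "f m \<le> f y" for y unfolding m[symmetric] by (rule Min_le) auto
    have "\<kappa> m * f m + (\<Sum>y\<in>UNIV. jr m y * (f m - f y)) = 1" using eq[of m] unfolding tr .
    moreover have "(\<Sum>y\<in>UNIV. jr m y * (f m - f y)) \<le> 0"
      using le jr_nonneg by (intro sum_nonpos mult_nonneg_nonpos) auto
    ultimately have "\<kappa> m * f m > 0" by linarith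
    hence "f m \<ge> 0" using killing_nonneg[of m] by (simp add: zero_less_mult_iff)
    thus ?thesis using le[of x] by linarith
  qed
  thus ?thesis using eq by (intro exI[of _ "f"]) (auto simp: algebra_simps)
qed

end

subsection \<open>Path measures\<close>

context network
begin

definition path_distr :: "'v => 'v => 'v path measure" where
  "path_distr x y = distr (restrict_space (lborel \<Otimes>\<^sub>M SM) (alive x y)) path_space (\<lambda>(t, \<omega>). path_upto x t \<omega>)"

lemma alive_section: "t > 0 ==> Pair t -` alive x y = alive_at E C \<kappa> x y t"
  by (auto simp: alive_def alive_at_def space_pair_measure)

text \<open>Conditioning divides by the transition probability, and the factor in the path measure
  multiplies by it again. If this probability is zero, both sides vanish.\<close>

lemma bridge_law_transition:
  assumes t: "t > 0" and A: "A \<in> sets path_space"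
  shows "emeasure (bridge_law E C \<kappa> t x y) A * ennreal (transition_prob E C \<kappa> t x y)
    = emeasure SM {\<omega> \<in> alive_at E C \<kappa> x y t. path_upto x t \<omega> \<in> A}"
proof -
  interpret SM: prob_space SM by (rule prob_space_SM)
  let ?A = "alive_at E C \<kappa> x y t" and ?U = "uniform_measure SM (alive_at E C \<kappa> x y t)"
  have setsA: "?A \<in> sets SM" using sets_Pair1[OF sets_alive, of t x y] alive_section[OF t] by simp
  have meas: "path_upto x t \<in> restrict_space ?U ?A \<rightarrow>\<^sub>M path_space"
  proof -
    have "(\<lambda>\<omega>. (t, \<omega>)) \<in> restrict_space SM ?A \<rightarrow>\<^sub>M restrict_space (lborel \<Otimes>\<^sub>M SM) (alive x y)"
      by (rule measurable_restrict_space2) (use alive_section[OF t, of x y] in \<open>auto simp: space_restrict_space intro: measurable_restrict_space1\<close>)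
    from measurable_compose[OF this measurable_path_upto]
    have "path_upto x t \<in> restrict_space SM ?A \<rightarrow>\<^sub>M path_space" by simp
    moreover have "sets (restrict_space ?U ?A) = sets (restrict_space SM ?A)" by (simp add: sets_restrict_space)
    ultimately show ?thesis by (simp cong: measurable_cong_sets)
  qed
  let ?B = "{\<omega> \<in> ?A. path_upto x t \<omega> \<in> A}"
  have B: "path_upto x t -` A \<inter> space (restrict_space ?U ?A) = ?B"
    using sets.sets_into_space[OF setsA] by (auto simp: space_restrict_space)
  have setsB: "?B \<in> sets SM"
  proof -
    have "?B \<in> sets (restrict_space ?U ?A)" using measurable_sets[OF meas A] unfolding B .
    thus ?thesis using setsA by (auto simp: sets_restrict_space)
  qed
  have "emeasure (bridge_law E C \<kappa> t x y) A = emeasure (restrict_space ?U ?A) ?B"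
    unfolding bridge_law_def Let_def by (subst emeasure_distr[OF meas A]) (simp only: B)
  also have "\<dots> = emeasure ?U ?B" using setsA setsB by (intro emeasure_restrict_space) auto
  also have "\<dots> = emeasure SM (?A \<inter> ?B) / emeasure SM ?A" using setsA setsB by (rule emeasure_uniform_measure)
  also have "?A \<inter> ?B = ?B" by auto
  finally have e: "emeasure (bridge_law E C \<kappa> t x y) A = emeasure SM ?B / emeasure SM ?A" .
  have p: "ennreal (transition_prob E C \<kappa> t x y) = emeasure SM ?A"
    unfolding transition_prob_def by (rule SM.emeasure_eq_measure[symmetric])
  show ?thesis
  proof (cases "emeasure SM ?A = 0")
    case True
    hence "emeasure SM ?B = 0" using emeasure_mono[of ?B ?A SM] setsA by auto
    thus ?thesis using True p by simp
  next
    case False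
    thus ?thesis unfolding e p by (simp add: ennreal_divide_times ennreal_mult_divide_eq SM.emeasure_eq_measure)
  qed
qed

text \<open>Integrating the unconditioned laws over time shows that the set function in the
  definition of \<open>path_measure\<close> is the image of Lebesgue time times the sample law,
  restricted to the pairs of a time and a sample alive at that time. In particular it is a
  measure.\<close>

lemma path_measure_eq: "path_measure E C \<kappa> x y = path_distr x y"
proof -
  interpret SM: prob_space SM by (rule prob_space_SM)
  have "(\<integral>\<^sup>+t\<in>{0<..}. emeasure (bridge_law E C \<kappa> t x y) A * ennreal (transition_prob E C \<kappa> t x y) \<partial>lborel)
     = emeasure (path_distr x y) A" if A: "A \<in> sets path_space" for A
  proof -
    let ?D = "{w \<in> alive x y. (case w of (t, \<omega>) => path_upto x t \<omega>) \<in> A}"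
    have pre: "(\<lambda>(t, \<omega>). path_upto x t \<omega>) -` A \<inter> space (restrict_space (lborel \<Otimes>\<^sub>M SM) (alive x y)) = ?D"
      using sets.sets_into_space[OF sets_alive] by (auto simp: space_restrict_space)
    have setsD: "?D \<in> sets (lborel \<Otimes>\<^sub>M SM)"
    proof -
      have "?D \<in> sets (restrict_space (lborel \<Otimes>\<^sub>M SM) (alive x y))"
        using measurable_sets[OF measurable_path_upto A, of x y] unfolding pre .
      thus ?thesis using sets_alive by (auto simp: sets_restrict_space)
    qed
    have "emeasure (path_distr x y) A = emeasure (restrict_space (lborel \<Otimes>\<^sub>M SM) (alive x y)) ?D"
      unfolding path_distr_def by (subst emeasure_distr[OF measurable_path_upto A]) (simp only: pre)
    also have "\<dots> = emeasure (lborel \<Otimes>\<^sub>M SM) ?D" using sets_alive setsD by (intro emeasure_restrict_space) auto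
    also have "\<dots> = (\<integral>\<^sup>+t. emeasure SM (Pair t -` ?D) \<partial>lborel)"
      by (rule SM.emeasure_pair_measure_alt[OF setsD])
    also have "\<dots> = (\<integral>\<^sup>+t\<in>{0<..}. emeasure (bridge_law E C \<kappa> t x y) A * ennreal (transition_prob E C \<kappa> t x y) \<partial>lborel)"
    proof (rule nn_integral_cong)
      fix t :: real
      show "emeasure SM (Pair t -` ?D) = emeasure (bridge_law E C \<kappa> t x y) A * ennreal (transition_prob E C \<kappa> t x y) * indicator {0<..} t"
      proof (cases "t > 0")
        case True
        have "Pair t -` ?D = {\<omega> \<in> alive_at E C \<kappa> x y t. path_upto x t \<omega> \<in> A}"
          using alive_section[OF True, of x y] by auto
        thus ?thesis using bridge_law_transition[OF True A] True by simp
      next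
        case False
          hence e: "Pair t -` ?D = {}" by (auto simp: alive_def)
          have "emeasure SM (Pair t -` ?D) = 0" by (simp only: e emeasure_empty)
          thus ?thesis using False by (simp only:) simp
      qed
    qed
    finally show ?thesis ..
  qed
  hence "path_measure E C \<kappa> x y = measure_of (space path_space) (sets path_space) (emeasure (path_distr x y))"
    unfolding path_measure_def by (intro measure_of_eq sets.space_closed) (simp add: sets.sigma_sets_eq)
  also have "\<dots> = path_distr x y" using measure_of_of_measure[of "path_distr x y"] by (simp add: path_distr_def)
  finally show ?thesis .
qed

lemma sets_path_measure [simp, measurable_cong]: "sets (path_measure E C \<kappa> x y) = sets path_space"
  by (simp add: path_measure_eq path_distr_def)

lemma space_path_measure [simp]: "space (path_measure E C \<kappa> x y) = space path_space"
  by (simp add: path_measure_eq path_distr_def)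

lemma nn_integral_path_measure:
  assumes [measurable]: "f \<in> borel_measurable path_space"
  shows "(\<integral>\<^sup>+\<gamma>. f \<gamma> \<partial>path_measure E C \<kappa> x y)
    = (\<integral>\<^sup>+\<omega>. (\<integral>\<^sup>+t. f (path_upto x t \<omega>) * indicator (alive x y) (t, \<omega>) \<partial>lborel) \<partial>SM)"
proof -
  interpret SM: prob_space SM by (rule prob_space_SM)
  interpret P: pair_sigma_finite "lborel :: real measure" SM ..
  have m: "(\<lambda>w. f (case w of (t, \<omega>) => path_upto x t \<omega>)) \<in> borel_measurable (restrict_space (lborel \<Otimes>\<^sub>M SM) (alive x y))"
    by (rule measurable_compose[OF measurable_path_upto assms])
  have m2: "(\<lambda>w. f (case w of (t, \<omega>) => path_upto x t \<omega>) * indicator (alive x y) w) \<in> borel_measurable (lborel \<Otimes>\<^sub>M SM)"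
    using m sets_alive by (subst (asm) borel_measurable_restrict_space_iff_ennreal) auto
  have "(\<integral>\<^sup>+\<gamma>. f \<gamma> \<partial>path_measure E C \<kappa> x y)
    = (\<integral>\<^sup>+w. f (case w of (t, \<omega>) => path_upto x t \<omega>) \<partial>restrict_space (lborel \<Otimes>\<^sub>M SM) (alive x y))"
    unfolding path_measure_eq path_distr_def by (rule nn_integral_distr[OF measurable_path_upto]) simp
  also have "\<dots> = (\<integral>\<^sup>+w. f (case w of (t, \<omega>) => path_upto x t \<omega>) * indicator (alive x y) w \<partial>(lborel \<Otimes>\<^sub>M SM))"
    using sets_alive by (intro nn_integral_restrict_space) auto
  also have "\<dots> = (\<integral>\<^sup>+\<omega>. (\<integral>\<^sup>+t. f (case (t, \<omega>) of (t, \<omega>) => path_upto x t \<omega>) * indicator (alive x y) (t, \<omega>) \<partial>lborel) \<partial>SM)"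
    by (rule P.nn_integral_snd[OF m2, symmetric])
  finally show ?thesis by simp
qed

section \<open>Law of the skeleton under a weight by local times\<close>

fun walk_weight :: "('v => real) => 'v list => real" where
  "walk_weight k (a # b # zs) = jr a b / (tr a + k a) * walk_weight k (b # zs)"
| "walk_weight k [a] = 1 / (tr a + k a)"
| "walk_weight k [] = 0"

lemma walk_weight_nonneg: "(\<And>v. k v \<ge> 0) ==> walk_weight k zs \<ge> 0"
  using tr_pos jr_nonneg by (induction k zs rule: walk_weight.induct) (auto intro!: mult_nonneg_nonneg divide_nonneg_nonneg add_nonneg_nonneg intro: less_imp_le)

lemma walk_weight_prod:
  "zs \<noteq> [] ==> walk_weight k zs = (\<Prod>j<length zs - 1. jr (zs ! j) (zs ! Suc j) / (tr (zs ! j) + k (zs ! j))) * (1 / (tr (last zs) + k (last zs)))"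
  by (induction k zs rule: walk_weight.induct) (simp_all add: prod.lessThan_Suc_shift del: prod.lessThan_Suc)

lemma nn_integral_SM_prod:
  assumes fin: "finite I" and f: "\<And>i. i \<in> I ==> f i \<in> borel_measurable (FM i)"
  shows "(\<integral>\<^sup>+\<omega>. (\<Prod>i\<in>I. f i (\<omega> i)) \<partial>SM) = (\<Prod>i\<in>I. \<integral>\<^sup>+z. f i z \<partial>FM i)"
proof -
  have m: "(\<lambda>\<omega>. \<Prod>i\<in>I. f i (\<omega> i)) \<in> borel_measurable (PiM I FM)"
    using f by (intro borel_measurable_prod_ennreal measurable_compose[OF measurable_component_singleton]) auto
  have "(\<Prod>i\<in>I. \<integral>\<^sup>+z. f i z \<partial>FM i) = (\<integral>\<^sup>+\<omega>. (\<Prod>i\<in>I. f i (\<omega> i)) \<partial>PiM I FM)"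
    using FM.product_nn_integral_prod[OF fin f] by simp
  also have "\<dots> = (\<integral>\<^sup>+\<omega>. (\<Prod>i\<in>I. f i (\<omega> i)) \<partial>distr (PiM UNIV FM) (PiM I FM) (\<lambda>\<omega>. restrict \<omega> I))"
    using FM.distr_PiM_restrict_finite[OF fin] by simp
  also have "\<dots> = (\<integral>\<^sup>+\<omega>. (\<Prod>i\<in>I. f i (restrict \<omega> I i)) \<partial>PiM UNIV FM)"
    by (rule nn_integral_distr) (use m in \<open>auto intro: measurable_restrict_subset\<close>)
  also have "\<dots> = (\<integral>\<^sup>+\<omega>. (\<Prod>i\<in>I. f i (\<omega> i)) \<partial>PiM UNIV FM)"
    by (intro nn_integral_cong prod.cong) auto
  finally show ?thesis by (simp add: SM_eq)
qed

text \<open>There are no self-loops, so the rate of a jump to the present vertex is zero. Almost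
  surely the list of chain values is therefore the skeleton as it stands.\<close>

lemma AE_no_repeat: "AE \<omega> in SM. \<forall>j y. snd (\<omega> (j, y)) \<noteq> Some y"
proof -
  have "AE \<omega> in SM. snd (\<omega> (j, y)) \<noteq> Some y" for j y
  proof -
    interpret p: prob_space "measure_pmf (JL y)" by (rule prob_space_measure_pmf)
    interpret h: prob_space "HL y" by (rule prob_space_HL)
    interpret pair_sigma_finite "HL y" "measure_pmf (JL y)" ..
    have a: "AE z in measure_pmf (JL y). z \<noteq> Some y"
      unfolding AE_measure_pmf_iff using pmf_JL[of y "Some y"] by (auto simp: set_pmf_iff jr_self)
    have "AE w in HL y \<Otimes>\<^sub>M measure_pmf (JL y). snd w \<noteq> Some y"
    proof (rule AE_pair_measure)
      show "{w \<in> space (HL y \<Otimes>\<^sub>M measure_pmf (JL y)). snd w \<noteq> Some y} \<in> sets (HL y \<Otimes>\<^sub>M measure_pmf (JL y))"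
        by measurable
      show "AE h in HL y. AE z in measure_pmf (JL y). snd (h, z) \<noteq> Some y" using a by simp
    qed
    hence "AE w in FM (j, y). snd w \<noteq> Some y" unfolding FM_def prod.case .
    thus ?thesis unfolding SM_eq using FM.AE_component[of "(j, y)" "\<lambda>w. snd w \<noteq> Some y"] by simp
  qed
  thus ?thesis by (simp add: AE_all_countable)
qed

definition follows :: "'v sample => 'v list => bool" where
  "follows \<omega> zs \<longleftrightarrow> (\<forall>j<length zs - 1. snd (\<omega> (j, zs ! j)) = Some (zs ! Suc j))"

lemma follows_chain:
  assumes "follows \<omega> zs" "zs \<noteq> []" "hd zs = x" "j < length zs"
  shows "jump_chain x \<omega> j = Some (zs ! j)" using assms(4)
proof (induction j)
  case 0 thus ?case using assms by (simp add: hd_conv_nth)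
next
  case (Suc j)
  hence "jump_chain x \<omega> j = Some (zs ! j)" by simp
  moreover have "snd (\<omega> (j, zs ! j)) = Some (zs ! Suc j)" using assms(1) Suc.prems by (simp add: follows_def)
  ultimately show ?case by simp
qed

lemma chain_follows:
  assumes "\<And>j. j < length zs ==> jump_chain x \<omega> j = Some (zs ! j)"
  shows "follows \<omega> zs" unfolding follows_def
proof (intro allI impI)
  fix j assume "j < length zs - 1"
  thus "snd (\<omega> (j, zs ! j)) = Some (zs ! Suc j)" using assms[of j] assms[of "Suc j"] by simp
qed

lemma follows_jump_time:
  assumes "follows \<omega> zs" "zs \<noteq> []" "hd zs = x" "m \<le> length zs"
  shows "jump_time x \<omega> m = (\<Sum>j<m. fst (\<omega> (j, zs ! j)))"
  unfolding jump_time_def using follows_chain[OF assms(1-3)] assms(4) by (intro sum.cong) (auto simp: holding_time_def)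

lemma sum_local_time:
  fixes k :: "'v => real"
  assumes "has_skeleton \<gamma> ts ys"
  shows "(\<Sum>v\<in>UNIV. k v * local_time \<gamma> v)
    = (\<Sum>i<length ys. k (ys ! i) * ((if Suc i < length ys then ts ! Suc i else fst \<gamma>) - ts ! i))"
proof -
  have "(\<Sum>v\<in>UNIV. k v * local_time \<gamma> v)
    = (\<Sum>v\<in>UNIV. \<Sum>i<length ys. if ys ! i = v then k v * ((if Suc i < length ys then ts ! Suc i else fst \<gamma>) - ts ! i) else 0)"
    unfolding local_time_skeleton[OF assms] sum_distrib_left by (intro sum.cong refl) auto
  also have "\<dots> = (\<Sum>i<length ys. \<Sum>v\<in>UNIV. if ys ! i = v then k v * ((if Suc i < length ys then ts ! Suc i else fst \<gamma>) - ts ! i) else 0)"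
    by (rule sum.swap)
  also have "\<dots> = (\<Sum>i<length ys. k (ys ! i) * ((if Suc i < length ys then ts ! Suc i else fst \<gamma>) - ts ! i))"
    by simp
  finally show ?thesis .
qed

definition kill_exp :: "('v => real) => 'v path => real" where
  "kill_exp k \<gamma> = exp (- (\<Sum>v\<in>UNIV. k v * local_time \<gamma> v))"

lemma measurable_kill_exp [measurable]: "kill_exp k \<in> borel_measurable path_space"
  unfolding kill_exp_def[abs_def] by measurable

text \<open>The event that the skeleton is \<open>zs\<close> fixes the jump chain, and the weight splits into independent
  factors, one for each coordinate \<open>(j, zs ! j)\<close> of the sample.\<close>

lemma path_integrand:
  assumes \<omega>: "\<omega> \<in> space SM" "\<forall>j y. snd (\<omega> (j, y)) \<noteq> Some y" and t: "t > 0"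
    and zs: "zs \<noteq> []" "hd zs = x" "last zs = y"
  defines "m \<equiv> length zs - 1" and "h \<equiv> (\<lambda>j. fst (\<omega> (j, zs ! j)))"
  shows "ennreal (kill_exp k (path_upto x t \<omega>)) * indicator {zs} (skeleton (path_upto x t \<omega>)) * indicator (alive x y) (t, \<omega>)
    = (if follows \<omega> zs then ennreal (\<Prod>j<m. exp (- (k (zs ! j) * h j))) *
        (ennreal (exp (- (k (zs ! m) * (t - (\<Sum>j<m. h j))))) * indicator {0..<h m} (t - (\<Sum>j<m. h j))) else 0)"
proof -
  have len: "length zs = Suc m" using zs(1) by (cases zs) (auto simp: m_def)
  have chain_adj: "distinct_adj (chain_list x \<omega> n)" if al: "\<And>j. j \<le> n ==> jump_chain x \<omega> j \<noteq> None" for n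
    unfolding distinct_adj_conv_nth
  proof (intro allI impI)
    fix i assume "Suc i < length (chain_list x \<omega> n)"
    hence i: "Suc i \<le> n" by (simp add: chain_list_nth)
    obtain a b where a: "jump_chain x \<omega> i = Some a" and b: "jump_chain x \<omega> (Suc i) = Some b"
      using al[of i] al[of "Suc i"] i by auto
    hence "snd (\<omega> (i, a)) = Some b" by simp
    hence "a \<noteq> b" using \<omega>(2) by metis
    thus "chain_list x \<omega> n ! i \<noteq> chain_list x \<omega> n ! Suc i" using a b i by (simp add: chain_list_nth del: jump_chain.simps)
  qed
  show ?thesis
  proof (cases "follows \<omega> zs \<and> jump_time x \<omega> m \<le> t \<and> t < jump_time x \<omega> (Suc m)")
    case True
    hence fo: "follows \<omega> zs" and int: "jump_time x \<omega> m \<le> t" "t < jump_time x \<omega> (Suc m)" by auto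
    have ch: "jump_chain x \<omega> j = Some (zs ! j)" if "j \<le> m" for j using follows_chain[OF fo zs(1,2), of j] that len by simp
    have cl: "chain_list x \<omega> m = zs" by (rule nth_equalityI) (use len ch in \<open>auto simp: chain_list_nth\<close>)
    have sk: "has_skeleton (path_upto x t \<omega>) (time_list x \<omega> m) zs"
      using path_upto_skeleton[OF \<omega>(1) _ int] chain_adj[of m] ch t unfolding cl by simp
    have JT: "jump_time x \<omega> j = (\<Sum>i<j. h i)" if "j \<le> Suc m" for j
      using follows_jump_time[OF fo zs(1,2), of j] that len by (simp add: h_def)
    have "position x \<omega> t = Some (zs ! m)" using position_eq[OF \<omega>(1) int] ch[of m] by simp
    moreover have "zs ! m = y" using zs unfolding m_def by (simp add: last_conv_nth)
    ultimately have al: "(t, \<omega>) \<in> alive x y" using \<omega>(1) t by (simp add: alive_def space_pair_measure)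
    have "(\<Sum>v\<in>UNIV. k v * local_time (path_upto x t \<omega>) v)
      = (\<Sum>i<Suc m. k (zs ! i) * ((if Suc i < Suc m then time_list x \<omega> m ! Suc i else t) - time_list x \<omega> m ! i))"
      using sum_local_time[OF sk, of k] unfolding len by (simp only: path_upto_def fst_conv)
    also have "\<dots> = (\<Sum>i<m. k (zs ! i) * h i) + k (zs ! m) * (t - (\<Sum>j<m. h j))"
    proof -
      have "k (zs ! i) * ((if Suc i < Suc m then time_list x \<omega> m ! Suc i else t) - time_list x \<omega> m ! i) = k (zs ! i) * h i" if "i < m" for i
        using that JT[of i] JT[of "Suc i"] by (simp add: time_list_nth)
      hence "(\<Sum>i<m. k (zs ! i) * ((if Suc i < Suc m then time_list x \<omega> m ! Suc i else t) - time_list x \<omega> m ! i)) = (\<Sum>i<m. k (zs ! i) * h i)"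
        by (intro sum.cong) auto
      moreover have "time_list x \<omega> m ! m = (\<Sum>j<m. h j)" using JT[of m] by (simp add: time_list_nth)
      ultimately show ?thesis by simp
    qed
    finally have "kill_exp k (path_upto x t \<omega>) = (\<Prod>j<m. exp (- (k (zs ! j) * h j))) * exp (- (k (zs ! m) * (t - (\<Sum>j<m. h j))))"
      by (simp add: kill_exp_def exp_sum[symmetric] sum_negf exp_add[symmetric])
    moreover have "t - (\<Sum>j<m. h j) \<in> {0..<h m}" using int JT[of m] JT[of "Suc m"] by simp
    ultimately show ?thesis using fo al skeleton_eq[OF sk] by (simp add: ennreal_mult prod_nonneg)
  next
    case False
    have "\<not> (skeleton (path_upto x t \<omega>) = zs \<and> (t, \<omega>) \<in> alive x y)"
    proof
      assume a: "skeleton (path_upto x t \<omega>) = zs \<and> (t, \<omega>) \<in> alive x y"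
      hence "position x \<omega> t = Some y" by (simp add: alive_def)
      then obtain n where n: "jump_time x \<omega> n \<le> t" "t < jump_time x \<omega> (Suc n)"
        using position_Some_iff[OF \<omega>(1)] by blast
      have al: "jump_chain x \<omega> j \<noteq> None" if "j \<le> n" for j
        using path_upto_pre_skeleton(8)[OF \<omega>(1) _ n, of j] that t by auto
      have sk: "has_skeleton (path_upto x t \<omega>) (time_list x \<omega> n) (chain_list x \<omega> n)"
        using path_upto_skeleton[OF \<omega>(1) _ n chain_adj[OF al]] t by simp
      have cl: "chain_list x \<omega> n = zs" using a skeleton_eq[OF sk] by simp
      hence nm: "n = m" using len chain_list_nth(2)[of x \<omega> n] by simp
      have "follows \<omega> zs"
      proof (rule chain_follows)
        fix j assume "j < length zs"
        hence j: "j \<le> n" using nm len by simp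
        thus "jump_chain x \<omega> j = Some (zs ! j)" using al[OF j] chain_list_nth(1)[OF j, of x \<omega>] cl by auto
      qed
      thus False using False n nm by simp
    qed
    moreover have "t - (\<Sum>j<m. h j) \<notin> {0..<h m}" if fo: "follows \<omega> zs"
    proof -
      have "jump_time x \<omega> j = (\<Sum>i<j. h i)" if "j \<le> Suc m" for j
        using follows_jump_time[OF fo zs(1,2), of j] that len by (simp add: h_def)
      thus ?thesis using False fo by auto
    qed
    ultimately show ?thesis by (auto simp: indicator_def)
  qed
qed

text \<open>By independence, a step from a to b contributes the Laplace transform
  \<open>tr a / (tr a + k a)\<close> of the holding time times the jump probability
  \<open>jr a b / tr a\<close>, and the last vertex contributes \<open>1 / (tr a + k a)\<close>. The
  product is \<open>walk_weight\<close>, the term of the walk in the expansion of the Green function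
  with killing \<open>\<kappa> + k\<close>.\<close>

theorem path_measure_skeleton:
  assumes k: "\<And>v. k v \<ge> 0"
  shows "(\<integral>\<^sup>+\<gamma>. ennreal (kill_exp k \<gamma>) * indicator {zs} (skeleton \<gamma>) \<partial>path_measure E C \<kappa> x y)
    = (if zs \<noteq> [] \<and> hd zs = x \<and> last zs = y then ennreal (walk_weight k zs) else 0)"
proof -
  let ?f = "\<lambda>\<omega> t. ennreal (kill_exp k (path_upto x t \<omega>)) * indicator {zs} (skeleton (path_upto x t \<omega>)) * indicator (alive x y) (t, \<omega>)"
  interpret SM: prob_space SM by (rule prob_space_SM)
  have den: "0 \<le> tr a + k a" for a using tr_pos[of a] k[of a] by linarith
  have pos: "AE t in lborel. t \<noteq> (0::real)" by (rule AE_lborel_singleton)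
  have "(\<integral>\<^sup>+\<gamma>. ennreal (kill_exp k \<gamma>) * indicator {zs} (skeleton \<gamma>) \<partial>path_measure E C \<kappa> x y)
    = (\<integral>\<^sup>+\<omega>. (\<integral>\<^sup>+t. ?f \<omega> t \<partial>lborel) \<partial>SM)"
    by (rule nn_integral_path_measure) measurable
  also have "\<dots> = (if zs \<noteq> [] \<and> hd zs = x \<and> last zs = y then ennreal (walk_weight k zs) else 0)"
  proof (cases "zs \<noteq> [] \<and> hd zs = x \<and> last zs = y")
    case False
    have "indicator {zs} (skeleton (path_upto x t \<omega>)) * indicator (alive x y) (t, \<omega>) = (0::ennreal)" if \<omega>: "\<omega> \<in> space SM" for t \<omega>
    proof (rule ccontr)
      assume "indicator {zs} (skeleton (path_upto x t \<omega>)) * indicator (alive x y) (t, \<omega>) \<noteq> (0::ennreal)"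
      hence s: "skeleton (path_upto x t \<omega>) = zs" and al: "(t, \<omega>) \<in> alive x y" by (auto simp: indicator_def split: if_splits)
      have t: "t > 0" "position x \<omega> t = Some y" using al by (auto simp: alive_def)
      hence "path_upto x t \<omega> \<in> space path_space" using path_upto_space[OF \<omega>] by simp
      then obtain ts ys where sk: "has_skeleton (path_upto x t \<omega>) ts ys" by (auto simp: path_space_def space_restrict_space)
      hence ys: "ys = zs" "zs \<noteq> []" using s skeleton_eq[OF sk] unfolding has_skeleton_def by auto
      \<comment> \<open>A path is frozen before time 0 and after its lifetime, so its values at -1
        and at \<open>t\<close> are the first and the last vertex of the skeleton; they have to be
        \<open>x\<close> and \<open>y\<close>.\<close>
      have "snd (path_upto x t \<omega>) (-1) = hd zs" using sk ys by (auto simp: has_skeleton_def)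
      moreover have "0 < jump_time x \<omega> (Suc 0)" using jump_time_strict[OF \<omega>, of 0 "Suc 0" x] by (simp add: jump_time_def)
      hence "position x \<omega> 0 = jump_chain x \<omega> 0" by (intro position_eq[OF \<omega>]) (auto simp: jump_time_def)
      hence "snd (path_upto x t \<omega>) (-1) = x" by (simp add: path_upto_def min_def)
      moreover have "snd (path_upto x t \<omega>) t = last zs"
      proof -
        have "length ts = length zs" "ts \<noteq> []" "last ts \<le> t" using sk ys by (auto simp: has_skeleton_def path_upto_def)
        thus ?thesis using sk ys unfolding has_skeleton_def by (auto simp: last_conv_nth)
      qed
      moreover have "snd (path_upto x t \<omega>) t = y" using t by (simp add: path_upto_def)
      ultimately show False using False ys by simp
    qed
    hence "(\<integral>\<^sup>+\<omega>. (\<integral>\<^sup>+t. ?f \<omega> t \<partial>lborel) \<partial>SM)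
      = (\<integral>\<^sup>+\<omega>. 0 \<partial>SM)" by (intro nn_integral_cong) (simp only: mult.assoc, simp)
    thus ?thesis using False by auto
  next
    case True
    define m where "m = length zs - 1"
    have len: "length zs = Suc m" using True by (cases zs) (auto simp: m_def)
    have lastm: "last zs = zs ! m" unfolding m_def using True by (intro last_conv_nth) blast
    \<comment> \<open>The contribution of a last holding time of length \<open>h\<close>, integrated
      over the position of the lifetime inside it.\<close>
    define T where "T h = (\<integral>\<^sup>+s. ennreal (exp (- (k (zs ! m) * s))) * indicator {0..<h} s \<partial>lborel)" for h
    have Tm [measurable]: "T \<in> borel_measurable borel"
    proof -
      have "(\<lambda>p. ennreal (exp (- (k (zs ! m) * snd p))) * indicator {p. 0 \<le> snd p \<and> snd p < fst p} p) \<in> borel_measurable (borel \<Otimes>\<^sub>M (lborel :: real measure))"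
        by measurable
      hence "(\<lambda>h. \<integral>\<^sup>+s. ennreal (exp (- (k (zs ! m) * snd (h, s)))) * indicator {p. 0 \<le> snd p \<and> snd p < fst p} (h, s) \<partial>lborel) \<in> borel_measurable borel"
        by (rule lborel.borel_measurable_nn_integral_fst)
      moreover have "ennreal (exp (- (k (zs ! m) * snd (h, s)))) * indicator {p. 0 \<le> snd p \<and> snd p < fst p} (h, s) = ennreal (exp (- (k (zs ! m) * s))) * indicator {0..<h} s" for h s
        by (auto simp: indicator_def)
      ultimately show ?thesis unfolding T_def[abs_def] by (simp only:)
    qed
    have gen: "(\<lambda>t. ennreal (exp (- (a * (t - H)))) * indicator {0..<b} (t - H)) \<in> borel_measurable lborel" for a H b :: real
    proof -
      note HL_borel [measurable del]
      show ?thesis by measurable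
    qed
    \<comment> \<open>The factor that belongs to the coordinate \<open>(j, zs ! j)\<close> of the
      sample; these coordinates are distinct even where the walk revisits a vertex, because their
      first components differ.\<close>
    define G where "G j z = (if j < m then ennreal (exp (- (k (zs ! j) * fst z))) * indicator {Some (zs ! Suc j)} (snd z) else T (fst z))" for j and z :: "real \<times> 'v option"
    have Gm: "G j \<in> borel_measurable (FM (j, zs ! j))" for j
    proof -
      have f: "fst \<in> (HL (zs ! j) \<Otimes>\<^sub>M measure_pmf (JL (zs ! j))) \<rightarrow>\<^sub>M borel" by (rule measurable_compose[OF measurable_fst HL_borel])
      thus ?thesis unfolding G_def[abs_def] FM_def prod.case by (cases "j < m") measurable
    qed
    have "(\<integral>\<^sup>+\<omega>. (\<integral>\<^sup>+t. ?f \<omega> t \<partial>lborel) \<partial>SM)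
      = (\<integral>\<^sup>+\<omega>. (\<Prod>i\<in>(\<lambda>j. (j, zs ! j)) ` {..m}. G (fst i) (\<omega> i)) \<partial>SM)"
    proof (rule nn_integral_cong_AE)
      have "AE \<omega> in SM. \<omega> \<in> space SM" by simp
      thus "AE \<omega> in SM. (\<integral>\<^sup>+t. ?f \<omega> t \<partial>lborel)
        = (\<Prod>i\<in>(\<lambda>j. (j, zs ! j)) ` {..m}. G (fst i) (\<omega> i))" using AE_no_repeat
      proof eventually_elim
        case (elim \<omega>)
        let ?h = "\<lambda>j. fst (\<omega> (j, zs ! j))"
        let ?H = "\<Sum>j<m. ?h j"
        let ?P = "ennreal (\<Prod>j<m. exp (- (k (zs ! j) * ?h j)))"
        let ?g = "\<lambda>t. ennreal (exp (- (k (zs ! m) * (t - ?H)))) * indicator {0..<?h m} (t - ?H)"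
        have "(\<integral>\<^sup>+t. ?f \<omega> t \<partial>lborel)
          = (\<integral>\<^sup>+t. (if follows \<omega> zs then ?P * ?g t else 0) \<partial>lborel)"
        proof (rule nn_integral_cong_AE)
          show "AE t in lborel. ?f \<omega> t = (if follows \<omega> zs then ?P * ?g t else 0)" using pos
          proof eventually_elim
            fix t :: real assume "t \<noteq> 0"
            show "?f \<omega> t = (if follows \<omega> zs then ?P * ?g t else 0)"
            proof (cases "t > 0")
              case t: True
              show ?thesis using path_integrand[OF elim t, of zs x y k] True unfolding m_def[symmetric] by blast
            next
              case False
              hence "t < 0" using \<open>t \<noteq> 0\<close> by simp
              have "0 \<le> ?H" using hold_pos[OF elim(1)] by (intro sum_nonneg less_imp_le)
              hence "t - ?H < 0" using \<open>t < 0\<close> by simp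
              thus ?thesis using False by (auto simp: alive_def indicator_def)
            qed
          qed
        qed
        also have "\<dots> = (if follows \<omega> zs then ?P * T (?h m) else 0)"
        proof -
          have "(\<integral>\<^sup>+t. ?P * (?g t) \<partial>lborel) = ?P * T (?h m)"
          proof (subst nn_integral_cmult)
            have "(\<integral>\<^sup>+t. ?g t \<partial>lborel) = T (?h m)"
              by (subst nn_integral_real_affine[of _ 1 ?H]) (auto simp: T_def)
            thus "?P * (\<integral>\<^sup>+t. ?g t \<partial>lborel) = ?P * T (?h m)" by simp
          qed (rule gen)
          thus ?thesis by simp
        qed
        also have "\<dots> = (\<Prod>j\<le>m. G j (\<omega> (j, zs ! j)))"
        proof -
          have pr: "(\<Prod>j\<le>m. G j (\<omega> (j, zs ! j))) = (\<Prod>j<m. G j (\<omega> (j, zs ! j))) * T (?h m)"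
            by (simp add: lessThan_Suc_atMost[symmetric]) (simp add: G_def)
          show ?thesis
          proof (cases "follows \<omega> zs")
            case True
            hence "G j (\<omega> (j, zs ! j)) = ennreal (exp (- (k (zs ! j) * ?h j)))" if "j < m" for j
              using that by (simp add: G_def follows_def m_def)
            hence "(\<Prod>j<m. G j (\<omega> (j, zs ! j))) = ?P" by (simp add: prod_ennreal)
            thus ?thesis using True pr by simp
          next
            case False
            then obtain j where j: "j < m" "snd (\<omega> (j, zs ! j)) \<noteq> Some (zs ! Suc j)" by (auto simp: follows_def m_def)
            hence "G j (\<omega> (j, zs ! j)) = 0" by (simp add: G_def)
            hence "(\<Prod>j<m. G j (\<omega> (j, zs ! j))) = 0" using j(1) by (intro prod_zero) auto
            thus ?thesis using False pr by simp
          qed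
        qed
        also have "\<dots> = (\<Prod>i\<in>(\<lambda>j. (j, zs ! j)) ` {..m}. G (fst i) (\<omega> i))"
          by (subst prod.reindex) (auto simp: inj_on_def)
        finally show ?case .
      qed
    qed
    also have "\<dots> = (\<Prod>i\<in>(\<lambda>j. (j, zs ! j)) ` {..m}. \<integral>\<^sup>+z. G (fst i) z \<partial>FM i)"
      by (rule nn_integral_SM_prod) (auto simp: Gm)
    also have "\<dots> = (\<Prod>j\<le>m. \<integral>\<^sup>+z. G j z \<partial>FM (j, zs ! j))"
      by (subst prod.reindex) (auto simp: inj_on_def)
    also have "\<dots> = (\<Prod>j<m. \<integral>\<^sup>+z. G j z \<partial>FM (j, zs ! j)) * (\<integral>\<^sup>+z. G m z \<partial>FM (m, zs ! m))"
      by (simp add: lessThan_Suc_atMost[symmetric])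
    also have "(\<Prod>j<m. \<integral>\<^sup>+z. G j z \<partial>FM (j, zs ! j)) = (\<Prod>j<m. ennreal (jr (zs ! j) (zs ! Suc j) / (tr (zs ! j) + k (zs ! j))))"
    proof (intro prod.cong refl)
      fix j assume "j \<in> {..<m}"
      hence j: "j < m" by simp
      let ?y = "zs ! j"
      have Gj: "G j = (\<lambda>z. ennreal (exp (- (k ?y * fst z))) * indicator {Some (zs ! Suc j)} (snd z))" using j by (auto simp: G_def)
      have "(\<integral>\<^sup>+z. G j z \<partial>FM (j, ?y)) = (\<integral>\<^sup>+h. \<integral>\<^sup>+n. G j (h, n) \<partial>measure_pmf (JL ?y) \<partial>HL ?y)"
        using Gm[of j] unfolding FM_def prod.case by (rule measure_pmf.nn_integral_fst[symmetric])
      also have "\<dots> = (\<integral>\<^sup>+h. ennreal (exp (- (k ?y * h))) * ennreal (pmf (JL ?y) (Some (zs ! Suc j))) \<partial>HL ?y)"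
        unfolding Gj by (intro nn_integral_cong) (simp add: nn_integral_cmult emeasure_pmf_single)
      also have "\<dots> = (\<integral>\<^sup>+h. ennreal (exp (- (k ?y * h))) \<partial>HL ?y) * ennreal (pmf (JL ?y) (Some (zs ! Suc j)))"
        by (rule nn_integral_multc) (use measurable_compose[OF HL_borel, of "\<lambda>h. ennreal (exp (- (k ?y * h)))" borel] in simp)
      also have "\<dots> = ennreal (tr ?y / (tr ?y + k ?y)) * ennreal (jr ?y (zs ! Suc j) / tr ?y)"
        by (simp add: nn_integral_HL_exp k pmf_JL)
      also have "\<dots> = ennreal (jr ?y (zs ! Suc j) / (tr ?y + k ?y))"
        using tr_pos[of ?y] k[of ?y] jr_nonneg[of ?y] by (subst ennreal_mult[symmetric]) (auto simp: field_simps)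
      finally show "(\<integral>\<^sup>+z. G j z \<partial>FM (j, ?y)) = ennreal (jr ?y (zs ! Suc j) / (tr ?y + k ?y))" .
    qed
    also have "\<dots> = ennreal (\<Prod>j<m. jr (zs ! j) (zs ! Suc j) / (tr (zs ! j) + k (zs ! j)))"
      using den jr_nonneg by (intro prod_ennreal) (auto intro!: divide_nonneg_nonneg)
    also have "(\<integral>\<^sup>+z. G m z \<partial>FM (m, zs ! m)) = ennreal (1 / (tr (zs ! m) + k (zs ! m)))"
    proof -
      let ?y = "zs ! m"
      have "(\<integral>\<^sup>+z. G m z \<partial>FM (m, ?y)) = (\<integral>\<^sup>+h. \<integral>\<^sup>+n. G m (h, n) \<partial>measure_pmf (JL ?y) \<partial>HL ?y)"
        using Gm[of m] unfolding FM_def prod.case by (rule measure_pmf.nn_integral_fst[symmetric])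
      also have "\<dots> = (\<integral>\<^sup>+h. T h \<partial>HL ?y)" by (simp add: G_def measure_pmf.emeasure_space_1[simplified])
      finally show ?thesis unfolding T_def using nn_integral_HL_truncated[OF k] by simp
    qed
    finally show ?thesis using True walk_weight_prod[of zs k, folded m_def] den jr_nonneg
      by (simp add: lastm ennreal_mult[symmetric] prod_nonneg divide_nonneg_nonneg)
  qed
  finally show ?thesis .
qed

end

lemma has_sum_sum:
  fixes f :: "'i => 'a => 'b::real_normed_vector"
  assumes "finite I" "\<And>i. i \<in> I ==> (f i has_sum s i) A"
  shows "((\<lambda>a. \<Sum>i\<in>I. f i a) has_sum (\<Sum>i\<in>I. s i)) A"
  using assms by (induction I rule: finite_induct) (auto intro: has_sum_add)

context network
begin

abbreviation "PM \<equiv> path_measure E C \<kappa>"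

definition bridge_weight :: "('v => real) => 'v => 'v => 'v list => real" where
  "bridge_weight k x y zs = (if zs \<noteq> [] \<and> hd zs = x \<and> last zs = y then walk_weight k zs else 0)"

lemma bridge_weight_nonneg: "(\<And>v. k v \<ge> 0) ==> bridge_weight k x y zs \<ge> 0"
  by (simp add: bridge_weight_def walk_weight_nonneg)

text \<open>Additional killing only lowers the weights. Splitting off the first step bounds the
  total weight of walks with at most \<open>n\<close> vertices by the mean lifetime, uniformly in
  \<open>n\<close>.\<close>

lemma summable_walk_weight:
  assumes k: "\<And>v. k v \<ge> 0"
  shows "bridge_weight k x y summable_on UNIV"
proof -
  obtain u where u: "\<And>x. u x \<ge> 0" "\<And>x. tr x * u x = 1 + (\<Sum>y\<in>UNIV. jr x y * u y)"
    using exists_mean_lifetime by blast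
  define LN where "LN x n = {zs. length zs \<le> n \<and> zs \<noteq> [] \<and> hd zs = x}" for x :: 'v and n
  have fin: "finite (LN x n)" for x n
    by (rule finite_subset[OF _ finite_lists_length_le[of "UNIV :: 'v set" n]]) (auto simp: LN_def)
  have w0: "walk_weight k zs \<ge> 0" for zs using walk_weight_nonneg k by blast
  have den: "tr x + k x > 0" "tr x + k x \<ge> tr x" for x using tr_pos[of x] k[of x] by auto
  have bd: "(\<Sum>zs\<in>LN x n. walk_weight k zs) \<le> u x" for x n
  proof (induction n arbitrary: x)
    case 0
    have "LN x 0 = {}" by (auto simp: LN_def)
    thus ?case using u by simp
  next
    case (Suc n)
    \<comment> \<open>A walk from \<open>x\<close> is either the single vertex or a step followed by
      a walk with one vertex less.\<close>
    have sub: "LN x (Suc n) = insert [x] ((#) x ` (\<Union>y. LN y n))"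
    proof (intro equalityI subsetI)
      fix zs assume "zs \<in> LN x (Suc n)"
      then obtain w where w: "zs = x # w" "length w \<le> n" by (cases zs) (auto simp: LN_def)
      show "zs \<in> insert [x] ((#) x ` (\<Union>y. LN y n))" using w by (cases "w = []") (auto simp: LN_def)
    qed (auto simp: LN_def)
    have disj: "[x] \<notin> (#) x ` (\<Union>y. LN y n)" by (auto simp: LN_def)
    have finU: "finite (\<Union>y. LN y n)" using fin by simp
    have "(\<Sum>zs\<in>LN x (Suc n). walk_weight k zs) = walk_weight k [x] + (\<Sum>zs\<in>(#) x ` (\<Union>y. LN y n). walk_weight k zs)"
      unfolding sub by (rule sum.insert[OF finite_imageI[OF finU] disj])
    moreover have "(\<Sum>zs\<in>(#) x ` (\<Union>y. LN y n). walk_weight k zs) = (\<Sum>zs\<in>(\<Union>y. LN y n). walk_weight k (x # zs))"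
      by (subst sum.reindex) (auto simp: inj_on_def)
    moreover have "(\<Sum>zs\<in>(\<Union>y. LN y n). walk_weight k (x # zs)) = (\<Sum>y\<in>UNIV. \<Sum>zs\<in>LN y n. walk_weight k (x # zs))"
      using fin by (intro sum.UNION_disjoint) (auto simp: LN_def)
    moreover have "(\<Sum>zs\<in>LN y n. walk_weight k (x # zs)) = jr x y / (tr x + k x) * (\<Sum>zs\<in>LN y n. walk_weight k zs)" for y
      unfolding sum_distrib_left
    proof (rule sum.cong[OF refl])
      fix zs assume "zs \<in> LN y n"
      then obtain w where "zs = y # w" by (cases zs) (auto simp: LN_def)
      thus "walk_weight k (x # zs) = jr x y / (tr x + k x) * walk_weight k zs" by simp
    qed
    moreover have "(\<Sum>y\<in>UNIV. jr x y / (tr x + k x) * (\<Sum>zs\<in>LN y n. walk_weight k zs)) \<le> (\<Sum>y\<in>UNIV. jr x y / (tr x + k x) * u y)"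
      using Suc.IH jr_nonneg den(1) by (intro sum_mono mult_left_mono divide_nonneg_pos) auto
    ultimately have "(\<Sum>zs\<in>LN x (Suc n). walk_weight k zs) \<le> 1 / (tr x + k x) + (\<Sum>y\<in>UNIV. jr x y / (tr x + k x) * u y)"
      by simp
    also have "\<dots> = (tr x * u x) / (tr x + k x)" unfolding u(2) by (simp add: add_divide_distrib sum_divide_distrib)
    also have "\<dots> \<le> u x"
      using den(1)[of x] mult_right_mono[OF den(2)[of x] u(1)[of x]] by (simp add: divide_le_eq mult.commute)
    finally show ?case .
  qed
  show ?thesis
  proof (rule nonneg_bdd_above_summable_on)
    show "bridge_weight k x y zs \<ge> 0" for zs using w0 by (simp add: bridge_weight_def)
    show "bdd_above (sum (bridge_weight k x y) ` {F. F \<subseteq> UNIV \<and> finite F})"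
    proof (rule bdd_aboveI2)
      fix F :: "'v list set" assume F: "F \<in> {F. F \<subseteq> UNIV \<and> finite F}"
      let ?n = "Max (length ` F)"
      have "sum (bridge_weight k x y) F \<le> (\<Sum>zs\<in>F. if zs \<noteq> [] \<and> hd zs = x then walk_weight k zs else 0)"
        using w0 by (intro sum_mono) (auto simp: bridge_weight_def)
      also have "\<dots> = (\<Sum>zs\<in>{zs\<in>F. zs \<noteq> [] \<and> hd zs = x}. walk_weight k zs)"
        using F by (intro sum.mono_neutral_cong_right) auto
      also have "\<dots> \<le> (\<Sum>zs\<in>LN x ?n. walk_weight k zs)" using F fin w0 by (intro sum_mono2) (auto simp: LN_def)
      also have "\<dots> \<le> u x" by (rule bd)
      finally show "sum (bridge_weight k x y) F \<le> u x" .
    qed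
  qed
qed

text \<open>Walks form a countable set, so the law is determined by its atoms. Integrals of
  functions of the skeleton thereby become sums over walks.\<close>

lemma skeleton_law:
  assumes k: "\<And>v. k v \<ge> 0"
  shows "distr (density (PM x y) (\<lambda>\<gamma>. ennreal (kill_exp k \<gamma>))) (count_space UNIV) skeleton
    = density (count_space UNIV) (\<lambda>zs. ennreal (bridge_weight k x y zs))"
proof (rule measure_eqI_countable[of _ UNIV])
  fix zs :: "'v list"
  have s: "{\<gamma> \<in> space path_space. skeleton \<gamma> = zs} \<in> sets path_space"
    using measurable_sets[OF measurable_skeleton, of "{zs}"] by (simp add: vimage_def Int_def conj_commute)
  have "emeasure (distr (density (PM x y) (\<lambda>\<gamma>. ennreal (kill_exp k \<gamma>))) (count_space UNIV) skeleton) {zs}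
    = (\<integral>\<^sup>+\<gamma>. ennreal (kill_exp k \<gamma>) * indicator {\<gamma> \<in> space path_space. skeleton \<gamma> = zs} \<gamma> \<partial>PM x y)"
    using s by (subst emeasure_distr) (auto simp: emeasure_density vimage_def Int_def conj_commute)
  also have "\<dots> = (\<integral>\<^sup>+\<gamma>. ennreal (kill_exp k \<gamma>) * indicator {zs} (skeleton \<gamma>) \<partial>PM x y)"
    by (intro nn_integral_cong) (auto simp: indicator_def)
  also have "\<dots> = ennreal (bridge_weight k x y zs)" unfolding path_measure_skeleton[OF k] bridge_weight_def by simp
  also have "\<dots> = emeasure (density (count_space UNIV) (\<lambda>zs. ennreal (bridge_weight k x y zs))) {zs}"
    by (simp add: emeasure_density)
  finally show "emeasure (distr (density (PM x y) (\<lambda>\<gamma>. ennreal (kill_exp k \<gamma>))) (count_space UNIV) skeleton) {zs}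
    = emeasure (density (count_space UNIV) (\<lambda>zs. ennreal (bridge_weight k x y zs))) {zs}" .
qed auto

lemma nn_integral_skeleton:
  assumes k: "\<And>v. k v \<ge> 0"
  shows "(\<integral>\<^sup>+\<gamma>. ennreal (kill_exp k \<gamma>) * f (skeleton \<gamma>) \<partial>PM x y)
    = (\<integral>\<^sup>+zs. ennreal (bridge_weight k x y zs) * f zs \<partial>count_space UNIV)"
proof -
  have "(\<integral>\<^sup>+zs. ennreal (bridge_weight k x y zs) * f zs \<partial>count_space UNIV)
    = (\<integral>\<^sup>+zs. f zs \<partial>distr (density (PM x y) (\<lambda>\<gamma>. ennreal (kill_exp k \<gamma>))) (count_space UNIV) skeleton)"
    unfolding skeleton_law[OF k] by (subst nn_integral_density) auto
  also have "\<dots> = (\<integral>\<^sup>+\<gamma>. f (skeleton \<gamma>) \<partial>density (PM x y) (\<lambda>\<gamma>. ennreal (kill_exp k \<gamma>)))"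
    by (rule nn_integral_distr) auto
  also have "\<dots> = (\<integral>\<^sup>+\<gamma>. ennreal (kill_exp k \<gamma>) * f (skeleton \<gamma>) \<partial>PM x y)"
    by (rule nn_integral_density) (auto intro: measurable_compose[OF measurable_skeleton])
  finally show ?thesis ..
qed

lemma kill_exp_bounds: "(\<And>v. k v \<ge> 0) ==> kill_exp k \<gamma> \<le> 1" "kill_exp k \<gamma> > 0" "kill_exp (\<lambda>_. 0) \<gamma> = 1"
  unfolding kill_exp_def by (auto intro!: sum_nonneg mult_nonneg_nonneg simp: local_time_def set_lebesgue_integral_def)

lemma integrable_bridge_weight:
  assumes "\<And>v. k v \<ge> 0" shows "integrable (count_space UNIV) (bridge_weight k x y)"
  using summable_walk_weight[OF assms] abs_summable_equivalent[of "bridge_weight k x y" UNIV]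
  by (simp add: abs_summable_on_def bridge_weight_nonneg[OF assms])

lemma finite_path_measure: "finite_measure (PM x y)"
proof
  have "emeasure (PM x y) (space (PM x y)) = (\<integral>\<^sup>+\<gamma>. ennreal (kill_exp (\<lambda>_. 0) \<gamma>) * 1 \<partial>PM x y)"
    by (simp add: kill_exp_bounds del: space_path_measure)
  also have "\<dots> = (\<integral>\<^sup>+zs. ennreal (bridge_weight (\<lambda>_. 0) x y zs) \<partial>count_space UNIV)"
    using nn_integral_skeleton[where k = "\<lambda>_. 0" and f = "\<lambda>_. 1"] by simp
  also have "\<dots> = ennreal (\<integral>zs. bridge_weight (\<lambda>_. 0) x y zs \<partial>count_space UNIV)"
    using integrable_bridge_weight[of "\<lambda>_. 0"] by (intro nn_integral_eq_integral) (auto simp: bridge_weight_nonneg)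
  finally show "emeasure (PM x y) (space (PM x y)) \<noteq> \<infinity>" by simp
qed

lemma walk_weight_walk_on: "walk_weight k zs \<noteq> 0 ==> walk_on E zs"
  by (induction k zs rule: walk_weight.induct) (auto simp: walk_on_def jump_rate_def split: if_splits)

text \<open>The weights vanish on lists that use a non-edge or have the wrong end vertices; this is
  the case of zero extra killing.\<close>

lemma AE_skeleton: "AE \<gamma> in PM x y. walk_on E (skeleton \<gamma>) \<and> hd (skeleton \<gamma>) = x \<and> last (skeleton \<gamma>) = y"
proof -
  let ?P = "\<lambda>zs. walk_on E zs \<and> hd zs = x \<and> last zs = y"
  have "(\<integral>\<^sup>+\<gamma>. indicator {zs. \<not> ?P zs} (skeleton \<gamma>) \<partial>PM x y) = (\<integral>\<^sup>+\<gamma>. ennreal (kill_exp (\<lambda>_. 0) \<gamma>) * indicator {zs. \<not> ?P zs} (skeleton \<gamma>) \<partial>PM x y)"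
    by (simp add: kill_exp_bounds)
  also have "\<dots> = (\<integral>\<^sup>+zs. ennreal (bridge_weight (\<lambda>_. 0) x y zs) * indicator {zs. \<not> ?P zs} zs \<partial>count_space UNIV)"
    by (rule nn_integral_skeleton) simp
  also have "\<dots> = (\<integral>\<^sup>+(zs :: 'v list). 0 \<partial>count_space UNIV)"
  proof (rule nn_integral_cong)
    fix zs
    show "ennreal (bridge_weight (\<lambda>_. 0) x y zs) * indicator {zs. \<not> ?P zs} zs = 0"
      using walk_weight_walk_on[of "\<lambda>_. 0" zs] by (cases "walk_weight (\<lambda>_. 0) zs = 0") (auto simp: bridge_weight_def)
  qed
  finally have "(\<integral>\<^sup>+\<gamma>. indicator {zs. \<not> ?P zs} (skeleton \<gamma>) \<partial>PM x y) = 0" by simp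
  hence "AE \<gamma> in PM x y. indicator {zs. \<not> ?P zs} (skeleton \<gamma>) = (0::ennreal)"
    by (subst (asm) nn_integral_0_iff_AE) (auto intro: measurable_compose[OF measurable_skeleton])
  thus ?thesis by eventually_elim (auto simp: indicator_def split: if_splits)
qed

lemma integral_skeleton:
  fixes f :: "'v list => 'b::euclidean_space"
  assumes k: "\<And>v. k v \<ge> 0"
  shows "(\<integral>\<gamma>. kill_exp k \<gamma> *\<^sub>R f (skeleton \<gamma>) \<partial>PM x y) = (\<integral>zs. bridge_weight k x y zs *\<^sub>R f zs \<partial>count_space UNIV)"
proof -
  have "(\<integral>zs. bridge_weight k x y zs *\<^sub>R f zs \<partial>count_space UNIV)
    = (\<integral>zs. f zs \<partial>distr (density (PM x y) (\<lambda>\<gamma>. ennreal (kill_exp k \<gamma>))) (count_space UNIV) skeleton)"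
    unfolding skeleton_law[OF k] by (subst integral_density) (auto simp: bridge_weight_nonneg[OF k])
  also have "\<dots> = (\<integral>\<gamma>. f (skeleton \<gamma>) \<partial>density (PM x y) (\<lambda>\<gamma>. ennreal (kill_exp k \<gamma>)))"
    by (rule integral_distr) auto
  also have "\<dots> = (\<integral>\<gamma>. kill_exp k \<gamma> *\<^sub>R f (skeleton \<gamma>) \<partial>PM x y)"
    by (rule integral_density) (auto intro: measurable_compose[OF measurable_skeleton] simp: kill_exp_def)
  finally show ?thesis ..
qed

section \<open>The twisted Green function as an integral over paths\<close>

lemma conj_hol_norm:
  assumes "is_connection \<beta> E U" "walk_on E zs"
  shows "norm (hol U zs ** b ** adj (hol U zs)) = norm b"
proof -
  have "hol U zs \<in> unitary_group \<beta>" using hol_unitary[OF assms(1)] assms(2) by (simp add: walk_on_def)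
  thus ?thesis using norm_unitary_mult(1)[of "hol U zs" \<beta> b] norm_unitary_mult(2)[of "adj (hol U zs)" \<beta> "hol U zs ** b"] unitary_closed(2)
    by metis
qed

text \<open>Column of the Green function of the twisted Laplacian with killing
  \<open>\<kappa> + k\<close>: the source is the matrix \<open>b\<close> at \<open>v\<close>, and
  the value at \<open>u\<close> averages its transports along paths from \<open>u\<close> to
  \<open>v\<close>.\<close>

definition holonomy_green ::
  "('v => real) => ('v => 'v => quat^'n^'n) => 'v => quat^'n^'n => 'v => quat^'n^'n" where
  "holonomy_green k U v b u = (\<integral>\<gamma>. kill_exp k \<gamma> *\<^sub>R (hol U (skeleton \<gamma>) ** b ** adj (hol U (skeleton \<gamma>))) \<partial>PM u v)"

context
  fixes \<beta> and U :: "'v => 'v => quat^'n^'n" and k :: "'v => real"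
  assumes conn: "is_connection \<beta> E U" and k: "\<And>v. k v \<ge> 0"
begin

lemma integrable_green: "integrable (count_space UNIV) (\<lambda>zs. bridge_weight k u v zs *\<^sub>R (hol U zs ** b ** adj (hol U zs)))"
proof (rule Bochner_Integration.integrable_bound)
  show "integrable (count_space UNIV) (\<lambda>zs. bridge_weight k u v zs * norm b)" using integrable_bridge_weight[OF k] by simp
  show "AE zs in count_space UNIV. norm (bridge_weight k u v zs *\<^sub>R (hol U zs ** b ** adj (hol U zs))) \<le> norm (bridge_weight k u v zs * norm b)"
  proof (rule AE_I2)
    fix zs
    show "norm (bridge_weight k u v zs *\<^sub>R (hol U zs ** b ** adj (hol U zs))) \<le> norm (bridge_weight k u v zs * norm b)"
    proof (cases "walk_weight k zs = 0")
      case True thus ?thesis by (simp add: bridge_weight_def)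
    next
      case False
      hence "norm (hol U zs ** b ** adj (hol U zs)) = norm b" using conj_hol_norm[OF conn] walk_weight_walk_on by blast
      thus ?thesis by (simp add: abs_mult)
    qed
  qed
qed simp

lemma has_sum_green: "((\<lambda>zs. bridge_weight k u v zs *\<^sub>R (hol U zs ** b ** adj (hol U zs))) has_sum holonomy_green k U v b u) UNIV"
proof -
  let ?f = "\<lambda>zs. bridge_weight k u v zs *\<^sub>R (hol U zs ** b ** adj (hol U zs))"
  have a: "Infinite_Set_Sum.abs_summable_on ?f UNIV" using integrable_green by (simp add: abs_summable_on_def)
  hence "infsetsum ?f UNIV = infsum ?f UNIV" by (rule infsetsum_infsum)
  moreover have "infsetsum ?f UNIV = holonomy_green k U v b u"
    unfolding infsetsum_def holonomy_green_def using integral_skeleton[OF k, where f = "\<lambda>zs. hol U zs ** b ** adj (hol U zs)"] by simp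
  moreover have "?f summable_on UNIV" using a abs_summable_equivalent abs_summable_summable by blast
  ultimately show ?thesis by (simp add: has_sum_iff)
qed

text \<open>Decomposition by the first step of the walk. Absolute convergence allows the sum over
  walks to be split.\<close>

lemma green_equation:
  "(tr u + k u) *\<^sub>R holonomy_green k U v b u = (if u = v then b else 0)
     + (\<Sum>y\<in>UNIV. jr u y *\<^sub>R (U u y ** holonomy_green k U v b y ** U y u))"
proof -
  let ?f = "\<lambda>u zs. bridge_weight k u v zs *\<^sub>R (hol U zs ** b ** adj (hol U zs))"
  let ?g = "\<lambda>w. \<Sum>y\<in>UNIV. jr u y *\<^sub>R (U u y ** ?f y w ** U y u)"
  have den: "tr u + k u > 0" using tr_pos[of u] k[of u] by linarith
  have "((\<lambda>zs. (tr u + k u) *\<^sub>R ?f u zs) has_sum (tr u + k u) *\<^sub>R holonomy_green k U v b u) UNIV"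
    by (rule has_sum_scaleR) (rule has_sum_green)
  hence "((\<lambda>zs. (tr u + k u) *\<^sub>R ?f u zs) has_sum (tr u + k u) *\<^sub>R holonomy_green k U v b u) (range ((#) u))"
    by (rule iffD1[OF has_sum_cong_neutral, rotated -1]) (auto simp: bridge_weight_def image_iff neq_Nil_conv)
  hence 1: "((\<lambda>w. (tr u + k u) *\<^sub>R ?f u (u # w)) has_sum (tr u + k u) *\<^sub>R holonomy_green k U v b u) UNIV"
    by (subst (asm) has_sum_reindex) (auto simp: o_def)
  \<comment> \<open>A walk from \<open>u\<close> is \<open>u # w\<close>. The empty \<open>w\<close>
    is the walk that stays at \<open>u\<close> and gives the source term if \<open>u = v\<close>;
    otherwise the first edge contributes its rate and the conjugation by the connection, and the
    remainder is a walk from the neighbour.\<close>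
  have g: "(\<lambda>w. (tr u + k u) *\<^sub>R ?f u (u # w)) = (\<lambda>w. (if w = [] then (if u = v then b else 0) else 0) + ?g w)"
  proof
    fix w
    show "(tr u + k u) *\<^sub>R ?f u (u # w) = (if w = [] then (if u = v then b else 0) else 0) + ?g w"
    proof (cases w)
      case Nil thus ?thesis using den by (cases "u = v") (simp_all add: bridge_weight_def)
    next
      case (Cons z w')
      have "?g w = (\<Sum>y\<in>UNIV. if y = z then jr u y *\<^sub>R (U u y ** ?f y w ** U y u) else 0)"
        using Cons by (intro sum.cong refl) (auto simp: bridge_weight_def)
      also have "\<dots> = jr u z *\<^sub>R (U u z ** ?f z w ** U z u)" by simp
      also have "\<dots> = (tr u + k u) *\<^sub>R ?f u (u # w)"
      proof (cases "(u, z) \<in> E")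
        case True
        hence "U z u = adj (U u z)" using conn by (auto simp: is_connection_def)
        thus ?thesis using Cons den by (simp add: bridge_weight_def adj_mult matrix_mul_assoc mult_scaleR)
      next
        case False thus ?thesis using Cons by (simp add: jump_rate_def bridge_weight_def)
      qed
      finally show ?thesis using Cons by simp
    qed
  qed
  have "(?g has_sum (\<Sum>y\<in>UNIV. jr u y *\<^sub>R (U u y ** holonomy_green k U v b y ** U y u))) UNIV"
  proof (rule has_sum_sum)
    fix y
    have bl: "bounded_linear (\<lambda>M. jr u y *\<^sub>R (U u y ** M ** U y u))"
      by (intro linear_conv_bounded_linear[THEN iffD1] linearI) (simp_all add: matrix_add_ldistrib quat_matrix_add_rdistrib mult_scaleR scaleR_add_right)
    show "((\<lambda>w. jr u y *\<^sub>R (U u y ** ?f y w ** U y u)) has_sum jr u y *\<^sub>R (U u y ** holonomy_green k U v b y ** U y u)) UNIV"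
      using has_sum_bounded_linear[OF bl has_sum_green] by (simp add: o_def)
  qed simp
  moreover have "((\<lambda>w. if w = [] then (if u = v then b else 0) else 0) has_sum (if u = v then b else 0)) (UNIV :: 'v list set)"
  proof -
    have "((\<lambda>w. if w = [] then c else 0) has_sum c) (UNIV :: 'v list set)" for c :: "quat^'n^'n"
      using has_sum_cong_neutral[of UNIV "{[] :: 'v list}" "\<lambda>w. if w = [] then c else 0" "\<lambda>_. c" c] has_sum_finite[of "{[] :: 'v list}" "\<lambda>_. c"] by auto
    thus ?thesis .
  qed
  ultimately have "((\<lambda>w. (if w = [] then (if u = v then b else 0) else 0) + ?g w) has_sum (if u = v then b else 0)
     + (\<Sum>y\<in>UNIV. jr u y *\<^sub>R (U u y ** holonomy_green k U v b y ** U y u))) UNIV" by (intro has_sum_add)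
  thus ?thesis using 1 unfolding g by (rule has_sum_unique[rotated])
qed

text \<open>Each walk contributes a conjugate of a hermitian matrix, and the hermitian matrices form
  a closed subspace.\<close>

lemma green_hermitian:
  assumes b: "b \<in> hermitian_space \<beta>"
  shows "holonomy_green k U v b u \<in> hermitian_space \<beta>"
proof -
  have f: "bridge_weight k u v zs *\<^sub>R (hol U zs ** b ** adj (hol U zs)) \<in> hermitian_space \<beta>" for zs
  proof (cases "bridge_weight k u v zs = 0")
    case True thus ?thesis using subspace_0[OF subspace_hermitian_space] by simp
  next
    case False
    hence "walk_on E zs" using walk_weight_walk_on by (auto simp: bridge_weight_def split: if_splits)
    hence "hol U zs \<in> scalar_matrices \<beta>" using hol_unitary[OF conn, of zs] by (auto simp: walk_on_def unitary_group_iff)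
    thus ?thesis using hermitian_conj[OF b] subspace_scale[OF subspace_hermitian_space] by blast
  qed
  show ?thesis
  proof (rule Lim_in_closed_set[OF closed_subspace[OF subspace_hermitian_space]])
    show "(sum (\<lambda>zs. bridge_weight k u v zs *\<^sub>R (hol U zs ** b ** adj (hol U zs))) \<longlongrightarrow> holonomy_green k U v b u) (finite_subsets_at_top UNIV)"
      using has_sum_green unfolding has_sum_def .
    show "\<forall>\<^sub>F F in finite_subsets_at_top UNIV. (\<Sum>zs\<in>F. bridge_weight k u v zs *\<^sub>R (hol U zs ** b ** adj (hol U zs))) \<in> hermitian_space \<beta>"
      using f by (intro always_eventually allI subspace_sum[OF subspace_hermitian_space])
  qed simp
qed

end

end

subsection \<open>The twisted Gaussian field\<close>

text \<open>The constant is the minimum of the form on the compact unit sphere, extended to all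
  vectors by homogeneity.\<close>

lemma coercive_of_positive:
  fixes Q :: "'a::euclidean_space => 'a"
  assumes lin: "linear Q" and pos: "\<And>x. x \<noteq> 0 ==> inner (Q x) x > 0"
  shows "\<exists>\<epsilon>>0. \<forall>x. inner (Q x) x \<ge> \<epsilon> * (norm x)\<^sup>2"
proof -
  have cont: "continuous_on A (\<lambda>x. inner (Q x) x)" for A
    by (intro continuous_intros linear_continuous_on linear_conv_bounded_linear[THEN iffD1] lin)
  obtain b :: 'a where "b \<in> Basis" using nonempty_Basis by blast
  hence "b \<in> sphere 0 1" by simp
  hence ne: "sphere (0::'a) 1 \<noteq> {}" by blast
  obtain z where z: "z \<in> sphere 0 1" and zmin: "\<And>y. y \<in> sphere 0 1 ==> inner (Q z) z \<le> inner (Q y) y"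
    using continuous_attains_inf[OF compact_sphere ne cont] by blast
  have "inner (Q x) x \<ge> inner (Q z) z * (norm x)\<^sup>2" for x
  proof (cases "x = 0")
    case False
    let ?y = "(1 / norm x) *\<^sub>R x"
    have "inner (Q z) z \<le> inner (Q ?y) ?y" using False by (intro zmin) simp
    also have "\<dots> = inner (Q x) x / (norm x)\<^sup>2" by (simp add: linear_scale[OF lin] power2_eq_square)
    finally show ?thesis using False by (simp add: field_simps)
  qed simp
  moreover have "inner (Q z) z > 0" using z by (intro pos) auto
  ultimately show ?thesis by blast
qed

lemma borel_measurable_component [measurable (raw)]:
  fixes f :: "'x => 'a::euclidean_space^'i"
  assumes "f \<in> borel_measurable M" shows "(\<lambda>x. f x $ i) \<in> borel_measurable M"
  using assms by (rule borel_measurable_continuous_on[rotated]) (intro continuous_intros)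

lemma subspace_field_space: "subspace (field_space \<beta> :: (quat^'n^'n^'v::finite) set)"
  using subspace_hermitian_space[of \<beta>] unfolding subspace_def field_space_def by auto

text \<open>One basis is chosen for both properties, since the measure in
  \<open>subspace_lborel\<close> is defined through its own choice.\<close>

definition field_onb :: "nat => (quat^'n^'n^'v::finite) set" where
  "field_onb \<beta> = (SOME B. is_onb (field_space \<beta>) B \<and> subspace_lborel (field_space \<beta>) = onb_lborel B)"

lemma field_onb: "is_onb (field_space \<beta>) (field_onb \<beta>)" "subspace_lborel (field_space \<beta>) = onb_lborel (field_onb \<beta>)"
  using someI_ex[OF subspace_lborel_onb[OF subspace_field_space]] unfolding field_onb_def by blast+

context network
begin

context
  fixes \<beta> and U :: "'v => 'v => quat^'n^'n"
  assumes conn: "is_connection \<beta> E U"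
begin

lemma gff_energy_eq:
  assumes A: "A \<in> field_space \<beta>"
  shows "gff_energy E C (\<lambda>x. \<kappa> x + k x) U A = inner (twisted_op E C (\<lambda>x. tr x + k x) U A) A / 2"
proof -
  have h: "adj (A $ x) = A $ x" for x using A by (simp add: field_space_def hermitian_space_iff)
  have n: "rtr (M ** M) = (norm M)\<^sup>2" if "adj M = M" for M :: "quat^'n^'n"
    using inner_matrix_eq[of M M] that by (simp add: power2_norm_eq_inner)
  have D: "adj (A $ y - U y x ** A $ x ** U x y) = A $ y - U y x ** A $ x ** U x y" if "(x, y) \<in> E" for x y
    using connection_adj(1,2)[OF conn that] h by (simp add: adj_mult matrix_mul_assoc)
  have "(\<Sum>(x, y)\<in>E. C x y * (let D = A $ y - U y x ** A $ x ** U x y in rtr (D ** D)))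
     = (\<Sum>(x, y)\<in>E. jr x y * (norm (A $ y - U y x ** A $ x ** U x y))\<^sup>2)"
    by (rule sum.cong[OF refl]) (clarsimp simp: n[OF D] jump_rate_def Let_def)
  also have "\<dots> = (\<Sum>(x, y)\<in>UNIV \<times> UNIV. jr x y * (norm (A $ y - U y x ** A $ x ** U x y))\<^sup>2)"
    by (rule sum.mono_neutral_left) (auto simp: jump_rate_def)
  also have "\<dots> = (\<Sum>x\<in>UNIV. \<Sum>y\<in>UNIV. jr x y * (norm (A $ y - U y x ** A $ x ** U x y))\<^sup>2)"
    by (rule sum.cartesian_product[symmetric])
  finally show ?thesis unfolding gff_energy_def twisted_op_quadratic[OF conn] by (simp add: n h)
qed

lemma gaussian_form_twisted:
  assumes k: "\<And>x. k x \<ge> 0"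
  shows "\<exists>\<epsilon>. gaussian_form (field_space \<beta>) (field_onb \<beta>) (twisted_op E C (\<lambda>x. tr x + k x) U) \<epsilon>"
proof -
  obtain \<epsilon> where "\<epsilon> > 0" "\<forall>A. inner (twisted_op E C (\<lambda>x. tr x + k x) U A) A \<ge> \<epsilon> * (norm A)\<^sup>2"
    using coercive_of_positive[OF linear_twisted_op, of E C "\<lambda>x. tr x + k x" U] twisted_op_pos[OF conn, of k, OF k] by blast
  hence "gaussian_form (field_space \<beta>) (field_onb \<beta>) (twisted_op E C (\<lambda>x. tr x + k x) U) \<epsilon>"
    by (intro gaussian_form.intro field_onb(1) linear_twisted_op twisted_op_sym[OF conn]) auto
  thus ?thesis by blast
qed

abbreviation "TG \<equiv> twisted_gff \<beta> E C \<kappa> U"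
abbreviation "FB \<equiv> (\<Pi>\<^sub>M b\<in>(field_onb \<beta> :: (quat^'n^'n^'v) set). lborel :: real measure)"
abbreviation "emb \<equiv> onb_embed (field_onb \<beta> :: (quat^'n^'n^'v) set)"

definition partition_fn :: real where
  "partition_fn = (\<integral>M. exp (- gff_energy E C \<kappa> U M) \<partial>subspace_lborel (field_space \<beta>))"

lemma continuous_gff_energy: "continuous_on A (gff_energy E C \<kappa> U)"
proof -
  have rtr: "continuous_on A (\<lambda>M. rtr (f M ** f M))" if "continuous_on A f" for f :: "quat^'n^'n^'v => quat^'n^'n" and A
  proof -
    have "rtr (f M ** f M) = inner (f M) (adj (f M))" for M by (simp add: inner_matrix_eq)
    thus ?thesis using that by (simp add: continuous_on_inner continuous_on_adj)
  qed
  show ?thesis unfolding gff_energy_def[abs_def] case_prod_unfold Let_def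
    by (intro continuous_intros rtr continuous_on_matrix_mult)
qed

lemma borel_gff_energy [measurable]: "gff_energy E C \<kappa> U \<in> borel_measurable borel"
  using continuous_gff_energy by (rule borel_measurable_continuous_onI)

lemma sets_TG [simp, measurable_cong]: "sets TG = sets borel" by (simp add: twisted_gff_def Let_def field_onb onb_lborel_def)

lemma space_TG [simp]: "space TG = UNIV" using sets_eq_imp_space_eq[OF sets_TG] by simp

lemma emb_field: "emb c \<in> field_space \<beta>" using gaussian_form.embed_S gaussian_form_twisted[of "\<lambda>_. 0"] by blast

lemma measurable_emb: "emb \<in> FB \<rightarrow>\<^sub>M borel"
  using gaussian_form.measurable_embed gaussian_form_twisted[of "\<lambda>_. 0"] by blast

lemma TG_alt: "TG = density (distr FB borel emb) (\<lambda>M. ennreal (exp (- gff_energy E C \<kappa> U M) / partition_fn))"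
  by (simp add: twisted_gff_def Let_def field_onb partition_fn_def onb_lborel_def)

lemma partition_fn_nonneg: "partition_fn \<ge> 0" by (simp add: partition_fn_def)

text \<open>The exponential of the squared norms adds \<open>k\<close> to the coefficient of the
  mass term, so the product is again a Gaussian weight of the same kind.\<close>

lemma energy_gw:
  assumes M: "M \<in> field_space \<beta>" and k: "\<And>x. k x \<ge> 0"
  shows "exp (- gff_energy E C \<kappa> U M) * exp (- (\<Sum>v\<in>UNIV. k v * ((norm (M $ v))\<^sup>2 / 2)))
    = gaussian_form.gw (twisted_op E C (\<lambda>x. tr x + k x) U) M"
proof -
  obtain \<epsilon> where gf: "gaussian_form (field_space \<beta>) (field_onb \<beta>) (twisted_op E C (\<lambda>x. tr x + k x) U) \<epsilon>"
    using gaussian_form_twisted[of k, OF k] by blast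
  have "inner (twisted_op E C (\<lambda>x. tr x + k x) U M) M = inner (twisted_op E C (\<lambda>x. tr x + 0) U M) M + (\<Sum>v\<in>UNIV. k v * (norm (M $ v))\<^sup>2)"
    unfolding twisted_op_quadratic[OF conn] by (simp add: distrib_right sum.distrib)
  also have "\<dots> = 2 * gff_energy E C \<kappa> U M + 2 * (\<Sum>v\<in>UNIV. k v * ((norm (M $ v))\<^sup>2 / 2))"
    using gff_energy_eq[OF M, of "\<lambda>_. 0"] by (simp add: sum_divide_distrib[symmetric])
  finally show ?thesis unfolding gaussian_form.gw_def[OF gf] by (simp add: exp_add[symmetric] add_divide_distrib)
qed

lemma integrable_emb:
  assumes "f \<in> borel_measurable borel" and "\<And>x. x \<in> field_space \<beta> ==> \<bar>f x\<bar> \<le> K * (1 + norm x) ^ N"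
  shows "integrable FB (\<lambda>c. f (emb c) * exp (- gff_energy E C \<kappa> U (emb c)))"
proof -
  obtain \<epsilon> where "gaussian_form (field_space \<beta>) (field_onb \<beta>) (twisted_op E C (\<lambda>x. tr x + 0) U) \<epsilon>"
    using gaussian_form_twisted[of "\<lambda>_. 0"] by blast
  hence "integrable FB (\<lambda>c. f (emb c) * gaussian_form.gw (twisted_op E C (\<lambda>x. tr x + 0) U) (emb c))"
    using assms by (rule gaussian_form.integrable_polynomial_growth)
  thus ?thesis using energy_gw[OF emb_field, of "\<lambda>_. 0"] by simp
qed

lemma integral_TG:
  assumes f [measurable]: "f \<in> borel_measurable borel"
  shows "(\<integral>\<Phi>. f \<Phi> \<partial>TG) = (\<integral>c. f (emb c) * exp (- gff_energy E C \<kappa> U (emb c)) \<partial>FB) / partition_fn"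
proof -
  have "(\<integral>\<Phi>. f \<Phi> \<partial>TG) = (\<integral>\<Phi>. (exp (- gff_energy E C \<kappa> U \<Phi>) / partition_fn) *\<^sub>R f \<Phi> \<partial>distr FB borel emb)"
    unfolding TG_alt by (rule integral_density) (auto simp: partition_fn_nonneg)
  also have "\<dots> = (\<integral>c. (exp (- gff_energy E C \<kappa> U (emb c)) / partition_fn) *\<^sub>R f (emb c) \<partial>FB)"
    by (rule integral_distr[OF measurable_emb]) measurable
  also have "\<dots> = (\<integral>c. (f (emb c) * exp (- gff_energy E C \<kappa> U (emb c))) / partition_fn \<partial>FB)"
    by (simp add: mult.commute)
  also have "\<dots> = (\<integral>c. f (emb c) * exp (- gff_energy E C \<kappa> U (emb c)) \<partial>FB) / partition_fn" by simp
  finally show ?thesis .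
qed

lemma AE_TG: "AE \<Phi> in TG. \<Phi> \<in> field_space \<beta>"
proof -
  have s: "field_space \<beta> \<in> sets borel" using closed_subspace[OF subspace_field_space] by (rule borel_closed)
  have "AE \<Phi> in distr FB borel emb. \<Phi> \<in> field_space \<beta>"
    using s by (subst AE_distr_iff[OF measurable_emb]) (auto simp: emb_field)
  thus ?thesis unfolding TG_alt by (subst AE_density) auto
qed

lemma integrable_TG:
  assumes f [measurable]: "f \<in> borel_measurable borel" and b: "\<And>x. x \<in> field_space \<beta> ==> \<bar>f x\<bar> \<le> K * (1 + norm x) ^ N"
  shows "integrable TG f"
proof -
  have "integrable FB (\<lambda>c. (exp (- gff_energy E C \<kappa> U (emb c)) / partition_fn) *\<^sub>R f (emb c))"
    using integrable_mult_right[OF integrable_emb[OF f b], of "1 / partition_fn"] by (simp add: mult.commute)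
  hence "integrable (distr FB borel emb) (\<lambda>\<Phi>. (exp (- gff_energy E C \<kappa> U \<Phi>) / partition_fn) *\<^sub>R f \<Phi>)"
    by (subst integrable_distr_eq[OF measurable_emb]) measurable
  thus ?thesis unfolding TG_alt by (subst integrable_density) (auto simp: partition_fn_nonneg)
qed

lemma finite_measure_TG: "finite_measure TG"
proof
  have "integrable TG (\<lambda>_. 1 :: real)" by (rule integrable_TG[of _ 1 0]) auto
  thus "emeasure TG (space TG) \<noteq> \<infinity>" by (simp add: integrable_iff_bounded)
qed

text \<open>Both integrals are unnormalised moments of the Gaussian form with killing
  \<open>\<kappa> + k\<close>, divided by the same partition function of the original field. The
  linear forms are supported at single vertices, and by the Green equation their dual vectors are
  columns of the Green function.\<close>

theorem twisted_wick:
  assumes k: "\<And>x. k x \<ge> 0" and I: "finite I" and c: "\<And>i. i \<in> I ==> c i \<in> hermitian_space \<beta>"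
  shows "(\<integral>\<Phi>. (\<Prod>i\<in>I. inner (\<Phi> $ v i) (c i)) * exp (- (\<Sum>u\<in>UNIV. k u * ((norm (\<Phi> $ u))\<^sup>2 / 2))) \<partial>TG)
    = (\<integral>\<Phi>. exp (- (\<Sum>u\<in>UNIV. k u * ((norm (\<Phi> $ u))\<^sup>2 / 2))) \<partial>TG)
      * (\<Sum>P\<in>pairings I. \<Prod>p\<in>P. inner (c (Min p)) (holonomy_green k U (v (Max p)) (c (Max p)) (v (Min p))))"
proof -
  let ?Q = "twisted_op E C (\<lambda>x. tr x + k x) U"
  obtain \<epsilon> where "gaussian_form (field_space \<beta>) (field_onb \<beta>) ?Q \<epsilon>"
    using gaussian_form_twisted[of k, OF k] by blast
  then interpret G: gaussian_form "field_space \<beta>" "field_onb \<beta>" ?Q \<epsilon> .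
  define g :: "nat => quat^'n^'n^'v" where "g i = axis (v i) (c i)" for i
  define h :: "nat => quat^'n^'n^'v" where "h i = (\<chi> u. holonomy_green k U (v i) (c i) u)" for i
  have mom: "(\<integral>\<Phi>. (\<Prod>i\<in>J. inner (\<Phi> $ v i) (c i)) * exp (- (\<Sum>u\<in>UNIV. k u * ((norm (\<Phi> $ u))\<^sup>2 / 2))) \<partial>TG)
    = G.moment g J / partition_fn" for J
  proof -
    let ?f = "\<lambda>\<Phi> :: quat^'n^'n^'v. (\<Prod>i\<in>J. inner (\<Phi> $ v i) (c i)) * exp (- (\<Sum>u\<in>UNIV. k u * ((norm (\<Phi> $ u))\<^sup>2 / 2)))"
    have "(\<integral>\<Phi>. ?f \<Phi> \<partial>TG) = (\<integral>d. ?f (emb d) * exp (- gff_energy E C \<kappa> U (emb d)) \<partial>FB) / partition_fn"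
      by (rule integral_TG) measurable
    also have "(\<integral>d. ?f (emb d) * exp (- gff_energy E C \<kappa> U (emb d)) \<partial>FB) = (\<integral>d. (\<Prod>i\<in>J. inner (emb d) (g i)) * G.gw (emb d) \<partial>FB)"
      by (intro Bochner_Integration.integral_cong refl) (simp add: energy_gw[OF emb_field k, symmetric] g_def inner_axis)
    finally show ?thesis by (simp add: G.moment_PB)
  qed
  have hS: "h i \<in> field_space \<beta>" if "i \<in> I" for i
    using green_hermitian[of \<beta> U k, OF conn k c[OF that]] by (simp add: h_def field_space_def)
  have Qh: "?Q (h i) = g i" for i unfolding vec_eq_iff[of "?Q (h i)"]
  proof
    fix u show "?Q (h i) $ u = g i $ u" using green_equation[of \<beta> U k, OF conn k, where v = "v i" and b = "c i" and u = u]
      by (simp add: twisted_op_def h_def g_def axis_def eq_commute[of u])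
  qed
  have Qxh: "inner (?Q x) (h i) = inner x (g i)" for x i using twisted_op_sym[OF conn, of _ x "h i"] by (simp add: Qh)
  \<comment> \<open>Symmetry of the operator is used to place the source at the vertex of the second
    label, so that the paths run from the vertex of the smaller label to that of the larger
    one.\<close>
  have ip: "inner (h i) (g j) = inner (c i) (holonomy_green k U (v j) (c j) (v i))" for i j
  proof -
    have "inner (h i) (g j) = inner (g i) (h j)" using Qxh[of "h i" j] by (simp add: Qh)
    also have "\<dots> = inner (c i) (h j $ v i)" by (simp add: g_def inner_axis')
    finally show ?thesis by (simp add: h_def)
  qed
  have "G.moment g I = G.moment g {} * (\<Sum>P\<in>pairings I. \<Prod>p\<in>P. inner (h (Min p)) (g (Max p)))"
    by (rule G.wick[OF I hS Qxh])
  thus ?thesis using mom[of I] mom[of "{}"] by (simp add: ip)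
qed

end

end

subsection \<open>Uniqueness of Laplace transforms on the orthant\<close>

definition bounded_borel :: "(real^'v::finite => real) => bool" where
  "bounded_borel f \<longleftrightarrow> f \<in> borel_measurable borel \<and> (\<exists>K. \<forall>s. \<bar>f s\<bar> \<le> K)"

text \<open>Abstracts the integrals \<open>f \<mapsto> \<integral>f d\<mu>\<close> against complex measures on the nonnegative orthant.\<close>

definition orthant_functional :: "((real^'v::finite => real) => complex) => bool" where
  "orthant_functional \<Lambda> \<longleftrightarrow>
     (\<forall>f g a b. bounded_borel f \<longrightarrow> bounded_borel g \<longrightarrow> \<Lambda> (\<lambda>s. a * f s + b * g s) = of_real a * \<Lambda> f + of_real b * \<Lambda> g) \<and>
     (\<forall>f g K. (\<forall>n. f n \<in> borel_measurable borel) \<longrightarrow> (\<forall>n s. \<bar>f n s\<bar> \<le> K) \<longrightarrow> (\<forall>s. (\<lambda>n. f n s) \<longlonglongrightarrow> g s)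
        \<longrightarrow> (\<lambda>n. \<Lambda> (f n)) \<longlonglongrightarrow> \<Lambda> g) \<and>
     (\<forall>f g. (\<forall>s. (\<forall>v. 0 \<le> s $ v) \<longrightarrow> f s = g s) \<longrightarrow> \<Lambda> f = \<Lambda> g)"

lemma orthant_functional_integral:
  fixes W :: "'a => complex" and Y :: "'a => real^'v::finite"
  assumes Y: "Y \<in> borel_measurable M" and pos: "\<And>\<gamma> v. 0 \<le> Y \<gamma> $ v" and W: "integrable M W"
  shows "orthant_functional (\<lambda>F. \<integral>\<gamma>. complex_of_real (F (Y \<gamma>)) * W \<gamma> \<partial>M)"
proof -
  have meas: "(\<lambda>\<gamma>. complex_of_real (F (Y \<gamma>)) * W \<gamma>) \<in> borel_measurable M" if "F \<in> borel_measurable borel" for F :: "real^'v => real"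
    using measurable_compose[OF Y that] borel_measurable_integrable[OF W] by measurable
  have bd: "norm (complex_of_real (F (Y \<gamma>)) * W \<gamma>) \<le> norm (K * norm (W \<gamma>))" if "\<And>s. \<bar>F s\<bar> \<le> K" for F :: "real^'v => real" and K \<gamma>
    unfolding norm_mult norm_of_real using that[of "Y \<gamma>"] by (intro mult_mono) auto
  have int: "integrable M (\<lambda>\<gamma>. complex_of_real (F (Y \<gamma>)) * W \<gamma>)" if F: "bounded_borel F" for F
  proof -
    obtain K where K: "\<And>s. \<bar>F s\<bar> \<le> K" using F unfolding bounded_borel_def by blast
    show ?thesis by (rule Bochner_Integration.integrable_bound[of _ "\<lambda>\<gamma>. K * norm (W \<gamma>)"])
        (use W F meas bd[OF K] in \<open>auto simp: bounded_borel_def intro!: AE_I2\<close>)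
  qed
  show ?thesis unfolding orthant_functional_def
  proof (intro conjI allI impI)
    fix f g :: "real^'v => real" and a b assume "bounded_borel f" "bounded_borel g"
    hence "integrable M (\<lambda>\<gamma>. of_real a * (complex_of_real (f (Y \<gamma>)) * W \<gamma>))" "integrable M (\<lambda>\<gamma>. of_real b * (complex_of_real (g (Y \<gamma>)) * W \<gamma>))"
      using int by simp_all
    from Bochner_Integration.integral_add[OF this]
    show "(\<integral>\<gamma>. complex_of_real (a * f (Y \<gamma>) + b * g (Y \<gamma>)) * W \<gamma> \<partial>M)
      = of_real a * (\<integral>\<gamma>. complex_of_real (f (Y \<gamma>)) * W \<gamma> \<partial>M) + of_real b * (\<integral>\<gamma>. complex_of_real (g (Y \<gamma>)) * W \<gamma> \<partial>M)"
      by (simp add: algebra_simps)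
  next
    fix f :: "nat => real^'v => real" and g K
    assume f: "\<forall>n. f n \<in> borel_measurable borel" and K: "\<forall>n s. \<bar>f n s\<bar> \<le> K" and lim: "\<forall>s. (\<lambda>n. f n s) \<longlonglongrightarrow> g s"
    have g: "g \<in> borel_measurable borel" by (rule borel_measurable_LIMSEQ_metric[of f]) (use f lim in blast)+
    show "(\<lambda>n. \<integral>\<gamma>. complex_of_real (f n (Y \<gamma>)) * W \<gamma> \<partial>M) \<longlonglongrightarrow> (\<integral>\<gamma>. complex_of_real (g (Y \<gamma>)) * W \<gamma> \<partial>M)"
    proof (rule integral_dominated_convergence[where w = "\<lambda>\<gamma>. norm (K * norm (W \<gamma>))"])
      show "AE \<gamma> in M. (\<lambda>n. complex_of_real (f n (Y \<gamma>)) * W \<gamma>) \<longlonglongrightarrow> complex_of_real (g (Y \<gamma>)) * W \<gamma>"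
        using lim by (intro AE_I2 tendsto_intros) auto
      show "AE \<gamma> in M. norm (complex_of_real (f n (Y \<gamma>)) * W \<gamma>) \<le> norm (K * norm (W \<gamma>))" for n
        using K by (intro AE_I2 bd) auto
    qed (use W meas f g in auto)
  next
    fix f g :: "real^'v => real" assume "\<forall>s. (\<forall>v. 0 \<le> s $ v) \<longrightarrow> f s = g s"
    hence "f (Y \<gamma>) = g (Y \<gamma>)" for \<gamma> using pos by blast
    thus "(\<integral>\<gamma>. complex_of_real (f (Y \<gamma>)) * W \<gamma> \<partial>M) = (\<integral>\<gamma>. complex_of_real (g (Y \<gamma>)) * W \<gamma> \<partial>M)" by simp
  qed
qed

text \<open>Rewrites the path integral of a field expectation as one integral over the product
  measure, where it has the form covered by \<open>orthant_functional_integral\<close>.\<close>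

lemma bounded_Fubini:
  fixes W :: "'a => complex" and Y :: "'a \<times> 'b => real^'v::finite"
  assumes M: "finite_measure M" and T: "finite_measure T" and Y: "Y \<in> borel_measurable (M \<Otimes>\<^sub>M T)"
    and W: "integrable M W" and F: "bounded_borel F"
  shows "integrable (M \<Otimes>\<^sub>M T) (\<lambda>w. W (fst w))"
    and "(\<integral>w. complex_of_real (F (Y w)) * W (fst w) \<partial>(M \<Otimes>\<^sub>M T)) = (\<integral>\<gamma>. complex_of_real (\<integral>\<omega>. F (Y (\<gamma>, \<omega>)) \<partial>T) * W \<gamma> \<partial>M)"
proof -
  interpret M: finite_measure M by fact
  interpret T: finite_measure T by fact
  interpret pair_sigma_finite M T ..
  obtain K where K: "\<And>s. \<bar>F s\<bar> \<le> K" and Fm: "F \<in> borel_measurable borel" using F unfolding bounded_borel_def by blast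
  have Wm [measurable]: "W \<in> borel_measurable M" using W by (rule borel_measurable_integrable)
  have FY [measurable]: "(\<lambda>w. F (Y w)) \<in> borel_measurable (M \<Otimes>\<^sub>M T)" by (rule measurable_compose[OF Y Fm])
  show iW: "integrable (M \<Otimes>\<^sub>M T) (\<lambda>w. W (fst w))"
    by (rule Fubini_integrable) (use W in \<open>auto simp: T.integrable_const\<close>)
  have "integrable (M \<Otimes>\<^sub>M T) (\<lambda>w. complex_of_real (F (Y w)) * W (fst w))"
  proof (rule Bochner_Integration.integrable_bound[of _ "\<lambda>w. K * norm (W (fst w))"])
    show "AE w in M \<Otimes>\<^sub>M T. norm (complex_of_real (F (Y w)) * W (fst w)) \<le> norm (K * norm (W (fst w)))"
      unfolding norm_mult norm_of_real by (intro AE_I2 mult_mono order_trans[OF K]) auto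
  qed (use iW in \<open>auto intro!: integrable_mult_right\<close>)
  from integral_fst'[OF this, symmetric]
  show "(\<integral>w. complex_of_real (F (Y w)) * W (fst w) \<partial>(M \<Otimes>\<^sub>M T)) = (\<integral>\<gamma>. complex_of_real (\<integral>\<omega>. F (Y (\<gamma>, \<omega>)) \<partial>T) * W \<gamma> \<partial>M)"
    by simp
qed

lemma orthant_functional_lin:
  assumes "orthant_functional \<Lambda>" "orthant_functional \<Lambda>'"
  shows "orthant_functional (\<lambda>F. c * \<Lambda> F + c' * \<Lambda>' F)" unfolding orthant_functional_def
proof (intro conjI allI impI)
  fix f g :: "real^'a => real" and a b assume "bounded_borel f" "bounded_borel g"
  hence "\<Lambda> (\<lambda>s. a * f s + b * g s) = of_real a * \<Lambda> f + of_real b * \<Lambda> g" "\<Lambda>' (\<lambda>s. a * f s + b * g s) = of_real a * \<Lambda>' f + of_real b * \<Lambda>' g"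
    using assms unfolding orthant_functional_def by blast+
  thus "c * \<Lambda> (\<lambda>s. a * f s + b * g s) + c' * \<Lambda>' (\<lambda>s. a * f s + b * g s) = of_real a * (c * \<Lambda> f + c' * \<Lambda>' f) + of_real b * (c * \<Lambda> g + c' * \<Lambda>' g)"
    by (simp add: algebra_simps)
next
  fix f :: "nat => real^'a => real" and g K
  assume f: "\<forall>n. f n \<in> borel_measurable borel" "\<forall>n s. \<bar>f n s\<bar> \<le> K" "\<forall>s. (\<lambda>n. f n s) \<longlonglongrightarrow> g s"
  have "(\<lambda>n. \<Lambda> (f n)) \<longlonglongrightarrow> \<Lambda> g" "(\<lambda>n. \<Lambda>' (f n)) \<longlonglongrightarrow> \<Lambda>' g"
    using assms f unfolding orthant_functional_def by blast+
  thus "(\<lambda>n. c * \<Lambda> (f n) + c' * \<Lambda>' (f n)) \<longlonglongrightarrow> c * \<Lambda> g + c' * \<Lambda>' g" by (intro tendsto_intros)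
next
  fix f g :: "real^'a => real" assume fg: "\<forall>s. (\<forall>v. 0 \<le> s $ v) \<longrightarrow> f s = g s"
  have "\<Lambda> f = \<Lambda> g" "\<Lambda>' f = \<Lambda>' g" using assms fg unfolding orthant_functional_def by blast+
  thus "c * \<Lambda> f + c' * \<Lambda>' f = c * \<Lambda> g + c' * \<Lambda>' g" by simp
qed

lemma orthant_functional_zero: "orthant_functional (\<lambda>_. 0)" by (simp add: orthant_functional_def)

lemma orthant_functional_sum:
  assumes "finite I" "\<And>i. i \<in> I ==> orthant_functional (\<Lambda> i)"
  shows "orthant_functional (\<lambda>F. \<Sum>i\<in>I. c i * \<Lambda> i F)" using assms
proof (induction I rule: finite_induct)
  case (insert i I)
  thus ?case using orthant_functional_lin[of "\<Lambda> i" "\<lambda>F. \<Sum>i\<in>I. c i * \<Lambda> i F" "c i" 1] by simp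
qed (simp add: orthant_functional_zero)

text \<open>Integer exponents suffice, because they give all monomials in the variables
  \<open>exp (- s $ v)\<close>, which range over the unit cube. The truncation by
  \<open>max 0\<close> keeps these functions bounded outside the orthant.\<close>

locale laplace_zero =
  fixes \<Lambda> :: "(real^'v::finite => real) => complex"
  assumes func: "orthant_functional \<Lambda>"
    and zero: "\<And>k :: 'v => nat. \<Lambda> (\<lambda>s. exp (- (\<Sum>v\<in>UNIV. real (k v) * max 0 (s $ v)))) = 0"
begin

lemma lin: "bounded_borel f ==> bounded_borel g ==> \<Lambda> (\<lambda>s. a * f s + b * g s) = of_real a * \<Lambda> f + of_real b * \<Lambda> g"
  and lim: "(\<And>n. f' n \<in> borel_measurable borel) ==> (\<And>n s. \<bar>f' n s\<bar> \<le> K) ==> (\<And>s. (\<lambda>n. f' n s) \<longlonglongrightarrow> g s) ==> (\<lambda>n. \<Lambda> (f' n)) \<longlonglongrightarrow> \<Lambda> g"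
  and orth: "(\<And>s. (\<And>v. 0 \<le> s $ v) ==> f s = g s) ==> \<Lambda> f = \<Lambda> g"
proof -
  note F = func[unfolded orthant_functional_def]
  show "bounded_borel f ==> bounded_borel g ==> \<Lambda> (\<lambda>s. a * f s + b * g s) = of_real a * \<Lambda> f + of_real b * \<Lambda> g"
    using F by simp
  show "(\<And>n. f' n \<in> borel_measurable borel) ==> (\<And>n s. \<bar>f' n s\<bar> \<le> K) ==> (\<And>s. (\<lambda>n. f' n s) \<longlonglongrightarrow> g s) ==> (\<lambda>n. \<Lambda> (f' n)) \<longlonglongrightarrow> \<Lambda> g"
    by (rule F[THEN conjunct2, THEN conjunct1, rule_format, of f' K g]) auto
  show "(\<And>s. (\<And>v. 0 \<le> s $ v) ==> f s = g s) ==> \<Lambda> f = \<Lambda> g"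
    by (rule F[THEN conjunct2, THEN conjunct2, rule_format]) auto
qed

lemma lim_zero:
  assumes "\<And>n. f' n \<in> borel_measurable borel" "\<And>n s. \<bar>f' n s\<bar> \<le> K" "\<And>s. (\<lambda>n. f' n s) \<longlonglongrightarrow> g s" "\<And>n. \<Lambda> (f' n) = 0"
  shows "\<Lambda> g = 0" using lim[OF assms(1-3)] by (simp add: assms(4) LIMSEQ_const_iff)

definition u :: "'v => real^'v => real" where "u v s = exp (- max 0 (s $ v))"

lemma u_range: "u v s \<in> {0..1}" by (simp add: u_def)

lemma borel_component [measurable]: "(\<lambda>s :: real^'v. s $ v) \<in> borel_measurable borel"
  by (intro borel_measurable_continuous_onI continuous_intros)

lemma borel_u [measurable]: "u v \<in> borel_measurable borel" unfolding u_def[abs_def] by measurable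

lemma zero_fun: "\<Lambda> (\<lambda>_. 0) = 0"
proof -
  have "bounded_borel (\<lambda>_ :: real^'v. 0)" unfolding bounded_borel_def by (auto intro: exI[of _ 0])
  from lin[OF this this, of 0 0] show ?thesis by simp
qed

lemma zero_sum:
  assumes "finite I" "\<And>i. i \<in> I ==> bounded_borel (f i) \<and> \<Lambda> (f i) = 0"
  shows "\<Lambda> (\<lambda>s. \<Sum>i\<in>I. a i * f i s) = 0 \<and> bounded_borel (\<lambda>s. \<Sum>i\<in>I. a i * f i s)"
  using assms
proof (induction I rule: finite_induct)
  case empty thus ?case by (auto simp: zero_fun bounded_borel_def)
next
  case (insert i I)
  let ?S = "\<lambda>s. \<Sum>i\<in>I. a i * f i s"
  have IH: "\<Lambda> ?S = 0" "bounded_borel ?S" using insert by auto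
  have fi: "bounded_borel (f i)" "\<Lambda> (f i) = 0" using insert by auto
  obtain K K' where K: "\<And>s. \<bar>?S s\<bar> \<le> K" "\<And>s. \<bar>f i s\<bar> \<le> K'" using IH fi unfolding bounded_borel_def by blast
  have "\<bar>a i * f i s + ?S s\<bar> \<le> \<bar>a i\<bar> * K' + K" for s
    using abs_triangle_ineq[of "a i * f i s" "?S s"] K(1)[of s] mult_left_mono[OF K(2)[of s], of "\<bar>a i\<bar>"] by (simp add: abs_mult)
  hence "bounded_borel (\<lambda>s. a i * f i s + ?S s)" using fi IH unfolding bounded_borel_def by (auto intro!: borel_measurable_add)
  moreover have "\<Lambda> (\<lambda>s. a i * f i s + 1 * ?S s) = 0" unfolding lin[OF fi(1) IH(2)] using fi IH by simp
  ultimately show ?case using insert by simp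
qed

lemma bounded_monomial: "bounded_borel (\<lambda>s. \<Prod>v\<in>UNIV. u v s ^ k v)"
proof -
  have "\<bar>\<Prod>v\<in>UNIV. u v s ^ k v\<bar> \<le> 1" for s
    unfolding abs_prod using u_range by (intro prod_le_1) (auto simp: power_le_one)
  thus ?thesis by (auto simp: bounded_borel_def)
qed

lemma zero_monomial: "\<Lambda> (\<lambda>s. \<Prod>v\<in>UNIV. u v s ^ k v) = 0"
  using zero[of k] by (simp add: u_def exp_of_nat_mult[symmetric] exp_sum[symmetric] sum_negf)

lemma zero_polynomial:
  assumes p: "\<And>v. real_polynomial_function (p v)"
  shows "\<Lambda> (\<lambda>s. \<Prod>v\<in>UNIV. p v (u v s)) = 0"
proof -
  obtain a n where a: "\<And>v x. p v x = (\<Sum>i\<le>n v. a v i * x ^ i)"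
    using p unfolding real_polynomial_function_iff_sum by metis
  let ?P = "PiE UNIV (\<lambda>v. {..n v}) :: ('v => nat) set"
  have "(\<Prod>v\<in>UNIV. p v (u v s)) = (\<Sum>k\<in>?P. (\<Prod>v\<in>UNIV. a v (k v)) * (\<Prod>v\<in>UNIV. u v s ^ k v))" for s
    unfolding a by (subst prod_sum_PiE) (auto simp: prod.distrib)
  moreover have "\<Lambda> (\<lambda>s. \<Sum>k\<in>?P. (\<Prod>v\<in>UNIV. a v (k v)) * (\<Prod>v\<in>UNIV. u v s ^ k v)) = 0"
    using zero_sum[of ?P "\<lambda>k s. \<Prod>v\<in>UNIV. u v s ^ k v" "\<lambda>k. \<Prod>v\<in>UNIV. a v (k v)"] bounded_monomial zero_monomial
    by (simp add: finite_PiE)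
  ultimately show ?thesis by simp
qed

text \<open>Weierstrass approximation in each variable separately on the unit interval; products of
  the approximants are combinations of monomials and converge boundedly.\<close>

lemma zero_continuous:
  assumes g: "\<And>v. continuous_on UNIV (g v)" "\<And>v x. g v x \<in> {0..1}"
  shows "\<Lambda> (\<lambda>s. \<Prod>v\<in>UNIV. g v (u v s)) = 0"
proof -
  let ?P = "\<lambda>v m p. real_polynomial_function p \<and> (\<forall>x\<in>{0..1}. \<bar>g v x - p x\<bar> < 1 / real (Suc m))"
  define p where "p v m = (SOME p. ?P v m p)" for v m
  have ex: "\<exists>h. ?P v m h" for v m
  proof -
    obtain h where "real_polynomial_function h" "\<And>x. x \<in> {0..1} ==> \<bar>g v x - h x\<bar> < 1 / real (Suc m)"
      by (rule Stone_Weierstrass_real_polynomial_function[of "{0..1::real}" "g v" "1 / real (Suc m)"])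
        (auto intro: continuous_on_subset[OF g(1)])
    thus ?thesis by blast
  qed
  have "?P v m (p v m)" for v m unfolding p_def by (rule someI_ex[OF ex])
  hence p: "\<And>v m. real_polynomial_function (p v m)" "\<And>v m x. x \<in> {0..1} ==> \<bar>g v x - p v m x\<bar> < 1 / real (Suc m)"
    by blast+
  show ?thesis
  \<comment> \<open>Each approximant is within 1 of a function with values between 0 and 1, so it is
    at most 2 in absolute value.\<close>
  proof (rule lim_zero[where f' = "\<lambda>m s. \<Prod>v\<in>UNIV. p v m (u v s)" and K = "2 ^ CARD('v)"])
    show "\<Lambda> (\<lambda>s. \<Prod>v\<in>UNIV. p v m (u v s)) = 0" for m by (rule zero_polynomial) (rule p)
    show "(\<lambda>s. \<Prod>v\<in>UNIV. p v m (u v s)) \<in> borel_measurable borel" for m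
    proof (intro borel_measurable_prod)
      fix v show "(\<lambda>s. p v m (u v s)) \<in> borel_measurable borel"
        by (rule measurable_compose[OF borel_u borel_measurable_continuous_onI])
          (use p(1) in \<open>auto simp: real_polynomial_function_eq continuous_on_polymonial_function intro!: continuous_on_polymonial_function\<close>)
    qed
    show "\<bar>\<Prod>v\<in>UNIV. p v m (u v s)\<bar> \<le> 2 ^ CARD('v)" for m s
    proof -
      have "\<bar>p v m (u v s)\<bar> \<le> 2" for v
      proof -
        have "\<bar>g v (u v s) - p v m (u v s)\<bar> < 1 / real (Suc m)" by (rule p(2)[OF u_range])
        also have "\<dots> \<le> 1" by simp
        finally show ?thesis using g(2)[of v "u v s"] by auto
      qed
      hence "(\<Prod>v\<in>UNIV. \<bar>p v m (u v s)\<bar>) \<le> (\<Prod>v\<in>(UNIV :: 'v set). 2)" by (intro prod_mono) auto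
      thus ?thesis by (simp add: abs_prod)
    qed
    fix s
    have "(\<lambda>m. p v m (u v s)) \<longlonglongrightarrow> g v (u v s)" for v
    proof (rule LIMSEQ_I)
      fix e :: real assume "e > 0"
      then obtain M where M: "1 / real (Suc M) < e" using nat_approx_posE by blast
      show "\<exists>M. \<forall>m\<ge>M. norm (p v m (u v s) - g v (u v s)) < e"
      proof (intro exI allI impI)
        fix m assume "m \<ge> M"
        hence "1 / real (Suc m) \<le> 1 / real (Suc M)" by (simp add: frac_le)
        thus "norm (p v m (u v s) - g v (u v s)) < e" using p(2)[OF u_range, of v v s m] M by (simp add: abs_minus_commute)
      qed
    qed
    thus "(\<lambda>m. \<Prod>v\<in>UNIV. p v m (u v s)) \<longlonglongrightarrow> (\<Prod>v\<in>UNIV. g v (u v s))" by (intro tendsto_prod)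
  qed
qed

lemma zero_box: "\<Lambda> (indicator {..a}) = 0"
proof -
  \<comment> \<open>Ramps of slope \<open>n\<close> that equal 1 from \<open>exp (- a $ v)\<close>
    on and converge to the indicator of the closed half-line. On the orthant the condition
    \<open>s $ v \<le> a $ v\<close> says that \<open>u v s\<close> lies in this half-line.\<close>
  define g where "g n v x = max 0 (min 1 (1 - real n * (exp (- a $ v) - x)))" for n v x
  have "\<Lambda> (\<lambda>s. \<Prod>v\<in>UNIV. indicator {x. x \<ge> exp (- a $ v)} (u v s)) = 0"
  proof (rule lim_zero[where f' = "\<lambda>n s. \<Prod>v\<in>UNIV. g n v (u v s)" and K = 1])
    show "\<Lambda> (\<lambda>s. \<Prod>v\<in>UNIV. g n v (u v s)) = 0" for n
      by (rule zero_continuous) (auto simp: g_def intro!: continuous_intros)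
    show "(\<lambda>s. \<Prod>v\<in>UNIV. g n v (u v s)) \<in> borel_measurable borel" for n unfolding g_def by measurable
    show "\<bar>\<Prod>v\<in>UNIV. g n v (u v s)\<bar> \<le> 1" for n s unfolding abs_prod by (rule prod_le_1) (auto simp: g_def)
    fix s
    have "(\<lambda>n. g n v x) \<longlonglongrightarrow> indicator {x. x \<ge> exp (- a $ v)} x" for v x
    proof (cases "x \<ge> exp (- a $ v)")
      case True
      hence "real n * (exp (- a $ v) - x) \<le> 0" for n by (intro mult_nonneg_nonpos) auto
      hence "1 \<le> 1 - real n * (exp (- a $ v) - x)" for n by (smt (verit))
      hence "g n v x = 1" for n by (simp add: g_def min_def max_def)
      thus ?thesis using True by simp
    next
      case False
      hence d: "exp (- a $ v) - x > 0" by simp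
      obtain M where M: "real M * (exp (- a $ v) - x) \<ge> 1"
        using real_arch_simple[of "1 / (exp (- a $ v) - x)"] d by (auto simp: pos_divide_le_eq)
      have "g n v x = 0" if "n \<ge> M" for n
      proof -
        have "real M * (exp (- a $ v) - x) \<le> real n * (exp (- a $ v) - x)" using that d by (intro mult_right_mono) auto
        hence "1 - real n * (exp (- a $ v) - x) \<le> 0" using M by linarith
        thus ?thesis by (simp add: g_def)
      qed
      hence "\<forall>\<^sub>F n in sequentially. g n v x = 0" unfolding eventually_sequentially by blast
      thus ?thesis using False by (simp add: tendsto_eventually)
    qed
    thus "(\<lambda>n. \<Prod>v\<in>UNIV. g n v (u v s)) \<longlonglongrightarrow> (\<Prod>v\<in>UNIV. indicator {x. x \<ge> exp (- a $ v)} (u v s))"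
      by (intro tendsto_prod)
  qed
  moreover have "\<Lambda> (\<lambda>s. \<Prod>v\<in>UNIV. indicator {x. x \<ge> exp (- a $ v)} (u v s)) = \<Lambda> (indicator {..a})"
  proof (rule orth)
    fix s :: "real^'v" assume s: "\<And>v. 0 \<le> s $ v"
    have "exp (- a $ v) \<le> u v s \<longleftrightarrow> s $ v \<le> a $ v" for v using s[of v] by (simp add: u_def)
    hence e: "indicator {x. x \<ge> exp (- a $ v)} (u v s) = (if s $ v \<le> a $ v then 1 else (0::real))" for v
      by (simp add: indicator_def)
    show "(\<Prod>v\<in>UNIV. indicator {x. x \<ge> exp (- a $ v)} (u v s)) = (indicator {..a} s :: real)"
    proof (cases "s \<le> a")
      case True thus ?thesis unfolding e by (simp add: less_eq_vec_def)
    next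
      case False
      then obtain v where "\<not> s $ v \<le> a $ v" by (auto simp: less_eq_vec_def)
      hence "(\<Prod>v\<in>UNIV. if s $ v \<le> a $ v then 1 else (0::real)) = 0" by (intro prod_zero bexI[of _ v]) auto
      thus ?thesis unfolding e using False by simp
    qed
  qed
  ultimately show ?thesis by simp
qed

lemma bounded_borel_indicator: "A \<in> sets borel ==> bounded_borel (indicator A)"
  unfolding bounded_borel_def by (auto intro!: exI[of _ 1] simp: indicator_def)

text \<open>Dynkin's argument: the lower boxes are stable under intersection and generate the Borel
  sets, while complements and disjoint unions are handled by linearity and bounded
  convergence.\<close>

lemma zero_indicator:
  assumes A: "A \<in> sets borel"
  shows "\<Lambda> (indicator A) = 0"
proof -
  have borel: "sets borel = sigma_sets UNIV (range (\<lambda>a. {..a :: real^'v}))"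
    unfolding borel_eq_atMost by (rule sets_measure_of) simp
  have univ: "\<Lambda> (\<lambda>_. 1) = 0"
  proof (rule lim_zero[where f' = "\<lambda>n. indicator {..\<chi> v. real n}" and K = 1])
    show "(\<lambda>n. indicator {..\<chi> v. real n} s) \<longlonglongrightarrow> (1::real)" for s :: "real^'v"
    proof (rule tendsto_eventually)
      obtain M where M: "Max (range (\<lambda>v. s $ v)) \<le> real M" using real_arch_simple by blast
      have "s \<le> (\<chi> v. real n)" if "n \<ge> M" for n
      proof -
        have "s $ v \<le> Max (range (\<lambda>v. s $ v))" for v by (rule Max_ge) auto
        hence "s $ v \<le> real n" for v using M that by (meson of_nat_mono order_trans)
        thus ?thesis by (simp add: less_eq_vec_def)
      qed
      thus "\<forall>\<^sub>F n in sequentially. indicator {..\<chi> v. real n} s = (1::real)"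
        unfolding eventually_sequentially by (intro exI[of _ M]) simp
    qed
  qed (auto simp: zero_box indicator_def)
  show ?thesis using A unfolding borel
  proof (rule sigma_sets_induct_disjoint[rotated 2])
    show "Int_stable (range (\<lambda>a. {..a :: real^'v}))"
    proof (clarsimp simp: Int_stable_def)
      fix a b :: "real^'v"
      have "{..a} \<inter> {..b} = {..inf a b}" by auto
      thus "{..a} \<inter> {..b} \<in> range atMost" by blast
    qed
    show "\<Lambda> (indicator A) = 0" if "A \<in> range (\<lambda>a. {..a})" for A using that zero_box by auto
    show "\<Lambda> (indicator {}) = 0" by (rule trans[OF orth zero_fun]) simp
    show "\<Lambda> (indicator (UNIV - A)) = 0" if A: "A \<in> sigma_sets UNIV (range (\<lambda>a. {..a}))" "\<Lambda> (indicator A) = 0" for A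
    proof -
      have "indicator (UNIV - A) = (\<lambda>s. 1 * 1 + (- 1) * indicator A s :: real)" by (auto simp: indicator_def)
      moreover have "\<Lambda> (\<lambda>s. 1 * 1 + (- 1) * indicator A s) = of_real 1 * \<Lambda> (\<lambda>_. 1) + of_real (- 1) * \<Lambda> (indicator A)"
        using A borel by (intro lin bounded_borel_indicator) (auto simp: bounded_borel_def)
      ultimately show ?thesis using A univ by simp
    qed
    show "\<Lambda> (indicator (\<Union>i. A i)) = 0" if A: "disjoint_family A" "range A \<subseteq> sigma_sets UNIV (range (\<lambda>a. {..a}))" "\<And>i. \<Lambda> (indicator (A i)) = 0" for A :: "nat => _"
    proof (rule lim_zero[where f' = "\<lambda>n s. \<Sum>i<n. 1 * indicator (A i) s" and K = 1])
      have bb: "A i \<in> sets borel" for i using A(2) borel by blast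
      show "\<Lambda> (\<lambda>s. \<Sum>i<n. 1 * indicator (A i) s) = 0" for n
        using zero_sum[of "{..<n}" "\<lambda>i. indicator (A i)" "\<lambda>_. 1"] A(3) bb bounded_borel_indicator by blast
      show "(\<lambda>s. \<Sum>i<n. 1 * indicator (A i) s :: real) \<in> borel_measurable borel" for n
        by (intro borel_measurable_sum borel_measurable_times borel_measurable_const borel_measurable_indicator bb)
      have e: "(\<Sum>i<n. 1 * indicator (A i) s) = (indicator (\<Union>i<n. A i) s :: real)" for n s
      proof -
        have "(indicator (\<Union>i<n. A i) s :: real) = (\<Sum>i<n. indicator (A i) s)"
          using A(1) by (intro indicator_UN_disjoint) (auto simp: disjoint_family_on_def)
        thus ?thesis by simp
      qed
      show "\<bar>\<Sum>i<n. 1 * indicator (A i) s\<bar> \<le> (1::real)" for n s unfolding e by (simp add: indicator_def)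
      show "(\<lambda>n. \<Sum>i<n. 1 * indicator (A i) s) \<longlonglongrightarrow> (indicator (\<Union>i. A i) s :: real)" for s
        unfolding e by (rule LIMSEQ_indicator_UN)
    qed
  qed auto
qed

theorem zero_bounded_borel:
  assumes F: "bounded_borel F"
  shows "\<Lambda> F = 0"
proof -
  \<comment> \<open>Boundedness is kept as a premise inside the induction formula, since the
    induction rule runs through all nonnegative measurable functions.\<close>
  have main: "(\<exists>K. \<forall>s. \<bar>f s\<bar> \<le> K) \<longrightarrow> \<Lambda> f = 0" if f: "f \<in> borel_measurable borel" "\<And>s. 0 \<le> f s" for f
    using f
  proof (induction rule: borel_measurable_induct_real)
    case (set A) thus ?case using zero_indicator by blast
  next
    case (mult f c)
    show ?case
    proof
      assume "\<exists>K. \<forall>s. \<bar>c * f s\<bar> \<le> K"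
      then obtain K where K: "\<And>s. \<bar>c * f s\<bar> \<le> K" by blast
      show "\<Lambda> (\<lambda>s. c * f s) = 0"
      proof (cases "c = 0")
        case True thus ?thesis using zero_fun by simp
      next
        case False
        hence "\<bar>f s\<bar> \<le> K / \<bar>c\<bar>" for s using K[of s] by (simp add: abs_mult field_simps)
        hence b: "\<exists>K. \<forall>s. \<bar>f s\<bar> \<le> K" by blast
        have "\<Lambda> (\<lambda>s. c * f s + 0 * f s) = of_real c * \<Lambda> f + of_real 0 * \<Lambda> f"
          using b mult by (intro lin) (auto simp: bounded_borel_def)
        thus ?thesis using b mult by simp
      qed
    qed
  next
    case (add f g)
    show ?case
    proof
      assume "\<exists>K. \<forall>s. \<bar>g s + f s\<bar> \<le> K"
      then obtain K where K: "\<And>s. \<bar>g s + f s\<bar> \<le> K" by blast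
      have "\<bar>f s\<bar> \<le> K" "\<bar>g s\<bar> \<le> K" for s using K[of s] add(2,5)[of s] by auto
      hence b: "\<exists>K. \<forall>s. \<bar>f s\<bar> \<le> K" "\<exists>K. \<forall>s. \<bar>g s\<bar> \<le> K" by blast+
      have "\<Lambda> (\<lambda>s. 1 * g s + 1 * f s) = of_real 1 * \<Lambda> g + of_real 1 * \<Lambda> f"
        using b add by (intro lin) (auto simp: bounded_borel_def)
      thus "\<Lambda> (\<lambda>s. g s + f s) = 0" using b add by simp
    qed
  next
    case (seq W)
    show ?case
    proof
      assume "\<exists>K. \<forall>s. \<bar>f s\<bar> \<le> K"
      then obtain K where K: "\<And>s. \<bar>f s\<bar> \<le> K" by blast
      \<comment> \<open>Increasing approximants stay below their limit and inherit its
        bound.\<close>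
      have "W i s \<le> f s" for i s
      proof (rule incseq_le)
        show "incseq (\<lambda>i. W i s)" using \<open>incseq W\<close> by (auto simp: incseq_def le_fun_def)
        show "(\<lambda>i. W i s) \<longlonglongrightarrow> f s" using seq by simp
      qed
      hence b: "\<bar>W i s\<bar> \<le> K" for i s using K[of s] seq(2)[of i s] by (smt (verit))
      show "\<Lambda> f = 0"
      proof (rule lim_zero[of W K f])
        show "\<Lambda> (W i) = 0" for i using seq b by blast
      qed (use seq b in simp_all)
    qed
  qed
  obtain K where K: "\<And>s. \<bar>F s\<bar> \<le> K" using F unfolding bounded_borel_def by blast
  have Fm: "F \<in> borel_measurable borel" using F unfolding bounded_borel_def by blast
  have m: "(\<lambda>s. F s + K) \<in> borel_measurable borel" using Fm by measurable
  have p: "0 \<le> F s + K" "\<bar>F s + K\<bar> \<le> 2 * K" for s using K[of s] by auto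
  have z1: "\<Lambda> (\<lambda>s. F s + K) = 0" using main[OF m p(1)] p(2) by blast
  have z2: "\<Lambda> (\<lambda>_. 1) = 0" using main[of "\<lambda>_. 1"] by auto
  have "\<Lambda> (\<lambda>s. 1 * (F s + K) + (- K) * 1) = of_real 1 * \<Lambda> (\<lambda>s. F s + K) + of_real (- K) * \<Lambda> (\<lambda>_. 1)"
    using m p(2) by (intro lin) (auto simp: bounded_borel_def)
  thus ?thesis using z1 z2 by simp
qed

end

subsection \<open>Moments of eigenvalues\<close>

lemma loopm_coord:
  fixes B :: "nat \<times> 'c => quat^'n^'n"
  assumes "distinct (map fst u)" "k \<in> fst ` set u"
  shows "loopm (\<lambda>s. if fst s = k then \<Sum>b\<in>N. a b *\<^sub>R b else B s) u
    = (\<Sum>b\<in>N. a b *\<^sub>R loopm (\<lambda>s. if fst s = k then b else B s) u)" using assms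
proof (induction u)
  case (Cons s u)
  show ?case
  proof (cases "fst s = k")
    case True
    hence "fst t \<noteq> k" if "t \<in> set u" for t using Cons.prems(1) that by (metis image_eqI list.simps(9) distinct.simps(2) list.set_map)
    hence "loopm (\<lambda>s. if fst s = k then V else B s) u = loopm B u" for V by (intro loopm_cong) auto
    thus ?thesis using True by (simp add: mult_sum_left mult_scaleR)
  next
    case False
    thus ?thesis using Cons by (simp add: mult_sum_right mult_scaleR)
  qed
qed simp

text \<open>Each label occurs at one place of one cycle only, so the value depends linearly on the
  matrix at that label.\<close>

lemma cycles_value_coord:
  fixes B :: "nat \<times> 'c => quat^'n^'n"
  assumes "distinct (map fst (concat XS))" "k \<in> fst ` set (concat XS)"
  shows "cycles_value \<beta> (\<lambda>s. if fst s = k then \<Sum>b\<in>N. a b *\<^sub>R b else B s) XS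
    = (\<Sum>b\<in>N. of_real (a b) * cycles_value \<beta> (\<lambda>s. if fst s = k then b else B s) XS)" using assms
proof (induction XS)
  case (Cons u XS)
  let ?L = "\<lambda>V. (\<lambda>s. if fst s = k then V else B s)"
  have d: "distinct (map fst u)" "distinct (map fst (concat XS))" "fst ` set u \<inter> fst ` set (concat XS) = {}"
    using Cons.prems(1) by (auto simp del: set_concat)
  show ?case
  proof (cases "k \<in> fst ` set u")
    case True
    hence "fst t \<noteq> k" if "t \<in> set (concat XS)" for t using d(3) that by blast
    hence "cycles_value \<beta> (?L V) XS = cycles_value \<beta> B XS" for V by (intro cycles_value_cong) auto
    thus ?thesis unfolding cycles_value_Cons loopm_coord[OF d(1) True] loop_trace_sum loop_trace_linear
      by (simp add: sum_distrib_right mult.assoc)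
  next
    case False
    hence k: "k \<in> fst ` set (concat XS)" using Cons.prems(2) by auto
    have "loopm (?L V) u = loopm B u" for V using False by (intro loopm_cong) auto
    thus ?thesis unfolding cycles_value_Cons Cons.IH[OF d(2) k] by (simp add: sum_distrib_left mult.left_commute)
  qed
qed simp

text \<open>The labels in \<open>D\<close> are expanded one after another; the remaining ones keep
  their matrices, which makes the induction possible.\<close>

lemma cycles_value_expand:
  fixes t :: "nat => quat^'n^'n" and XS :: "(nat \<times> 'c) list list"
  assumes "finite D" and d: "distinct (map fst (concat XS))" and sub: "D \<subseteq> fst ` set (concat XS)"
    and t: "\<And>k. k \<in> D ==> (\<Sum>b\<in>N. inner (t k) b *\<^sub>R b) = t k"
  shows "cycles_value \<beta> (\<lambda>s. t (fst s)) XS = (\<Sum>c\<in>PiE D (\<lambda>_. N). of_real (\<Prod>k\<in>D. inner (t k) (c k))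
    * cycles_value \<beta> (\<lambda>s. if fst s \<in> D then c (fst s) else t (fst s)) XS)" using assms(1) sub t
proof (induction D rule: finite_induct)
  case (insert k D)
  let ?v = "\<lambda>D c. cycles_value \<beta> (\<lambda>s. if fst s \<in> D then c (fst s) else t (fst s)) XS"
  have "?v D c = (\<Sum>b\<in>N. of_real (inner (t k) b) * ?v (insert k D) (c(k := b)))" for c
  proof -
    have e: "(\<lambda>s. if fst s \<in> D then c (fst s) else t (fst s)) = (\<lambda>s. if fst s = k then \<Sum>b\<in>N. inner (t k) b *\<^sub>R b else if fst s \<in> D then c (fst s) else t (fst s))"
      using insert.hyps(2) insert.prems(2)[of k] by auto
    have e2: "(\<lambda>s. if fst s = k then b else if fst s \<in> D then c (fst s) else t (fst s)) = (\<lambda>s. if fst s \<in> insert k D then (c(k := b)) (fst s) else t (fst s))" for b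
      by auto
    show ?thesis by (subst e, subst cycles_value_coord[OF d]) (use insert.prems(1) in \<open>auto simp only: e2\<close>)
  qed
  hence "cycles_value \<beta> (\<lambda>s. t (fst s)) XS
    = (\<Sum>c\<in>PiE D (\<lambda>_. N). of_real (\<Prod>j\<in>D. inner (t j) (c j)) * (\<Sum>b\<in>N. of_real (inner (t k) b) * ?v (insert k D) (c(k := b))))"
    using insert by auto
  also have "\<dots> = (\<Sum>b\<in>N. \<Sum>c\<in>PiE D (\<lambda>_. N). of_real (inner (t k) b * (\<Prod>j\<in>D. inner (t j) (c j))) * ?v (insert k D) (c(k := b)))"
    unfolding sum_distrib_left by (subst sum.swap) (simp add: mult_ac)
  also have "\<dots> = (\<Sum>c\<in>PiE (insert k D) (\<lambda>_. N). of_real (\<Prod>j\<in>insert k D. inner (t j) (c j)) * ?v (insert k D) c)"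
  proof -
    have "(\<Prod>j\<in>insert k D. inner (t j) ((c(k := b)) j)) = inner (t k) b * (\<Prod>j\<in>D. inner (t j) (c j))" for c b
      using insert.hyps by (simp add: prod.insert) (intro disjI2 prod.cong, auto)
    thus ?thesis unfolding sum_PiE_insert[OF insert.hyps(2)] by simp
  qed
  finally show ?case .
qed simp

section \<open>Measurability of symmetric functions of the eigenvalues\<close>

lemma is_spectrum_hermitian:
  fixes M :: "quat^'n^'n"
  assumes "is_spectrum \<beta> M l" shows "M \<in> hermitian_space \<beta>"
proof -
  obtain Q d where Q: "Q \<in> unitary_group \<beta>" and d: "adj Q ** M ** Q = diag_matrix d"
    using assms unfolding is_spectrum_def by blast
  have "of_real r \<in> scalars \<beta>" for r by (simp add: scalars_def of_real_def)
  moreover have "0 \<in> scalars \<beta>" by (simp add: scalars_def)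
  ultimately have dh: "diag_matrix d \<in> hermitian_space \<beta>"
    unfolding hermitian_space_def adj_def diag_matrix_def by (auto simp: vec_eq_iff quat_eq_iff qcnj_def of_real_def)
  have "Q ** diag_matrix d ** adj Q = (Q ** adj Q) ** M ** (Q ** adj Q)" unfolding d[symmetric] by (simp add: matrix_mul_assoc)
  hence "M = Q ** diag_matrix d ** adj Q" using Q by (simp add: unitary_group_iff)
  thus ?thesis using hermitian_conj[OF dh] Q by (simp add: unitary_group_iff)
qed

lemma continuous_on_mpow: "continuous_on A f ==> continuous_on A (\<lambda>x. mpow (f x) k :: quat^'n^'n)"
  by (induction k) (auto intro!: continuous_on_matrix_mult)

lemma continuous_on_rtr: "continuous_on A f ==> continuous_on A (\<lambda>x. rtr (f x :: quat^'n^'n))"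
proof -
  assume "continuous_on A f"
  moreover have "rtr (f x) = inner (f x) (mat 1)" for x by (simp add: inner_matrix_eq)
  ultimately show ?thesis by (simp add: continuous_on_inner)
qed

lemma borel_rtr_mpow [measurable]: "(\<lambda>M. rtr (mpow M k)) \<in> borel_measurable (borel :: (quat^'n^'n) measure)"
  by (intro borel_measurable_continuous_onI continuous_on_rtr continuous_on_mpow continuous_on_id)

text \<open>On the closed set of hermitian matrices the sum is a continuous trace. Elsewhere no
  spectrum exists, so \<open>eigval\<close> refers to a description of an empty predicate and the
  sum is a constant.\<close>

lemma borel_sum_eigval [measurable]:
  "(\<lambda>M :: quat^'n^'n. \<Sum>i=1..CARD('n). eigval \<beta> M i ^ k) \<in> borel_measurable borel"
proof -
  let ?c = "\<Sum>i=1..CARD('n). ((THE l :: real list. False) ! (i - 1)) ^ k"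
  have s [measurable]: "hermitian_space \<beta> \<in> sets (borel :: (quat^'n^'n) measure)"
    using closed_subspace[OF subspace_hermitian_space] by (rule borel_closed)
  have "(\<Sum>i=1..CARD('n). eigval \<beta> M i ^ k) = (if M \<in> hermitian_space \<beta> then rtr (mpow M k) else ?c)" for M :: "quat^'n^'n"
  proof (cases "M \<in> hermitian_space \<beta>")
    case True thus ?thesis using sum_eigval_power[OF True, of k] by simp
  next
    case False
    hence "is_spectrum \<beta> M = (\<lambda>_. False)" using is_spectrum_hermitian by blast
    thus ?thesis using False by (simp add: eigval_def)
  qed
  thus ?thesis by simp
qed

lemma borel_measurable_vec_lambda [measurable (raw)]:
  fixes f :: "'i::finite => 'a => real"
  assumes "\<And>i. f i \<in> borel_measurable M"
  shows "(\<lambda>x. \<chi> i. f i x) \<in> borel_measurable M"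
proof -
  have "(\<chi> i. f i x) = (\<Sum>i\<in>UNIV. f i x *\<^sub>R axis i 1)" for x
    by (simp add: vec_eq_iff axis_def if_distrib cong: if_cong)
  thus ?thesis using assms by simp
qed

lemma borel_half_square [measurable]:
  "half_square \<beta> \<in> borel_measurable (borel :: (quat^'n^'n^'v::finite) measure)"
proof -
  have "(\<lambda>\<Phi> :: quat^'n^'n^'v. \<Sum>i=1..CARD('n). eigval \<beta> (\<Phi> $ v) i ^ 2) \<in> borel_measurable borel" for v
    by (rule measurable_compose[OF _ borel_sum_eigval]) measurable
  thus ?thesis unfolding half_square_def[abs_def] by measurable
qed

section \<open>Finite product measures on tuples of paths\<close>

lemma finite_measure_PiM:
  assumes I: "finite I" and M: "\<And>i. finite_measure (M i)"
  shows "product_sigma_finite M" "finite_measure (PiM I M)"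
proof -
  show ps: "product_sigma_finite M" using M by (simp add: product_sigma_finite_def finite_measure.sigma_finite_measure)
  interpret product_sigma_finite M by fact
  have "integrable (PiM I M) (\<lambda>x. \<Prod>i\<in>I. (\<lambda>_. 1 :: real) (x i))"
    by (rule product_integrable_prod[OF I]) (simp add: finite_measure.integrable_const[OF M])
  thus "finite_measure (PiM I M)" by (intro finite_measureI) (simp add: integrable_iff_bounded)
qed

lemma AE_PiM_finite:
  assumes I: "finite I" and M: "\<And>i. finite_measure (M i)" and P: "\<And>i. i \<in> I ==> AE x in M i. P i x"
  shows "AE x in PiM I M. \<forall>i\<in>I. P i (x i)"
proof (rule AE_finite_allI[OF I])
  fix i assume i: "i \<in> I"
  interpret product_sigma_finite M using I M by (rule finite_measure_PiM)
  obtain N where N: "{x \<in> space (M i). \<not> P i x} \<subseteq> N" "N \<in> sets (M i)" "emeasure (M i) N = 0"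
    using P[OF i] by (rule AE_E)
  let ?A = "\<lambda>j. if j = i then N else space (M j)"
  have "emeasure (PiM I M) (PiE I ?A) = (\<Prod>j\<in>I. emeasure (M j) (?A j))" by (rule emeasure_PiM[OF I]) (use N in auto)
  also have "\<dots> = 0" using I i N by (intro prod_zero) auto
  finally have z: "emeasure (PiM I M) (PiE I ?A) = 0" .
  show "AE x in PiM I M. P i (x i)"
  proof (rule AE_I[OF _ z])
    show "PiE I ?A \<in> sets (PiM I M)" using N I by (intro sets_PiM_I_finite) auto
    show "{x \<in> space (PiM I M). \<not> P i (x i)} \<subseteq> PiE I ?A"
      using N(1) i by (auto simp: space_PiM PiE_iff extensional_def)
  qed
qed

text \<open>A tuple of skeletons takes values in a countable discrete space, on which every function
  is measurable.\<close>

lemma measurable_skeleton_function: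
  fixes h :: "(nat set => 'v::finite list) => complex"
  assumes P: "finite P" and M: "\<And>p. sets (M p) = sets (path_space :: 'v path measure)"
  shows "(\<lambda>\<gamma>. h (\<lambda>p. skeleton (\<gamma> p))) \<in> borel_measurable (PiM P M)"
proof -
  have "(\<lambda>\<gamma>. \<lambda>p\<in>P. skeleton (\<gamma> p)) \<in> PiM P M \<rightarrow>\<^sub>M PiM P (\<lambda>_. count_space (UNIV :: 'v list set))"
  proof (intro measurable_restrict measurable_compose[OF measurable_component_singleton])
    fix p show "skeleton \<in> M p \<rightarrow>\<^sub>M count_space UNIV" unfolding measurable_cong_sets[OF M refl] by (rule measurable_skeleton)
  qed
  moreover have "PiM P (\<lambda>_. count_space (UNIV :: 'v list set)) = count_space (PiE P (\<lambda>_. UNIV))"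
    by (rule count_space_PiM_finite[OF P]) simp
  ultimately have m: "(\<lambda>\<gamma>. \<lambda>p\<in>P. skeleton (\<gamma> p)) \<in> PiM P M \<rightarrow>\<^sub>M count_space (PiE P (\<lambda>_. UNIV))" by simp
  \<comment> \<open>Outside \<open>P\<close> the components of a point of the product space are
    \<open>undefined\<close>, so the skeleton has a fixed value there and can be filled in.\<close>
  let ?h = "\<lambda>g. h (\<lambda>p. if p \<in> P then g p else skeleton (undefined :: 'v path))"
  have "?h \<in> count_space (PiE P (\<lambda>_. UNIV)) \<rightarrow>\<^sub>M borel" by simp
  from measurable_compose[OF m this]
  have "(\<lambda>\<gamma>. h (\<lambda>p. if p \<in> P then (\<lambda>p\<in>P. skeleton (\<gamma> p)) p else skeleton undefined)) \<in> borel_measurable (PiM P M)" .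
  moreover have "(\<lambda>p. if p \<in> P then (\<lambda>p\<in>P. skeleton (\<gamma> p)) p else skeleton undefined) = (\<lambda>p. skeleton (\<gamma> p))" if "\<gamma> \<in> space (PiM P M)" for \<gamma>
    using that by (auto simp: space_PiM PiE_def extensional_def)
  ultimately show ?thesis by (subst measurable_cong) simp_all
qed

text \<open>Holonomies only see the discrete walks. This reduces measurability of the Wilson product
  to that of the skeletons.\<close>

lemma wilson_product_skeleton:
  fixes U :: "'v => 'v => quat^'n^'n"
  shows
  "\<exists>h. \<forall>\<gamma>. wilson_product \<nu> \<beta> U start \<rho> \<gamma> = h (\<lambda>p. skeleton (\<gamma> p))"
proof -
  define gl where "gl g k = (let k' = partner \<rho> k; w = g {k, k'} in if k < k' then w else rev w)" for g :: "nat set => 'v list" and k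
  have "glued_walk \<rho> \<gamma> k = gl (\<lambda>p. skeleton (\<gamma> p)) k" for \<gamma> :: "nat set => 'v path" and k
    by (simp add: glued_walk_def gl_def)
  hence "wilson_product \<nu> \<beta> U start \<rho> \<gamma> = (\<Prod>c\<in>boundary_cycles \<nu> \<rho>. wilson_loop \<beta> U (concat_walks
     (map (\<lambda>j. gl (\<lambda>p. skeleton (\<gamma> p)) (fst (((join \<nu> \<circ> glue \<rho>) ^^ j) (start c)))) [0..<card c div 2])))" for \<gamma>
    unfolding wilson_product_def cycle_loop_def by simp
  thus ?thesis by (intro exI[of _ "\<lambda>g. \<Prod>c\<in>boundary_cycles \<nu> \<rho>. wilson_loop \<beta> U (concat_walks
     (map (\<lambda>j. gl g (fst (((join \<nu> \<circ> glue \<rho>) ^^ j) (start c)))) [0..<card c div 2]))"] allI)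
qed

section \<open>The moment expansion\<close>

context network
begin

context
  fixes \<beta> and \<nu> :: "nat list" and U :: "'v => 'v => quat^'n^'n" and x :: "nat => 'v"
    and start :: "ribbon => side set => side"
  assumes \<beta>: "\<beta> \<in> {1, 2, 4}" and conn: "is_connection \<beta> E U" and pos: "\<forall>d\<in>set \<nu>. d > 0"
    and x: "block_constant \<nu> x"
    and start: "\<And>\<rho>. \<rho> \<in> ribbon_pairings \<nu> ==> valid_start \<nu> \<beta> \<rho> (start \<rho>)"
begin

abbreviation "T \<equiv> twisted_gff \<beta> E C \<kappa> U"
abbreviation "half_edges \<equiv> {1..sum_list \<nu>}"
abbreviation "MP P \<equiv> (\<Pi>\<^sub>M p\<in>P. PM (x (Min p)) (x (Max p)))"
abbreviation "W P tw \<equiv> wilson_product \<nu> \<beta> U (start (P, tw)) (P, tw)"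
abbreviation "cv c \<equiv> cycles_value \<beta> (\<lambda>s. c (fst s)) (vertex_cycles \<nu>)"

definition vertex_moment :: "quat^'n^'n^'v => real" where
  "vertex_moment \<Phi> = (\<Prod>l=1..length \<nu>. rtr (mpow (\<Phi> $ x (psum \<nu> l)) (\<nu> ! (l - 1))))"

definition weighted_wilson :: "nat set set => (nat set => 'v path) => complex" where
  "weighted_wilson P \<gamma> = (\<Sum>tw\<in>Pow P. of_real (weight \<nu> \<beta> (P, tw)) * W P tw \<gamma>)"

definition N :: "(quat^'n^'n) set" where "N = (SOME N. is_onb (hermitian_space \<beta>) N)"

lemma N: "is_onb (hermitian_space \<beta>) N" "finite N" "b \<in> N ==> b \<in> hermitian_space \<beta>"
proof -
  show n: "is_onb (hermitian_space \<beta>) N" unfolding N_def using is_onb_exists[OF subspace_hermitian_space] by (rule someI_ex)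
  thus "finite N" by (rule is_onb_finite)
  show "b \<in> N ==> b \<in> hermitian_space \<beta>" using n by (auto simp: is_onb_def)
qed

lemma ribbon_pairings_eq: "ribbon_pairings \<nu> = (SIGMA P:pairings half_edges. Pow P)"
  by (auto simp: ribbon_pairings_def pairings_def)

lemma pairing_finite: "P \<in> pairings half_edges ==> finite P" by (auto simp: pairings_def intro: finite_elements)

lemma valid_start: "P \<in> pairings half_edges ==> tw \<subseteq> P ==> valid_start \<nu> \<beta> (P, tw) (start (P, tw))"
  by (rule start) (auto simp: ribbon_pairings_eq)

lemma sets_T [simp, measurable_cong]: "sets T = sets borel" using sets_TG[OF conn] .

lemma AE_paths:
  assumes "P \<in> pairings half_edges"
  shows "AE \<gamma> in MP P. \<forall>p\<in>P. walk_on E (skeleton (\<gamma> p)) \<and> hd (skeleton (\<gamma> p)) = x (Min p) \<and> last (skeleton (\<gamma> p)) = x (Max p)"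
  by (rule AE_PiM_finite[OF pairing_finite[OF assms] finite_path_measure AE_skeleton])

lemma integrable_wilson:
  assumes P: "P \<in> pairings half_edges" and tw: "tw \<subseteq> P"
  shows "integrable (MP P) (W P tw)"
proof (rule finite_measure.integrable_const_bound)
  show "finite_measure (MP P)" by (rule finite_measure_PiM[OF pairing_finite[OF P] finite_path_measure])
  show "AE \<gamma> in MP P. norm (W P tw \<gamma>) \<le> (2 * (real CARD('n) * norm (mat 1 :: quat^'n^'n))) ^ faces \<nu> (P, tw)"
    using AE_paths[OF P]
  proof eventually_elim
    case (elim \<gamma>)
    show ?case by (rule wilson_product_bound[OF pos conn x P tw valid_start[OF P tw]]) (use elim in auto)
  qed
  obtain h where "\<forall>\<gamma>. W P tw \<gamma> = h (\<lambda>p. skeleton (\<gamma> p))" using wilson_product_skeleton by blast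
  hence h: "W P tw = (\<lambda>\<gamma>. h (\<lambda>p. skeleton (\<gamma> p)))" by auto
  show "W P tw \<in> borel_measurable (MP P)" unfolding h by (rule measurable_skeleton_function[OF pairing_finite[OF P]]) simp
qed

text \<open>Each half-edge carries the field at its vertex, and every such matrix is expanded in the
  basis. The random part becomes a product of linear forms, as Wick's theorem requires, and the
  traces become deterministic coefficients.\<close>

lemma vertex_moment_expand:
  assumes \<Phi>: "\<Phi> \<in> field_space \<beta>"
  shows "loop_sign \<beta> ^ length \<nu> * of_real (vertex_moment \<Phi>)
    = (\<Sum>c\<in>PiE half_edges (\<lambda>_. N). of_real (\<Prod>k\<in>half_edges. inner (\<Phi> $ x k) (c k)) * cv c)"
proof -
  have h: "\<Phi> $ v \<in> hermitian_space \<beta>" for v using \<Phi> by (simp add: field_space_def)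
  have m: "map fst (concat (vertex_cycles \<nu>)) = [1..<sum_list \<nu> + 1]"
    unfolding concat_vertex_cycles[OF pos] by (simp add: o_def del: upt_Suc)
  hence s: "fst ` set (concat (vertex_cycles \<nu>)) = half_edges"
    by (metis atLeastLessThan_upt atLeastLessThanSuc_atLeastAtMost Suc_eq_plus1 list.set_map)
  have "loop_sign \<beta> ^ length \<nu> * of_real (vertex_moment \<Phi>) = cycles_value \<beta> (\<lambda>s. \<Phi> $ x (fst s)) (vertex_cycles \<nu>)"
    unfolding vertex_moment_def by (rule vertex_cycles_value[OF pos x h, symmetric])
  also have "\<dots> = (\<Sum>c\<in>PiE half_edges (\<lambda>_. N). of_real (\<Prod>k\<in>half_edges. inner (\<Phi> $ x k) (c k))
    * cycles_value \<beta> (\<lambda>s. if fst s \<in> half_edges then c (fst s) else \<Phi> $ x (fst s)) (vertex_cycles \<nu>))"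
    by (rule cycles_value_expand[where t = "\<lambda>k. \<Phi> $ x k"]) (use m s is_onb_expand[OF N(1) h] in auto)
  also have "\<dots> = (\<Sum>c\<in>PiE half_edges (\<lambda>_. N). of_real (\<Prod>k\<in>half_edges. inner (\<Phi> $ x k) (c k)) * cv c)"
  proof (intro sum.cong refl arg_cong2[where f = "(*)"] cycles_value_cong)
    fix c :: "nat => quat^'n^'n" and s assume "s \<in> set (concat (vertex_cycles \<nu>))"
    hence "fst s \<in> half_edges" using s by blast
    thus "(if fst s \<in> half_edges then c (fst s) else \<Phi> $ x (fst s)) = c (fst s)" by simp
  qed
  finally show ?thesis .
qed

lemma borel_vertex_moment [measurable]: "vertex_moment \<in> borel_measurable borel" unfolding vertex_moment_def[abs_def]
  by (intro borel_measurable_prod measurable_compose[OF _ borel_rtr_mpow] borel_measurable_component) simp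

lemma integrable_prod_inner:
  assumes e: "e \<in> borel_measurable borel" "\<And>\<Phi>. \<bar>e \<Phi>\<bar> \<le> 1"
  shows "integrable T (\<lambda>\<Phi>. (\<Prod>k\<in>half_edges. inner (\<Phi> $ x k) (c k)) * e \<Phi>)"
proof (rule integrable_TG[OF conn])
  show "(\<lambda>\<Phi>. (\<Prod>k\<in>half_edges. inner (\<Phi> $ x k) (c k)) * e \<Phi>) \<in> borel_measurable borel" using e(1) by measurable
  fix \<Phi> :: "quat^'n^'n^'v"
  have eq: "(\<Prod>k\<in>half_edges. inner (\<Phi> $ x k) (c k)) = (\<Prod>k\<in>half_edges. inner \<Phi> (axis (x k) (c k)))" by (simp add: inner_axis)
  have "\<bar>\<Prod>k\<in>half_edges. inner (\<Phi> $ x k) (c k)\<bar> * \<bar>e \<Phi>\<bar> \<le> ((\<Prod>k\<in>half_edges. norm (axis (x k) (c k) :: quat^'n^'n^'v)) * (1 + norm \<Phi>) ^ card half_edges) * 1"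
    unfolding eq by (intro mult_mono abs_prod_inner_le e(2)) (auto intro!: mult_nonneg_nonneg prod_nonneg)
  thus "\<bar>(\<Prod>k\<in>half_edges. inner (\<Phi> $ x k) (c k)) * e \<Phi>\<bar> \<le> (\<Prod>k\<in>half_edges. norm (axis (x k) (c k) :: quat^'n^'n^'v)) * (1 + norm \<Phi>) ^ card half_edges"
    by (simp add: abs_mult)
qed

lemma vertex_moment_integral:
  assumes e: "e \<in> borel_measurable borel" "\<And>\<Phi>. \<bar>e \<Phi>\<bar> \<le> 1"
  shows "integrable T (\<lambda>\<Phi>. complex_of_real (vertex_moment \<Phi> * e \<Phi>))"
    and "loop_sign \<beta> ^ length \<nu> * (\<integral>\<Phi>. complex_of_real (vertex_moment \<Phi> * e \<Phi>) \<partial>T)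
      = (\<Sum>c\<in>PiE half_edges (\<lambda>_. N). of_real (\<integral>\<Phi>. (\<Prod>k\<in>half_edges. inner (\<Phi> $ x k) (c k)) * e \<Phi> \<partial>T) * cv c)"
proof -
  let ?f = "\<lambda>\<Phi>. complex_of_real (vertex_moment \<Phi> * e \<Phi>)"
  let ?g = "\<lambda>c \<Phi>. complex_of_real ((\<Prod>k\<in>half_edges. inner (\<Phi> $ x k) (c k)) * e \<Phi>) * cv c"
  let ?l = "loop_sign \<beta> ^ length \<nu>"
  let ?S = "\<lambda>\<Phi>. \<Sum>c\<in>PiE half_edges (\<lambda>_. N). ?g c \<Phi>"
  have m: "(\<lambda>\<Phi>. ?l * ?f \<Phi>) \<in> borel_measurable T" using e(1) by measurable
  have i: "integrable T (\<lambda>\<Phi>. ?g c \<Phi>)" for c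
    using integrable_prod_inner[OF e, of c] by (intro integrable_mult_left integrable_of_real)
  have S: "integrable T ?S" using i by (intro Bochner_Integration.integrable_sum)
  have ae: "AE \<Phi> in T. ?l * ?f \<Phi> = ?S \<Phi>" using AE_TG[OF conn]
  proof eventually_elim
    case (elim \<Phi>)
    have "?l * ?f \<Phi> = (?l * of_real (vertex_moment \<Phi>)) * of_real (e \<Phi>)" by simp
    also have "\<dots> = ?S \<Phi>" unfolding vertex_moment_expand[OF elim] sum_distrib_right by (intro sum.cong refl) simp
    finally show ?case .
  qed
  have "integrable T (\<lambda>\<Phi>. ?l * ?f \<Phi>)"
    using integrable_cong_AE[OF m borel_measurable_integrable[OF S] ae] S by simp
  hence "integrable T (\<lambda>\<Phi>. (1 / ?l) * (?l * ?f \<Phi>))" by (rule integrable_mult_right)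
  moreover have "(1 / ?l) * (?l * z) = z" for z by (simp add: loop_sign_def)
  ultimately show "integrable T (\<lambda>\<Phi>. ?f \<Phi>)" by (simp only:)
  have "?l * (\<integral>\<Phi>. ?f \<Phi> \<partial>T) = (\<integral>\<Phi>. ?l * ?f \<Phi> \<partial>T)" by simp
  also have "\<dots> = (\<integral>\<Phi>. ?S \<Phi> \<partial>T)" by (rule integral_cong_AE[OF m borel_measurable_integrable[OF S] ae])
  also have "\<dots> = (\<Sum>c\<in>PiE half_edges (\<lambda>_. N). (\<integral>\<Phi>. ?g c \<Phi> \<partial>T))"
    by (rule Bochner_Integration.integral_sum[OF i])
  also have "\<dots> = (\<Sum>c\<in>PiE half_edges (\<lambda>_. N). of_real (\<integral>\<Phi>. (\<Prod>k\<in>half_edges. inner (\<Phi> $ x k) (c k)) * e \<Phi> \<partial>T) * cv c)"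
    by (simp only: integral_mult_left_zero integral_complex_of_real)
  finally show "?l * (\<integral>\<Phi>. ?f \<Phi> \<partial>T)
      = (\<Sum>c\<in>PiE half_edges (\<lambda>_. N). of_real (\<integral>\<Phi>. (\<Prod>k\<in>half_edges. inner (\<Phi> $ x k) (c k)) * e \<Phi> \<partial>T) * cv c)" .
qed

lemma inner_green:
  assumes k: "\<And>v. k v \<ge> 0"
  shows "integrable (PM u v) (\<lambda>\<gamma>. kill_exp k \<gamma> * inner a (hol U (skeleton \<gamma>) ** b ** adj (hol U (skeleton \<gamma>))))"
    and "inner a (holonomy_green k U v b u) = (\<integral>\<gamma>. kill_exp k \<gamma> * inner a (hol U (skeleton \<gamma>) ** b ** adj (hol U (skeleton \<gamma>))) \<partial>PM u v)"
proof -
  let ?g = "\<lambda>\<gamma>. kill_exp k \<gamma> * inner a (hol U (skeleton \<gamma>) ** b ** adj (hol U (skeleton \<gamma>)))"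
  let ?f = "\<lambda>\<gamma>. kill_exp k \<gamma> *\<^sub>R (hol U (skeleton \<gamma>) ** b ** adj (hol U (skeleton \<gamma>)))"
  have i: "integrable (PM u v) ?f"
  proof (rule finite_measure.integrable_const_bound[OF finite_path_measure])
    show "AE \<gamma> in PM u v. norm (?f \<gamma>) \<le> norm b" using AE_skeleton
    proof eventually_elim
      case (elim \<gamma>)
      have "norm (?f \<gamma>) = kill_exp k \<gamma> * norm b"
        using conj_hol_norm[OF conn, where zs = "skeleton \<gamma>" and b = b] elim kill_exp_bounds(2)[of k \<gamma>] by simp
      also have "\<dots> \<le> 1 * norm b" by (rule mult_right_mono[OF kill_exp_bounds(1)[OF k]]) simp
      finally show ?case by simp
    qed
    have "(\<lambda>\<gamma>. hol U (skeleton \<gamma>) ** b ** adj (hol U (skeleton \<gamma>))) \<in> borel_measurable (PM u v)"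
      by (rule measurable_compose[of skeleton _ "count_space UNIV"]) auto
    thus "?f \<in> borel_measurable (PM u v)" by (intro borel_measurable_scaleR) auto
  qed
  show "integrable (PM u v) (\<lambda>\<gamma>. ?g \<gamma>)" using integrable_inner_right[OF i, of a] by simp
  show "inner a (holonomy_green k U v b u) = (\<integral>\<gamma>. ?g \<gamma> \<partial>PM u v)"
    unfolding holonomy_green_def using integral_inner_right[of a "PM u v" ?f] i by simp
qed

definition exp_square :: "('v => real) => quat^'n^'n^'v => real" where
  "exp_square k \<Phi> = exp (- (\<Sum>u\<in>UNIV. k u * ((norm (\<Phi> $ u))\<^sup>2 / 2)))"

lemma exp_square: "exp_square k \<in> borel_measurable borel" "(\<And>v. k v \<ge> 0) ==> \<bar>exp_square k \<Phi>\<bar> \<le> 1"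
  unfolding exp_square_def[abs_def] by measurable (auto intro!: sum_nonneg mult_nonneg_nonneg)

text \<open>For each choice of basis elements Wick's theorem gives products of Green functions,
  which are integrals over independent paths. For fixed paths the sum over basis elements is
  evaluated by the ribbon expansion. Both sides then carry the nonzero factor
  \<open>loop_sign \<beta> ^ length \<nu>\<close>, which cancels.\<close>

theorem exponential_identity:
  assumes k: "\<And>v. k v \<ge> 0"
  shows "(\<integral>\<Phi>. complex_of_real (vertex_moment \<Phi> * exp_square k \<Phi>) \<partial>T)
    = of_real (\<integral>\<Phi>. exp_square k \<Phi> \<partial>T) * (\<Sum>P\<in>pairings half_edges.
        \<integral>\<gamma>. complex_of_real (\<Prod>p\<in>P. kill_exp k (\<gamma> p)) * weighted_wilson P \<gamma> \<partial>MP P)"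
proof -
  let ?l = "loop_sign \<beta> ^ length \<nu>" and ?Z = "\<integral>\<Phi>. exp_square k \<Phi> \<partial>T"
  let ?F = "PiE half_edges (\<lambda>_. N)"
  let ?J = "\<lambda>P. \<integral>\<gamma>. complex_of_real (\<Prod>p\<in>P. kill_exp k (\<gamma> p)) * weighted_wilson P \<gamma> \<partial>MP P"
  let ?g = "\<lambda>c P. \<Prod>p\<in>P. inner (c (Min p)) (holonomy_green k U (x (Max p)) (c (Max p)) (x (Min p)))"
  let ?h = "\<lambda>\<gamma>. hol U (skeleton \<gamma>)"
  define q where "q c p \<gamma> = kill_exp k \<gamma> * inner (c (Min p)) (?h \<gamma> ** c (Max p) ** adj (?h \<gamma>))" for c :: "nat => quat^'n^'n" and p :: "nat set" and \<gamma> :: "'v path"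
  have qi: "integrable (PM (x (Min p)) (x (Max p))) (q c p)" for c p unfolding q_def[abs_def] by (rule inner_green(1)[OF k])
  let ?q = "\<lambda>c P. \<integral>\<gamma>. (\<Prod>p\<in>P. q c p (\<gamma> p)) \<partial>MP P"
  have prodq: "integrable (MP P) (\<lambda>\<gamma>. \<Prod>p\<in>P. q c p (\<gamma> p))"
    "?q c P = ?g c P"
    if P: "P \<in> pairings half_edges" for P c
  proof -
    interpret product_sigma_finite "\<lambda>p. PM (x (Min p)) (x (Max p))"
      by (rule finite_measure_PiM(1)[OF finite.emptyI finite_path_measure])
    show "integrable (MP P) (\<lambda>\<gamma>. \<Prod>p\<in>P. q c p (\<gamma> p))" by (rule product_integrable_prod[OF pairing_finite[OF P] qi])
    show "?q c P = ?g c P"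
      unfolding product_integral_prod[OF pairing_finite[OF P] qi] by (simp add: inner_green(2)[OF k] q_def[abs_def])
  qed
  have wick: "(\<integral>\<Phi>. (\<Prod>i\<in>half_edges. inner (\<Phi> $ x i) (c i)) * exp_square k \<Phi> \<partial>T)
      = ?Z * (\<Sum>P\<in>pairings half_edges. ?q c P)" if c: "c \<in> ?F" for c
  proof -
    have "(\<integral>\<Phi>. (\<Prod>i\<in>half_edges. inner (\<Phi> $ x i) (c i)) * exp_square k \<Phi> \<partial>T)
      = ?Z * (\<Sum>P\<in>pairings half_edges. ?g c P)"
      unfolding exp_square_def[abs_def] by (rule twisted_wick[OF conn k]) (use c N(3) in \<open>auto dest: PiE_mem\<close>)
    thus ?thesis by (simp add: prodq(2))
  qed
  have pair: "(\<Sum>c\<in>?F. of_real (?q c P) * cv c) = ?l * ?J P" if P: "P \<in> pairings half_edges" for P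
  proof -
    let ?S = "\<lambda>\<gamma>. \<Sum>c\<in>?F. complex_of_real (\<Prod>p\<in>P. q c p (\<gamma> p)) * cv c"
    let ?R = "\<lambda>\<gamma>. ?l * (complex_of_real (\<Prod>p\<in>P. kill_exp k (\<gamma> p)) * weighted_wilson P \<gamma>)"
    have i: "integrable (MP P) (\<lambda>\<gamma>. complex_of_real (\<Prod>p\<in>P. q c p (\<gamma> p)) * cv c)" for c
      using prodq(1)[OF P, of c] by (intro integrable_mult_left integrable_of_real)
    have "(\<Sum>c\<in>?F. of_real (?q c P) * cv c) = (\<integral>\<gamma>. ?S \<gamma> \<partial>MP P)"
      by (subst Bochner_Integration.integral_sum[OF i]) (simp only: integral_mult_left_zero integral_complex_of_real)
    also have "\<dots> = (\<integral>\<gamma>. ?R \<gamma> \<partial>MP P)"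
    proof (rule integral_cong_AE)
      show "?S \<in> borel_measurable (MP P)" using i by (intro borel_measurable_sum borel_measurable_integrable)
      have "weighted_wilson P \<in> borel_measurable (MP P)" unfolding weighted_wilson_def[abs_def] using integrable_wilson[OF P]
        by (intro borel_measurable_sum borel_measurable_times borel_measurable_const borel_measurable_integrable) auto
      moreover have "(\<lambda>\<gamma>. \<Prod>p\<in>P. kill_exp k (\<gamma> p)) \<in> borel_measurable (MP P)"
        by (intro borel_measurable_prod measurable_compose[OF measurable_component_singleton]) auto
      ultimately show "?R \<in> borel_measurable (MP P)" by measurable
      show "AE \<gamma> in MP P. ?S \<gamma> = ?R \<gamma>" using AE_paths[OF P]
      proof eventually_elim
        case (elim \<gamma>)
        have "?S \<gamma> = complex_of_real (\<Prod>p\<in>P. kill_exp k (\<gamma> p)) * (\<Sum>c\<in>?F. (\<Prod>p\<in>P. of_real (inner (c (Min p))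
            (?h (\<gamma> p) ** c (Max p) ** adj (?h (\<gamma> p))))) * cv c)"
          unfolding sum_distrib_left q_def by (intro sum.cong refl) (simp add: prod.distrib)
        also have "(\<Sum>c\<in>?F. (\<Prod>p\<in>P. complex_of_real (inner (c (Min p)) (?h (\<gamma> p) ** c (Max p) ** adj (?h (\<gamma> p))))) * cv c) = ?l * weighted_wilson P \<gamma>"
          unfolding weighted_wilson_def
          by (rule ribbon_expansion[OF \<beta> N(1) pos conn x P valid_start[OF P]]) (use elim in auto)
        finally show ?case by (simp add: mult.left_commute)
      qed
    qed
    also have "\<dots> = ?l * ?J P" by simp
    finally show ?thesis .
  qed
  have "?l * (\<integral>\<Phi>. complex_of_real (vertex_moment \<Phi> * exp_square k \<Phi>) \<partial>T)
    = (\<Sum>c\<in>?F. of_real (?Z * (\<Sum>P\<in>pairings half_edges. ?q c P)) * cv c)"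
    unfolding vertex_moment_integral(2)[OF exp_square(1) exp_square(2)[OF k]] by (intro sum.cong refl) (simp only: wick)
  also have "\<dots> = of_real ?Z * (\<Sum>P\<in>pairings half_edges. \<Sum>c\<in>?F. of_real (?q c P) * cv c)"
    by (subst sum.swap) (simp add: sum_distrib_left sum_distrib_right mult.assoc)
  also have "\<dots> = of_real ?Z * (\<Sum>P\<in>pairings half_edges. ?l * ?J P)" using pair by simp
  also have "\<dots> = ?l * (of_real ?Z * (\<Sum>P\<in>pairings half_edges. ?J P))"
    by (simp add: sum_distrib_left mult.left_commute)
  finally show ?thesis by (simp add: loop_sign_def split: if_splits)
qed

section \<open>From exponentials to bounded measurable functions\<close>

definition norm_squares :: "quat^'n^'n^'v => real^'v" where
  "norm_squares \<Phi> = (\<chi> v. (norm (\<Phi> $ v))\<^sup>2 / 2)"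

definition total_local_time :: "nat set set => (nat set => 'v path) => real^'v" where
  "total_local_time P \<gamma> = (\<chi> v. \<Sum>p\<in>P. local_time (\<gamma> p) v)"

definition moment_side :: "(real^'v => real) => complex" where
  "moment_side F = (\<integral>\<Phi>. complex_of_real (F (norm_squares \<Phi>)) * of_real (vertex_moment \<Phi>) \<partial>T)"

definition ribbon_term :: "ribbon => (real^'v => real) => complex" where
  "ribbon_term \<rho> F = (\<integral>\<gamma>. complex_of_real (\<integral>\<Phi>. F (norm_squares \<Phi> + total_local_time (fst \<rho>) \<gamma>) \<partial>T)
     * wilson_product \<nu> \<beta> U (start \<rho>) \<rho> \<gamma> \<partial>paths_measure E C \<kappa> x \<rho>)"

lemma borel_norm_squares [measurable]: "norm_squares \<in> borel_measurable borel"
  unfolding norm_squares_def[abs_def] by measurable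

lemma measurable_total_local_time:
  "(\<lambda>\<gamma>. total_local_time (fst \<rho>) \<gamma>) \<in> paths_measure E C \<kappa> x \<rho> \<rightarrow>\<^sub>M borel"
  unfolding total_local_time_def paths_measure_def
  by (intro borel_measurable_vec_lambda borel_measurable_sum measurable_compose[OF measurable_component_singleton]) auto

lemma local_time_nonneg: "local_time \<gamma> v \<ge> 0"
  unfolding local_time_def set_lebesgue_integral_def by (rule Bochner_Integration.integral_nonneg) auto

lemma paths_measure_eq: "paths_measure E C \<kappa> x (P, tw) = MP P" by (simp add: paths_measure_def)

lemma finite_ribbon_pairings: "finite (ribbon_pairings \<nu>)" unfolding ribbon_pairings_eq
  by (intro finite_SigmaI finite_pairings finite_Pow_iff[THEN iffD2] pairing_finite finite_atLeastAtMost)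

lemma moment_side_functional: "orthant_functional moment_side" unfolding moment_side_def[abs_def]
proof (rule orthant_functional_integral)
  show "norm_squares \<in> borel_measurable T" by measurable
  show "0 \<le> norm_squares \<Phi> $ v" for \<Phi> v by (simp add: norm_squares_def)
  show "integrable T (\<lambda>\<Phi>. complex_of_real (vertex_moment \<Phi>))"
    using vertex_moment_integral(1)[where e = "\<lambda>_. 1"] by simp
qed

lemma moment_side_alt: "moment_side F = (\<integral>\<Phi>. complex_of_real (vertex_moment \<Phi> * F (norm_squares \<Phi>)) \<partial>T)"
  unfolding moment_side_def by (simp only: of_real_mult mult.commute)

text \<open>\<open>ribbon_term\<close> is an iterated integral, whereas the functional is the
  integral over the product of path and field measures; by Fubini they agree on bounded functions,
  which are the only ones to which the uniqueness argument is applied.\<close>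

lemma ribbon_term_functional:
  assumes "\<rho> \<in> ribbon_pairings \<nu>"
  shows "\<exists>\<Lambda>. orthant_functional \<Lambda> \<and> (\<forall>F. bounded_borel F \<longrightarrow> \<Lambda> F = ribbon_term \<rho> F)"
proof -
  obtain P tw where \<rho>: "\<rho> = (P, tw)" "P \<in> pairings half_edges" "tw \<subseteq> P"
    using assms unfolding ribbon_pairings_eq by auto
  let ?M = "paths_measure E C \<kappa> x \<rho>" and ?Y = "\<lambda>w. norm_squares (snd w) + total_local_time (fst \<rho>) (fst w)"
  have M: "finite_measure ?M" unfolding \<rho>(1) paths_measure_eq
    by (rule finite_measure_PiM[OF pairing_finite[OF \<rho>(2)] finite_path_measure])
  have Y: "?Y \<in> borel_measurable (?M \<Otimes>\<^sub>M T)"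
    by (intro borel_measurable_add measurable_compose[OF measurable_snd] measurable_compose[OF measurable_fst] measurable_total_local_time)
      (simp cong: measurable_cong_sets)
  have W: "integrable ?M (wilson_product \<nu> \<beta> U (start \<rho>) \<rho>)"
    unfolding \<rho>(1) paths_measure_eq by (rule integrable_wilson[OF \<rho>(2,3)])
  note fub = bounded_Fubini[OF M finite_measure_TG[OF conn] Y W]
  have "bounded_borel (\<lambda>_ :: real^'v. 0)" unfolding bounded_borel_def by (auto intro: exI[of _ 0])
  hence "orthant_functional (\<lambda>F. \<integral>w. complex_of_real (F (?Y w)) * wilson_product \<nu> \<beta> U (start \<rho>) \<rho> (fst w) \<partial>(?M \<Otimes>\<^sub>M T))"
    by (intro orthant_functional_integral Y fub(1))
      (auto simp: norm_squares_def total_local_time_def intro!: add_nonneg_nonneg sum_nonneg local_time_nonneg)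
  thus ?thesis using fub(2) by (auto simp: ribbon_term_def)
qed

text \<open>Squares and local times are nonnegative, so the truncation disappears and the
  exponential of their sum factors. The field part integrates to the same constant for all paths and
  pairings, and each path keeps its own killing factor.\<close>

lemma functionals_agree_exp:
  fixes k :: "'v => nat"
  defines "e \<equiv> (\<lambda>s :: real^'v. exp (- (\<Sum>v\<in>UNIV. real (k v) * max 0 (s $ v))))"
  shows "moment_side e = (\<Sum>\<rho>\<in>ribbon_pairings \<nu>. of_real (weight \<nu> \<beta> \<rho>) * ribbon_term \<rho> e)"
proof -
  let ?k = "\<lambda>v. real (k v)" and ?P = "pairings {1..sum_list \<nu>}"
  let ?Z = "\<integral>\<Phi>. exp_square (\<lambda>v. real (k v)) \<Phi> \<partial>T"
  let ?K = "\<lambda>P \<gamma>. \<Prod>p\<in>P. kill_exp ?k (\<gamma> p)"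
  let ?w = "\<lambda>P tw \<gamma>. complex_of_real (?K P \<gamma>) * W P tw \<gamma>"
  have k0: "0 \<le> ?k v" for v by simp
  have e1: "e (norm_squares \<Phi>) = exp_square ?k \<Phi>" for \<Phi> by (simp add: e_def norm_squares_def exp_square_def)
  have e2: "e (norm_squares \<Phi> + total_local_time P \<gamma>) = exp_square ?k \<Phi> * ?K P \<gamma>" if "finite P" for \<Phi> P \<gamma>
  proof -
    have "max 0 (norm_squares \<Phi> $ v + total_local_time P \<gamma> $ v) = norm_squares \<Phi> $ v + total_local_time P \<gamma> $ v" for v
      by (simp add: norm_squares_def total_local_time_def add_nonneg_nonneg sum_nonneg local_time_nonneg)
    moreover have "(\<Sum>v\<in>UNIV. ?k v * (\<Sum>p\<in>P. local_time (\<gamma> p) v)) = (\<Sum>p\<in>P. \<Sum>v\<in>UNIV. ?k v * local_time (\<gamma> p) v)"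
      unfolding sum_distrib_left by (rule sum.swap)
    ultimately show ?thesis
      using that by (simp add: e_def norm_squares_def total_local_time_def exp_square_def kill_exp_def distrib_left sum.distrib
        exp_sum[symmetric] sum_negf exp_add[symmetric])
  qed
  have intK: "integrable (MP P) (\<lambda>\<gamma>. ?w P tw \<gamma>)"
    if P: "P \<in> ?P" "tw \<subseteq> P" for P tw
  proof (rule Bochner_Integration.integrable_bound[OF integrable_wilson[OF P]])
    have "(\<lambda>\<gamma>. ?K P \<gamma>) \<in> borel_measurable (MP P)"
      by (intro borel_measurable_prod measurable_compose[OF measurable_component_singleton]) auto
    thus "(\<lambda>\<gamma>. ?w P tw \<gamma>) \<in> borel_measurable (MP P)"
      using borel_measurable_integrable[OF integrable_wilson[OF P]] by measurable
    have kb: "0 \<le> kill_exp ?k w \<and> kill_exp ?k w \<le> 1" for w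
      using kill_exp_bounds(1)[of ?k, OF k0] kill_exp_bounds(2)[of ?k w] by (simp add: less_imp_le)
    have "0 \<le> ?K P \<gamma>" "?K P \<gamma> \<le> 1" for \<gamma> by (rule prod_nonneg, simp add: kb, rule prod_le_1, rule kb)
    thus "AE \<gamma> in MP P. norm (?w P tw \<gamma>) \<le> norm (W P tw \<gamma>)"
      unfolding norm_mult norm_of_real by (intro AE_I2) (simp add: mult_left_le_one_le)
  qed
  have ribbon: "ribbon_term (P, tw) e = of_real ?Z * (\<integral>\<gamma>. ?w P tw \<gamma> \<partial>MP P)"
    if P: "P \<in> ?P" for P tw unfolding ribbon_term_def paths_measure_eq fst_conv e2[OF pairing_finite[OF P]]
    by (simp add: mult.assoc)
  have "moment_side e = (\<integral>\<Phi>. complex_of_real (vertex_moment \<Phi> * exp_square ?k \<Phi>) \<partial>T)"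
    unfolding moment_side_alt e1 ..
  also have "\<dots> = of_real ?Z * (\<Sum>P\<in>?P. \<integral>\<gamma>. complex_of_real (?K P \<gamma>) * weighted_wilson P \<gamma> \<partial>MP P)"
    by (rule exponential_identity[OF k0])
  also have "\<dots> = (\<Sum>P\<in>?P. \<Sum>tw\<in>Pow P. of_real (weight \<nu> \<beta> (P, tw)) * ribbon_term (P, tw) e)"
    unfolding sum_distrib_left
  proof (rule sum.cong[OF refl])
    fix P assume P: "P \<in> ?P"
    have "(\<integral>\<gamma>. complex_of_real (?K P \<gamma>) * weighted_wilson P \<gamma> \<partial>MP P)
      = (\<integral>\<gamma>. (\<Sum>tw\<in>Pow P. of_real (weight \<nu> \<beta> (P, tw)) * (?w P tw \<gamma>)) \<partial>MP P)"
      by (simp add: weighted_wilson_def sum_distrib_left mult.left_commute)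
    also have "\<dots> = (\<Sum>tw\<in>Pow P. of_real (weight \<nu> \<beta> (P, tw)) * (\<integral>\<gamma>. ?w P tw \<gamma> \<partial>MP P))"
      using intK[OF P] by (subst Bochner_Integration.integral_sum) auto
    finally show "of_real ?Z * (\<integral>\<gamma>. complex_of_real (?K P \<gamma>) * weighted_wilson P \<gamma> \<partial>MP P)
      = (\<Sum>tw\<in>Pow P. of_real (weight \<nu> \<beta> (P, tw)) * ribbon_term (P, tw) e)"
      by (simp add: ribbon[OF P] sum_distrib_left mult.left_commute)
  qed
  also have "\<dots> = (\<Sum>\<rho>\<in>ribbon_pairings \<nu>. of_real (weight \<nu> \<beta> \<rho>) * ribbon_term \<rho> e)"
    unfolding ribbon_pairings_eq by (subst sum.Sigma) (simp_all add: finite_pairings pairing_finite del: One_nat_def)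
  finally show ?thesis .
qed

text \<open>The difference of the two sides is a functional on the orthant that vanishes on the
  exponentials with integer exponents, hence on all bounded measurable functions.\<close>

theorem functionals_agree:
  assumes F: "bounded_borel F"
  shows "moment_side F = (\<Sum>\<rho>\<in>ribbon_pairings \<nu>. of_real (weight \<nu> \<beta> \<rho>) * ribbon_term \<rho> F)"
proof -
  obtain R where R: "\<And>\<rho>. \<rho> \<in> ribbon_pairings \<nu> ==> orthant_functional (R \<rho>) \<and> (\<forall>F. bounded_borel F \<longrightarrow> R \<rho> F = ribbon_term \<rho> F)"
    using ribbon_term_functional by metis
  let ?\<Lambda> = "\<lambda>F. 1 * moment_side F + (- 1) * (\<Sum>\<rho>\<in>ribbon_pairings \<nu>. of_real (weight \<nu> \<beta> \<rho>) * R \<rho> F)"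
  have eq: "?\<Lambda> F = moment_side F - (\<Sum>\<rho>\<in>ribbon_pairings \<nu>. of_real (weight \<nu> \<beta> \<rho>) * ribbon_term \<rho> F)" if "bounded_borel F" for F
    using R that by simp
  have func: "orthant_functional ?\<Lambda>"
    using R by (intro orthant_functional_lin orthant_functional_sum moment_side_functional finite_ribbon_pairings) blast
  interpret laplace_zero ?\<Lambda>
  proof (rule laplace_zero.intro[OF func])
    fix k :: "'v => nat"
    let ?e = "\<lambda>s :: real^'v. exp (- (\<Sum>v\<in>UNIV. real (k v) * max 0 (s $ v)))"
    have "bounded_borel ?e" unfolding bounded_borel_def by (auto intro!: exI[of _ 1] sum_nonneg borel_measurable_exp)
    from eq[OF this] show "?\<Lambda> ?e = 0" by (simp add: functionals_agree_exp)
  qed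
  show ?thesis using zero_bounded_borel[OF F] eq[OF F] by simp
qed

text \<open>Almost surely the field is hermitian at each vertex, where power sums of eigenvalues are
  traces of powers and half the sum of squares is half the squared norm.\<close>

lemma moment_side_eq:
  assumes F [measurable]: "F \<in> borel_measurable borel"
  shows "moment_side F = complex_of_real
      (\<integral>\<Phi>. (\<Prod>l=1..length \<nu>. \<Sum>i=1..CARD('n). eigval \<beta> (\<Phi> $ x (psum \<nu> l)) i ^ (\<nu> ! (l - 1)))
           * F (half_square \<beta> \<Phi>) \<partial>T)"
proof -
  let ?p = "\<lambda>\<Phi>. \<Prod>l=1..length \<nu>. \<Sum>i=1..CARD('n). eigval \<beta> (\<Phi> $ x (psum \<nu> l)) i ^ (\<nu> ! (l - 1))"
  have "moment_side F = of_real (\<integral>\<Phi>. vertex_moment \<Phi> * F (norm_squares \<Phi>) \<partial>T)"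
    unfolding moment_side_alt by (rule integral_complex_of_real)
  also have "(\<integral>\<Phi>. vertex_moment \<Phi> * F (norm_squares \<Phi>) \<partial>T)
    = (\<integral>\<Phi>. ?p \<Phi> * F (half_square \<beta> \<Phi>) \<partial>T)"
  proof (rule integral_cong_AE)
    show "(\<lambda>\<Phi>. vertex_moment \<Phi> * F (norm_squares \<Phi>)) \<in> borel_measurable (T)" by measurable
    have "(\<lambda>\<Phi> :: quat^'n^'n^'v. \<Sum>i=1..CARD('n). eigval \<beta> (\<Phi> $ v) i ^ m) \<in> borel_measurable (T)" for v m
      by (rule measurable_compose[OF _ borel_sum_eigval]) measurable
    thus "(\<lambda>\<Phi>. ?p \<Phi> * F (half_square \<beta> \<Phi>)) \<in> borel_measurable (T)"
      by (intro borel_measurable_times borel_measurable_prod) measurable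
    show "AE \<Phi> in T. vertex_moment \<Phi> * F (norm_squares \<Phi>) = ?p \<Phi> * F (half_square \<beta> \<Phi>)"
      using AE_TG[OF conn]
    proof eventually_elim
      case (elim \<Phi>)
      have "\<Phi> $ v \<in> hermitian_space \<beta>" for v using elim by (simp add: field_space_def)
      thus ?case by (simp only: vertex_moment_def sum_eigval_power half_square_eq[OF elim] norm_squares_def)
    qed
  qed
  finally show ?thesis .
qed

lemma ribbon_term_eq:
  assumes F [measurable]: "F \<in> borel_measurable borel"
  shows "ribbon_term \<rho> F = (\<integral>\<gamma>. complex_of_real
             (\<integral>\<Phi>. F (half_square \<beta> \<Phi> + (\<chi> v. \<Sum>p\<in>fst \<rho>. local_time (\<gamma> p) v)) \<partial>T)
           * wilson_product \<nu> \<beta> U (start \<rho>) \<rho> \<gamma> \<partial>paths_measure E C \<kappa> x \<rho>)"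
proof -
  let ?f = "\<lambda>\<gamma> \<Phi>. F (half_square \<beta> \<Phi> + (\<chi> v. \<Sum>p\<in>fst \<rho>. local_time (\<gamma> p) v))"
  have "(\<integral>\<Phi>. F (norm_squares \<Phi> + total_local_time (fst \<rho>) \<gamma>) \<partial>T)
     = (\<integral>\<Phi>. ?f \<gamma> \<Phi> \<partial>T)" for \<gamma>
  proof (rule integral_cong_AE)
    show "(\<lambda>\<Phi>. F (norm_squares \<Phi> + total_local_time (fst \<rho>) \<gamma>)) \<in> borel_measurable (T)" by measurable
    show "(\<lambda>\<Phi>. ?f \<gamma> \<Phi>) \<in> borel_measurable (T)" by measurable
    show "AE \<Phi> in T. F (norm_squares \<Phi> + total_local_time (fst \<rho>) \<gamma>) = ?f \<gamma> \<Phi>"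
      using AE_TG[OF conn] by eventually_elim (simp add: half_square_eq norm_squares_def total_local_time_def)
  qed
  thus ?thesis by (simp add: ribbon_term_def)
qed

theorem moment_expansion:
  assumes F: "F \<in> borel_measurable borel" "bounded (range F)"
  shows "complex_of_real
      (\<integral>\<Phi>. (\<Prod>l=1..length \<nu>. \<Sum>i=1..CARD('n). eigval \<beta> (\<Phi> $ x (psum \<nu> l)) i ^ (\<nu> ! (l - 1)))
           * F (half_square \<beta> \<Phi>) \<partial>T) =
    (\<Sum>\<rho>\<in>ribbon_pairings \<nu>. complex_of_real (weight \<nu> \<beta> \<rho>) *
      (\<integral>\<gamma>. complex_of_real (\<integral>\<Phi>. F (half_square \<beta> \<Phi> + (\<chi> v. \<Sum>p\<in>fst \<rho>. local_time (\<gamma> p) v)) \<partial>T)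
           * wilson_product \<nu> \<beta> U (start \<rho>) \<rho> \<gamma> \<partial>paths_measure E C \<kappa> x \<rho>))"
proof -
  have "bounded_borel F" using F by (auto simp: bounded_borel_def bounded_iff)
  thus ?thesis using functionals_agree[of F] by (simp only: moment_side_eq[OF F(1)] ribbon_term_eq[OF F(1)])
qed

end

end

theorem corollary3p8:
  fixes E :: "('v::finite \<times> 'v) set" and C :: "'v \<Rightarrow> 'v \<Rightarrow> real" and \<kappa> :: "'v \<Rightarrow> real"
    and U :: "'v \<Rightarrow> 'v \<Rightarrow> quat^'n::finite^'n"
    and \<beta> :: nat and \<nu> :: "nat list" and F :: "real^'v \<Rightarrow> real" and x :: "nat \<Rightarrow> 'v"
    and start :: "ribbon \<Rightarrow> side set \<Rightarrow> side"
  assumes "network E C \<kappa>"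
    and "CARD('n) \<ge> 2"
    and "\<beta> \<in> {1, 2, 4}"
    and "is_connection \<beta> E U" and "\<not> trivial_connection \<beta> E U"
    and "\<forall>d\<in>set \<nu>. d > 0" and "even (sum_list \<nu>)"
    and "F \<in> borel_measurable borel" and "bounded (range F)"
    and "\<And>l k k'. l \<in> {1..length \<nu>} \<Longrightarrow> k \<in> {psum \<nu> (l - 1) + 1..psum \<nu> l} \<Longrightarrow>
           k' \<in> {psum \<nu> (l - 1) + 1..psum \<nu> l} \<Longrightarrow> x k = x k'"
    and "\<And>\<rho>. \<rho> \<in> ribbon_pairings \<nu> \<Longrightarrow> valid_start \<nu> \<beta> \<rho> (start \<rho>)"
  shows "complex_of_real
      (\<integral>\<Phi>. (\<Prod>l=1..length \<nu>. \<Sum>i=1..CARD('n). eigval \<beta> (\<Phi> $ x (psum \<nu> l)) i ^ (\<nu> ! (l - 1)))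
           * F (half_square \<beta> \<Phi>) \<partial>twisted_gff \<beta> E C \<kappa> U) =
    (\<Sum>\<rho>\<in>ribbon_pairings \<nu>. complex_of_real (weight \<nu> \<beta> \<rho>) *
      (\<integral>\<gamma>. complex_of_real
             (\<integral>\<Phi>. F (half_square \<beta> \<Phi> + (\<chi> v. \<Sum>p\<in>fst \<rho>. local_time (\<gamma> p) v))
                \<partial>twisted_gff \<beta> E C \<kappa> U)
           * wilson_product \<nu> \<beta> U (start \<rho>) \<rho> \<gamma>
         \<partial>paths_measure E C \<kappa> x \<rho>))"
  by (rule network.moment_expansion[OF assms(1,3,4,6) _ _ assms(8,9)]) (unfold block_constant_def, (use assms(10,11) in blast)+)

end
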